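(* (1) A $5$-dimensional non-solvable Lie group $G$ is a contact Lie group if and only if its Lie algebra is one of the following: (i) (decomposable) $aff(\mathbb R)\oplus sl(2)$, $aff(\mathbb R)\oplus so(3)$; (ii) (non-decomposable) $\mathbb R^2\rtimes sl(2)$. (2) Let $\mathcal G$ be a $5$-dimensional non-decomposable solvable Lie algebra with trivial centre $Z(\mathcal G)=0$. (i) If the derived ideal $[\mathcal G,\mathcal G]$ has dimension $3$ and is nonabelian, then $\mathcal G$ is a contact Lie algebra. (ii) If $[\mathcal G,\mathcal G]$ has dimension $4$, then $\mathcal G$ is contact if and only if either (a) $\dim Z([\mathcal G,\mathcal G])=1$, or else (b) $\dim Z([\mathcal G,\mathcal G])=2$ and there is $v\in\mathcal G$ such that $Z([\mathcal G,\mathcal G])$ is not an eigenspace of $ad_v$.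
   Context: All Lie algebras are real and finite dimensional, and $Z(\cdot)$ denotes the center. For a linear form $\eta$ on a Lie algebra, $\partial\eta(x,y):=-\eta([x,y])$. A Lie algebra of dimension $2n+1$ is contact if it has a linear form $\eta$ with $(\partial\eta)^n\wedge\eta\neq0$; a Lie group is a contact Lie group if it has a left invariant contact form, equivalently if its Lie algebra is contact. A Lie algebra is decomposable if it is the direct sum of two (nonzero) ideals. $aff(\mathbb R)$ is the 2-dimensional nonabelian Lie algebra, $sl(2)=sl(2,\mathbb R)$, and $\mathbb R^2\rtimes sl(2)$ is the semidirect product for the natural action of $sl(2,\mathbb R)$ on $\mathbb R^2$ by matrix multiplication. "$Z([\mathcal G,\mathcal G])$ is not an eigenspace of $ad_v$" means there is no $\lambda\in\mathbb R$ with $[v,x]=\lambda x$ for all $x\in Z([\mathcal G,\mathcal G])$. *)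

theory Defs
  imports "HOL-Analysis.Analysis" "HOL-Combinatorics.Permutations" "HOL-Algebra.Group"
begin

section \<open>Exterior algebra and contact pairs\<close>

text \<open>
  A \<open>k\<close>-form is a function of a sequence of vectors that only looks at the entries \<open>0, \<dots>, k - 1\<close>.
  The wedge product of a \<open>p\<close>-form and a \<open>q\<close>-form carries the factor \<open>1 / (p! q!)\<close>.
\<close>

definition wedge ::
  "nat \<Rightarrow> nat \<Rightarrow> ((nat \<Rightarrow> 'a) \<Rightarrow> real) \<Rightarrow> ((nat \<Rightarrow> 'a) \<Rightarrow> real) \<Rightarrow> (nat \<Rightarrow> 'a) \<Rightarrow> real" where
  "wedge p q \<alpha> \<beta> v =
     (\<Sum>\<sigma> | \<sigma> permutes {..<p + q}.
        of_int (sign \<sigma>) * \<alpha> (\<lambda>i. v (\<sigma> i)) * \<beta> (\<lambda>i. v (\<sigma> (p + i)))) / (fact p * fact q)"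

primrec wedge_power :: "nat \<Rightarrow> ((nat \<Rightarrow> 'a) \<Rightarrow> real) \<Rightarrow> nat \<Rightarrow> (nat \<Rightarrow> 'a) \<Rightarrow> real" where
  "wedge_power k \<omega> 0 = (\<lambda>_. 1)"
| "wedge_power k \<omega> (Suc n) = wedge k (k * n) \<omega> (wedge_power k \<omega> n)"

text \<open>\<open>\<omega>\<^sup>n \<and> \<eta> \<noteq> 0\<close> on the vector space \<open>V\<close>, for a 2-form \<open>\<omega>\<close> and a 1-form \<open>\<eta>\<close>.\<close>

definition contact_pair :: "'a set \<Rightarrow> nat \<Rightarrow> ('a \<Rightarrow> 'a \<Rightarrow> real) \<Rightarrow> ('a \<Rightarrow> real) \<Rightarrow> bool" where
  "contact_pair V n \<omega> \<eta> \<longleftrightarrow>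
     (\<exists>v. range v \<subseteq> V \<and>
        wedge (2 * n) 1 (wedge_power 2 (\<lambda>u. \<omega> (u 0) (u 1)) n) (\<lambda>u. \<eta> (u 0)) v \<noteq> 0)"


section \<open>Lie algebras\<close>

definition linear_on :: "'a::real_vector set \<Rightarrow> ('a \<Rightarrow> 'b::real_vector) \<Rightarrow> bool" where
  "linear_on V f \<longleftrightarrow>
     (\<forall>x\<in>V. \<forall>y\<in>V. f (x + y) = f x + f y) \<and> (\<forall>c. \<forall>x\<in>V. f (c *\<^sub>R x) = c *\<^sub>R f x)"

text \<open>A real Lie algebra is a subspace \<open>L\<close> of a real vector space together with a bracket on \<open>L\<close>.\<close>

locale lie_algebra =
  fixes L :: "'a::real_vector set" and br :: "'a \<Rightarrow> 'a \<Rightarrow> 'a"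
  assumes subspace: "subspace L"
    and closed: "x \<in> L \<Longrightarrow> y \<in> L \<Longrightarrow> br x y \<in> L"
    and linear_right: "x \<in> L \<Longrightarrow> linear_on L (br x)"
    and linear_left: "y \<in> L \<Longrightarrow> linear_on L (\<lambda>x. br x y)"
    and alternating: "x \<in> L \<Longrightarrow> br x x = 0"
    and jacobi: "x \<in> L \<Longrightarrow> y \<in> L \<Longrightarrow> z \<in> L \<Longrightarrow>
      br x (br y z) + br y (br z x) + br z (br x y) = 0"

definition lie_center :: "'a::real_vector set \<Rightarrow> ('a \<Rightarrow> 'a \<Rightarrow> 'a) \<Rightarrow> 'a set" where
  "lie_center L br = {x \<in> L. \<forall>y\<in>L. br x y = 0}"

definition lie_derived :: "'a::real_vector set \<Rightarrow> ('a \<Rightarrow> 'a \<Rightarrow> 'a) \<Rightarrow> 'a set" where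
  "lie_derived L br = span {br x y | x y. x \<in> L \<and> y \<in> L}"

definition lie_abelian :: "'a::real_vector set \<Rightarrow> ('a \<Rightarrow> 'a \<Rightarrow> 'a) \<Rightarrow> bool" where
  "lie_abelian L br \<longleftrightarrow> (\<forall>x\<in>L. \<forall>y\<in>L. br x y = 0)"

definition lie_solvable :: "'a::real_vector set \<Rightarrow> ('a \<Rightarrow> 'a \<Rightarrow> 'a) \<Rightarrow> bool" where
  "lie_solvable L br \<longleftrightarrow> (\<exists>k. ((\<lambda>S. lie_derived S br) ^^ k) L = {0})"

definition lie_ideal :: "'a::real_vector set \<Rightarrow> 'a set \<Rightarrow> ('a \<Rightarrow> 'a \<Rightarrow> 'a) \<Rightarrow> bool" where
  "lie_ideal I L br \<longleftrightarrow> subspace I \<and> I \<subseteq> L \<and> (\<forall>x\<in>L. \<forall>y\<in>I. br x y \<in> I)"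

definition lie_decomposable :: "'a::real_vector set \<Rightarrow> ('a \<Rightarrow> 'a \<Rightarrow> 'a) \<Rightarrow> bool" where
  "lie_decomposable L br \<longleftrightarrow>
     (\<exists>I J. lie_ideal I L br \<and> lie_ideal J L br \<and> I \<noteq> {0} \<and> J \<noteq> {0} \<and>
        I \<inter> J = {0} \<and> L = {x + y | x y. x \<in> I \<and> y \<in> J})"

definition lie_isomorphic ::
  "'a::real_vector set \<Rightarrow> ('a \<Rightarrow> 'a \<Rightarrow> 'a) \<Rightarrow> 'b::real_vector set \<Rightarrow> ('b \<Rightarrow> 'b \<Rightarrow> 'b) \<Rightarrow> bool" where
  "lie_isomorphic L br L' br' \<longleftrightarrow>
     (\<exists>f. bij_betw f L L' \<and> linear_on L f \<and> (\<forall>x\<in>L. \<forall>y\<in>L. f (br x y) = br' (f x) (f y)))"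

definition contact_lie_algebra :: "'a::real_vector set \<Rightarrow> ('a \<Rightarrow> 'a \<Rightarrow> 'a) \<Rightarrow> bool" where
  "contact_lie_algebra L br \<longleftrightarrow>
     (\<exists>n \<eta>. dim L = 2 * n + 1 \<and> linear_on L \<eta> \<and> contact_pair L n (\<lambda>x y. - \<eta> (br x y)) \<eta>)"


subsection \<open>The Lie algebras in the classification\<close>

text \<open>
  The pair \<open>(a, b)\<close> stands for the matrix with rows \<open>(a, b)\<close> and \<open>(0, 0)\<close>, that is, for the
  infinitesimal affine map \<open>x \<mapsto> a x + b\<close>; the carrier is \<open>UNIV\<close>.
\<close>

definition aff_bracket :: "real \<times> real \<Rightarrow> real \<times> real \<Rightarrow> real \<times> real" where
  "aff_bracket x y = (0, fst x * snd y - snd x * fst y)"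

definition commutator :: "real^'n^'n \<Rightarrow> real^'n^'n \<Rightarrow> real^'n^'n" where
  "commutator A B = A ** B - B ** A"

definition sl2 :: "(real^2^2) set" where
  "sl2 = {A. trace A = 0}"

definition so3 :: "(real^3^3) set" where
  "so3 = {A. transpose A = - A}"

definition direct_sum_bracket ::
  "('a \<Rightarrow> 'a \<Rightarrow> 'a) \<Rightarrow> ('b \<Rightarrow> 'b \<Rightarrow> 'b) \<Rightarrow> 'a \<times> 'b \<Rightarrow> 'a \<times> 'b \<Rightarrow> 'a \<times> 'b" where
  "direct_sum_bracket br br' x y = (br (fst x) (fst y), br' (snd x) (snd y))"

definition R2_sl2_bracket ::
  "(real^2) \<times> (real^2^2) \<Rightarrow> (real^2) \<times> (real^2^2) \<Rightarrow> (real^2) \<times> (real^2^2)" where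
  "R2_sl2_bracket x y = (snd x *v fst y - snd y *v fst x, commutator (snd x) (snd y))"


section \<open>Smooth manifolds\<close>

text \<open>
  \<open>Ck_on k S f\<close> and \<open>smooth_on S f\<close> are meant for open \<open>S\<close> and finite-dimensional domains, where
  the iterated directional derivatives detect \<open>C\<^sup>k\<close>.
\<close>

primrec Ck_on ::
  "nat \<Rightarrow> 'a::real_normed_vector set \<Rightarrow> ('a \<Rightarrow> 'b::real_normed_vector) \<Rightarrow> bool" where
  "Ck_on 0 S f \<longleftrightarrow> continuous_on S f"
| "Ck_on (Suc k) S f \<longleftrightarrow>
     (\<forall>x\<in>S. f differentiable (at x)) \<and> (\<forall>v. Ck_on k S (\<lambda>x. frechet_derivative f (at x) v))"

definition smooth_on ::
  "'a::real_normed_vector set \<Rightarrow> ('a \<Rightarrow> 'b::real_normed_vector) \<Rightarrow> bool" where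
  "smooth_on S f \<longleftrightarrow> (\<forall>k. Ck_on k S f)"

text \<open>A chart is a pair of its domain and its coordinate map.\<close>

type_synonym ('g, 'e) chart = "'g set \<times> ('g \<Rightarrow> 'e)"

definition chart_inv :: "('g, 'e) chart \<Rightarrow> 'e \<Rightarrow> 'g" where
  "chart_inv c = inv_into (fst c) (snd c)"

definition in_charts ::
  "('g, 'e) chart \<Rightarrow> ('h, 'f) chart \<Rightarrow> ('g \<Rightarrow> 'h) \<Rightarrow> 'e \<Rightarrow> 'f" where
  "in_charts c d f = (\<lambda>x. snd d (f (chart_inv c x)))"

definition smooth_in_charts ::
  "('g, 'e::real_normed_vector) chart set \<Rightarrow> ('h, 'f::real_normed_vector) chart set \<Rightarrow>
     ('g \<Rightarrow> 'h) \<Rightarrow> bool" where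
  "smooth_in_charts A B f \<longleftrightarrow>
     (\<forall>c\<in>A. \<forall>d\<in>B. smooth_on (snd c ` {p \<in> fst c. f p \<in> fst d}) (in_charts c d f))"

definition smooth_manifold ::
  "'g topology \<Rightarrow> ('g, 'e::euclidean_space) chart set \<Rightarrow> bool" where
  "smooth_manifold T A \<longleftrightarrow>
     Hausdorff_space T \<and> second_countable T \<and>
     (\<Union>c\<in>A. fst c) = topspace T \<and>
     (\<forall>c\<in>A. openin T (fst c) \<and> open (snd c ` fst c) \<and>
        homeomorphic_map (subtopology T (fst c)) (top_of_set (snd c ` fst c)) (snd c)) \<and>
     smooth_in_charts A A (\<lambda>p. p)"

definition smooth_map ::
  "'g topology \<Rightarrow> ('g, 'e::real_normed_vector) chart set \<Rightarrow>
   'h topology \<Rightarrow> ('h, 'f::real_normed_vector) chart set \<Rightarrow> ('g \<Rightarrow> 'h) \<Rightarrow> bool" where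
  "smooth_map T A T' B f \<longleftrightarrow> continuous_map T T' f \<and> smooth_in_charts A B f"

definition prod_atlas ::
  "('g, 'e) chart set \<Rightarrow> ('h, 'f) chart set \<Rightarrow> ('g \<times> 'h, 'e \<times> 'f) chart set" where
  "prod_atlas A B = {(fst c \<times> fst d, map_prod (snd c) (snd d)) | c d. c \<in> A \<and> d \<in> B}"

text \<open>
  The tangent space at \<open>p\<close> is identified with the model space \<open>'e\<close> by means of a chart around \<open>p\<close>.
  \<open>tangent_map c d f p\<close> is the differential of \<open>f\<close> at \<open>p\<close>, read in \<open>c\<close> around \<open>p\<close> and in \<open>d\<close>
  around \<open>f p\<close>.
\<close>

definition tangent_map ::
  "('g, 'e::real_normed_vector) chart \<Rightarrow> ('h, 'f::real_normed_vector) chart \<Rightarrow>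
     ('g \<Rightarrow> 'h) \<Rightarrow> 'g \<Rightarrow> 'e \<Rightarrow> 'f" where
  "tangent_map c d f p = frechet_derivative (in_charts c d f) (at (snd c p))"

text \<open>
  \<open>\<eta> c p v\<close> is the value of the 1-form \<open>\<eta>\<close> at \<open>p\<close> on the tangent vector with coordinates \<open>v\<close> in the
  chart \<open>c\<close>.
\<close>

definition one_form ::
  "('g, 'e::euclidean_space) chart set \<Rightarrow> (('g, 'e) chart \<Rightarrow> 'g \<Rightarrow> 'e \<Rightarrow> real) \<Rightarrow> bool" where
  "one_form A \<eta> \<longleftrightarrow>
     (\<forall>c\<in>A. \<forall>p\<in>fst c. linear (\<eta> c p)) \<and>
     (\<forall>c\<in>A. \<forall>d\<in>A. \<forall>p\<in>fst c \<inter> fst d. \<forall>v. \<eta> d p (tangent_map c d (\<lambda>q. q) p v) = \<eta> c p v) \<and>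
     (\<forall>c\<in>A. \<forall>v. smooth_on (snd c ` fst c) (\<lambda>x. \<eta> c (chart_inv c x) v))"

text \<open>
  The exterior derivative of \<open>\<eta>\<close> at \<open>p\<close> in the chart \<open>c\<close>, normalised by
  \<open>d\<eta>(X, Y) = X \<eta>(Y) - Y \<eta>(X) - \<eta>([X, Y])\<close>; on left invariant fields this is \<open>- \<eta>([X, Y])\<close>.
\<close>

definition ext_deriv ::
  "(('g, 'e::euclidean_space) chart \<Rightarrow> 'g \<Rightarrow> 'e \<Rightarrow> real) \<Rightarrow>
     ('g, 'e) chart \<Rightarrow> 'g \<Rightarrow> 'e \<Rightarrow> 'e \<Rightarrow> real" where
  "ext_deriv \<eta> c p u v =
     frechet_derivative (\<lambda>x. \<eta> c (chart_inv c x) v) (at (snd c p)) u -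
     frechet_derivative (\<lambda>x. \<eta> c (chart_inv c x) u) (at (snd c p)) v"

definition contact_form ::
  "('g, 'e::euclidean_space) chart set \<Rightarrow> (('g, 'e) chart \<Rightarrow> 'g \<Rightarrow> 'e \<Rightarrow> real) \<Rightarrow> bool" where
  "contact_form A \<eta> \<longleftrightarrow> one_form A \<eta> \<and>
     (\<exists>n. DIM('e) = 2 * n + 1 \<and>
        (\<forall>c\<in>A. \<forall>p\<in>fst c. contact_pair UNIV n (ext_deriv \<eta> c p) (\<eta> c p)))"


section \<open>Lie groups\<close>

locale lie_group = group G
  for G :: "'g monoid" (structure)
    and T :: "'g topology"
    and A :: "('g, 'e::euclidean_space) chart set" +
  assumes topspace: "topspace T = carrier G"
    and manifold: "smooth_manifold T A"
    and smooth_mult: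
      "smooth_map (prod_topology T T) (prod_atlas A A) T A (\<lambda>(x, y). x \<otimes> y)"
    and smooth_inv: "smooth_map T A T A (\<lambda>x. inv x)"

definition left_invariant ::
  "'g monoid \<Rightarrow> ('g, 'e::euclidean_space) chart set \<Rightarrow>
     (('g, 'e) chart \<Rightarrow> 'g \<Rightarrow> 'e \<Rightarrow> real) \<Rightarrow> bool" where
  "left_invariant G A \<eta> \<longleftrightarrow>
     (\<forall>g\<in>carrier G. \<forall>c\<in>A. \<forall>d\<in>A. \<forall>p\<in>fst c. g \<otimes>\<^bsub>G\<^esub> p \<in> fst d \<longrightarrow>
        (\<forall>v. \<eta> d (g \<otimes>\<^bsub>G\<^esub> p) (tangent_map c d (\<lambda>q. g \<otimes>\<^bsub>G\<^esub> q) p v) = \<eta> c p v))"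

definition contact_lie_group ::
  "'g monoid \<Rightarrow> ('g, 'e::euclidean_space) chart set \<Rightarrow> bool" where
  "contact_lie_group G A \<longleftrightarrow> (\<exists>\<eta>. contact_form A \<eta> \<and> left_invariant G A \<eta>)"

text \<open>
  For a chart \<open>c\<close> around the identity, \<open>left_field G c v\<close> is the left invariant vector field with
  value \<open>v\<close> at the identity, as a vector field on the image of \<open>c\<close>. The Lie algebra of \<open>G\<close> is the
  tangent space at the identity, that is \<open>UNIV :: 'e set\<close> in the coordinates given by \<open>c\<close>; the
  bracket of \<open>u\<close> and \<open>v\<close> is the value at the identity of the bracket of the corresponding left
  invariant vector fields.
\<close>

definition left_field ::
  "'g monoid \<Rightarrow> ('g, 'e::euclidean_space) chart \<Rightarrow> 'e \<Rightarrow> 'e \<Rightarrow> 'e" where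
  "left_field G c v x = tangent_map c c (\<lambda>q. chart_inv c x \<otimes>\<^bsub>G\<^esub> q) \<one>\<^bsub>G\<^esub> v"

definition field_bracket ::
  "('e::euclidean_space \<Rightarrow> 'e) \<Rightarrow> ('e \<Rightarrow> 'e) \<Rightarrow> 'e \<Rightarrow> 'e" where
  "field_bracket X Y x = frechet_derivative Y (at x) (X x) - frechet_derivative X (at x) (Y x)"

definition lie_group_bracket ::
  "'g monoid \<Rightarrow> ('g, 'e::euclidean_space) chart \<Rightarrow> 'e \<Rightarrow> 'e \<Rightarrow> 'e" where
  "lie_group_bracket G c u v =
     field_bracket (left_field G c u) (left_field G c v) (snd c \<one>\<^bsub>G\<^esub>)"

end

theory Submission imports Defs begin

text \<open>
  The theorem reduces to linear algebra on five-dimensional Lie algebras. On a Lie group, a left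
  invariant form \<open>\<eta>\<close> satisfies \<open>d\<eta>(X\<^sub>u, X\<^sub>v) = - \<eta>([X\<^sub>u, X\<^sub>v])\<close> on left invariant fields
  (\<open>left_invariant_form\<close>), and every linear form on the tangent space at the identity extends to a
  left invariant form (\<open>left_invariant_form_exists\<close>). Hence the group is contact iff its Lie algebra
  is (\<open>contact_lie_group_iff\<close>). That the bracket of the group is a Lie algebra at all is derived from
  the symmetry of second derivatives: differentiating the left invariance of the fields shows that
  they are closed under brackets, and differentiating once more gives the Jacobi identity. In
  dimension five, \<open>\<eta>\<close> is a contact form iff no nonzero vector lies both in the kernel of \<open>\<eta>\<close> and in
  the radical of \<open>\<eta> \<circ> [\<cdot>, \<cdot>]\<close> (\<open>contact_iff_5\<close>).

  Nonsolvable case. The derived series stops at a nonzero perfect ideal \<open>P\<close>. A nonzero perfect Lie algebra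
  has dimension at least three, and dimension four is impossible: its \<open>ad\<close> operators are traceless,
  which forces all forms \<open>h \<circ> [\<cdot>, \<cdot>]\<close> to be degenerate; but these make up a four-dimensional
  subspace of the six-dimensional space of 2-forms, and the Pfaffian, a quadratic form of signature
  \<open>(3, 3)\<close>, cannot vanish on it (\<open>no_perfect_dim_4\<close>). If \<open>dim P = 3\<close>, then \<open>P\<close> is \<open>sl(2)\<close> or \<open>so(3)\<close>, all its derivations
  are inner, and the contact condition makes the centraliser of \<open>P\<close> nonabelian, hence \<open>aff(\<real>)\<close>
  (\<open>simple_ideal_3_isomorphic\<close>). If \<open>P\<close> is everything, a proper ideal has to be found without
  structure theory. The Killing form \<open>\<kappa>\<close> is degenerate: otherwise \<open>\<eta> = \<kappa>(x, \<cdot>)\<close> for a vector \<open>x\<close> such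
  that \<open>ad x\<close> is injective and traceless on \<open>ker \<eta>\<close> and preserves the 3-form \<open>\<kappa>([u, v], w)\<close> there; the
  3-form then vanishes, which leaves too few brackets for a perfect algebra. If
  the Killing form vanishes, Engel's theorem gives a non-nilpotent \<open>ad x\<close>, and the Cayley-Hamilton
  equation of \<open>ad x\<close> modulo \<open>x\<close> produces an ideal (\<open>perfect_contact_5_has_ideal\<close>). A proper ideal is an
  abelian plane on which the algebra acts through \<open>sl(2)\<close>; correcting lifts of the standard basis
  gives the semidirect product of \<open>\<real>\<^sup>2\<close> and \<open>sl(2)\<close>.

  Solvable case. The main obstruction is that \<open>E = [R, S]\<close> cannot be invertible when it commutes with
  \<open>S\<close>, because the identity would then be the commutator \<open>[E\<^sup>-\<^sup>1 R, S]\<close> (\<open>no_invertible_commutator\<close>).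
  It excludes that the second derived ideal has codimension one in the derived ideal, and it shows
  that the derived ideal acts nilpotently where needed. For a three-dimensional nonabelian derived
  ideal only the Heisenberg algebra remains. For a four-dimensional one the dimension of the second
  derived ideal is zero, one or two; the derived ideal is then abelian, a Heisenberg algebra plus a
  line, or filiform, its centre has dimension four, two or one, and in each case a contact form is
  written down or excluded directly.
\<close>

section \<open>Pfaffians and contact pairs\<close>

abbreviation (input) swp :: "nat \<Rightarrow> nat \<Rightarrow> nat \<Rightarrow> nat" where "swp \<equiv> Transposition.transpose"

text \<open>
  The Pfaffian of the matrix of \<open>\<omega>\<close> on four vectors, that is, half the value of \<open>\<omega> \<and> \<omega>\<close>.
\<close>

definition pf4 :: "('a \<Rightarrow> 'a \<Rightarrow> real) \<Rightarrow> 'a \<Rightarrow> 'a \<Rightarrow> 'a \<Rightarrow> 'a \<Rightarrow> real" where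
  "pf4 \<omega> a b c d = \<omega> a b * \<omega> c d - \<omega> a c * \<omega> b d + \<omega> a d * \<omega> b c"

text \<open>
  A permutation factors uniquely into one transposition for each of the positions \<open>0, 1, 2\<close>. The
  factorisation turns a sum over permutations into nested sums over small explicit sets.
\<close>

lemma sum_permutes_lessThan_4:
  fixes F :: "(nat \<Rightarrow> nat) \<Rightarrow> real"
  shows "(\<Sum>\<sigma> | \<sigma> permutes {..<4}. F \<sigma>) =
    (\<Sum>a\<in>{0,1,2,3}. \<Sum>b\<in>{1,2,3}. \<Sum>c\<in>{2,3}. F (swp 0 a \<circ> (swp 1 b \<circ> swp 2 c)))"
proof -
  have e: "{..<4::nat} = {0,1,2,3}" by auto
  have f0: "finite {1::nat,2,3}" "(0::nat) \<notin> {1,2,3}" by auto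
  have f1: "finite {2::nat,3}" "(1::nat) \<notin> {2,3}" by auto
  have f2: "finite {3::nat}" "(2::nat) \<notin> {3}" by auto
  show ?thesis
    unfolding e sum_over_permutations_insert[OF f0]
    unfolding sum_over_permutations_insert[OF f1]
    unfolding sum_over_permutations_insert[OF f2]
    unfolding permutes_sing by simp
qed

lemma wedge_power_2_1:
  assumes "\<And>x y. x \<in> V \<Longrightarrow> y \<in> V \<Longrightarrow> \<omega> y x = - \<omega> x y" and "range v \<subseteq> V"
  shows "wedge_power 2 (\<lambda>u. \<omega> (u 0) (u 1)) 1 v = \<omega> (v 0) (v 1)"
proof -
  have e: "{..<2::nat} = {0,1}" by auto
  have f: "finite {1::nat}" "(0::nat) \<notin> {1}" by auto
  have "v i \<in> V" for i using assms(2) by auto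
  then have "\<omega> (v 1) (v 0) = - \<omega> (v 0) (v 1)" by (intro assms(1))
  then show ?thesis
    unfolding One_nat_def wedge_power.simps wedge_def
    by (simp add: e sum_over_permutations_insert[OF f] permutes_sing
      sign_swap_id sign_id swap_id_eq flip: One_nat_def)
qed

lemma sign_comp_transpose:
  assumes "permutation \<alpha>" and "a \<noteq> b"
  shows "sign (\<alpha> \<circ> swp a b) = - sign \<alpha>"
  using assms by (simp add: sign_compose permutation_swap_id sign_swap_id)

lemma sum_transpose_2_3:
  fixes Q :: "nat \<Rightarrow> nat \<Rightarrow> nat \<Rightarrow> nat \<Rightarrow> real"
  assumes "permutation \<alpha>" and "\<And>a b c d. Q a b d c = - Q a b c d"
  shows "(\<Sum>c\<in>{2,3}. of_int (sign (\<alpha> \<circ> swp 2 c)) *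
      Q ((\<alpha> \<circ> swp 2 c) 0) ((\<alpha> \<circ> swp 2 c) 1)
        ((\<alpha> \<circ> swp 2 c) 2) ((\<alpha> \<circ> swp 2 c) 3))
    = 2 * of_int (sign \<alpha>) * Q (\<alpha> 0) (\<alpha> 1) (\<alpha> 2) (\<alpha> 3)"
proof -
  have "Q (\<alpha> 0) (\<alpha> 1) (\<alpha> 3) (\<alpha> 2) = - Q (\<alpha> 0) (\<alpha> 1) (\<alpha> 2) (\<alpha> 3)" by (rule assms(2))
  then show ?thesis
    by (simp add: sign_comp_transpose[OF assms(1)] swap_id_eq)
qed

lemma sum_transpose_1:
  fixes Q R :: "nat \<Rightarrow> nat \<Rightarrow> nat \<Rightarrow> nat \<Rightarrow> real"
  assumes "permutation \<alpha>" and R: "\<And>a b c d. Q a b c d - Q a c b d - Q a d c b = R a b c d"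
  shows "(\<Sum>c\<in>{1,2,3}. of_int (sign (\<alpha> \<circ> swp 1 c)) *
      Q ((\<alpha> \<circ> swp 1 c) 0) ((\<alpha> \<circ> swp 1 c) 1)
        ((\<alpha> \<circ> swp 1 c) 2) ((\<alpha> \<circ> swp 1 c) 3))
    = of_int (sign \<alpha>) * R (\<alpha> 0) (\<alpha> 1) (\<alpha> 2) (\<alpha> 3)"
  unfolding R[symmetric] by (simp add: sign_comp_transpose[OF assms(1)] swap_id_eq algebra_simps)

lemma sum_transpose_0:
  fixes R :: "nat \<Rightarrow> nat \<Rightarrow> nat \<Rightarrow> nat \<Rightarrow> real"
  assumes "\<And>a b c d. R b a c d = - R a b c d" "\<And>a b c d. R a c b d = - R a b c d" "\<And>a b c d. R a b d c = - R a b c d"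
  shows "(\<Sum>c\<in>{0,1,2,3}. of_int (sign (swp 0 c)) *
      R ((swp 0 c) 0) ((swp 0 c) 1)
        ((swp 0 c) 2) ((swp 0 c) 3))
    = 4 * R 0 1 2 3"
proof -
  have "R 1 0 2 3 = - R 0 1 2 3" "R 2 1 0 3 = - R 0 1 2 3" "R 3 1 2 0 = - R 0 1 2 3"
    using assms by metis+
  then show ?thesis by (simp add: sign_swap_id sign_id swap_id_eq)
qed

text \<open>
  The nested sum is evaluated from the inside: \<open>Q\<close> already alternates in its last two arguments,
  which gives a factor 2; the sum over the images of 1 completes \<open>Q\<close> to the alternating \<open>R\<close>; and
  the sum over the images of 0 repeats the same value four times.
\<close>

lemma sum_permutes_4_alternating:
  fixes Q R :: "nat \<Rightarrow> nat \<Rightarrow> nat \<Rightarrow> nat \<Rightarrow> real"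
  assumes Q: "\<And>a b c d. Q a b d c = - Q a b c d"
    and R: "\<And>a b c d. Q a b c d - Q a c b d - Q a d c b = R a b c d"
    and alt: "\<And>a b c d. R b a c d = - R a b c d" "\<And>a b c d. R a c b d = - R a b c d"
      "\<And>a b c d. R a b d c = - R a b c d"
  shows "(\<Sum>\<sigma> | \<sigma> permutes {..<4}. of_int (sign \<sigma>) * Q (\<sigma> 0) (\<sigma> 1) (\<sigma> 2) (\<sigma> 3)) = 8 * R 0 1 2 3"
proof -
  define S where "S \<sigma> = of_int (sign \<sigma>) * Q (\<sigma> 0) (\<sigma> 1) (\<sigma> 2) (\<sigma> 3)" for \<sigma>
  have 3: "(\<Sum>c\<in>{2,3}. S (swp 0 a \<circ> (swp 1 b \<circ> swp 2 c)))
     = 2 * S (swp 0 a \<circ> swp 1 b)" for a b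
    unfolding S_def o_assoc
    by (subst sum_transpose_2_3[where Q=Q, OF _ Q])
      (simp_all add: permutation_compose permutation_swap_id)
  have 2: "(\<Sum>b\<in>{1,2,3}. S (swp 0 a \<circ> swp 1 b))
     = of_int (sign (swp 0 a)) * R (swp 0 a 0)
        (swp 0 a 1) (swp 0 a 2) (swp 0 a 3)" for a
    unfolding S_def by (rule sum_transpose_1[OF permutation_swap_id R])
  have "(\<Sum>\<sigma> | \<sigma> permutes {..<4}. S \<sigma>) = 2 * (4 * R 0 1 2 3)"
    unfolding sum_permutes_lessThan_4 3 sum_distrib_left[symmetric] 2
    unfolding sum_transpose_0[where R=R, OF alt] ..
  then show ?thesis unfolding S_def by simp
qed

lemma wedge_power_2_2:
  assumes as: "\<And>x y. x \<in> V \<Longrightarrow> y \<in> V \<Longrightarrow> \<omega> y x = - \<omega> x y" and v: "range v \<subseteq> V"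
  shows "wedge_power 2 (\<lambda>u. \<omega> (u 0) (u 1)) 2 v = 2 * pf4 \<omega> (v 0) (v 1) (v 2) (v 3)"
proof -
  have vV: "v i \<in> V" for i using v by auto
  have *: "wedge_power 2 (\<lambda>u. \<omega> (u 0) (u 1)) 1 (\<lambda>i. v (\<sigma> (2 + i))) = \<omega> (v (\<sigma> 2)) (v (\<sigma> 3))" for \<sigma>
    using wedge_power_2_1[where v="\<lambda>i. v (\<sigma> (2 + i))" and V=V and \<omega>=\<omega>, OF as] vV
    by (simp add: image_subset_iff numeral_eq_Suc)
  have asv: "\<omega> (v a) (v b) = - \<omega> (v b) (v a)" for a b using as[OF vV vV] .
  have alt: "pf4 \<omega> (v b) (v a) (v c) (v d) = - pf4 \<omega> (v a) (v b) (v c) (v d)"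
    "pf4 \<omega> (v a) (v c) (v b) (v d) = - pf4 \<omega> (v a) (v b) (v c) (v d)"
    "pf4 \<omega> (v a) (v b) (v d) (v c) = - pf4 \<omega> (v a) (v b) (v c) (v d)" for a b c d
    unfolding pf4_def by (simp_all add: asv[of b a] asv[of c b] asv[of d c])
  have "wedge_power 2 (\<lambda>u. \<omega> (u 0) (u 1)) 2 v
    = wedge 2 2 (\<lambda>u. \<omega> (u 0) (u 1)) (wedge_power 2 (\<lambda>u. \<omega> (u 0) (u 1)) 1) v"
    by (simp add: numeral_2_eq_2)
  also have "\<dots> = (\<Sum>\<sigma> | \<sigma> permutes {..<4}.
        of_int (sign \<sigma>) * \<omega> (v (\<sigma> 0)) (v (\<sigma> 1)) * \<omega> (v (\<sigma> 2)) (v (\<sigma> 3))) / 4"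
    unfolding wedge_def * by simp
  also have "(\<Sum>\<sigma> | \<sigma> permutes {..<4}. of_int (sign \<sigma>) * \<omega> (v (\<sigma> 0)) (v (\<sigma> 1)) * \<omega> (v (\<sigma> 2)) (v (\<sigma> 3)))
     = 8 * pf4 \<omega> (v 0) (v 1) (v 2) (v 3)"
  proof -
    have 1: "\<omega> (v a) (v b) * \<omega> (v d) (v c) = - (\<omega> (v a) (v b) * \<omega> (v c) (v d))" for a b c d
      using asv[of d c] by simp
    have 2: "\<omega> (v a) (v b) * \<omega> (v c) (v d) - \<omega> (v a) (v c) * \<omega> (v b) (v d) - \<omega> (v a) (v d) * \<omega> (v c) (v b)
       = pf4 \<omega> (v a) (v b) (v c) (v d)" for a b c d
      unfolding pf4_def by (simp add: asv[of c b])
    show ?thesis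
    using sum_permutes_4_alternating[where Q="\<lambda>a b c d. \<omega> (v a) (v b) * \<omega> (v c) (v d)"
       and R="\<lambda>a b c d. pf4 \<omega> (v a) (v b) (v c) (v d)", OF 1 2 alt]
    by (simp only: mult.assoc)
  qed
  finally show ?thesis by simp
qed

text \<open>
  On five vectors \<open>\<omega> \<and> \<omega> \<and> \<eta>\<close> is twice its expansion along \<open>\<eta>\<close>. A permutation of five indices is a
  transposition that moves \<open>b\<close> to the last position, followed by a permutation of the other four;
  the latter contribute 24 equal terms, because the Pfaffian is alternating.
\<close>

lemma contact_pair_2_iff:
  assumes as: "\<And>x y. x \<in> V \<Longrightarrow> y \<in> V \<Longrightarrow> \<omega> y x = - \<omega> x y"
  shows "contact_pair V 2 \<omega> \<eta> \<longleftrightarrow> (\<exists>v. range v \<subseteq> V \<and>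
     pf4 \<omega> (v 1) (v 2) (v 3) (v (4::nat)) * \<eta> (v 0) - pf4 \<omega> (v 0) (v 2) (v 3) (v 4) * \<eta> (v 1)
     + pf4 \<omega> (v 0) (v 1) (v 3) (v 4) * \<eta> (v 2) - pf4 \<omega> (v 0) (v 1) (v 2) (v 4) * \<eta> (v 3)
     + pf4 \<omega> (v 0) (v 1) (v 2) (v 3) * \<eta> (v 4) \<noteq> 0)" (is "_ \<longleftrightarrow> (\<exists>v. _ \<and> ?F v \<noteq> 0)")
proof -
  have key: "wedge (2 * 2) 1 (wedge_power 2 (\<lambda>u. \<omega> (u 0) (u 1)) 2) (\<lambda>u. \<eta> (u 0)) v = 2 * ?F v"
    if v: "range v \<subseteq> V" for v
  proof -
    have vV: "v i \<in> V" for i using v by auto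
    have w: "wedge_power 2 (\<lambda>u. \<omega> (u 0) (u 1)) 2 (\<lambda>i. v (\<sigma> i)) =
      2 * pf4 \<omega> (v (\<sigma> 0)) (v (\<sigma> 1)) (v (\<sigma> 2)) (v (\<sigma> 3))" for \<sigma>
      by (rule wedge_power_2_2[where v="\<lambda>i. v (\<sigma> i)" and V=V and \<omega>=\<omega>, OF as])
        (simp_all add: image_subset_iff vV)
    have a: "\<omega> (v 1) (v 0) = - \<omega> (v 0) (v 1)" "\<omega> (v 2) (v 0) = - \<omega> (v 0) (v 2)"
       "\<omega> (v 3) (v 0) = - \<omega> (v 0) (v 3)" "\<omega> (v 4) (v 0) = - \<omega> (v 0) (v 4)"
       "\<omega> (v 2) (v 1) = - \<omega> (v 1) (v 2)" "\<omega> (v 3) (v 1) = - \<omega> (v 1) (v 3)"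
       "\<omega> (v 4) (v 1) = - \<omega> (v 1) (v 4)" "\<omega> (v 3) (v 2) = - \<omega> (v 2) (v 3)"
       "\<omega> (v 4) (v 2) = - \<omega> (v 2) (v 4)" "\<omega> (v 4) (v 3) = - \<omega> (v 3) (v 4)"
      using as vV by blast+
    define P where "P \<tau> = (\<lambda>i j k l. pf4 \<omega> (v (\<tau> i)) (v (\<tau> j)) (v (\<tau> k)) (v (\<tau> l)))" for \<tau> :: "nat \<Rightarrow> nat"
    have inner: "(\<Sum>q | q permutes {..<4}. of_int (sign (swp 4 b \<circ> q)) *
        P (swp 4 b) (q 0) (q 1) (q 2) (q 3) * \<eta> (v ((swp 4 b \<circ> q) 4)))
        = 24 * of_int (sign (swp 4 b)) * P (swp 4 b) 0 1 2 3 * \<eta> (v b)" for b :: nat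
    proof -
      have q4: "q 4 = 4" if "q permutes {..<4::nat}" for q
        using that by (simp add: permutes_def)
      have sg: "sign (swp 4 b \<circ> q) = sign (swp 4 b) * sign q" if "q permutes {..<4::nat}" for q
        using that by (intro sign_compose permutation_swap_id) (auto simp: permutation_permutes)
      have t: "swp 4 b (4::nat) = b" by simp
      have "(\<Sum>q | q permutes {..<4}. of_int (sign (swp 4 b \<circ> q)) *
        P (swp 4 b) (q 0) (q 1) (q 2) (q 3) * \<eta> (v ((swp 4 b \<circ> q) 4)))
        = of_int (sign (swp 4 b)) * \<eta> (v b) * (\<Sum>q | q permutes {..<4}. of_int (sign q) *
            P (swp 4 b) (q 0) (q 1) (q 2) (q 3))"
        unfolding sum_distrib_left
        by (intro sum.cong refl) (simp add: q4 sg)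
      also have "(\<Sum>q | q permutes {..<4}. of_int (sign q) *
            P (swp 4 b) (q 0) (q 1) (q 2) (q 3)) = 24 * P (swp 4 b) 0 1 2 3"
      proof -
        define u where "u i = v (swp 4 b i)" for i :: nat
        have asv: "\<omega> (u a) (u b) = - \<omega> (u b) (u a)" for a b unfolding u_def using as[OF vV vV] .
        have alt: "pf4 \<omega> (u b) (u a) (u c) (u d) = - pf4 \<omega> (u a) (u b) (u c) (u d)"
          "pf4 \<omega> (u a) (u c) (u b) (u d) = - pf4 \<omega> (u a) (u b) (u c) (u d)"
          "pf4 \<omega> (u a) (u b) (u d) (u c) = - pf4 \<omega> (u a) (u b) (u c) (u d)" for a b c d
          unfolding pf4_def by (simp_all add: asv[of b a] asv[of c b] asv[of d c])
        have 2: "pf4 \<omega> (u a) (u b) (u c) (u d) - pf4 \<omega> (u a) (u c) (u b) (u d) - pf4 \<omega> (u a) (u d) (u c) (u b)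
          = 3 * pf4 \<omega> (u a) (u b) (u c) (u d)" for a b c d
          unfolding pf4_def by (simp add: asv[of c b] asv[of d c] asv[of d b])
        have alt3: "3 * pf4 \<omega> (u b) (u a) (u c) (u d) = - (3 * pf4 \<omega> (u a) (u b) (u c) (u d))"
          "3 * pf4 \<omega> (u a) (u c) (u b) (u d) = - (3 * pf4 \<omega> (u a) (u b) (u c) (u d))"
          "3 * pf4 \<omega> (u a) (u b) (u d) (u c) = - (3 * pf4 \<omega> (u a) (u b) (u c) (u d))" for a b c d
          using alt(1)[of b a c d] alt(2)[of a c b d] alt(3)[of a b d c] by simp_all
        show ?thesis unfolding P_def u_def[symmetric]
          using sum_permutes_4_alternating[where Q="\<lambda>a b c d. pf4 \<omega> (u a) (u b) (u c) (u d)"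
            and R="\<lambda>a b c d. 3 * pf4 \<omega> (u a) (u b) (u c) (u d)", OF alt(3) 2 alt3]
          by simp
      qed
      finally have "(\<Sum>q | q permutes {..<4}. of_int (sign (swp 4 b \<circ> q)) *
        P (swp 4 b) (q 0) (q 1) (q 2) (q 3) * \<eta> (v ((swp 4 b \<circ> q) 4)))
        = of_int (sign (swp 4 b)) * \<eta> (v b) * (24 * P (swp 4 b) 0 1 2 3)" .
      also have "\<dots> = 24 * of_int (sign (swp 4 b)) * P (swp 4 b) 0 1 2 3 * \<eta> (v b)"
        by (simp only: mult_ac)
      finally show ?thesis .
    qed
    have f: "finite {..<4::nat}" "4 \<notin> {..<4::nat}" by auto
    have e: "{..<2*2+1::nat} = insert 4 {..<4}" by auto
    have e2: "insert (4::nat) {..<4} = {0,1,2,3,4}" by auto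
    have S1: "wedge (2 * 2) 1 (wedge_power 2 (\<lambda>u. \<omega> (u 0) (u 1)) 2) (\<lambda>u. \<eta> (u 0)) v
      = (\<Sum>b\<in>{0,1,2,3,4}. \<Sum>q | q permutes {..<4}. of_int (sign (swp 4 b \<circ> q)) *
        (2 * P (swp 4 b) (q 0) (q 1) (q 2) (q 3)) * \<eta> (v ((swp 4 b \<circ> q) 4))) / 24"
      unfolding wedge_def w e sum_over_permutations_insert[OF f]
      unfolding e2 P_def
      by (simp add: fact_numeral)
    have S2: "(\<Sum>b\<in>{0,1,2,3,4}. \<Sum>q | q permutes {..<4}. of_int (sign (swp 4 b \<circ> q)) *
        (2 * P (swp 4 b) (q 0) (q 1) (q 2) (q 3)) * \<eta> (v ((swp 4 b \<circ> q) 4))) / 24 = (\<Sum>b\<in>{0,1,2,3,4}. 2 * (\<Sum>q | q permutes {..<4}. of_int (sign (swp 4 b \<circ> q)) *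
        P (swp 4 b) (q 0) (q 1) (q 2) (q 3) * \<eta> (v ((swp 4 b \<circ> q) 4)))) / 24"
      unfolding sum_distrib_left by (simp add: algebra_simps)
    have S3: "(\<Sum>b\<in>{0,1,2,3,4::nat}. 2 * (24 * of_int (sign (swp 4 b)) * P (swp 4 b) 0 1 2 3 * \<eta> (v b))) / 24
        = 2 * (\<Sum>b\<in>{0,1,2,3,4}. of_int (sign (swp 4 b)) * P (swp 4 b) 0 1 2 3 * \<eta> (v b))"
      by simp
    have S4: "(\<Sum>b\<in>{0,1,2,3,4::nat}. of_int (sign (swp 4 b)) * P (swp 4 b) 0 1 2 3 * \<eta> (v b)) = ?F v"
      unfolding P_def pf4_def by (simp add: sign_swap_id swap_id_eq a[unfolded One_nat_def] sign_id algebra_simps)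
    show ?thesis unfolding S1 S2 inner S3 S4 ..
  qed
  show ?thesis unfolding contact_pair_def
  proof (intro ex_cong1 conj_cong refl)
    fix v :: "nat \<Rightarrow> 'a" assume v: "range v \<subseteq> V"
    have aux: "a = 2 * b \<Longrightarrow> a \<noteq> 0 \<longleftrightarrow> b \<noteq> 0" for a b :: real by simp
    show "wedge (2 * 2) 1 (wedge_power 2 (\<lambda>u. \<omega> (u 0) (u 1)) 2) (\<lambda>u. \<eta> (u 0)) v \<noteq> 0 \<longleftrightarrow> ?F v \<noteq> 0"
      by (rule aux[OF key[OF v]])
  qed
qed

lemma wedge_power_comp:
  assumes "\<And>x y. x \<in> V \<Longrightarrow> y \<in> V \<Longrightarrow> \<omega>' (f x) (f y) = \<omega> x y" and "range v \<subseteq> V"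
  shows "wedge_power 2 (\<lambda>u. \<omega>' (u 0) (u 1)) n (\<lambda>i. f (v i)) = wedge_power 2 (\<lambda>u. \<omega> (u 0) (u 1)) n v"
  using assms(2)
proof (induction n arbitrary: v)
  case 0
  show ?case by (simp only: wedge_power.simps)
next
  case (Suc n)
  have vV: "v i \<in> V" for i using Suc.prems by (simp add: image_subset_iff)
  have a: "wedge_power 2 (\<lambda>u. \<omega>' (u 0) (u 1)) n (\<lambda>i. f (v (\<sigma> (2 + i)))) =
        wedge_power 2 (\<lambda>u. \<omega> (u 0) (u 1)) n (\<lambda>i. v (\<sigma> (2 + i)))" for \<sigma>
    by (rule Suc.IH) (simp add: image_subset_iff vV)
  have b: "\<omega>' (f (v (\<sigma> 0))) (f (v (\<sigma> 1))) = \<omega> (v (\<sigma> 0)) (v (\<sigma> 1))" for \<sigma>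
    by (rule assms(1)) (rule vV)+
  show ?case unfolding wedge_power.simps wedge_def
    by (intro arg_cong2[where f="(/)"] sum.cong refl) (simp only: a b)
qed

text \<open>
  The wedge products evaluate the forms only at the entries of a sequence of vectors, so a
  sequence that witnesses nondegeneracy can be mapped entrywise.
\<close>

lemma contact_pair_transport:
  assumes "contact_pair V n \<omega> \<eta>" and "f ` V \<subseteq> V'"
    and "\<And>x y. x \<in> V \<Longrightarrow> y \<in> V \<Longrightarrow> \<omega>' (f x) (f y) = \<omega> x y"
    and "\<And>x. x \<in> V \<Longrightarrow> \<eta>' (f x) = \<eta> x"
  shows "contact_pair V' n \<omega>' \<eta>'"
proof -
  obtain v where v: "range v \<subseteq> V"
    "wedge (2 * n) 1 (wedge_power 2 (\<lambda>u. \<omega> (u 0) (u 1)) n) (\<lambda>u. \<eta> (u 0)) v \<noteq> 0"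
    using assms(1) unfolding contact_pair_def by blast
  have vV: "v i \<in> V" for i using v(1) by (simp add: image_subset_iff)
  have a: "wedge_power 2 (\<lambda>u. \<omega>' (u 0) (u 1)) n (\<lambda>i. f (v (\<sigma> i))) =
        wedge_power 2 (\<lambda>u. \<omega> (u 0) (u 1)) n (\<lambda>i. v (\<sigma> i))" for \<sigma>
    by (rule wedge_power_comp[where f=f and V=V and \<omega>=\<omega> and \<omega>'=\<omega>' and v="\<lambda>i. v (\<sigma> i)", OF assms(3)]) (simp_all add: image_subset_iff vV)
  have b: "\<eta>' (f (v (\<sigma> i))) = \<eta> (v (\<sigma> i))" for \<sigma> i
    by (rule assms(4)) (rule vV)
  have "wedge (2 * n) 1 (wedge_power 2 (\<lambda>u. \<omega>' (u 0) (u 1)) n) (\<lambda>u. \<eta>' (u 0)) (\<lambda>i. f (v i)) \<noteq> 0"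
    using v(2) unfolding wedge_def a b .
  moreover have "range (\<lambda>i. f (v i)) \<subseteq> V'"
    using vV assms(2) by (simp add: image_subset_iff)
  ultimately show ?thesis
    unfolding contact_pair_def by (intro exI[of _ "\<lambda>i. f (v i)"] conjI)
qed

section \<open>Kernels and orthogonal projections\<close>

lemma exists_common_kernel:
  fixes f :: "'e::euclidean_space \<Rightarrow> 'b::euclidean_space"
  assumes "linear f" and "subspace S" and "DIM('b) < dim S"
  obtains u where "u \<in> S" "u \<noteq> 0" "f u = 0"
proof -
  have "\<not> inj_on f S"
  proof
    assume "inj_on f S"
    then have "dim (f ` S) = dim S"
      using assms(1,2) by (intro dim_image_eq) (simp_all add: span_eq_iff[THEN iffD2])
    moreover have "dim (f ` S) \<le> DIM('b)" by (rule dim_subset_UNIV)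
    ultimately show False using assms(3) by simp
  qed
  then obtain x y where "x \<in> S" "y \<in> S" "x \<noteq> y" "f x = f y"
    by (auto simp: inj_on_def)
  then show ?thesis
    using that[of "x - y"] assms by (simp add: subspace_diff linear_diff)
qed

lemma linear_relation_6:
  fixes b1 b2 b3 b4 b5 b6 :: "'e::euclidean_space"
  assumes "DIM('e) < 6"
  obtains c1 c2 c3 c4 c5 c6 :: real where
    "c1 *\<^sub>R b1 + c2 *\<^sub>R b2 + c3 *\<^sub>R b3 + c4 *\<^sub>R b4 + c5 *\<^sub>R b5 + c6 *\<^sub>R b6 = 0"
    "\<not> (c1 = 0 \<and> c2 = 0 \<and> c3 = 0 \<and> c4 = 0 \<and> c5 = 0 \<and> c6 = 0)"
proof -
  let ?f = "\<lambda>(c1, c2, c3, c4, c5, c6). c1 *\<^sub>R b1 + c2 *\<^sub>R b2 + c3 *\<^sub>R b3 + c4 *\<^sub>R b4 + c5 *\<^sub>R b5 + c6 *\<^sub>R b6"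
  have "linear ?f" by (auto intro!: linearI simp: algebra_simps)
  then obtain u where "?f u = 0" "u \<noteq> 0"
    by (rule exists_common_kernel[of ?f UNIV]) (use assms in \<open>simp_all add: dim_UNIV\<close>)
  then show ?thesis using that by (cases u) (auto simp: zero_prod_def)
qed

lemma linear_relation_5:
  fixes b1 b2 b3 b4 b5 :: "'e::euclidean_space"
  assumes "DIM('e) < 5"
  obtains c1 c2 c3 c4 c5 :: real where
    "c1 *\<^sub>R b1 + c2 *\<^sub>R b2 + c3 *\<^sub>R b3 + c4 *\<^sub>R b4 + c5 *\<^sub>R b5 = 0"
    "\<not> (c1 = 0 \<and> c2 = 0 \<and> c3 = 0 \<and> c4 = 0 \<and> c5 = 0)"
proof -
  let ?f = "\<lambda>(c1, c2, c3, c4, c5). c1 *\<^sub>R b1 + c2 *\<^sub>R b2 + c3 *\<^sub>R b3 + c4 *\<^sub>R b4 + c5 *\<^sub>R b5"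
  have "linear ?f" by (auto intro!: linearI simp: algebra_simps)
  then obtain u where "?f u = 0" "u \<noteq> 0"
    by (rule exists_common_kernel[of ?f UNIV]) (use assms in \<open>simp_all add: dim_UNIV\<close>)
  then show ?thesis using that by (cases u) (auto simp: zero_prod_def)
qed

text \<open>
  Projecting along \<open>S\<close> onto its orthogonal complement realises the quotient by \<open>S\<close> inside the space
  itself. Being self-adjoint and idempotent, \<open>q\<close> has a sum of squares as its trace.
\<close>

lemma orthogonal_projection_exists:
  fixes S :: "'e::euclidean_space set"
  assumes "subspace S"
  obtains q :: "'e \<Rightarrow> 'e" where "linear q" "\<And>x. q x = 0 \<longleftrightarrow> x \<in> S" "\<And>x. q (q x) = q x"
    "\<And>x y. q x \<bullet> y = x \<bullet> q y" "dim (range q) + dim S = DIM('e)"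
proof -
  obtain B where B: "B \<subseteq> S" "pairwise orthogonal B" "\<And>x. x \<in> B \<Longrightarrow> norm x = 1" "independent B"
      "card B = dim S" "span B = S"
    using orthonormal_basis_subspace[OF assms] by metis
  have fin: "finite B" using B(4) by (rule independent_imp_finite)
  define q where "q x = x - (\<Sum>b\<in>B. (x \<bullet> b) *\<^sub>R b)" for x
  have lin: "linear q" unfolding q_def
    by (rule linearI) (simp_all add: inner_add_left scaleR_add_left sum.distrib scaleR_right.sum algebra_simps)
  have qB: "q x \<bullet> b = 0" if "b \<in> B" for x b
  proof -
    have "(\<Sum>c\<in>B. (x \<bullet> c) *\<^sub>R c) \<bullet> b = (\<Sum>c\<in>B. if c = b then x \<bullet> b else 0)"
      unfolding inner_sum_left using B(2,3) that
      by (intro sum.cong) (auto simp: pairwise_def orthogonal_def dot_square_norm)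
    also have "\<dots> = x \<bullet> b" using fin that by simp
    finally show ?thesis by (simp add: q_def inner_diff_left)
  qed
  have S: "(\<Sum>b\<in>B. (x \<bullet> b) *\<^sub>R b) \<in> S" for x
    using B(1) assms by (intro subspace_sum subspace_scale) auto
  have qS: "q x \<bullet> s = 0" if "s \<in> S" for x s
  proof -
    have "s \<in> span B" using that B(6) by simp
    then have "orthogonal (q x) s"
      by (rule orthogonal_to_span) (simp add: orthogonal_def qB)
    then show ?thesis by (simp add: orthogonal_def)
  qed
  have zero: "q x = 0 \<longleftrightarrow> x \<in> S" for x
  proof
    assume "q x = 0" then show "x \<in> S" using S[of x] by (simp add: q_def)
  next
    assume "x \<in> S"
    then have "q x \<in> S" using S[of x] assms unfolding q_def by (intro subspace_diff)
    then have "q x \<bullet> q x = 0" by (rule qS)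
    then show "q x = 0" by simp
  qed
  have diff: "x - q x \<in> S" for x using S[of x] by (simp add: q_def)
  have idem: "q (q x) = q x" for x
    using zero[of "x - q x"] diff[of x] by (simp add: linear_diff[OF lin])
  have adj: "q x \<bullet> y = x \<bullet> q y" for x y
  proof -
    have "q x \<bullet> (y - q y) = 0" "q y \<bullet> (x - q x) = 0" by (intro qS diff)+
    then show ?thesis by (simp add: inner_diff_right inner_commute)
  qed
  have "{x + y |x y. x \<in> range q \<and> y \<in> S} = UNIV"
  proof -
    have "x = q x + (x - q x)" for x by simp
    then show ?thesis using diff by blast
  qed
  moreover have "range q \<inter> S = {0}"
  proof (intro equalityI subsetI)
    fix x assume "x \<in> range q \<inter> S"
    then obtain y where y: "x = q y" "x \<in> S" by auto
    have "q x = 0" using y(2) zero by blast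
    moreover have "q x = x" unfolding y(1) by (rule idem)
    ultimately show "x \<in> {0}" by simp
  next
    fix x assume "x \<in> {0::'e}"
    then have "x = q 0" using linear_0[OF lin] by simp
    then show "x \<in> range q \<inter> S" using subspace_0[OF assms] \<open>x \<in> {0}\<close> by auto
  qed
  moreover have "subspace (range q)" by (rule linear_subspace_image[OF lin subspace_UNIV])
  ultimately have "dim (range q) + dim S = DIM('e)"
    using dim_sums_Int[of "range q" S] assms by (simp add: dim_UNIV)
  then show ?thesis using that lin zero idem adj by blast
qed

section \<open>Traces of endomorphisms\<close>

definition op_trace :: "('e::euclidean_space \<Rightarrow> 'e) \<Rightarrow> real" where
  "op_trace f = (\<Sum>b\<in>Basis. f b \<bullet> b)"

lemma op_trace_add: "op_trace (\<lambda>x. f x + g x) = op_trace f + op_trace g"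
  and op_trace_diff: "op_trace (\<lambda>x. f x - g x) = op_trace f - op_trace g"
  and op_trace_minus: "op_trace (\<lambda>x. - f x) = - op_trace f"
  and op_trace_scale: "op_trace (\<lambda>x. c *\<^sub>R f x) = c * op_trace f"
  and op_trace_zero: "op_trace (\<lambda>x. 0) = 0"
  by (simp_all add: op_trace_def inner_add_left inner_diff_left sum.distrib sum_subtractf sum_distrib_left sum_negf)

lemma op_trace_id: "op_trace (\<lambda>x::'e. x) = DIM('e::euclidean_space)"
  by (simp add: op_trace_def)

lemma op_trace_comp_commute:
  fixes f g :: "'e::euclidean_space \<Rightarrow> 'e"
  assumes "linear f" "linear g"
  shows "op_trace (\<lambda>x. f (g x)) = op_trace (\<lambda>x. g (f x))"
proof -
  have *: "op_trace (\<lambda>x. f (g x)) = (\<Sum>b\<in>Basis. \<Sum>c\<in>Basis. (g b \<bullet> c) * (f c \<bullet> b))"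
    if "linear f" for f g :: "'e \<Rightarrow> 'e"
  proof -
    have "f (g b) \<bullet> b = (\<Sum>c\<in>Basis. (g b \<bullet> c) * (f c \<bullet> b))" for b
    proof -
      have "f (g b) = f (\<Sum>c\<in>Basis. (g b \<bullet> c) *\<^sub>R c)" by (simp only: euclidean_representation)
      also have "\<dots> = (\<Sum>c\<in>Basis. (g b \<bullet> c) *\<^sub>R f c)"
        using that by (simp add: linear_sum linear_scale)
      finally show ?thesis by (simp add: inner_sum_left)
    qed
    then show ?thesis by (simp add: op_trace_def)
  qed
  show ?thesis unfolding *[OF assms(1)] *[OF assms(2)]
    by (subst sum.swap) (simp add: mult.commute)
qed

lemma op_trace_adjoint:
  fixes f :: "'e::euclidean_space \<Rightarrow> 'e"
  assumes "\<And>x y. f x \<bullet> y = x \<bullet> g y"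
  shows "op_trace g = op_trace f"
  unfolding op_trace_def by (intro sum.cong refl) (metis assms inner_commute)

text \<open>
  The trace does not depend on the basis: expanding both the orthonormal basis in the \<open>b i\<close> and
  their images back gives the same double sum.
\<close>

lemma op_trace_basis:
  fixes f :: "'e::euclidean_space \<Rightarrow> 'e" and \<beta> :: "'i \<Rightarrow> 'e \<Rightarrow> real"
  assumes "linear f" and "\<And>i. i \<in> I \<Longrightarrow> linear (\<beta> i)" and "\<And>y. y = (\<Sum>i\<in>I. \<beta> i y *\<^sub>R b i)"
  shows "op_trace f = (\<Sum>i\<in>I. \<beta> i (f (b i)))"
proof -
  have "f e \<bullet> e = (\<Sum>i\<in>I. \<beta> i e * (f (b i) \<bullet> e))" for e
  proof -
    have "f e = f (\<Sum>i\<in>I. \<beta> i e *\<^sub>R b i)" using assms(3)[of e] by simp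
    also have "\<dots> = (\<Sum>i\<in>I. \<beta> i e *\<^sub>R f (b i))" using assms(1) by (simp add: linear_sum linear_scale)
    finally show ?thesis by (simp add: inner_sum_left)
  qed
  then have "op_trace f = (\<Sum>e\<in>Basis. \<Sum>i\<in>I. \<beta> i e * (f (b i) \<bullet> e))"
    by (simp add: op_trace_def)
  also have "\<dots> = (\<Sum>i\<in>I. \<Sum>e\<in>Basis. \<beta> i e * (f (b i) \<bullet> e))" by (rule sum.swap)
  also have "\<dots> = (\<Sum>i\<in>I. \<beta> i (f (b i)))"
  proof (intro sum.cong refl)
    fix i assume i: "i \<in> I"
    have "\<beta> i (f (b i)) = \<beta> i (\<Sum>e\<in>Basis. (f (b i) \<bullet> e) *\<^sub>R e)" by (simp only: euclidean_representation)
    also have "\<dots> = (\<Sum>e\<in>Basis. (f (b i) \<bullet> e) *\<^sub>R \<beta> i e)"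
      using assms(2)[OF i] by (simp add: linear_sum linear_scale)
    finally show "(\<Sum>e\<in>Basis. \<beta> i e * (f (b i) \<bullet> e)) = \<beta> i (f (b i))" by (simp add: mult.commute)
  qed
  finally show ?thesis .
qed

section \<open>Lie algebras on a Euclidean space\<close>

lemma linear_on_UNIV: "linear_on UNIV f \<longleftrightarrow> linear f"
  by (auto simp: linear_on_def linear_iff)

locale lie_space =
  fixes br :: "'e::euclidean_space \<Rightarrow> 'e \<Rightarrow> 'e"
  assumes lie: "lie_algebra UNIV br"
begin

lemma linear_br [simp]: "linear (br x)"
  using lie_algebra.linear_right[OF lie, of x] by (simp add: linear_on_UNIV)

lemma linear_br_left [simp]: "linear (\<lambda>x. br x y)"
  using lie_algebra.linear_left[OF lie, of y] by (simp add: linear_on_UNIV)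

lemma br_simps:
  "br x (y + z) = br x y + br x z" "br (x + y) z = br x z + br y z"
  "br x (y - z) = br x y - br x z" "br (x - y) z = br x z - br y z"
  "br x (c *\<^sub>R y) = c *\<^sub>R br x y" "br (c *\<^sub>R x) y = c *\<^sub>R br x y"
  "br x (- y) = - br x y" "br (- x) y = - br x y"
  "br x 0 = 0" "br 0 x = 0" "br x x = 0"
  using linear_add[OF linear_br] linear_add[OF linear_br_left[of z]]
    linear_diff[OF linear_br] linear_diff[OF linear_br_left[of z]]
    linear_scale[OF linear_br] linear_scale[OF linear_br_left[of y]]
    linear_neg[OF linear_br] linear_neg[OF linear_br_left[of y]]
    linear_0[OF linear_br] linear_0[OF linear_br_left[of x]] lie_algebra.alternating[OF lie, of x]
  by simp_all

lemma br_skew: "br y x = - br x y"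
proof -
  have "br (x + y) (x + y) = 0" by (simp only: br_simps)
  moreover have "br (x + y) (x + y) = (br x x + br y x) + (br x y + br y y)" by (simp only: br_simps(1,2))
  ultimately have "br y x + br x y = 0" by (simp add: br_simps(11))
  then show ?thesis by (simp add: eq_neg_iff_add_eq_0)
qed

lemma br_jacobi: "br x (br y z) = br (br x y) z + br y (br x z)"
proof -
  have "br x (br y z) + br y (br z x) + br z (br x y) = 0" using lie_algebra.jacobi[OF lie] by simp
  moreover have "br y (br z x) = - br y (br x z)" using br_skew[of z x] by (simp add: br_simps)
  moreover have "br z (br x y) = - br (br x y) z" by (rule br_skew)
  ultimately show ?thesis by (simp add: algebra_simps)
qed

abbreviation derived :: "'e set" where "derived \<equiv> lie_derived UNIV br"

lemma br_in_derived: "br x y \<in> derived"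
  unfolding lie_derived_def by (intro span_base) auto

lemma subspace_derived: "subspace derived"
  unfolding lie_derived_def by (rule subspace_span)

lemma derived_induct:
  assumes "z \<in> derived" "subspace {z. P z}" "\<And>x y. P (br x y)"
  shows "P z"
  using assms unfolding lie_derived_def by (auto intro: span_induct[where P=P])

text \<open>
  Jacobi: \<open>[u, [x, y]] = [[u, x], y] + [x, [u, y]]\<close>.
\<close>

lemma derived_ideal:
  assumes "subspace K" "\<And>u p. p \<in> K \<Longrightarrow> br u p \<in> K"
  shows "subspace (lie_derived K br)" "p \<in> lie_derived K br \<Longrightarrow> br u p \<in> lie_derived K br" "lie_derived K br \<subseteq> K"
proof -
  show "subspace (lie_derived K br)" by (simp add: lie_derived_def)
  show "lie_derived K br \<subseteq> K" unfolding lie_derived_def using assms by (intro span_minimal) auto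
  assume "p \<in> lie_derived K br"
  then have "p \<in> span {br x y |x y. x \<in> K \<and> y \<in> K}" by (simp add: lie_derived_def)
  then show "br u p \<in> lie_derived K br"
  proof (rule span_induct)
    show "subspace {p. br u p \<in> lie_derived K br}"
      by (auto simp: subspace_def br_simps lie_derived_def intro: span_zero span_add span_scale)
    fix z assume "z \<in> {br x y |x y. x \<in> K \<and> y \<in> K}"
    then obtain x y where z: "z = br x y" "x \<in> K" "y \<in> K" by blast
    have "br (br u x) y \<in> lie_derived K br" "br x (br u y) \<in> lie_derived K br"
      using assms(2) z unfolding lie_derived_def by (blast intro: span_base)+
    then show "br u z \<in> lie_derived K br" unfolding z br_jacobi[of u x y]
      by (simp add: lie_derived_def span_add)
  qed
qed

lemma br_in_lie_derived: "x \<in> K \<Longrightarrow> y \<in> K \<Longrightarrow> br x y \<in> lie_derived K br"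
  unfolding lie_derived_def by (intro span_base) blast

text \<open>
  By the Jacobi identity \<open>ad [x, y]\<close> is the commutator of \<open>ad x\<close> and \<open>ad y\<close>. In a perfect Lie
  algebra all \<open>ad\<close> operators are therefore traceless.
\<close>

lemma op_trace_br:
  assumes "z \<in> derived" shows "op_trace (br z) = 0"
  using assms
proof (rule derived_induct)
  show "subspace {z. op_trace (br z) = 0}"
  proof -
    have "br (x + y) = (\<lambda>z. br x z + br y z)" "br (c *\<^sub>R x) = (\<lambda>z. c *\<^sub>R br x z)" "br 0 = (\<lambda>z. 0)" for x y c
      by (simp_all add: fun_eq_iff br_simps)
    then show ?thesis by (simp add: subspace_def op_trace_add op_trace_scale op_trace_zero)
  qed
next
  fix x y
  have "br (br x y) = (\<lambda>z. br x (br y z) - br y (br x z))"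
    by (rule ext) (simp add: br_jacobi[of x y])
  then show "op_trace (br (br x y)) = 0"
    by (simp add: op_trace_diff op_trace_comp_commute[of "br x" "br y"])
qed

end

section \<open>Contact forms in dimension five\<close>

text \<open>
  The \<open>wij\<close> form a skew-symmetric matrix with kernel vector \<open>c\<close>. For odd size, such a vector is
  proportional to the vector of sub-Pfaffians, which is what the four auxiliary identities express;
  pairing with \<open>e\<close> then gives 0.
\<close>

lemma pfaffian_kernel_0:
  fixes c0 c1 c2 c3 c4 e0 e1 e2 e3 e4 w01 w02 w03 w04 w12 w13 w14 w23 w24 w34 :: real
  assumes e: "c0*e0 + c1*e1 + c2*e2 + c3*e3 + c4*e4 = 0"
    and r0: "- c1*w01 - c2*w02 - c3*w03 - c4*w04 = 0"
    and r1: "c0*w01 - c2*w12 - c3*w13 - c4*w14 = 0"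
    and r2: "c0*w02 + c1*w12 - c3*w23 - c4*w24 = 0"
    and r3: "c0*w03 + c1*w13 + c2*w23 - c4*w34 = 0"
    and r4: "c0*w04 + c1*w14 + c2*w24 + c3*w34 = 0"
  shows "c0*((w12*w34 - w13*w24 + w14*w23)*e0 - (w02*w34 - w03*w24 + w04*w23)*e1
     + (w01*w34 - w03*w14 + w04*w13)*e2 - (w01*w24 - w02*w14 + w04*w12)*e3
     + (w01*w23 - w02*w13 + w03*w12)*e4) = 0" (is "c0 * ?F = 0")
proof -
  define P0 where "P0 = w12*w34 - w13*w24 + w14*w23"
  have 1: "c0*(w02*w34 - w03*w24 + w04*w23) = - c1*P0
      + (w34*(c0*w02 + c1*w12 - c3*w23 - c4*w24) - w24*(c0*w03 + c1*w13 + c2*w23 - c4*w34) + w23*(c0*w04 + c1*w14 + c2*w24 + c3*w34))"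
    by (simp add: P0_def algebra_simps)
  have 2: "c0*(w01*w34 - w03*w14 + w04*w13) = c2*P0
      + (w34*(c0*w01 - c2*w12 - c3*w13 - c4*w14) - w14*(c0*w03 + c1*w13 + c2*w23 - c4*w34) + w13*(c0*w04 + c1*w14 + c2*w24 + c3*w34))"
    by (simp add: P0_def algebra_simps)
  have 3: "c0*(w01*w24 - w02*w14 + w04*w12) = - c3*P0
      + (w24*(c0*w01 - c2*w12 - c3*w13 - c4*w14) - w14*(c0*w02 + c1*w12 - c3*w23 - c4*w24) + w12*(c0*w04 + c1*w14 + c2*w24 + c3*w34))"
    by (simp add: P0_def algebra_simps)
  have 4: "c0*(w01*w23 - w02*w13 + w03*w12) = c4*P0
      + (w23*(c0*w01 - c2*w12 - c3*w13 - c4*w14) - w13*(c0*w02 + c1*w12 - c3*w23 - c4*w24) + w12*(c0*w03 + c1*w13 + c2*w23 - c4*w34))"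
    by (simp add: P0_def algebra_simps)
  have "c0 * ?F = c0*P0*e0 - c0*(w02*w34 - w03*w24 + w04*w23)*e1 + c0*(w01*w34 - w03*w14 + w04*w13)*e2
     - c0*(w01*w24 - w02*w14 + w04*w12)*e3 + c0*(w01*w23 - w02*w13 + w03*w12)*e4"
    unfolding P0_def by (simp add: algebra_simps)
  also have "\<dots> = P0 * (c0*e0 + c1*e1 + c2*e2 + c3*e3 + c4*e4)"
    unfolding 1 2 3 4 r1 r2 r3 r4 by (simp add: algebra_simps)
  finally show ?thesis unfolding e by simp
qed

text \<open>
  The case of \<open>c1, \<dots>, c4\<close> is reduced to \<open>c0\<close> by cyclically shifting the five indices; the minus
  signs in the instances come from \<open>wji = - wij\<close>.
\<close>

lemma pfaffian_kernel:
  fixes c0 c1 c2 c3 c4 e0 e1 e2 e3 e4 w01 w02 w03 w04 w12 w13 w14 w23 w24 w34 :: real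
  assumes "c0*e0 + c1*e1 + c2*e2 + c3*e3 + c4*e4 = 0"
    and "- c1*w01 - c2*w02 - c3*w03 - c4*w04 = 0"
    and "c0*w01 - c2*w12 - c3*w13 - c4*w14 = 0"
    and "c0*w02 + c1*w12 - c3*w23 - c4*w24 = 0"
    and "c0*w03 + c1*w13 + c2*w23 - c4*w34 = 0"
    and "c0*w04 + c1*w14 + c2*w24 + c3*w34 = 0"
    and nz: "(w12*w34 - w13*w24 + w14*w23)*e0 - (w02*w34 - w03*w24 + w04*w23)*e1
     + (w01*w34 - w03*w14 + w04*w13)*e2 - (w01*w24 - w02*w14 + w04*w12)*e3
     + (w01*w23 - w02*w13 + w03*w12)*e4 \<noteq> 0" (is "?F \<noteq> 0")
  shows "c0 = 0 \<and> c1 = 0 \<and> c2 = 0 \<and> c3 = 0 \<and> c4 = 0"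
proof -
  have 0: "c0 * ?F = 0" by (rule pfaffian_kernel_0) (rule assms)+
  have 1: "c1 * ?F = 0"
    by (rule trans[OF _ pfaffian_kernel_0[of c1 e1 c2 e2 c3 e3 c4 e4 c0 e0 w12 w13 w14 "-w01" w23 w24 "-w02" w34 "-w03" "-w04"]])
      (simp add: algebra_simps, (use assms(1-6) in linarith)+)
  have 2: "c2 * ?F = 0"
    by (rule trans[OF _ pfaffian_kernel_0[of c2 e2 c3 e3 c4 e4 c0 e0 c1 e1 w23 w24 "-w02" "-w12" w34 "-w03" "-w13" "-w04" "-w14" w01]])
      (simp add: algebra_simps, (use assms(1-6) in linarith)+)
  have 3: "c3 * ?F = 0"
    by (rule trans[OF _ pfaffian_kernel_0[of c3 e3 c4 e4 c0 e0 c1 e1 c2 e2 w34 "-w03" "-w13" "-w23" "-w04" "-w14" "-w24" w01 w02 w12]])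
      (simp add: algebra_simps, (use assms(1-6) in linarith)+)
  have 4: "c4 * ?F = 0"
    by (rule trans[OF _ pfaffian_kernel_0[of c4 e4 c0 e0 c1 e1 c2 e2 c3 e3 "-w04" "-w14" "-w24" "-w34" w01 w02 w03 w12 w13 w23]])
      (simp add: algebra_simps, (use assms(1-6) in linarith)+)
  show ?thesis using 0 1 2 3 4 nz by (metis mult_eq_0_iff)
qed

text \<open>
  If \<open>\<omega> \<and> \<omega> \<and> \<eta>\<close> does not vanish on \<open>v0, \<dots>, v4\<close>, a vector in \<open>ker \<eta>\<close> and in the radical of \<open>\<omega>\<close>
  depends linearly on them, and \<open>pfaffian_kernel\<close> makes the relation trivial. Conversely two
  hyperbolic pairs for \<open>\<omega>\<close> and a vector of the radical of \<open>\<omega>\<close> form a basis on which the top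
  form is nonzero.
\<close>

lemma (in lie_space) contact_iff_5:
  assumes dim: "DIM('e) = 5"
  shows "contact_lie_algebra UNIV br \<longleftrightarrow>
    (\<exists>\<eta> :: 'e \<Rightarrow> real. linear \<eta> \<and> (\<forall>u. \<eta> u = 0 \<longrightarrow> (\<forall>y. \<eta> (br u y) = 0) \<longrightarrow> u = 0))"
proof -
  have d6: "DIM('e) < 6" using dim by simp
  have pair: "contact_pair UNIV 2 (\<lambda>x y. - \<eta> (br x y)) \<eta> \<longleftrightarrow>
      (\<forall>u. \<eta> u = 0 \<longrightarrow> (\<forall>y. \<eta> (br u y) = 0) \<longrightarrow> u = 0)" if lin: "linear \<eta>" for \<eta> :: "'e \<Rightarrow> real"
  proof -
    define \<omega> where "\<omega> x y = - \<eta> (br x y)" for x y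
    have skew: "\<omega> y x = - \<omega> x y" for x y
      unfolding \<omega>_def br_skew[of y x] linear_neg[OF lin] by simp
    have lin\<omega>: "\<omega> (x + y) z = \<omega> x z + \<omega> y z" "\<omega> (a *\<^sub>R x) z = a * \<omega> x z" "\<omega> 0 z = 0"
       "\<omega> z (x + y) = \<omega> z x + \<omega> z y" "\<omega> z (a *\<^sub>R x) = a * \<omega> z x" "\<omega> z 0 = 0" "\<omega> x x = 0"
      "\<omega> z (x - y) = \<omega> z x - \<omega> z y" "\<omega> (x - y) z = \<omega> x z - \<omega> y z"
      for x y z a unfolding \<omega>_def by (simp_all add: br_simps linear_add[OF lin] linear_scale[OF lin] linear_0[OF lin] linear_diff[OF lin])
    have iff: "contact_pair UNIV 2 \<omega> \<eta> \<longleftrightarrow> (\<exists>v. 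
     pf4 \<omega> (v 1) (v 2) (v 3) (v (4::nat)) * \<eta> (v 0) - pf4 \<omega> (v 0) (v 2) (v 3) (v 4) * \<eta> (v 1)
     + pf4 \<omega> (v 0) (v 1) (v 3) (v 4) * \<eta> (v 2) - pf4 \<omega> (v 0) (v 1) (v 2) (v 4) * \<eta> (v 3)
     + pf4 \<omega> (v 0) (v 1) (v 2) (v 3) * \<eta> (v 4) \<noteq> 0)" (is "_ \<longleftrightarrow> (\<exists>v. ?F v \<noteq> 0)")
      using contact_pair_2_iff[of UNIV \<omega> \<eta>, OF skew] by simp
    show ?thesis
    proof
      assume "contact_pair UNIV 2 (\<lambda>x y. - \<eta> (br x y)) \<eta>"
      then obtain v where v: "?F v \<noteq> 0" using iff unfolding \<omega>_def by metis
      show "\<forall>u. \<eta> u = 0 \<longrightarrow> (\<forall>y. \<eta> (br u y) = 0) \<longrightarrow> u = 0"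
      proof (intro allI impI)
        fix u assume u: "\<eta> u = 0" "\<forall>y. \<eta> (br u y) = 0"
        have u\<omega>: "\<omega> u y = 0" for y using u(2) by (simp add: \<omega>_def)
        obtain c0 c1 c2 c3 c4 c5 where rel: "c0 *\<^sub>R v 0 + c1 *\<^sub>R v 1 + c2 *\<^sub>R v 2 + c3 *\<^sub>R v 3 + c4 *\<^sub>R v 4 + c5 *\<^sub>R u = 0"
          and nz: "\<not> (c0 = 0 \<and> c1 = 0 \<and> c2 = 0 \<and> c3 = 0 \<and> c4 = 0 \<and> c5 = 0)"
          by (rule linear_relation_6[OF d6, of "v 0" "v 1" "v 2" "v 3" "v 4" u]) (rule that)
        have e: "c0 * \<eta> (v 0) + c1 * \<eta> (v 1) + c2 * \<eta> (v 2) + c3 * \<eta> (v 3) + c4 * \<eta> (v 4) = 0"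
          using arg_cong[OF rel, of \<eta>] u(1) by (simp add: linear_add[OF lin] linear_scale[OF lin] linear_0[OF lin])
        have w: "c0 * \<omega> (v 0) y + c1 * \<omega> (v 1) y + c2 * \<omega> (v 2) y + c3 * \<omega> (v 3) y + c4 * \<omega> (v 4) y = 0" for y
          using arg_cong[OF rel, of "\<lambda>x. \<omega> x y"] u\<omega> by (simp add: lin\<omega>)
        have sk: "\<omega> (v 1) (v 0) = - \<omega> (v 0) (v 1)" "\<omega> (v 2) (v 0) = - \<omega> (v 0) (v 2)"
          "\<omega> (v 3) (v 0) = - \<omega> (v 0) (v 3)" "\<omega> (v 4) (v 0) = - \<omega> (v 0) (v 4)"
          "\<omega> (v 2) (v 1) = - \<omega> (v 1) (v 2)" "\<omega> (v 3) (v 1) = - \<omega> (v 1) (v 3)"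
          "\<omega> (v 4) (v 1) = - \<omega> (v 1) (v 4)" "\<omega> (v 3) (v 2) = - \<omega> (v 2) (v 3)"
          "\<omega> (v 4) (v 2) = - \<omega> (v 2) (v 4)" "\<omega> (v 4) (v 3) = - \<omega> (v 3) (v 4)"
          by (rule skew)+
        have W0: "- c1 * \<omega> (v 0) (v 1) - c2 * \<omega> (v 0) (v 2) - c3 * \<omega> (v 0) (v 3) - c4 * \<omega> (v 0) (v 4) = 0"
          using w[of "v 0"] unfolding sk lin\<omega>(7) by linarith
        have W1: "c0 * \<omega> (v 0) (v 1) - c2 * \<omega> (v 1) (v 2) - c3 * \<omega> (v 1) (v 3) - c4 * \<omega> (v 1) (v 4) = 0"
          using w[of "v 1"] unfolding sk lin\<omega>(7) by linarith
        have W2: "c0 * \<omega> (v 0) (v 2) + c1 * \<omega> (v 1) (v 2) - c3 * \<omega> (v 2) (v 3) - c4 * \<omega> (v 2) (v 4) = 0"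
          using w[of "v 2"] unfolding sk lin\<omega>(7) by linarith
        have W3: "c0 * \<omega> (v 0) (v 3) + c1 * \<omega> (v 1) (v 3) + c2 * \<omega> (v 2) (v 3) - c4 * \<omega> (v 3) (v 4) = 0"
          using w[of "v 3"] unfolding sk lin\<omega>(7) by linarith
        have W4: "c0 * \<omega> (v 0) (v 4) + c1 * \<omega> (v 1) (v 4) + c2 * \<omega> (v 2) (v 4) + c3 * \<omega> (v 3) (v 4) = 0"
          using w[of "v 4"] unfolding sk lin\<omega>(7) by linarith
        have "c0 = 0 \<and> c1 = 0 \<and> c2 = 0 \<and> c3 = 0 \<and> c4 = 0"
          by (rule pfaffian_kernel[OF e W0 W1 W2 W3 W4 v[unfolded pf4_def]])
        then show "u = 0" using rel nz by simp
      qed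
    next
      assume nd: "\<forall>u. \<eta> u = 0 \<longrightarrow> (\<forall>y. \<eta> (br u y) = 0) \<longrightarrow> u = 0"
      have nd: "u = 0" if "\<eta> u = 0" "\<And>y. \<omega> u y = 0" for u
        using nd that by (simp add: \<omega>_def)
      have norm: "\<exists>y. \<omega> e y = 1" if e: "\<eta> e = 0" "e \<noteq> 0" for e
      proof -
        obtain y where "\<omega> e y \<noteq> 0" using nd[of e] e by blast
        then have "\<omega> e ((1 / \<omega> e y) *\<^sub>R y) = 1" by (simp add: lin\<omega>)
        then show ?thesis by blast
      qed
      have d5: "dim (UNIV :: 'e set) = 5" using dim by (simp add: dim_UNIV)
      obtain e1 where e1: "\<eta> e1 = 0" "e1 \<noteq> 0"
        using exists_common_kernel[of \<eta> UNIV] lin d5 by auto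
      obtain f1 where f1: "\<omega> e1 f1 = 1" using norm[OF e1] by blast
      have l3: "linear (\<lambda>x. (\<eta> x, \<omega> e1 x, \<omega> f1 x))"
        by (rule linearI) (simp_all add: lin\<omega> linear_add[OF lin] linear_scale[OF lin])
      obtain e2 where "e2 \<noteq> 0" "(\<eta> e2, \<omega> e1 e2, \<omega> f1 e2) = 0"
        by (rule exists_common_kernel[OF l3 subspace_UNIV]) (simp add: dim, rule that)
      then have e2: "\<eta> e2 = 0" "\<omega> e1 e2 = 0" "\<omega> f1 e2 = 0" "e2 \<noteq> 0"
        by (simp_all add: zero_prod_def)
      obtain y2 where y2: "\<omega> e2 y2 = 1" using norm[OF e2(1,4)] by blast
      \<comment> \<open>making \<open>y2\<close> orthogonal to the first hyperbolic pair does not change its pairing with \<open>e2\<close>\<close>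
      define f2 where "f2 = y2 - (\<omega> e1 y2) *\<^sub>R f1 + (\<omega> f1 y2) *\<^sub>R e1"
      have f2: "\<omega> e1 f2 = 0" "\<omega> f1 f2 = 0" "\<omega> e2 f2 = 1"
        using f1 y2 e2(2,3) skew[of e1 f1] skew[of f1 e2] skew[of e1 e2] by (simp_all add: f2_def lin\<omega>)
      have l4: "linear (\<lambda>x. (\<omega> e1 x, \<omega> f1 x, \<omega> e2 x, \<omega> f2 x))"
        by (rule linearI) (simp_all add: lin\<omega>)
      obtain \<xi> where "\<xi> \<noteq> 0" "(\<omega> e1 \<xi>, \<omega> f1 \<xi>, \<omega> e2 \<xi>, \<omega> f2 \<xi>) = 0"
        by (rule exists_common_kernel[OF l4 subspace_UNIV]) (simp add: dim, rule that)
      then have \<xi>: "\<omega> e1 \<xi> = 0" "\<omega> f1 \<xi> = 0" "\<omega> e2 \<xi> = 0" "\<omega> f2 \<xi> = 0" "\<xi> \<noteq> 0"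
        by (simp_all add: zero_prod_def)
      \<comment> \<open>the two pairs and \<open>\<xi>\<close> are a basis, so \<open>\<xi>\<close> is orthogonal to everything\<close>
      have \<xi>0: "\<omega> \<xi> z = 0" for z
      proof (rule ccontr)
        assume ne: "\<omega> \<xi> z \<noteq> 0"
        obtain c1 c2 c3 c4 c5 c6 where rel: "c1 *\<^sub>R e1 + c2 *\<^sub>R f1 + c3 *\<^sub>R e2 + c4 *\<^sub>R f2 + c5 *\<^sub>R \<xi> + c6 *\<^sub>R z = 0"
          and nz: "\<not> (c1 = 0 \<and> c2 = 0 \<and> c3 = 0 \<and> c4 = 0 \<and> c5 = 0 \<and> c6 = 0)"
          by (rule linear_relation_6[OF d6, of e1 f1 e2 f2 \<xi> z]) (rule that)
        have ap: "c1 * \<omega> y e1 + c2 * \<omega> y f1 + c3 * \<omega> y e2 + c4 * \<omega> y f2 + c5 * \<omega> y \<xi> + c6 * \<omega> y z = 0" for y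
          using arg_cong[OF rel, of "\<lambda>x. \<omega> y x"] by (simp add: lin\<omega>)
        have sk: "\<omega> \<xi> e1 = 0" "\<omega> \<xi> f1 = 0" "\<omega> \<xi> e2 = 0" "\<omega> \<xi> f2 = 0" "\<omega> f1 e1 = -1" "\<omega> f2 e2 = -1"
          "\<omega> f2 e1 = 0" "\<omega> f2 f1 = 0" "\<omega> e2 e1 = 0" "\<omega> e2 f1 = 0"
          using skew[of e1 \<xi>] skew[of f1 \<xi>] skew[of e2 \<xi>] skew[of f2 \<xi>] skew[of e1 f1] skew[of e2 f2]
            skew[of e1 f2] skew[of f1 f2] skew[of e1 e2] skew[of f1 e2] \<xi> f1 f2 e2 by linarith+
        have "c6 = 0" using ap[of \<xi>] ne \<xi>
          by (simp add: lin\<omega>(7) sk)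
        moreover have "c1 = 0" "c2 = 0" "c3 = 0" "c4 = 0"
          using ap[of f1] ap[of e1] ap[of f2] ap[of e2] \<open>c6 = 0\<close> f1 f2 e2 \<xi>
          by (simp_all add: lin\<omega>(7) sk)
        moreover have "c5 = 0" using rel \<xi>(5) calculation by simp
        ultimately show False using nz by simp
      qed
      have "\<eta> \<xi> \<noteq> 0" using nd \<xi>0 \<xi>(5) by blast
      moreover define v where "v i = (if i = 0 then e1 else if i = 1 then f1 else if i = 2 then e2 else if i = 3 then f2 else \<xi>)" for i :: nat
      have "?F v = \<eta> \<xi>"
        using \<xi> f1 f2 e2 by (simp add: v_def pf4_def)
      ultimately show "contact_pair UNIV 2 (\<lambda>x y. - \<eta> (br x y)) \<eta>"
        using iff unfolding \<omega>_def by metis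
    qed
  qed
  have "contact_lie_algebra UNIV br \<longleftrightarrow> (\<exists>\<eta>. linear \<eta> \<and> contact_pair UNIV 2 (\<lambda>x y. - \<eta> (br x y)) \<eta>)"
  proof -
    have "(DIM('e) = 2 * n + 1) = (n = 2)" for n using dim by auto
    then show ?thesis unfolding contact_lie_algebra_def linear_on_UNIV dim_UNIV by auto
  qed
  also have "\<dots> \<longleftrightarrow> (\<exists>\<eta> :: 'e \<Rightarrow> real. linear \<eta> \<and> (\<forall>u. \<eta> u = 0 \<longrightarrow> (\<forall>y. \<eta> (br u y) = 0) \<longrightarrow> u = 0))"
    (is "(\<exists>\<eta>. ?P \<eta>) \<longleftrightarrow> (\<exists>\<eta>. ?Q \<eta>)")
  proof -
    have "?P \<eta> \<longleftrightarrow> ?Q \<eta>" for \<eta> using pair[of \<eta>] by argo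
    then show ?thesis by presburger
  qed
  finally show ?thesis .
qed

section \<open>Coordinates and quotients\<close>

text \<open>
  A coordinate system: \<open>br'\<close> is the bracket \<open>br\<close> read in the coordinates \<open>g\<close>.
\<close>

definition lie_embedding ::
  "('v::euclidean_space \<Rightarrow> 'a::real_vector) \<Rightarrow> ('v \<Rightarrow> 'v \<Rightarrow> 'v) \<Rightarrow> ('a \<Rightarrow> 'a \<Rightarrow> 'a) \<Rightarrow> bool" where
  "lie_embedding g br' br \<longleftrightarrow> linear g \<and> inj g \<and> (\<forall>x y. g (br' x y) = br (g x) (g y))"

lemma dim_linear_image_inj:
  fixes g :: "'v::euclidean_space \<Rightarrow> 'a::real_vector"
  assumes "linear g" "inj g"
  shows "dim (g ` S) = dim S"
proof -
  interpret finite_dimensional_vector_space_pair_1 scaleR "Basis :: 'v set" "scaleR :: real \<Rightarrow> 'a \<Rightarrow> 'a"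
    by unfold_locales
  have "real_vector.dim (g ` S) = dim S"
    using dim_image_eq[of g S] assms by (simp add: inj_on_subset linear_def real_vector.dim_def)
  then show ?thesis by simp
qed

lemma lie_derived_image:
  assumes "lie_embedding g br' br"
  shows "lie_derived (g ` S) br = g ` lie_derived S br'"
proof -
  have "{br x y |x y. x \<in> g ` S \<and> y \<in> g ` S} = g ` {br' x y |x y. x \<in> S \<and> y \<in> S}"
    using assms unfolding lie_embedding_def image_def by auto metis
  then show ?thesis
    using assms by (simp add: lie_derived_def lie_embedding_def linear_span_image)
qed

lemma lie_center_image:
  assumes "lie_embedding g br' br"
  shows "lie_center (g ` S) br = g ` lie_center S br'"
proof -
  have "br (g x) (g y) = 0 \<longleftrightarrow> br' x y = 0" for x y
    using assms linear_injective_0[of g] linear_0[of g] unfolding lie_embedding_def by metis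
  then show ?thesis unfolding lie_center_def by auto
qed

lemma lie_abelian_image:
  assumes "lie_embedding g br' br"
  shows "lie_abelian (g ` S) br \<longleftrightarrow> lie_abelian S br'"
proof -
  have "br (g x) (g y) = 0 \<longleftrightarrow> br' x y = 0" for x y
    using assms linear_injective_0[of g] linear_0[of g] unfolding lie_embedding_def by metis
  then show ?thesis unfolding lie_abelian_def by auto
qed

lemma lie_solvable_image:
  assumes "lie_embedding g br' br"
  shows "lie_solvable (g ` S) br \<longleftrightarrow> lie_solvable S br'"
proof -
  have "((\<lambda>S. lie_derived S br) ^^ k) (g ` S) = g ` ((\<lambda>S. lie_derived S br') ^^ k) S" for k
    by (induction k) (simp_all add: lie_derived_image[OF assms])
  moreover have "g ` X = {0} \<longleftrightarrow> X = {0}" for X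
    using assms linear_0[of g] inj_image_eq_iff[of g X "{0}"] by (simp add: lie_embedding_def)
  ultimately show ?thesis unfolding lie_solvable_def by simp
qed

text \<open>
  A Lie algebra given as a subspace of an arbitrary vector space is moved to a Euclidean space, where
  traces and orthogonal projections are available.
\<close>

lemma lie_algebra_coordinates:
  fixes L :: "'a::real_vector set"
  assumes "lie_algebra L br" and "dim L = DIM('v::euclidean_space)"
  obtains g :: "'v::euclidean_space \<Rightarrow> 'a::real_vector" and br' where "lie_embedding g br' br" "lie_algebra UNIV br'" "range g = L"
proof -
  interpret lie_algebra L br by fact
  obtain B where B: "B \<subseteq> L" "independent B" "L \<subseteq> span B" "card B = DIM('v)"
    using basis_exists[of L] assms(2) by metis
  have "finite B" using B(4) DIM_positive[where 'a='v] by (metis card.infinite less_irrefl)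
  then obtain h where h: "bij_betw h (Basis :: 'v set) B"
    using finite_same_card_bij[of "Basis :: 'v set" B] B(4) by auto
  have span: "span B = L" using B subspace by (simp add: span_minimal subset_antisym)
  obtain g :: "'v \<Rightarrow> 'a" where g: "linear g" "\<And>b. b \<in> Basis \<Longrightarrow> g b = h b"
    using linear_independent_extend[OF independent_Basis, of h] by blast
  have gB: "g ` Basis = B" using h g(2) by (metis bij_betw_imp_surj_on image_cong)
  have injB: "inj_on g Basis" using h g(2) by (metis bij_betw_def inj_on_cong)
  have inj: "inj g"
  proof -
    have "inj_on g (span Basis)"
      using linear_inj_on_span_iff_independent_image[of g Basis] g(1) gB B(2) injB by auto
    then show ?thesis by simp
  qed
  have range: "range g = L"
    using linear_span_image[OF g(1), of Basis] gB span by simp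
  define br' where "br' x y = inv_into UNIV g (br (g x) (g y))" for x y
  have gbr: "g (br' x y) = br (g x) (g y)" for x y
  proof -
    have "g x \<in> L" "g y \<in> L" using range by auto
    then have "br (g x) (g y) \<in> range g" using closed range by simp
    then show ?thesis unfolding br'_def by (rule f_inv_into_f)
  qed
  have gL: "g x \<in> L" for x using range by auto
  have ginj: "g x = g y \<Longrightarrow> x = y" for x y using inj by (simp add: inj_def)
  have "lie_algebra UNIV br'"
  proof
    show "linear_on UNIV (br' x)" for x
      unfolding linear_on_def using linear_right[OF gL, of x] gL
      by (auto intro!: ginj simp: gbr linear_add[OF g(1)] linear_scale[OF g(1)] linear_on_def)
    show "linear_on UNIV (\<lambda>x. br' x y)" for y
      unfolding linear_on_def using linear_left[OF gL, of y] gL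
      by (auto intro!: ginj simp: gbr linear_add[OF g(1)] linear_scale[OF g(1)] linear_on_def)
    show "br' x x = 0" for x using alternating[OF gL, of x] by (auto intro!: ginj simp: gbr linear_0[OF g(1)])
    show "br' x (br' y z) + br' y (br' z x) + br' z (br' x y) = 0" for x y z
      using jacobi[OF gL gL gL, of x y z] by (auto intro!: ginj simp: gbr linear_0[OF g(1)] linear_add[OF g(1)])
  qed auto
  then show ?thesis using that[of g br'] g(1) inj gbr range by (auto simp: lie_embedding_def)
qed

lemma contact_lie_algebra_image:
  assumes emb: "lie_embedding g br' br"
  shows "contact_lie_algebra (range g) br \<longleftrightarrow> contact_lie_algebra UNIV br'"
proof -
  have lin: "linear g" and inj: "inj g" and gbr: "\<And>x y. g (br' x y) = br (g x) (g y)"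
    using emb by (auto simp: lie_embedding_def)
  have dim: "dim (range g) = dim (UNIV :: 'a set)" by (rule dim_linear_image_inj[OF lin inj])
  show ?thesis
  proof
    assume "contact_lie_algebra (range g) br"
    then obtain n \<eta> where n: "dim (range g) = 2 * n + 1" and \<eta>: "linear_on (range g) \<eta>"
      and c: "contact_pair (range g) n (\<lambda>x y. - \<eta> (br x y)) \<eta>"
      unfolding contact_lie_algebra_def by blast
    have "contact_pair UNIV n (\<lambda>x y. - \<eta> (g (br' x y))) (\<lambda>x. \<eta> (g x))"
      by (rule contact_pair_transport[OF c, where f="inv_into UNIV g"]) (auto simp: inj gbr)
    moreover have "linear_on UNIV (\<lambda>x. \<eta> (g x))"
      using \<eta> by (auto simp: linear_on_def linear_add[OF lin] linear_scale[OF lin])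
    ultimately show "contact_lie_algebra UNIV br'"
      unfolding contact_lie_algebra_def dim[symmetric] using n by blast
  next
    assume "contact_lie_algebra UNIV br'"
    then obtain n \<eta> where n: "dim (UNIV :: 'a set) = 2 * n + 1" and \<eta>: "linear_on UNIV \<eta>"
      and c: "contact_pair UNIV n (\<lambda>x y. - \<eta> (br' x y)) \<eta>"
      unfolding contact_lie_algebra_def by blast
    have "contact_pair (range g) n (\<lambda>x y. - \<eta> (inv_into UNIV g (br x y))) (\<lambda>x. \<eta> (inv_into UNIV g x))"
      by (rule contact_pair_transport[OF c, where f=g]) (auto simp: inj simp flip: gbr)
    moreover have "linear_on (range g) (\<lambda>x. \<eta> (inv_into UNIV g x))"
    proof -
      have "inv_into UNIV g (g x + g y) = x + y" "inv_into UNIV g (c *\<^sub>R g x) = c *\<^sub>R x" for x y c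
        using inv_f_f[OF inj, of "x + y"] inv_f_f[OF inj, of "c *\<^sub>R x"]
        by (simp_all add: linear_add[OF lin] linear_scale[OF lin])
      then show ?thesis using \<eta> inj by (auto simp: linear_on_def)
    qed
    ultimately show "contact_lie_algebra (range g) br"
      unfolding contact_lie_algebra_def dim using n by blast
  qed
qed

lemma op_trace_conj:
  fixes h :: "'v::euclidean_space \<Rightarrow> 'e::euclidean_space"
  assumes "linear f" and h: "linear h" "bij h" and m: "\<And>v. f (h v) = h (m v)"
  shows "op_trace f = op_trace m"
proof -
  have hh: "h (inv_into UNIV h y) = y" for y using h(2) by (simp add: bij_is_surj surj_f_inv_f)
  have hi: "inv_into UNIV h (h v) = v" for v using h(2) by (simp add: bij_is_inj)
  have lin: "linear (inv_into UNIV h)"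
  proof (rule linearI)
    show "inv_into UNIV h (x + y) = inv_into UNIV h x + inv_into UNIV h y" for x y
      using hi[of "inv_into UNIV h x + inv_into UNIV h y"] by (simp add: linear_add[OF h(1)] hh)
    show "inv_into UNIV h (c *\<^sub>R x) = c *\<^sub>R inv_into UNIV h x" for c x
      using hi[of "c *\<^sub>R inv_into UNIV h x"] by (simp add: linear_scale[OF h(1)] hh)
  qed
  have "y = (\<Sum>i\<in>Basis. (inv_into UNIV h y \<bullet> i) *\<^sub>R h i)" for y
  proof -
    have "(\<Sum>i\<in>Basis. (inv_into UNIV h y \<bullet> i) *\<^sub>R h i) = h (\<Sum>i\<in>Basis. (inv_into UNIV h y \<bullet> i) *\<^sub>R i)"
      using h(1) by (simp add: linear_sum linear_scale)
    also have "\<dots> = y" using h(2) by (simp add: euclidean_representation surj_f_inv_f bij_is_surj)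
    finally show ?thesis ..
  qed
  moreover have "linear (\<lambda>y. inv_into UNIV h y \<bullet> i)" for i
    using lin by (auto simp: linear_iff inner_add_left)
  ultimately have "op_trace f = (\<Sum>i\<in>Basis. inv_into UNIV h (f (h i)) \<bullet> i)"
    using op_trace_basis[where I=Basis and b=h and \<beta>="\<lambda>i y. inv_into UNIV h y \<bullet> i" and f=f] assms(1) by blast
  then show ?thesis unfolding m op_trace_def using h(2) by (simp add: bij_is_inj)
qed

lemma op_trace_vec: "op_trace f = (\<Sum>i\<in>UNIV. f (axis i 1) $ i)" for f :: "real^'n \<Rightarrow> real^'n"
proof -
  have "(\<Sum>b\<in>Basis. f b \<bullet> b) = (\<Sum>i\<in>UNIV. f (axis i 1) \<bullet> axis i 1)"
  proof (rule sum.reindex_cong[where l="\<lambda>i. axis i 1"])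
    show "inj (\<lambda>i. axis i (1::real) :: real^'n)" by (auto simp: inj_def axis_eq_axis)
    show "(Basis :: (real^'n) set) = range (\<lambda>i. axis i 1)" by (auto simp: Basis_vec_def)
  qed simp
  then show ?thesis by (simp add: op_trace_def inner_axis)
qed

lemma op_trace_prod:
  fixes f :: "'v::euclidean_space \<times> 'w::euclidean_space \<Rightarrow> 'v \<times> 'w"
  shows "op_trace f = op_trace (\<lambda>x. fst (f (x, 0))) + op_trace (\<lambda>y. snd (f (0, y)))"
proof -
  have "op_trace f = (\<Sum>b\<in>(\<lambda>u. (u, 0)) ` Basis. f b \<bullet> b) + (\<Sum>b\<in>(\<lambda>u. (0, u)) ` Basis. f b \<bullet> b)"
    unfolding op_trace_def Basis_prod_def by (rule sum.union_disjoint) auto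
  also have "\<dots> = (\<Sum>x\<in>Basis. f (x, 0) \<bullet> (x, 0)) + (\<Sum>y\<in>Basis. f (0, y) \<bullet> (0, y))"
    by (subst (1 2) sum.reindex) (auto simp: inj_on_def)
  finally show ?thesis by (simp add: op_trace_def inner_prod_def)
qed

lemma bij_linear_dim:
  fixes g :: "'v::euclidean_space \<Rightarrow> 'e::euclidean_space"
  assumes "linear g" "DIM('v) = DIM('e)" "\<And>x. g x = 0 \<Longrightarrow> x = 0"
  shows "bij g"
proof -
  have "inj g" using assms by (simp add: linear_injective_0)
  moreover have "surj g"
  proof -
    have "dim (range g) = DIM('e)"
      using dim_linear_image_inj[OF assms(1) \<open>inj g\<close>, of UNIV] assms(2) by (simp add: dim_UNIV)
    then have "span (range g) = UNIV" by (simp add: dim_eq_full)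
    then show ?thesis using linear_subspace_image[OF assms(1) subspace_UNIV] by (simp add: span_eq_iff[THEN iffD2])
  qed
  ultimately show ?thesis by (simp add: bij_def)
qed

context lie_space begin

text \<open>
  The quotient by the ideal \<open>ker q\<close>, modelled on the complement \<open>range q\<close> with the projected bracket.
\<close>

lemma quotient_lie_algebra:
  assumes q: "linear q" "\<And>x. q (q x) = q x" and ideal: "\<And>x y. q y = 0 \<Longrightarrow> q (br x y) = 0"
  shows "lie_algebra (range q) (\<lambda>x y. q (br x y))"
    and "lie_derived (range q) (\<lambda>x y. q (br x y)) = q ` derived"
    and "q (br (q x) (q y)) = q (br x y)"
proof -
  have q1: "q (br x (q y)) = q (br x y)" for x y
    using ideal[of "q y - y" x] by (simp add: linear_diff[OF q(1)] q(2) br_simps)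
  have q2: "q (br (q x) y) = q (br x y)" for x y
    using q1[of y x] by (simp add: br_skew[of y] linear_neg[OF q(1)])
  show q3: "q (br (q x) (q y)) = q (br x y)" for x y by (simp add: q1 q2)
  show "lie_algebra (range q) (\<lambda>x y. q (br x y))"
  proof
    show "subspace (range q)" by (rule linear_subspace_image[OF q(1) subspace_UNIV])
    show "q (br x (q (br y z))) + q (br y (q (br z x))) + q (br z (q (br x y))) = 0" for x y z
      unfolding q1 linear_add[OF q(1), symmetric] using lie_algebra.jacobi[OF lie, of x y z] by (simp add: linear_0[OF q(1)])
  qed (auto simp: linear_on_def br_simps linear_add[OF q(1)] linear_scale[OF q(1)] linear_0[OF q(1)])
  have "{q (br x y) |x y. x \<in> range q \<and> y \<in> range q} = q ` {br x y |x y. x \<in> UNIV \<and> y \<in> UNIV}"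
    using q3 by (auto simp: image_def) metis
  then show "lie_derived (range q) (\<lambda>x y. q (br x y)) = q ` derived"
    by (simp add: lie_derived_def linear_span_image[OF q(1)])
qed

lemma perfect_functional:
  assumes "derived = UNIV" "\<And>x y. h \<bullet> br x y = 0"
  shows "h = 0"
proof -
  have "h \<in> derived" using assms(1) by simp
  have "h \<bullet> z = 0" if "z \<in> derived" for z
    using that by (rule derived_induct) (auto simp: subspace_def inner_add_right assms(2))
  then have "h \<bullet> h = 0" using \<open>h \<in> derived\<close> by blast
  then show ?thesis by simp
qed

end

section \<open>Perfect Lie algebras of dimension at most four\<close>

lemma span_pairD:
  assumes "x \<in> span {a, b}"
  obtains s t where "x = s *\<^sub>R a + t *\<^sub>R b"
proof -
  obtain s where "x - s *\<^sub>R a \<in> span {b}" using assms unfolding span_breakdown_eq by blast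
  then obtain t where "x - s *\<^sub>R a = t *\<^sub>R b" unfolding span_singleton by blast
  then show ?thesis using that[of s t] by (simp add: algebra_simps)
qed

text \<open>
  If two vectors \<open>a, b\<close> span, every bracket is a multiple of \<open>[a, b]\<close>. So a perfect algebra that is
  spanned by two vectors is spanned by one, and then by \<open>[c, c] = 0\<close>.
\<close>

lemma perfect_dim_ge_3:
  fixes V :: "'e::euclidean_space set"
  assumes "lie_algebra V br" and perf: "lie_derived V br = V" and "V \<noteq> {0}"
  shows "3 \<le> dim V"
proof (rule ccontr)
  assume d: "\<not> 3 \<le> dim V"
  interpret lie_algebra V br by fact
  have line: "V \<subseteq> span {br a b}" if ab: "a \<in> V" "b \<in> V" "V \<subseteq> span {a, b}" for a b
  proof -
    have "br x y \<in> span {br a b}" if "x \<in> V" "y \<in> V" for x y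
    proof -
      obtain x1 x2 where x: "x = x1 *\<^sub>R a + x2 *\<^sub>R b"
        using \<open>x \<in> V\<close> ab(3) by (meson span_pairD subsetD)
      obtain y1 y2 where y: "y = y1 *\<^sub>R a + y2 *\<^sub>R b"
        using \<open>y \<in> V\<close> ab(3) by (meson span_pairD subsetD)
      have sc: "c *\<^sub>R a \<in> V" "c *\<^sub>R b \<in> V" for c using ab subspace by (simp_all add: subspace_scale)
      have L: "br u (v + w) = br u v + br u w" "br (v + w) u = br v u + br w u"
        "br u (c *\<^sub>R v) = c *\<^sub>R br u v" "br (c *\<^sub>R v) u = c *\<^sub>R br v u" if "u \<in> V" "v \<in> V" "w \<in> V" for u v w c
        using linear_right[OF that(1)] linear_left[OF that(1)] that by (auto simp: linear_on_def)
      have ba: "br b a = - br a b"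
      proof -
        have s: "a + b \<in> V" using ab subspace by (simp add: subspace_add)
        have "br (a + b) (a + b) = (br a a + br b a) + (br a b + br b b)"
          using L(1)[OF s ab(1) ab(2)] L(2)[OF ab(1) ab(1) ab(2)] L(2)[OF ab(2) ab(1) ab(2)] by simp
        then have "br b a + br a b = 0" using alternating[OF s] alternating[OF ab(1)] alternating[OF ab(2)] by simp
        then show ?thesis by (simp add: eq_neg_iff_add_eq_0)
      qed
      have "br x y = x1 *\<^sub>R br a y + x2 *\<^sub>R br b y"
        using L(2)[OF \<open>y \<in> V\<close> sc(1)[of x1] sc(2)[of x2]] L(4)[OF \<open>y \<in> V\<close> ab(1) ab(1)] L(4)[OF \<open>y \<in> V\<close> ab(2) ab(1)]
        unfolding x by simp
      also have "br a y = y2 *\<^sub>R br a b"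
        using L(1)[OF ab(1) sc(1)[of y1] sc(2)[of y2]] L(3)[OF ab(1) ab(1) ab(1)] L(3)[OF ab(1) ab(2) ab(1)]
          alternating[OF ab(1)] unfolding y by simp
      also have "br b y = - (y1 *\<^sub>R br a b)"
        using L(1)[OF ab(2) sc(1)[of y1] sc(2)[of y2]] L(3)[OF ab(2) ab(1) ab(1)] L(3)[OF ab(2) ab(2) ab(1)]
          alternating[OF ab(2)] ba unfolding y by simp
      finally have "br x y = (x1 * y2 - x2 * y1) *\<^sub>R br a b" by (simp add: algebra_simps)
      then show ?thesis unfolding span_singleton by blast
    qed
    then have "lie_derived V br \<subseteq> span {br a b}"
      unfolding lie_derived_def by (intro span_minimal) auto
    then show ?thesis using perf by simp
  qed
  obtain B where B: "B \<subseteq> V" "independent B" "V \<subseteq> span B" "card B = dim V"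
    using basis_exists[of V] by metis
  have V0: "0 \<in> V" using subspace by (rule subspace_0)
  have "\<exists>a\<in>V. \<exists>b\<in>V. V \<subseteq> span {a, b}"
  proof -
    have "finite B" using B(2) by (rule independent_imp_finite)
    moreover have "card B = 0 \<or> card B = 1 \<or> card B = 2" using d B(4) by linarith
    ultimately consider "B = {}" | a where "B = {a}" | a b where "B = {a, b}"
      by (auto simp: card_1_singleton_iff card_2_iff)
    then show ?thesis
    proof cases
      case 1
      then have "V \<subseteq> span {0, 0}" using B(3) by simp
      then show ?thesis using V0 by blast
    next
      case (2 a)
      then have "V \<subseteq> span {a, a}" using B(3) by simp
      then show ?thesis using 2 B(1) by blast
    next
      case (3 a b) then show ?thesis using B by blast
    qed
  qed
  then obtain a b where ab: "a \<in> V" "b \<in> V" "V \<subseteq> span {a, b}" by blast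
  have c: "br a b \<in> V" using ab closed by simp
  have "V \<subseteq> span {br (br a b) (br a b)}" using line[OF c c] line[OF ab] by simp
  then have "V \<subseteq> {0}" using alternating[OF c] by simp
  then show False using V0 assms(3) by blast
qed

text \<open>
  Cayley-Hamilton, where the coefficients of \<open>X\<^sup>3\<close> and \<open>X\<^sup>2\<close> of the characteristic polynomial vanish by
  Newton's identities; \<open>e3\<close> and \<open>e4\<close> are the other two elementary symmetric functions.
\<close>

lemma matrix_4_cayley_hamilton:
  fixes M :: "real^4^4"
  assumes "trace M = 0" "trace (M ** M) = 0"
  shows "\<exists>c d. M ** M ** (M ** M) = c *\<^sub>R M - d *\<^sub>R mat 1"
proof -
  define m where "m i j = M $ i $ j" for i j
  define p where "p i j = m i 1 * m 1 j + m i 2 * m 2 j + m i 3 * m 3 j + m i 4 * m 4 j" for i j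
  define mi where "mi i j k = m i i * (m j j * m k k - m j k * m k j) - m i j * (m j i * m k k - m j k * m k i)
     + m i k * (m j i * m k j - m j j * m k i)" for i j k
  define e3 where "e3 = mi 1 2 3 + mi 1 2 4 + mi 1 3 4 + mi 2 3 4"
  have M2: "(M ** M) $ i $ j = p i j" for i j
    by (simp add: matrix_matrix_mult_def sum_4 p_def m_def)
  define t1 where "t1 = m 1 1 + m 2 2 + m 3 3 + m 4 4"
  define t2 where "t2 = p 1 1 + p 2 2 + p 3 3 + p 4 4"
  define e4 where "e4 = m 1 1 * (m 2 2 * (m 3 3 * m 4 4 - m 3 4 * m 4 3) - m 2 3 * (m 3 2 * m 4 4 - m 3 4 * m 4 2) + m 2 4 * (m 3 2 * m 4 3 - m 3 3 * m 4 2))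
   - m 1 2 * (m 2 1 * (m 3 3 * m 4 4 - m 3 4 * m 4 3) - m 2 3 * (m 3 1 * m 4 4 - m 3 4 * m 4 1) + m 2 4 * (m 3 1 * m 4 3 - m 3 3 * m 4 1))
   + m 1 3 * (m 2 1 * (m 3 2 * m 4 4 - m 3 4 * m 4 2) - m 2 2 * (m 3 1 * m 4 4 - m 3 4 * m 4 1) + m 2 4 * (m 3 1 * m 4 2 - m 3 2 * m 4 1))
   - m 1 4 * (m 2 1 * (m 3 2 * m 4 3 - m 3 3 * m 4 2) - m 2 2 * (m 3 1 * m 4 3 - m 3 3 * m 4 1) + m 2 3 * (m 3 1 * m 4 2 - m 3 2 * m 4 1))"
  define q where "q i j = p i 1 * m 1 j + p i 2 * m 2 j + p i 3 * m 3 j + p i 4 * m 4 j" for i j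
  have t: "t1 = 0" "t2 = 0"
    using assms by (simp_all add: t1_def t2_def trace_def sum_4 M2 m_def)
  have "\<forall>i j. 2 * (p i 1 * p 1 j + p i 2 * p 2 j + p i 3 * p 3 j + p i 4 * p 4 j) =
      2 * t1 * q i j - (t1 * t1 - t2) * p i j + 2 * e3 * m i j - (if i = j then 2 * e4 else 0)"
    unfolding forall_4 by (simp, unfold q_def t1_def t2_def e3_def mi_def p_def e4_def, intro conjI; algebra)
  then have c0: "2 * (p i 1 * p 1 j + p i 2 * p 2 j + p i 3 * p 3 j + p i 4 * p 4 j) =
      2 * e3 * m i j - (if i = j then 2 * e4 else 0)" for i j
    unfolding t by simp
  have halve: "x = y - z * (if b then 1 else 0)" if "2 * x = 2 * e3 * w - (if b then 2 * z else 0)" "y = e3 * w" for x y z w :: real and b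
    using that by (cases b) simp_all
  have c: "p i 1 * p 1 j + p i 2 * p 2 j + p i 3 * p 3 j + p i 4 * p 4 j = e3 * m i j - e4 * (if i = j then 1 else 0)" for i j
    by (rule halve[OF c0 refl])
  have "(M ** M ** (M ** M)) $ i $ j = e3 * m i j - e4 * (if i = j then 1 else 0)" for i j
    using c[of i j] unfolding matrix_matrix_mult_def[of "M ** M"] by (simp add: sum_4 M2)
  then have "M ** M ** (M ** M) = e3 *\<^sub>R M - e4 *\<^sub>R mat 1"
    by (simp add: vec_eq_iff m_def mat_def)
  then show ?thesis by blast
qed

lemma pfaffian_kernel_4:
  fixes c1 c2 c3 c4 w12 w13 w14 w23 w24 w34 :: real
  assumes "- c2*w12 - c3*w13 - c4*w14 = 0" "c1*w12 - c3*w23 - c4*w24 = 0"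
    "c1*w13 + c2*w23 - c4*w34 = 0" "c1*w14 + c2*w24 + c3*w34 = 0"
    and nz: "w12*w34 - w13*w24 + w14*w23 \<noteq> 0"
  shows "c1 = 0 \<and> c2 = 0 \<and> c3 = 0 \<and> c4 = 0"
proof -
  have "c1 * (w12*w34 - w13*w24 + w14*w23) = 0" "c2 * (w12*w34 - w13*w24 + w14*w23) = 0"
    "c3 * (w12*w34 - w13*w24 + w14*w23) = 0" "c4 * (w12*w34 - w13*w24 + w14*w23) = 0"
    using assms(1-4) by algebra+
  then show ?thesis using nz by (metis mult_eq_0_iff)
qed

lemma linear_zero_on_Basis:
  fixes f :: "'e::euclidean_space \<Rightarrow> 'b::real_vector"
  assumes "linear f" "\<And>b. b \<in> Basis \<Longrightarrow> f b = 0"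
  shows "f x = 0"
proof -
  have "f x = f (\<Sum>b\<in>Basis. (x \<bullet> b) *\<^sub>R b)" by (simp only: euclidean_representation)
  also have "\<dots> = 0" using assms by (simp add: linear_sum linear_scale)
  finally show ?thesis .
qed

lemma linear_eq_on_vec_Basis:
  fixes f :: "real^'n \<Rightarrow> 'b::real_vector"
  assumes "linear f" "\<And>i. f (axis i 1) = 0"
  shows "f x = 0"
  by (rule linear_zero_on_Basis[OF assms(1)]) (auto simp: Basis_vec_def assms(2))

text \<open>
  Suppose \<open>\<omega> = h \<circ> [\<cdot>, \<cdot>]\<close> is nondegenerate, with \<open>T\<close> the induced map to the dual. Then \<open>h = \<omega>(z, \<cdot>)\<close> for some
  \<open>z\<close>, and the Jacobi identity becomes \<open>\<omega>([z, x], y) + \<omega>(x, [z, y]) = \<omega>(x, y)\<close>: via \<open>T\<close>, the operator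
  \<open>ad z\<close> is conjugate to \<open>1 - (ad z)\<^sup>T\<close>. Taking traces gives \<open>2 tr (ad z) = 4\<close>, but \<open>ad z\<close> is traceless.
\<close>

lemma unimodular_4_pfaffian_zero:
  fixes br :: "real^4 \<Rightarrow> real^4 \<Rightarrow> real^4"
  assumes "lie_algebra UNIV br" "lie_derived UNIV br = UNIV"
  shows "pf4 (\<lambda>x y. h \<bullet> br x y) b1 b2 b3 b4 = 0"
proof (rule ccontr)
  assume ne: "pf4 (\<lambda>x y. h \<bullet> br x y) b1 b2 b3 b4 \<noteq> 0"
  interpret lie_space br using assms(1) by (rule lie_space.intro)
  define \<omega> where "\<omega> x y = h \<bullet> br x y" for x y
  have skew: "\<omega> y x = - \<omega> x y" for x y unfolding \<omega>_def br_skew[of y x] by simp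
  have self: "\<omega> x x = 0" for x by (simp add: \<omega>_def br_simps)
  have ne': "\<omega> b1 b2 * \<omega> b3 b4 - \<omega> b1 b3 * \<omega> b2 b4 + \<omega> b1 b4 * \<omega> b2 b3 \<noteq> 0"
    using ne by (simp add: pf4_def \<omega>_def)
  define T where "T z = (\<Sum>b\<in>Basis. \<omega> z b *\<^sub>R b)" for z
  have T: "T z \<bullet> y = \<omega> z y" for z y
  proof -
    have "T z \<bullet> y = (\<Sum>b\<in>Basis. (y \<bullet> b) * \<omega> z b)"
      unfolding T_def inner_sum_left by (simp add: inner_commute mult.commute)
    also have "\<dots> = h \<bullet> br z (\<Sum>b\<in>Basis. (y \<bullet> b) *\<^sub>R b)"
      by (simp add: \<omega>_def linear_sum[OF linear_br] linear_scale[OF linear_br] inner_sum_right)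
    finally show ?thesis by (simp add: euclidean_representation \<omega>_def)
  qed
  have linT: "linear T"
    by (rule linearI; rule euclidean_eqI) (simp_all add: T inner_add_left, simp_all add: \<omega>_def br_simps inner_add_right)
  have "z = 0" if "T z = 0" for z
  proof -
    have z0: "\<omega> z y = 0" for y using T[of z y] that by simp
    have D4: "DIM(real^4) < 5" by simp
    obtain c1 c2 c3 c4 c5 where rel: "c1 *\<^sub>R b1 + c2 *\<^sub>R b2 + c3 *\<^sub>R b3 + c4 *\<^sub>R b4 + c5 *\<^sub>R z = 0"
      and nz: "\<not> (c1 = 0 \<and> c2 = 0 \<and> c3 = 0 \<and> c4 = 0 \<and> c5 = 0)"
      by (rule linear_relation_5[OF D4, of b1 b2 b3 b4 z]) (rule that)
    have w: "c1 * \<omega> b1 y + c2 * \<omega> b2 y + c3 * \<omega> b3 y + c4 * \<omega> b4 y = 0" for y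
      using arg_cong[OF rel, of "\<lambda>x. \<omega> x y"] z0[of y]
      by (simp add: \<omega>_def br_simps inner_add_right)
    have sk: "\<omega> b2 b1 = - \<omega> b1 b2" "\<omega> b3 b1 = - \<omega> b1 b3" "\<omega> b4 b1 = - \<omega> b1 b4"
      "\<omega> b3 b2 = - \<omega> b2 b3" "\<omega> b4 b2 = - \<omega> b2 b4" "\<omega> b4 b3 = - \<omega> b3 b4" by (rule skew)+
    have "c1 = 0 \<and> c2 = 0 \<and> c3 = 0 \<and> c4 = 0"
    proof (rule pfaffian_kernel_4[OF _ _ _ _ ne'])
      show "- c2 * \<omega> b1 b2 - c3 * \<omega> b1 b3 - c4 * \<omega> b1 b4 = 0" using w[of b1] unfolding sk self by linarith
      show "c1 * \<omega> b1 b2 - c3 * \<omega> b2 b3 - c4 * \<omega> b2 b4 = 0" using w[of b2] unfolding sk self by linarith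
      show "c1 * \<omega> b1 b3 + c2 * \<omega> b2 b3 - c4 * \<omega> b3 b4 = 0" using w[of b3] unfolding sk self by linarith
      show "c1 * \<omega> b1 b4 + c2 * \<omega> b2 b4 + c3 * \<omega> b3 b4 = 0" using w[of b4] unfolding sk self by linarith
    qed
    then show ?thesis using rel nz by simp
  qed
  then have bij: "bij T" by (intro bij_linear_dim linT) auto
  then obtain z where z: "T z = h" by (metis bij_pointE)
  define D' where "D' = adjoint (br z)"
  have D': "D' x \<bullet> y = x \<bullet> br z y" for x y
    unfolding D'_def by (metis adjoint_works linear_br inner_commute)
  have "T (br z x) = T x - D' (T x)" for x
  proof (rule euclidean_eqI)
    fix y :: "real^4"
    have "\<omega> z (br x y) = h \<bullet> br x y" using T[of z "br x y"] z by simp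
    then have "h \<bullet> br z (br x y) = h \<bullet> br x y" by (simp add: \<omega>_def)
    then show "T (br z x) \<bullet> y = (T x - D' (T x)) \<bullet> y"
      unfolding inner_diff_left D' T unfolding \<omega>_def br_jacobi[of z x y] by (simp add: inner_add_right)
  qed
  then have "(\<lambda>u. u - D' u) (T v) = T (br z v)" for v by simp
  moreover have "linear (\<lambda>u. u - D' u)"
    unfolding D'_def by (intro linear_compose_sub linear_id[unfolded id_def] adjoint_linear) simp
  ultimately have "op_trace (\<lambda>u. u - D' u) = op_trace (br z)"
    using op_trace_conj[OF _ linT bij] by blast
  moreover have "op_trace D' = op_trace (br z)"
    by (rule op_trace_adjoint) (metis D' inner_commute)
  moreover have "op_trace (br z) = 0" by (rule op_trace_br) (simp add: assms(2))
  ultimately show False by (simp add: op_trace_diff op_trace_id)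
qed

text \<open>
  The map \<open>h \<mapsto> \<omega>\<^sub>h = h \<circ> [\<cdot>, \<cdot>]\<close> into the six-dimensional space of 2-forms is injective, as the
  algebra is perfect, and the Pfaffian vanishes on its image. With \<open>J\<close> the isometry for which
  \<open>pf(\<omega>, J \<omega>)\<close> is the sum of squares of the coefficients, \<open>4 + 4 > 6\<close> yields \<open>(h, k) \<noteq> 0\<close> with
  \<open>\<omega>\<^sub>h = J \<omega>\<^sub>k\<close>. Polarising the Pfaffian at \<open>h + k\<close> makes the sum of squares of \<open>\<omega>\<^sub>k\<close> vanish.
\<close>

lemma no_perfect_real_4:
  fixes br :: "real^4 \<Rightarrow> real^4 \<Rightarrow> real^4"
  assumes "lie_algebra UNIV br" "lie_derived UNIV br = UNIV"
  shows False
proof -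
  interpret lie_space br using assms(1) by (rule lie_space.intro)
  define a where "a i j h = h \<bullet> br (axis i 1) (axis j 1)" for i j h
  have add: "a i j (h + k) = a i j h + a i j k" for i j h k by (simp add: a_def inner_add_left)
  have pf: "a 1 2 h * a 3 4 h - a 1 3 h * a 2 4 h + a 1 4 h * a 2 3 h = 0" for h
    using unimodular_4_pfaffian_zero[OF assms, of h "axis 1 1" "axis 2 1" "axis 3 1" "axis 4 1"]
    by (simp add: pf4_def a_def)
  let ?F = "\<lambda>(h, k). (a 1 2 h - a 3 4 k, a 1 3 h + a 2 4 k, a 1 4 h - a 2 3 k, a 2 3 h - a 1 4 k,
      a 2 4 h + a 1 3 k, a 3 4 h - a 1 2 k)"
  have lin: "linear ?F" by (rule linearI) (auto simp: a_def inner_add_left algebra_simps)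
  obtain u where u: "u \<noteq> 0" "?F u = 0"
    by (rule exists_common_kernel[OF lin subspace_UNIV]) (simp add: dim_UNIV, rule that)
  obtain h k where hk: "u = (h, k)" by (cases u)
  have e: "a 1 2 h = a 3 4 k" "a 1 3 h = - a 2 4 k" "a 1 4 h = a 2 3 k" "a 2 3 h = a 1 4 k"
    "a 2 4 h = - a 1 3 k" "a 3 4 h = a 1 2 k"
    using u(2) unfolding hk by (auto simp: zero_prod_def)
  have "a 1 2 k * a 1 2 k + a 1 3 k * a 1 3 k + a 1 4 k * a 1 4 k + a 2 3 k * a 2 3 k
     + a 2 4 k * a 2 4 k + a 3 4 k * a 3 4 k = 0"
    using pf[of "h + k"] pf[of h] pf[of k] unfolding add e by algebra
  moreover have "0 \<le> r * r" for r :: real by simp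
  ultimately have "a 1 2 k * a 1 2 k = 0 \<and> a 1 3 k * a 1 3 k = 0 \<and> a 1 4 k * a 1 4 k = 0
    \<and> a 2 3 k * a 2 3 k = 0 \<and> a 2 4 k * a 2 4 k = 0 \<and> a 3 4 k * a 3 4 k = 0"
    by (smt (verit))
  then have k: "a 1 2 k = 0" "a 1 3 k = 0" "a 1 4 k = 0" "a 2 3 k = 0" "a 2 4 k = 0" "a 3 4 k = 0"
    by simp_all
  have zero: "g = 0" if "a 1 2 g = 0" "a 1 3 g = 0" "a 1 4 g = 0" "a 2 3 g = 0" "a 2 4 g = 0" "a 3 4 g = 0" for g
  proof (rule perfect_functional[OF assms(2)])
    have sk: "a j i g = - a i j g" for i j unfolding a_def br_skew[of "axis j 1" "axis i 1"] by simp
    have "a i i g = 0" for i by (simp add: a_def br_simps)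
    then have "\<forall>i j. a i j g = 0"
      unfolding forall_4 using that sk[of 2 1] sk[of 3 1] sk[of 4 1] sk[of 3 2] sk[of 4 2] sk[of 4 3] by simp
    then have ax: "g \<bullet> br (axis i 1) (axis j 1) = 0" for i j by (simp add: a_def)
    have 1: "g \<bullet> br (axis i 1) y = 0" for i y
      by (rule linear_eq_on_vec_Basis[where f="\<lambda>y. g \<bullet> br (axis i 1) y"])
        (auto intro!: linearI simp: br_simps inner_add_right ax)
    show "g \<bullet> br x y = 0" for x y
      by (rule linear_eq_on_vec_Basis[where f="\<lambda>x. g \<bullet> br x y"])
        (auto intro!: linearI simp: br_simps inner_add_right 1)
  qed
  have "k = 0" using k by (rule zero)
  moreover have "h = 0" by (rule zero) (simp_all add: e k)
  ultimately show False using u(1) hk by (simp add: zero_prod_def)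
qed

lemma no_perfect_dim_4:
  fixes V :: "'a::real_vector set"
  assumes "lie_algebra V br" "lie_derived V br = V" "dim V = 4"
  shows False
proof -
  have "dim V = DIM(real^4)" using assms(3) by simp
  then obtain g :: "real^4 \<Rightarrow> 'a" and br' where g: "lie_embedding g br' br" "lie_algebra UNIV br'" "range g = V"
    by (rule lie_algebra_coordinates[OF assms(1)])
  have "g ` lie_derived UNIV br' = range g"
    using lie_derived_image[OF g(1), of UNIV] assms(2) g(3) by simp
  then have "lie_derived UNIV br' = UNIV"
    using g(1) inj_image_eq_iff[of g] unfolding lie_embedding_def by blast
  then show False by (rule no_perfect_real_4[OF g(2)])
qed

section \<open>Three-dimensional perfect Lie algebras\<close>

lemma op_trace_real: "op_trace f = f 1" for f :: "real \<Rightarrow> real"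
  by (simp add: op_trace_def)

lemma basis_3:
  fixes x y z :: "'e::euclidean_space"
  assumes "DIM('e) = 3" and ind: "\<And>a b c. a *\<^sub>R x + b *\<^sub>R y + c *\<^sub>R z = 0 \<Longrightarrow> a = 0 \<and> b = 0 \<and> c = 0"
  obtains a b c where "u = a *\<^sub>R x + b *\<^sub>R y + c *\<^sub>R z"
proof -
  let ?h = "\<lambda>(a, b, c). a *\<^sub>R x + b *\<^sub>R y + c *\<^sub>R z"
  have "linear ?h" by (auto intro!: linearI simp: algebra_simps)
  then have "bij ?h" using ind assms(1) by (intro bij_linear_dim) (auto simp: zero_prod_def)
  then have "u \<in> range ?h" by (simp add: bij_is_surj)
  then obtain v where "u = ?h v" by (rule rangeE)
  then show ?thesis using that by (cases v) auto
qed

lemma op_trace_3: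
  fixes x y z :: "'e::euclidean_space"
  assumes "DIM('e) = 3" and ind: "\<And>a b c. a *\<^sub>R x + b *\<^sub>R y + c *\<^sub>R z = 0 \<Longrightarrow> a = 0 \<and> b = 0 \<and> c = 0"
    and "linear f" and f: "f x = a1 *\<^sub>R x + a2 *\<^sub>R y + a3 *\<^sub>R z"
      "f y = b1 *\<^sub>R x + b2 *\<^sub>R y + b3 *\<^sub>R z" "f z = c1 *\<^sub>R x + c2 *\<^sub>R y + c3 *\<^sub>R z"
  shows "op_trace f = a1 + b2 + c3"
proof -
  let ?h = "\<lambda>(a, b, c). a *\<^sub>R x + b *\<^sub>R y + c *\<^sub>R z"
  let ?m = "\<lambda>(s, t, r). (s * a1 + t * b1 + r * c1, s * a2 + t * b2 + r * c2, s * a3 + t * b3 + r * c3)"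
  have lin: "linear ?h" by (auto intro!: linearI simp: algebra_simps)
  then have "bij ?h" using ind assms(1) by (intro bij_linear_dim) (auto simp: zero_prod_def)
  moreover have "f (?h v) = ?h (?m v)" for v
    by (cases v) (simp add: linear_add[OF assms(3)] linear_scale[OF assms(3)] f algebra_simps)
  ultimately have "op_trace f = op_trace ?m" using op_trace_conj[OF assms(3) lin] by blast
  also have "\<dots> = a1 + b2 + c3"
    by (simp add: op_trace_prod op_trace_real zero_prod_def)
  finally show ?thesis .
qed

lemma solve_second:
  fixes x y :: "'a::real_vector"
  assumes "a *\<^sub>R x + b *\<^sub>R y = 0" "b \<noteq> 0"
  shows "y = (- a / b) *\<^sub>R x"
proof -
  have "b *\<^sub>R y = - (a *\<^sub>R x)" using assms(1) by (metis add.commute eq_neg_iff_add_eq_0)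
  then have "(1 / b) *\<^sub>R (b *\<^sub>R y) = (1 / b) *\<^sub>R (- (a *\<^sub>R x))" by simp
  then show ?thesis using assms(2) by simp
qed

lemma coefficient_zero_outside_span:
  fixes x y w :: "'a::real_vector"
  assumes "a *\<^sub>R x + b *\<^sub>R y + c *\<^sub>R w = 0" "w \<notin> span {x, y}"
  shows "c = 0"
proof (rule ccontr)
  assume "c \<noteq> 0"
  have "a *\<^sub>R x + b *\<^sub>R y \<in> span {x, y}"
    by (intro span_add span_scale span_base) auto
  moreover have "w = (- 1 / c) *\<^sub>R (a *\<^sub>R x + b *\<^sub>R y)"
    using solve_second[of 1 "a *\<^sub>R x + b *\<^sub>R y" c w] assms(1) \<open>c \<noteq> 0\<close> by simp
  ultimately show False using assms(2) by (metis span_scale)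
qed

context lie_space begin

text \<open>
  If \<open>x, y\<close> were independent and commuted, then with a third vector \<open>w\<close> all brackets would be
  combinations of \<open>[x, w]\<close> and \<open>[y, w]\<close>, and the algebra would not be perfect.
\<close>

lemma perfect_3_centralizer:
  assumes dim: "DIM('e) = 3" and perf: "derived = UNIV" and "br x y = 0" "x \<noteq> 0"
  shows "\<exists>t. y = t *\<^sub>R x"
proof (rule ccontr)
  assume no: "\<not> ?thesis"
  have "\<exists>w. w \<notin> span {x, y}"
  proof (rule ccontr)
    assume "\<not> ?thesis"
    then have "span {x, y} = UNIV" by auto
    then have "dim {x, y} = 3" using dim by (metis dim_span dim_UNIV)
    moreover have "dim {x, y} \<le> card {x, y}" by (rule dim_le_card) (simp_all add: span_base)
    moreover have "card {x, y} \<le> 2" by (simp add: card_insert_if)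
    ultimately show False by simp
  qed
  then obtain w where w: "w \<notin> span {x, y}" by blast
  have ind: "a = 0 \<and> b = 0 \<and> c = 0" if rel: "a *\<^sub>R x + b *\<^sub>R y + c *\<^sub>R w = 0" for a b c
  proof -
    have c: "c = 0" using rel w by (rule coefficient_zero_outside_span)
    have b: "b = 0"
    proof (rule ccontr)
      assume "b \<noteq> 0"
      then have "y = (- a / b) *\<^sub>R x" using rel c by (intro solve_second) auto
      then show False using no by blast
    qed
    show ?thesis using rel b c assms(4) by simp
  qed
  have "linear (\<lambda>h. (h \<bullet> br x w, h \<bullet> br y w))" by (auto intro!: linearI simp: inner_add_left)
  then obtain h where h: "h \<noteq> 0" "(h \<bullet> br x w, h \<bullet> br y w) = 0"
    by (rule exists_common_kernel[OF _ subspace_UNIV]) (simp add: dim dim_UNIV, rule that)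
  have sk: "br w x = - br x w" "br w y = - br y w" "br y x = - br x y" by (rule br_skew)+
  have "h \<bullet> br u v = 0" for u v
  proof -
    obtain a b c where u: "u = a *\<^sub>R x + b *\<^sub>R y + c *\<^sub>R w" by (rule basis_3[OF dim ind])
    obtain a' b' c' where v: "v = a' *\<^sub>R x + b' *\<^sub>R y + c' *\<^sub>R w" by (rule basis_3[OF dim ind])
    show ?thesis unfolding u v using h(2) assms(3)
      by (simp add: br_simps sk inner_add_right inner_diff_right zero_prod_def)
  qed
  then show False using perfect_functional[OF perf] h(1) by blast
qed

text \<open>
  As \<open>ad w\<close> is traceless and kills \<open>w\<close>, the eigenvalue \<open>-1\<close> on \<open>e\<close> is accompanied by an eigenvalue \<open>1\<close>
  with an eigenvector \<open>f\<close>. Then \<open>[e, f]\<close> commutes with \<open>w\<close>, so it is a nonzero multiple of \<open>w\<close>. After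
  rescaling, the vectors \<open>e + f\<close>, \<open>w\<close>, \<open>e - f\<close> satisfy the stated relations.
\<close>

lemma perfect_3_from_eigenvector:
  assumes dim: "DIM('e) = 3" and perf: "derived = UNIV" and we: "br w e = - e" and e: "e \<noteq> 0"
  shows "\<exists>x y z. br x y = z \<and> br z x = y \<and> br y z = - x \<and>
    (\<forall>a b c. a *\<^sub>R x + b *\<^sub>R y + c *\<^sub>R z = 0 \<longrightarrow> a = 0 \<and> b = 0 \<and> c = 0)"
proof -
  have w0: "w \<noteq> 0" using we e by (auto simp: br_simps)
  have indep2: "a = 0 \<and> b = 0" if "a *\<^sub>R w + b *\<^sub>R e = 0" for a b
  proof -
    have "br w (a *\<^sub>R w + b *\<^sub>R e) = 0" using that by (simp add: br_simps)
    then have "b = 0" using we e by (simp add: br_simps)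
    then show ?thesis using that w0 by simp
  qed
  have "\<exists>u. u \<notin> span {w, e}"
  proof (rule ccontr)
    assume "\<not> ?thesis"
    then have "span {w, e} = UNIV" by auto
    then have "dim {w, e} = 3" using dim by (metis dim_span dim_UNIV)
    moreover have "dim {w, e} \<le> card {w, e}" by (rule dim_le_card) (simp_all add: span_base)
    moreover have "card {w, e} \<le> 2" by (simp add: card_insert_if)
    ultimately show False by simp
  qed
  then obtain u where u: "u \<notin> span {w, e}" by blast
  have ind: "a = 0 \<and> b = 0 \<and> c = 0" if rel: "a *\<^sub>R w + b *\<^sub>R e + c *\<^sub>R u = 0" for a b c
  proof -
    have c: "c = 0" using rel u by (rule coefficient_zero_outside_span)
    then show ?thesis using rel indep2[of a b] by simp
  qed
  obtain \<beta> \<alpha> \<gamma> where wu: "br w u = \<beta> *\<^sub>R w + \<alpha> *\<^sub>R e + \<gamma> *\<^sub>R u" by (rule basis_3[OF dim ind])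
  have "op_trace (br w) = 0 + -1 + \<gamma>"
    by (rule op_trace_3[OF dim ind, where ?a2.0=0 and ?a3.0=0 and ?b1.0=0 and ?b3.0=0])
      (auto simp: br_simps we wu)
  then have \<gamma>: "\<gamma> = 1" using op_trace_br[of w] perf by simp
  \<comment> \<open>the coefficients turn \<open>u\<close>, an eigenvector modulo \<open>w\<close> and \<open>e\<close>, into an eigenvector\<close>
  define f where "f = u + (\<alpha> / 2) *\<^sub>R e + \<beta> *\<^sub>R w"
  have wf: "br w f = f"
    unfolding f_def br_simps wu we \<gamma> by (simp add: algebra_simps scaleR_left_distrib[symmetric])
  have indf: "a = 0 \<and> b = 0 \<and> c = 0" if rel: "a *\<^sub>R w + b *\<^sub>R e + c *\<^sub>R f = 0" for a b c
  proof -
    have "(a + c * \<beta>) *\<^sub>R w + (b + c * (\<alpha> / 2)) *\<^sub>R e + c *\<^sub>R u = 0"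
      using rel unfolding f_def by (simp add: algebra_simps)
    then show ?thesis using ind by force
  qed
  have "br w (br e f) = 0" unfolding br_jacobi[of w e f] we wf by (simp add: br_simps)
  then obtain c where c: "br e f = c *\<^sub>R w"
    using perfect_3_centralizer[OF dim perf _ w0] by blast
  have c0: "c \<noteq> 0"
  proof
    assume "c = 0"
    then obtain t where "f = t *\<^sub>R e" using c perfect_3_centralizer[OF dim perf _ e] by auto
    then show False using indf[of 0 t "-1"] by simp
  qed
  \<comment> \<open>the scaling for which \<open>[e + f, e - f] = - w\<close>\<close>
  define f' where "f' = (1 / (2 * c)) *\<^sub>R f"
  have wf': "br w f' = f'" by (simp add: f'_def br_simps wf)
  have ef': "br e f' = (1 / 2) *\<^sub>R w" using c0 by (simp add: f'_def br_simps c)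
  have sk: "br f' e = - ((1 / 2) *\<^sub>R w)" "br e w = e" "br f' w = - f'"
    using br_skew[of f' e] br_skew[of e w] br_skew[of f' w] ef' we wf' by simp_all
  have h: "(1 / 2) *\<^sub>R w + (1 / 2) *\<^sub>R w = w" by (simp add: scaleR_left_distrib[symmetric])
  have "br (e + f') w = e - f'" "br (e - f') (e + f') = w" "br w (e - f') = - (e + f')"
    by (simp_all add: br_simps sk we wf' ef' h)
  moreover have "a = 0 \<and> b = 0 \<and> d = 0" if "a *\<^sub>R (e + f') + b *\<^sub>R w + d *\<^sub>R (e - f') = 0" for a b d
  proof -
    have "b *\<^sub>R w + (a + d) *\<^sub>R e + ((a - d) / (2 * c)) *\<^sub>R f = 0"
      using that unfolding f'_def by (simp add: algebra_simps diff_divide_distrib)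
    then have "b = 0 \<and> a + d = 0 \<and> (a - d) / (2 * c) = 0" by (rule indf)
    then show ?thesis using c0 by auto
  qed
  ultimately show ?thesis by (intro exI[of _ "e + f'"] exI[of _ w] exI[of _ "e - f'"]) blast
qed

text \<open>
  Either some \<open>ad w\<close> has a nonzero real eigenvalue, and the algebra is \<open>sl(2)\<close> with \<open>\<nu> = -1\<close>. Or
  \<open>ad x\<close>, which is traceless, squares to a negative multiple \<open>\<alpha>\<close> of the identity on its image; scaled so that it is a
  rotation there, it leaves only the sign of \<open>[y, z] = \<nu> x\<close> undetermined.
\<close>

lemma perfect_3_basis:
  assumes dim: "DIM('e) = 3" and perf: "derived = UNIV"
  shows "\<exists>x y z \<nu>. (\<nu> = 1 \<or> \<nu> = -1) \<and> br x y = z \<and> br z x = y \<and> br y z = \<nu> *\<^sub>R x \<and>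
    (\<forall>a b c. a *\<^sub>R x + b *\<^sub>R y + c *\<^sub>R z = 0 \<longrightarrow> a = 0 \<and> b = 0 \<and> c = 0)"
proof -
  note ker = perfect_3_centralizer[OF dim perf]
  have eig: ?thesis if "br w e = - e" "e \<noteq> 0" for w e
    using perfect_3_from_eigenvector[OF dim perf that] by (metis scaleR_minus1_left)
  have eig': ?thesis if "br w e = t *\<^sub>R e" "e \<noteq> 0" "t \<noteq> 0" for w e t
    by (rule eig[of "(- 1 / t) *\<^sub>R w" e]) (use that in \<open>simp_all add: br_simps\<close>)
  obtain x :: 'e where x: "x \<noteq> 0" using nonzero_Basis nonempty_Basis by blast
  show ?thesis
  proof (cases "x \<in> range (br x)")
    case True
    then obtain w where "x = br x w" by blast
    then have "br w x = - x" using br_skew[of w x] by simp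
    then show ?thesis using x by (rule eig)
  next
    case False
    have nr: "t = 0" if "t *\<^sub>R x = br x v" for t v
    proof (rule ccontr)
      assume "t \<noteq> 0"
      then have "x = br x ((1 / t) *\<^sub>R v)" using that[symmetric] by (simp add: br_simps)
      then show False using False by blast
    qed
    have "\<exists>y0. br x y0 \<noteq> 0"
    proof (rule ccontr)
      assume "\<not> ?thesis"
      then have all: "br x v = 0" for v by blast
      have "linear (\<lambda>v. v \<bullet> x)" by (auto intro!: linearI simp: inner_add_left)
      then obtain v where v: "v \<noteq> 0" "v \<bullet> x = 0"
        by (rule exists_common_kernel[OF _ subspace_UNIV]) (simp add: dim dim_UNIV, rule that)
      then show False using ker[OF all[of v] x] x by auto
    qed
    then obtain y0 where y0: "br x y0 \<noteq> 0" by blast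
    define y where "y = br x y0"
    define z where "z = br x y"
    have y: "y \<noteq> 0" using y0 by (simp add: y_def)
    show ?thesis
    proof (cases "\<exists>t. z = t *\<^sub>R y")
      case True
      then obtain t where t: "z = t *\<^sub>R y" by blast
      have "t \<noteq> 0"
      proof
        assume "t = 0"
        then have "br x y = 0" using t by (simp add: z_def)
        then obtain s where "y = s *\<^sub>R x" using ker[OF _ x] by blast
        then show False using nr[of s y0] y by (simp add: y_def)
      qed
      then show ?thesis using eig'[of x y t] t y by (simp add: z_def)
    next
      case nz: False
      have ind: "a = 0 \<and> b = 0 \<and> c = 0" if rel: "a *\<^sub>R x + b *\<^sub>R y + c *\<^sub>R z = 0" for a b c
      proof -
        have "a *\<^sub>R x = br x (- (b *\<^sub>R y0 + c *\<^sub>R y))"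
        proof -
          have "a *\<^sub>R x = - (b *\<^sub>R y + c *\<^sub>R z)" using rel by (metis add.assoc eq_neg_iff_add_eq_0)
          then show ?thesis by (simp add: br_simps y_def[symmetric] z_def[symmetric])
        qed
        then have a: "a = 0" by (rule nr)
        have c: "c = 0"
        proof (rule ccontr)
          assume "c \<noteq> 0"
          then have "z = (- b / c) *\<^sub>R y" using rel a by (intro solve_second) auto
          then show False using nz by blast
        qed
        show ?thesis using a c rel y by simp
      qed
      obtain \<delta> \<alpha> \<beta> where xz: "br x z = \<delta> *\<^sub>R x + \<alpha> *\<^sub>R y + \<beta> *\<^sub>R z" by (rule basis_3[OF dim ind])
      have "\<delta> *\<^sub>R x = br x (z - \<alpha> *\<^sub>R y0 - \<beta> *\<^sub>R y)"
        using xz by (simp add: br_simps y_def[symmetric] z_def[symmetric])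
      then have \<delta>: "\<delta> = 0" by (rule nr)
      have "op_trace (br x) = 0 + 0 + \<beta>"
        by (rule op_trace_3[OF dim ind, where x=x and y=y and z=z and ?a2.0=0 and ?a3.0=0 and ?b1.0=0 and ?b3.0=1 and ?c1.0=0 and ?c2.0=\<alpha>])
          (auto simp: br_simps xz \<delta> z_def[symmetric])
      then have \<beta>: "\<beta> = 0" using op_trace_br[of x] perf by simp
      have xz: "br x z = \<alpha> *\<^sub>R y" using xz \<delta> \<beta> by simp
      have \<alpha>: "\<alpha> \<noteq> 0"
      proof
        assume "\<alpha> = 0"
        then obtain s where "z = s *\<^sub>R x" using xz ker[OF _ x, of z] by auto
        then show False using ind[of s 0 "-1"] by simp
      qed
      show ?thesis
      proof (cases "\<alpha> > 0")
        case True
        define s where "s = sqrt \<alpha>"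
        have s: "s * s = \<alpha>" "s \<noteq> 0" using True by (simp_all add: s_def)
        have "br x (s *\<^sub>R y + z) = s *\<^sub>R (s *\<^sub>R y + z)"
          by (simp add: br_simps xz z_def[symmetric] s(1) algebra_simps)
        moreover have "s *\<^sub>R y + z \<noteq> 0" using ind[of 0 s 1] by auto
        ultimately show ?thesis using eig' s(2) by blast
      next
        case False
        define s where "s = sqrt (- \<alpha>)"
        have s: "s * s = - \<alpha>" "s \<noteq> 0" using False \<alpha> by (simp_all add: s_def)
        define X where "X = (1 / s) *\<^sub>R x"
        define Z where "Z = (1 / s) *\<^sub>R z"
        have Xy: "br X y = Z" by (simp add: X_def Z_def br_simps z_def)
        have "\<alpha> / (s * s) = -1" using s \<alpha> by simp
        then have XZ: "br X Z = - y" by (simp add: X_def Z_def br_simps xz)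
        have X0: "X \<noteq> 0" using x s(2) by (simp add: X_def)
        have "br X (br y Z) = 0" unfolding br_jacobi[of X y Z] Xy XZ by (simp add: br_simps)
        then obtain \<nu> where \<nu>: "br y Z = \<nu> *\<^sub>R X" using ker[OF _ X0] by blast
        have \<nu>0: "\<nu> \<noteq> 0"
        proof
          assume "\<nu> = 0"
          then obtain t where "Z = t *\<^sub>R y" using \<nu> ker[OF _ y, of Z] by auto
          then show False using ind[of 0 "-t" "1/s"] s(2) by (simp add: Z_def)
        qed
        define r where "r = 1 / sqrt \<bar>\<nu>\<bar>"
        have r: "r * r * \<nu> = sgn \<nu>" "r \<noteq> 0" using \<nu>0 by (simp_all add: r_def sgn_if abs_if)
        have "br X (r *\<^sub>R y) = r *\<^sub>R Z" "br (r *\<^sub>R Z) X = r *\<^sub>R y"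
          using br_skew[of Z X] by (simp_all add: br_simps Xy XZ)
        moreover have "br (r *\<^sub>R y) (r *\<^sub>R Z) = sgn \<nu> *\<^sub>R X"
          by (simp add: br_simps \<nu> r(1)[symmetric] mult.assoc)
        moreover have "sgn \<nu> = 1 \<or> sgn \<nu> = -1" using \<nu>0 by (simp add: sgn_if)
        moreover have "a = 0 \<and> b = 0 \<and> c = 0" if "a *\<^sub>R X + b *\<^sub>R (r *\<^sub>R y) + c *\<^sub>R (r *\<^sub>R Z) = 0" for a b c
          using ind[of "a / s" "b * r" "c * r / s"] that s(2) r(2) by (simp add: X_def Z_def)
        ultimately show ?thesis by blast
      qed
    qed
  qed
qed

end

section \<open>Isomorphisms with the models\<close>

lemma subspace_dim_2_basis:
  fixes S :: "'e::euclidean_space set"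
  assumes "subspace S" "dim S = 2"
  obtains u v where "u \<in> S" "v \<in> S" "\<forall>w\<in>S. \<exists>a b. w = a *\<^sub>R u + b *\<^sub>R v"
    "\<forall>a b. a *\<^sub>R u + b *\<^sub>R v = 0 \<longrightarrow> a = 0 \<and> b = 0"
proof -
  have "dim (UNIV :: (real \<times> real) set) = dim S" using assms(2) by (simp add: dim_UNIV)
  then obtain g :: "real \<times> real \<Rightarrow> 'e" where g: "linear g" "g ` UNIV = S" "inj_on g UNIV"
    using subspace_isomorphism[OF subspace_UNIV assms(1)] by metis
  define u where "u = g (1, 0)"
  define v where "v = g (0, 1)"
  have e: "g (a, b) = a *\<^sub>R u + b *\<^sub>R v" for a b
  proof -
    have "g (a, b) = g (a *\<^sub>R (1, 0) + b *\<^sub>R (0, 1))" by simp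
    then show ?thesis by (simp only: linear_add[OF g(1)] linear_scale[OF g(1)] u_def v_def)
  qed
  have "\<forall>w\<in>S. \<exists>a b. w = a *\<^sub>R u + b *\<^sub>R v"
  proof
    fix w assume "w \<in> S"
    then obtain p where "w = g p" using g(2) by blast
    then show "\<exists>a b. w = a *\<^sub>R u + b *\<^sub>R v" using e[of "fst p" "snd p"] by auto
  qed
  moreover have "\<forall>a b. a *\<^sub>R u + b *\<^sub>R v = 0 \<longrightarrow> a = 0 \<and> b = 0"
  proof (intro allI impI)
    fix a b assume "a *\<^sub>R u + b *\<^sub>R v = 0"
    then have "g (a, b) = g 0" using e linear_0[OF g(1)] by simp
    then have "(a, b) = 0" using g(3) unfolding inj_on_def by blast
    then show "a = 0 \<and> b = 0" by (simp add: zero_prod_def)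
  qed
  ultimately show ?thesis using that[of u v] g(2) by (auto simp: u_def v_def)
qed

lemma basis_5:
  fixes b1 b2 b3 b4 b5 :: "'e::euclidean_space"
  assumes "DIM('e) = 5" and ind: "\<And>c1 c2 c3 c4 c5. c1 *\<^sub>R b1 + c2 *\<^sub>R b2 + c3 *\<^sub>R b3 + c4 *\<^sub>R b4 + c5 *\<^sub>R b5 = 0 \<Longrightarrow>
    c1 = 0 \<and> c2 = 0 \<and> c3 = 0 \<and> c4 = 0 \<and> c5 = 0"
  obtains c1 c2 c3 c4 c5 where "u = c1 *\<^sub>R b1 + c2 *\<^sub>R b2 + c3 *\<^sub>R b3 + c4 *\<^sub>R b4 + c5 *\<^sub>R b5"
proof -
  let ?h = "\<lambda>(c1, c2, c3, c4, c5). c1 *\<^sub>R b1 + c2 *\<^sub>R b2 + c3 *\<^sub>R b3 + c4 *\<^sub>R b4 + c5 *\<^sub>R b5"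
  have "linear ?h" by (auto intro!: linearI simp: algebra_simps)
  then have "bij ?h" using ind assms(1) by (intro bij_linear_dim) (auto simp: zero_prod_def)
  then have "u \<in> range ?h" by (simp add: bij_is_surj)
  then obtain v where "u = ?h v" by (rule rangeE)
  then show ?thesis using that by (cases v) auto
qed

text \<open>
  The isomorphism is described by its inverse: a map from the model, whose elements have coordinates,
  is easy to write down.
\<close>

lemma lie_isomorphic_from_model:
  assumes M: "subspace M" "\<And>x y. x \<in> M \<Longrightarrow> y \<in> M \<Longrightarrow> brM x y \<in> M"
    and g: "linear g" "\<And>x. x \<in> M \<Longrightarrow> g x = 0 \<Longrightarrow> x = 0" "\<And>u. \<exists>x\<in>M. u = g x"
      "\<And>x y. x \<in> M \<Longrightarrow> y \<in> M \<Longrightarrow> g (brM x y) = br (g x) (g y)"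
  shows "lie_isomorphic UNIV br M brM"
proof -
  have inj: "inj_on g M"
    using g(2) M(1) by (intro inj_onI) (metis g(1) linear_diff right_minus_eq subspace_diff)
  have bij: "bij_betw g M UNIV" using inj g(3) by (auto simp: bij_betw_def)
  define f where "f = inv_into M g"
  have fM: "f u \<in> M" and gf: "g (f u) = u" for u
    using bij by (auto simp: f_def bij_betw_def f_inv_into_f inv_into_into)
  have f: "f u = x" if "x \<in> M" "g x = u" for u x
    using that inj by (auto simp: f_def)
  have "bij_betw f UNIV M" unfolding f_def by (rule bij_betw_inv_into[OF bij])
  moreover have "linear_on UNIV f"
    unfolding linear_on_def using fM gf M(1)
    by (auto intro!: f simp: linear_add[OF g(1)] linear_scale[OF g(1)] subspace_add subspace_scale)
  moreover have "f (br u v) = brM (f u) (f v)" for u v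
    by (rule f) (simp_all add: fM M(2) g(4) gf)
  ultimately show ?thesis unfolding lie_isomorphic_def by blast
qed

lemma (in lie_space) contact_of_isomorphic:
  fixes \<eta> :: "'m::real_vector \<Rightarrow> real"
  assumes dim: "DIM('e) = 5" and iso: "lie_isomorphic UNIV br M brM" and \<eta>: "linear \<eta>"
    and nd: "\<And>u. u \<in> M \<Longrightarrow> \<eta> u = 0 \<Longrightarrow> (\<And>y. y \<in> M \<Longrightarrow> \<eta> (brM u y) = 0) \<Longrightarrow> u = 0"
  shows "contact_lie_algebra UNIV br"
proof -
  obtain f where f: "bij_betw f UNIV M" "linear_on UNIV f" "\<And>x y. f (br x y) = brM (f x) (f y)"
    using iso unfolding lie_isomorphic_def by auto
  have lin: "linear f" using f(2) by (simp add: linear_on_UNIV)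
  show ?thesis unfolding contact_iff_5[OF dim]
  proof (intro exI conjI allI impI)
    show "linear (\<lambda>x. \<eta> (f x))" using linear_compose[OF lin \<eta>] by (simp add: o_def)
    fix u assume u: "\<eta> (f u) = 0" "\<forall>y. \<eta> (f (br u y)) = 0"
    have "f u = 0"
    proof (rule nd)
      show "f u \<in> M" using f(1) by (auto simp: bij_betw_def)
      show "\<eta> (brM (f u) y) = 0" if "y \<in> M" for y
      proof -
        obtain x where "y = f x" using \<open>y \<in> M\<close> f(1) by (auto simp: bij_betw_def)
        then show ?thesis using u(2) f(3) by simp
      qed
    qed (rule u(1))
    then show "u = 0"
      using f(1) linear_0[OF lin] unfolding bij_betw_def inj_on_def by (metis UNIV_I)
  qed
qed

lemma sl2_iff: "X \<in> sl2 \<longleftrightarrow> X $ 2 $ 2 = - X $ 1 $ 1"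
  by (auto simp: sl2_def trace_def sum_2)

lemma so3_iff: "X \<in> so3 \<longleftrightarrow> X $ 1 $ 1 = 0 \<and> X $ 2 $ 2 = 0 \<and> X $ 3 $ 3 = 0 \<and>
    X $ 1 $ 2 = - X $ 2 $ 1 \<and> X $ 2 $ 3 = - X $ 3 $ 2 \<and> X $ 3 $ 1 = - X $ 1 $ 3"
  by (auto simp: so3_def transpose_def vec_eq_iff forall_3)

lemma subspace_sl2: "subspace sl2"
  by (auto simp: subspace_def sl2_iff)

lemma subspace_so3: "subspace so3"
  by (auto simp: subspace_def so3_iff)

lemma commutator_2_nth:
  fixes X Y :: "real^2^2"
  shows "commutator X Y $ 1 $ 1 = X $ 1 $ 2 * Y $ 2 $ 1 - Y $ 1 $ 2 * X $ 2 $ 1"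
    "commutator X Y $ 1 $ 2 = X $ 1 $ 1 * Y $ 1 $ 2 + X $ 1 $ 2 * Y $ 2 $ 2 - Y $ 1 $ 1 * X $ 1 $ 2 - Y $ 1 $ 2 * X $ 2 $ 2"
    "commutator X Y $ 2 $ 1 = X $ 2 $ 1 * Y $ 1 $ 1 + X $ 2 $ 2 * Y $ 2 $ 1 - Y $ 2 $ 1 * X $ 1 $ 1 - Y $ 2 $ 2 * X $ 2 $ 1"
    "commutator X Y $ 2 $ 2 = X $ 2 $ 1 * Y $ 1 $ 2 - Y $ 2 $ 1 * X $ 1 $ 2"
  by (simp_all add: commutator_def matrix_matrix_mult_def sum_2 algebra_simps)

lemma commutator_3_nth:
  fixes X Y :: "real^3^3"
  shows "commutator X Y $ i $ j = X $ i $ 1 * Y $ 1 $ j + X $ i $ 2 * Y $ 2 $ j + X $ i $ 3 * Y $ 3 $ j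
    - (Y $ i $ 1 * X $ 1 $ j + Y $ i $ 2 * X $ 2 $ j + Y $ i $ 3 * X $ 3 $ j)"
  by (simp add: commutator_def matrix_matrix_mult_def sum_3)

lemma sl2_commutator: "X \<in> sl2 \<Longrightarrow> Y \<in> sl2 \<Longrightarrow> commutator X Y \<in> sl2"
  by (simp add: sl2_iff commutator_2_nth)

lemma so3_commutator: "X \<in> so3 \<Longrightarrow> Y \<in> so3 \<Longrightarrow> commutator X Y \<in> so3"
  by (simp add: so3_iff commutator_3_nth algebra_simps)

context lie_space begin

text \<open>
  The functional is \<open>b\<^sup>*\<close> on \<open>aff(\<real>)\<close>, whose differential is nondegenerate there, plus the coordinate of a
  compact element of \<open>sl(2)\<close>. Four test elements suffice to cut out the kernel.
\<close>

lemma contact_if_aff_sl2: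
  assumes "DIM('e) = 5" "lie_isomorphic UNIV br (UNIV \<times> sl2) (direct_sum_bracket aff_bracket commutator)"
  shows "contact_lie_algebra UNIV br"
proof (rule contact_of_isomorphic[OF assms, where \<eta>="\<lambda>u. snd (fst u) + (snd u $ 1 $ 2 - snd u $ 2 $ 1)"])
  show "linear (\<lambda>u::(real \<times> real) \<times> (real^2^2). snd (fst u) + (snd u $ 1 $ 2 - snd u $ 2 $ 1))"
    by (rule linearI) (auto simp: algebra_simps)
  fix u :: "(real \<times> real) \<times> (real^2^2)"
  assume uM: "u \<in> UNIV \<times> sl2" and e: "(snd (fst u) + (snd u $ 1 $ 2 - snd u $ 2 $ 1)) = 0"
    and k: "\<And>y. y \<in> UNIV \<times> sl2 \<Longrightarrow> (snd (fst (direct_sum_bracket aff_bracket commutator u y)) + (snd (direct_sum_bracket aff_bracket commutator u y) $ 1 $ 2 - snd (direct_sum_bracket aff_bracket commutator u y) $ 2 $ 1)) = 0"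
  obtain a b X where u: "u = ((a, b), X)" by (metis prod.exhaust)
  have X: "X $ 2 $ 2 = - X $ 1 $ 1" using uM u by (simp add: sl2_iff)
  have 0: "(0::real^2^2) \<in> sl2" by (simp add: sl2_iff)
  define Y1 :: "real^2^2" where "Y1 = vector [vector [1, 0], vector [0, -1]]"
  define Y2 :: "real^2^2" where "Y2 = vector [vector [0, 1], vector [0, 0]]"
  have "Y1 \<in> sl2" "Y2 \<in> sl2" by (simp_all add: sl2_iff Y1_def Y2_def)
  then have "((0, 0), Y1) \<in> UNIV \<times> sl2" "((0, 0), Y2) \<in> UNIV \<times> sl2"
    "((1, 0), 0) \<in> UNIV \<times> sl2" "((0, 1), 0) \<in> UNIV \<times> sl2" using 0 by simp_all
  note this[THEN k]
  then show "u = 0" using e X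
    by (simp add: u direct_sum_bracket_def aff_bracket_def commutator_2_nth Y1_def Y2_def zero_prod_def vec_eq_iff forall_2)
qed

text \<open>
  As for \<open>sl(2)\<close>: \<open>b\<^sup>*\<close> on \<open>aff(\<real>)\<close> plus the coordinate of one of the rotations.
\<close>

lemma contact_if_aff_so3:
  assumes "DIM('e) = 5" "lie_isomorphic UNIV br (UNIV \<times> so3) (direct_sum_bracket aff_bracket commutator)"
  shows "contact_lie_algebra UNIV br"
proof (rule contact_of_isomorphic[OF assms, where \<eta>="\<lambda>u. snd (fst u) + snd u $ 1 $ 2"])
  show "linear (\<lambda>u::(real \<times> real) \<times> (real^3^3). snd (fst u) + snd u $ 1 $ 2)"
    by (rule linearI) (auto simp: algebra_simps)
  fix u :: "(real \<times> real) \<times> (real^3^3)"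
  assume uM: "u \<in> UNIV \<times> so3" and e: "(snd (fst u) + snd u $ 1 $ 2) = 0"
    and k: "\<And>y. y \<in> UNIV \<times> so3 \<Longrightarrow> (snd (fst (direct_sum_bracket aff_bracket commutator u y)) + snd (direct_sum_bracket aff_bracket commutator u y) $ 1 $ 2) = 0"
  obtain a b X where u: "u = ((a, b), X)" by (metis prod.exhaust)
  have X: "X \<in> so3" using uM u by simp
  have 0: "(0::real^3^3) \<in> so3" by (simp add: so3_iff)
  define Y1 :: "real^3^3" where "Y1 = vector [vector [0, 0, 1], vector [0, 0, 0], vector [-1, 0, 0]]"
  define Y2 :: "real^3^3" where "Y2 = vector [vector [0, 0, 0], vector [0, 0, 1], vector [0, -1, 0]]"
  have "Y1 \<in> so3" "Y2 \<in> so3" by (simp_all add: so3_iff Y1_def Y2_def vector_3)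
  then have "((0, 0), Y1) \<in> UNIV \<times> so3" "((0, 0), Y2) \<in> UNIV \<times> so3"
    "((1, 0), 0) \<in> UNIV \<times> so3" "((0, 1), 0) \<in> UNIV \<times> so3" using 0 by simp_all
  note this[THEN k]
  then show "u = 0" using e X[unfolded so3_iff]
    by (simp add: u direct_sum_bracket_def aff_bracket_def commutator_3_nth Y1_def Y2_def vector_3 zero_prod_def vec_eq_iff forall_3)
qed

text \<open>
  The functional is a coordinate on \<open>\<real>\<^sup>2\<close> plus a coordinate on \<open>sl(2)\<close> that does not vanish on the
  stabiliser of the former.
\<close>

lemma contact_if_R2_sl2:
  assumes "DIM('e) = 5" "lie_isomorphic UNIV br (UNIV \<times> sl2) R2_sl2_bracket"
  shows "contact_lie_algebra UNIV br"
proof (rule contact_of_isomorphic[OF assms, where \<eta>="\<lambda>(v, X). v $ 1 + X $ 2 $ 1"])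
  show "linear (\<lambda>(v::real^2, X::real^2^2). v $ 1 + X $ 2 $ 1)"
    by (rule linearI) (auto simp: algebra_simps)
  fix u :: "(real^2) \<times> (real^2^2)"
  assume uM: "u \<in> UNIV \<times> sl2" and e: "(case u of (v, X) \<Rightarrow> v $ 1 + X $ 2 $ 1) = 0"
    and k: "\<And>y. y \<in> UNIV \<times> sl2 \<Longrightarrow> (case R2_sl2_bracket u y of (v, X) \<Rightarrow> v $ 1 + X $ 2 $ 1) = 0"
  obtain v X where u: "u = (v, X)" by (metis prod.exhaust)
  have X: "X $ 2 $ 2 = - X $ 1 $ 1" using uM u by (simp add: sl2_iff)
  have 0: "(0::real^2^2) \<in> sl2" by (simp add: sl2_iff)
  define Y1 :: "real^2^2" where "Y1 = vector [vector [1, 0], vector [0, -1]]"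
  define Y2 :: "real^2^2" where "Y2 = vector [vector [0, 1], vector [0, 0]]"
  have "Y1 \<in> sl2" "Y2 \<in> sl2" by (simp_all add: sl2_iff Y1_def Y2_def)
  then have "(0, Y1) \<in> UNIV \<times> sl2" "(0, Y2) \<in> UNIV \<times> sl2"
    "(vector [1, 0], 0) \<in> UNIV \<times> sl2" "(vector [0, 1], 0) \<in> UNIV \<times> sl2" using 0 by simp_all
  note this[THEN k]
  then show "u = 0" using e X
    by (simp add: u R2_sl2_bracket_def commutator_2_nth Y1_def Y2_def zero_prod_def vec_eq_iff forall_2
      matrix_vector_mult_def sum_2)
qed

lemma aff_complement_isomorphic:
  assumes dim: "DIM('e) = 5" and \<nu>: "\<nu> = 1 \<or> \<nu> = -1"
    and ab: "br a b = b" "br a x = 0" "br a y = 0" "br a z = 0" "br b x = 0" "br b y = 0" "br b z = 0"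
    and xyz: "br x y = z" "br z x = y" "br y z = \<nu> *\<^sub>R x"
    and ind: "\<And>c1 c2 c3 c4 c5. c1 *\<^sub>R a + c2 *\<^sub>R b + c3 *\<^sub>R x + c4 *\<^sub>R y + c5 *\<^sub>R z = 0 \<Longrightarrow>
      c1 = 0 \<and> c2 = 0 \<and> c3 = 0 \<and> c4 = 0 \<and> c5 = 0"
  shows "lie_isomorphic UNIV br (UNIV \<times> sl2) (direct_sum_bracket aff_bracket commutator) \<or>
    lie_isomorphic UNIV br (UNIV \<times> so3) (direct_sum_bracket aff_bracket commutator)"
proof -
  have sk: "br b a = - b" "br x a = 0" "br y a = 0" "br z a = 0" "br x b = 0" "br y b = 0" "br z b = 0"
    "br y x = - z" "br x z = - y" "br z y = - (\<nu> *\<^sub>R x)"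
    using br_skew[of b a] br_skew[of x a] br_skew[of y a] br_skew[of z a] br_skew[of x b] br_skew[of y b]
      br_skew[of z b] br_skew[of y x] br_skew[of x z] br_skew[of z y] ab xyz by simp_all
  from \<nu> show ?thesis
  proof
    assume \<nu>: "\<nu> = 1"
    \<comment> \<open>\<open>x, y, z\<close> correspond to the infinitesimal rotations about the three axes\<close>
    let ?g = "\<lambda>((r, s), X::real^3^3). r *\<^sub>R a + s *\<^sub>R b + X$3$2 *\<^sub>R x + X$1$3 *\<^sub>R y + X$2$1 *\<^sub>R z"
    have "lie_isomorphic UNIV br (UNIV \<times> so3) (direct_sum_bracket aff_bracket commutator)"
    proof (rule lie_isomorphic_from_model[where g="?g"])
      show "subspace (UNIV \<times> so3)" by (rule subspace_Times[OF subspace_UNIV subspace_so3])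
      show "direct_sum_bracket aff_bracket commutator p q \<in> UNIV \<times> so3" if "p \<in> UNIV \<times> so3" "q \<in> UNIV \<times> so3"
        for p q :: "(real \<times> real) \<times> (real^3^3)" using that by (auto simp: direct_sum_bracket_def so3_commutator)
      show "linear ?g" by (rule linearI) (auto simp: algebra_simps)
      show "p = 0" if "p \<in> UNIV \<times> so3" "?g p = 0" for p
      proof -
        obtain r s X where p: "p = ((r, s), X)" by (metis prod.exhaust)
        show ?thesis using that ind[of r s "X$3$2" "X$1$3" "X$2$1"]
          by (simp add: p so3_iff zero_prod_def vec_eq_iff forall_3)
      qed
      show "\<exists>p\<in>UNIV \<times> so3. u = ?g p" for u
      proof -
        obtain c1 c2 c3 c4 c5 where u: "u = c1 *\<^sub>R a + c2 *\<^sub>R b + c3 *\<^sub>R x + c4 *\<^sub>R y + c5 *\<^sub>R z"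
          by (rule basis_5[OF dim ind])
        show ?thesis
          by (rule bexI[of _ "((c1, c2), vector [vector [0, -c5, c4], vector [c5, 0, -c3], vector [-c4, c3, 0]])"])
            (simp_all add: u so3_iff vector_3)
      qed
      show "?g (direct_sum_bracket aff_bracket commutator p q) = br (?g p) (?g q)"
        if "p \<in> UNIV \<times> so3" "q \<in> UNIV \<times> so3" for p q
      proof -
        obtain r s X where p: "p = ((r, s), X)" by (metis prod.exhaust)
        obtain r' s' Y where q: "q = ((r', s'), Y)" by (metis prod.exhaust)
        have X: "X$1$1 = 0" "X$2$2 = 0" "X$3$3 = 0" "X$1$2 = - X$2$1" "X$2$3 = - X$3$2" "X$3$1 = - X$1$3"
          and Y: "Y$1$1 = 0" "Y$2$2 = 0" "Y$3$3 = 0" "Y$1$2 = - Y$2$1" "Y$2$3 = - Y$3$2" "Y$3$1 = - Y$1$3"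
          using that p q by (simp_all add: so3_iff)
        show ?thesis unfolding p q
          by (simp add: direct_sum_bracket_def aff_bracket_def commutator_3_nth X Y br_simps ab sk xyz \<nu> algebra_simps)
      qed
    qed
    then show ?thesis ..
  next
    assume \<nu>: "\<nu> = -1"
    \<comment> \<open>with \<open>E, F, H\<close> the standard basis of \<open>sl(2)\<close>: \<open>x = (E - F) / 2\<close>, \<open>y = H / 2\<close>, \<open>z = - (E + F) / 2\<close>\<close>
    let ?g = "\<lambda>((r, s), X::real^2^2). r *\<^sub>R a + s *\<^sub>R b + (X$1$2 - X$2$1) *\<^sub>R x + (2 * X$1$1) *\<^sub>R y + (- X$1$2 - X$2$1) *\<^sub>R z"
    have "lie_isomorphic UNIV br (UNIV \<times> sl2) (direct_sum_bracket aff_bracket commutator)"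
    proof (rule lie_isomorphic_from_model[where g="?g"])
      show "subspace (UNIV \<times> sl2)" by (rule subspace_Times[OF subspace_UNIV subspace_sl2])
      show "direct_sum_bracket aff_bracket commutator p q \<in> UNIV \<times> sl2" if "p \<in> UNIV \<times> sl2" "q \<in> UNIV \<times> sl2"
        for p q :: "(real \<times> real) \<times> (real^2^2)" using that by (auto simp: direct_sum_bracket_def sl2_commutator)
      show "linear ?g" by (rule linearI) (auto simp: algebra_simps)
      show "p = 0" if "p \<in> UNIV \<times> sl2" "?g p = 0" for p
      proof -
        obtain r s X where p: "p = ((r, s), X)" by (metis prod.exhaust)
        have "r = 0 \<and> s = 0 \<and> X$1$2 - X$2$1 = 0 \<and> 2 * X$1$1 = 0 \<and> - X$1$2 - X$2$1 = 0"
          by (rule ind) (use that in \<open>simp add: p\<close>)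
        then show ?thesis using that(1)
          by (simp add: p sl2_iff zero_prod_def vec_eq_iff forall_2)
      qed
      show "\<exists>p\<in>UNIV \<times> sl2. u = ?g p" for u
      proof -
        obtain c1 c2 c3 c4 c5 where u: "u = c1 *\<^sub>R a + c2 *\<^sub>R b + c3 *\<^sub>R x + c4 *\<^sub>R y + c5 *\<^sub>R z"
          by (rule basis_5[OF dim ind])
        show ?thesis
          by (rule bexI[of _ "((c1, c2), vector [vector [c4 / 2, (c3 - c5) / 2], vector [- (c3 + c5) / 2, - c4 / 2]])"])
            (simp_all add: u sl2_iff diff_divide_distrib add_divide_distrib algebra_simps flip: scaleR_left_distrib)
      qed
      show "?g (direct_sum_bracket aff_bracket commutator p q) = br (?g p) (?g q)"
        if "p \<in> UNIV \<times> sl2" "q \<in> UNIV \<times> sl2" for p q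
      proof -
        obtain r s X where p: "p = ((r, s), X)" by (metis prod.exhaust)
        obtain r' s' Y where q: "q = ((r', s'), Y)" by (metis prod.exhaust)
        have X: "X$2$2 = - X$1$1" and Y: "Y$2$2 = - Y$1$1" using that p q by (simp_all add: sl2_iff)
        have two: "(2 * t) *\<^sub>R w = t *\<^sub>R w + t *\<^sub>R w" for t and w :: 'e
          by (simp add: scaleR_left_distrib[symmetric])
        show ?thesis unfolding p q
          by (simp add: direct_sum_bracket_def aff_bracket_def commutator_2_nth X Y br_simps ab sk xyz \<nu> algebra_simps two)
      qed
    qed
    then show ?thesis ..
  qed
qed

lemma R2_sl2_table_isomorphic:
  assumes dim: "DIM('e) = 5"
    and tab: "br p q = 0" "br h p = p" "br h q = - q" "br e p = 0" "br e q = p" "br f p = q" "br f q = 0"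
      "br h e = 2 *\<^sub>R e" "br h f = -2 *\<^sub>R f" "br e f = h"
    and ind: "\<And>c1 c2 c3 c4 c5. c1 *\<^sub>R p + c2 *\<^sub>R q + c3 *\<^sub>R h + c4 *\<^sub>R e + c5 *\<^sub>R f = 0 \<Longrightarrow>
      c1 = 0 \<and> c2 = 0 \<and> c3 = 0 \<and> c4 = 0 \<and> c5 = 0"
  shows "lie_isomorphic UNIV br (UNIV \<times> sl2) R2_sl2_bracket"
proof -
  have sk: "br q p = 0" "br p h = - p" "br q h = q" "br p e = 0" "br q e = - p" "br p f = - q" "br q f = 0"
      "br e h = -2 *\<^sub>R e" "br f h = 2 *\<^sub>R f" "br f e = - h"
    using br_skew[of q p] br_skew[of p h] br_skew[of q h] br_skew[of p e] br_skew[of q e] br_skew[of p f] br_skew[of q f]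
      br_skew[of e h] br_skew[of f h] br_skew[of f e] tab by simp_all
  let ?g = "\<lambda>(v::real^2, X::real^2^2). v$1 *\<^sub>R p + v$2 *\<^sub>R q + X$1$1 *\<^sub>R h + X$1$2 *\<^sub>R e + X$2$1 *\<^sub>R f"
  show ?thesis
  proof (rule lie_isomorphic_from_model[where g="?g"])
    show "subspace ((UNIV :: (real^2) set) \<times> sl2)" by (rule subspace_Times[OF subspace_UNIV subspace_sl2])
    show "R2_sl2_bracket x y \<in> UNIV \<times> sl2" if "x \<in> UNIV \<times> sl2" "y \<in> UNIV \<times> sl2"
      for x y using that by (auto simp: R2_sl2_bracket_def sl2_commutator)
    show "linear ?g" by (rule linearI) (auto simp: algebra_simps)
    show "x = 0" if "x \<in> UNIV \<times> sl2" "?g x = 0" for x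
    proof -
      obtain v X where x: "x = (v, X)" by (metis prod.exhaust)
      show ?thesis using that ind[of "v$1" "v$2" "X$1$1" "X$1$2" "X$2$1"]
        by (simp add: x sl2_iff zero_prod_def vec_eq_iff forall_2)
    qed
    show "\<exists>x\<in>UNIV \<times> sl2. u = ?g x" for u
    proof -
      obtain c1 c2 c3 c4 c5 where u: "u = c1 *\<^sub>R p + c2 *\<^sub>R q + c3 *\<^sub>R h + c4 *\<^sub>R e + c5 *\<^sub>R f"
        by (rule basis_5[OF dim ind])
      show ?thesis
        by (rule bexI[of _ "(vector [c1, c2], vector [vector [c3, c4], vector [c5, - c3]])"])
          (simp_all add: u sl2_iff)
    qed
    show "?g (R2_sl2_bracket x y) = br (?g x) (?g y)" if "x \<in> UNIV \<times> sl2" "y \<in> UNIV \<times> sl2" for x y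
    proof -
      obtain v X where x: "x = (v, X)" by (metis prod.exhaust)
      obtain w Y where y: "y = (w, Y)" by (metis prod.exhaust)
      have X: "X$2$2 = - X$1$1" and Y: "Y$2$2 = - Y$1$1" using that x y by (simp_all add: sl2_iff)
      show ?thesis unfolding x y
        by (simp add: R2_sl2_bracket_def matrix_vector_mult_def sum_2 commutator_2_nth X Y br_simps tab sk algebra_simps)
    qed
  qed
qed

text \<open>
  A plane meets \<open>ker \<eta>\<close>, and a central vector is in the radical of \<open>\<eta> \<circ> [\<cdot>, \<cdot>]\<close>.
\<close>

lemma contact_no_central_plane:
  assumes dim: "DIM('e) = 5" and c: "contact_lie_algebra UNIV br"
    and S: "subspace S" "dim S = 2" "\<And>u y. u \<in> S \<Longrightarrow> br u y = 0"
  shows False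
proof -
  obtain \<eta> :: "'e \<Rightarrow> real" where \<eta>: "linear \<eta>" "\<And>u. \<eta> u = 0 \<Longrightarrow> (\<And>y. \<eta> (br u y) = 0) \<Longrightarrow> u = 0"
    using c unfolding contact_iff_5[OF dim] by blast
  obtain u where "u \<in> S" "u \<noteq> 0" "\<eta> u = 0"
    by (rule exists_common_kernel[OF \<eta>(1) S(1)]) (simp add: S(2), rule that)
  then show False using \<eta>(2)[of u] S(3) linear_0[OF \<eta>(1)] by simp
qed

text \<open>
  In the basis of \<open>P\<close> provided by \<open>perfect_3_basis\<close> one computes that every derivation of \<open>P\<close> is
  inner. So the centraliser \<open>C\<close> of \<open>P\<close> is a complementary ideal, of dimension two. It is not abelian,
  for it would be a central plane; hence it is \<open>aff(\<real>)\<close>.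
\<close>

lemma simple_ideal_3_isomorphic:
  assumes dim: "DIM('e) = 5" and contact: "contact_lie_algebra UNIV br"
    and P: "subspace P" "dim P = 3" "\<And>u p. p \<in> P \<Longrightarrow> br u p \<in> P" "lie_algebra P br" "lie_derived P br = P"
  shows "lie_isomorphic UNIV br (UNIV \<times> sl2) (direct_sum_bracket aff_bracket commutator) \<or>
    lie_isomorphic UNIV br (UNIV \<times> so3) (direct_sum_bracket aff_bracket commutator)"
proof -
  have "dim P = DIM(real^3)" using P(2) by simp
  then obtain g :: "real^3 \<Rightarrow> 'e" and br' where g: "lie_embedding g br' br" "lie_algebra UNIV br'" "range g = P"
    by (rule lie_algebra_coordinates[OF P(4)])
  have lin: "linear g" and inj: "inj g" and gbr: "\<And>x y. g (br' x y) = br (g x) (g y)"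
    using g(1) by (auto simp: lie_embedding_def)
  have "g ` lie_derived UNIV br' = range g"
    using lie_derived_image[OF g(1), of UNIV] P(5) g(3) by simp
  then have perf: "lie_derived UNIV br' = UNIV" using inj inj_image_eq_iff by blast
  interpret P: lie_space br' using g(2) by (rule lie_space.intro)
  obtain x0 y0 z0 \<nu> where \<nu>: "\<nu> = 1 \<or> \<nu> = -1" and t0: "br' x0 y0 = z0" "br' z0 x0 = y0" "br' y0 z0 = \<nu> *\<^sub>R x0"
    and ind0: "\<And>a b c. a *\<^sub>R x0 + b *\<^sub>R y0 + c *\<^sub>R z0 = 0 \<Longrightarrow> a = 0 \<and> b = 0 \<and> c = 0"
    using P.perfect_3_basis[OF _ perf] by auto
  define x where "x = g x0"
  define y where "y = g y0"
  define z where "z = g z0"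
  have t: "br x y = z" "br z x = y" "br y z = \<nu> *\<^sub>R x"
    unfolding x_def y_def z_def gbr[symmetric] t0 linear_scale[OF lin] by simp_all
  have sk: "br y x = - z" "br x z = - y" "br z y = - (\<nu> *\<^sub>R x)"
    using br_skew[of y x] br_skew[of x z] br_skew[of z y] t by simp_all
  have comb: "a *\<^sub>R x + b *\<^sub>R y + c *\<^sub>R z = g (a *\<^sub>R x0 + b *\<^sub>R y0 + c *\<^sub>R z0)" for a b c
    by (simp add: x_def y_def z_def linear_add[OF lin] linear_scale[OF lin])
  have ind: "a = 0 \<and> b = 0 \<and> c = 0" if "a *\<^sub>R x + b *\<^sub>R y + c *\<^sub>R z = 0" for a b c
  proof (rule ind0)
    have "g (a *\<^sub>R x0 + b *\<^sub>R y0 + c *\<^sub>R z0) = g 0" using that comb linear_0[OF lin] by simp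
    then show "a *\<^sub>R x0 + b *\<^sub>R y0 + c *\<^sub>R z0 = 0" using inj by (simp add: inj_def)
  qed
  have xyzP: "x \<in> P" "y \<in> P" "z \<in> P" using g(3) by (auto simp: x_def y_def z_def)
  have Pcomb: "\<exists>a b c. p = a *\<^sub>R x + b *\<^sub>R y + c *\<^sub>R z" if "p \<in> P" for p
  proof -
    obtain v where v: "p = g v" using \<open>p \<in> P\<close> g(3) by auto
    obtain a b c where "v = a *\<^sub>R x0 + b *\<^sub>R y0 + c *\<^sub>R z0" by (rule basis_3[OF _ ind0]) simp_all
    then show ?thesis using comb v by metis
  qed
  define C where "C = {u. br u x = 0 \<and> br u y = 0 \<and> br u z = 0}"
  have C: "subspace C" by (auto simp: C_def subspace_def br_simps)
  \<comment> \<open>\<open>ad u\<close> acts on \<open>P\<close> as \<open>ad p\<close> for some \<open>p \<in> P\<close>\<close>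
  have dec: "\<exists>p\<in>P. u - p \<in> C" for u
  proof -
    obtain a1 a2 a3 where a: "br u x = a1 *\<^sub>R x + a2 *\<^sub>R y + a3 *\<^sub>R z" using Pcomb P(3) xyzP by metis
    obtain b1 b2 b3 where b: "br u y = b1 *\<^sub>R x + b2 *\<^sub>R y + b3 *\<^sub>R z" using Pcomb P(3) xyzP by metis
    obtain c1 c2 c3 where c: "br u z = c1 *\<^sub>R x + c2 *\<^sub>R y + c3 *\<^sub>R z" using Pcomb P(3) xyzP by metis
    have "br u z = br (br u x) y + br x (br u y)" unfolding t(1)[symmetric] by (rule br_jacobi)
    then have "(c1 + \<nu> * a3) *\<^sub>R x + (c2 + b3) *\<^sub>R y + (c3 - a1 - b2) *\<^sub>R z = 0"
      unfolding a b c by (simp add: br_simps t sk algebra_simps)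
    then have e1: "c1 + \<nu> * a3 = 0" "c2 + b3 = 0" "c3 - a1 - b2 = 0" using ind by blast+
    have "br u y = br (br u z) x + br z (br u x)" using br_jacobi[of u z x] unfolding t .
    then have "(b1 + \<nu> * a2) *\<^sub>R x + (b2 - c3 - a1) *\<^sub>R y + (b3 + c2) *\<^sub>R z = 0"
      unfolding a b c by (simp add: br_simps t sk algebra_simps)
    then have e2: "b1 + \<nu> * a2 = 0" "b2 - c3 - a1 = 0" using ind by blast+
    have "\<nu> *\<^sub>R br u x = br (br u y) z + br y (br u z)" using br_jacobi[of u y z] unfolding t br_simps .
    then have "(\<nu> * (a1 - b2 - c3)) *\<^sub>R x + (\<nu> * a2 + b1) *\<^sub>R y + (\<nu> * a3 + c1) *\<^sub>R z = 0"
      unfolding a b c by (simp add: br_simps t sk algebra_simps)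
    then have "\<nu> * (a1 - b2 - c3) = 0" using ind by blast
    then have e3: "a1 - b2 - c3 = 0" using \<nu> by auto
    have z: "a1 = 0" "b2 = 0" "c3 = 0" "c1 = - \<nu> * a3" "c2 = - b3" "b1 = - \<nu> * a2" using e1 e2 e3 by linarith+
    show ?thesis
    proof (rule bexI[of _ "b3 *\<^sub>R x - a3 *\<^sub>R y + a2 *\<^sub>R z"])
      show "u - (b3 *\<^sub>R x - a3 *\<^sub>R y + a2 *\<^sub>R z) \<in> C"
        unfolding C_def by (simp add: br_simps a b c t sk z algebra_simps)
      show "b3 *\<^sub>R x - a3 *\<^sub>R y + a2 *\<^sub>R z \<in> P"
        using xyzP P(1) by (simp add: subspace_add subspace_diff subspace_scale)
    qed
  qed
  have CP: "p = 0" if pC: "p \<in> C" and pP: "p \<in> P" for p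
  proof -
    obtain a b c where p: "p = a *\<^sub>R x + b *\<^sub>R y + c *\<^sub>R z" using Pcomb[OF pP] by blast
    have "0 *\<^sub>R x + c *\<^sub>R y + (- b) *\<^sub>R z = 0" "(- (\<nu> * c)) *\<^sub>R x + 0 *\<^sub>R y + a *\<^sub>R z = 0"
      using pC unfolding C_def p by (simp_all add: br_simps t sk algebra_simps)
    then have "c = 0" "b = 0" "a = 0" using ind by (metis neg_equal_0_iff_equal)+
    then show ?thesis using p by simp
  qed
  have CPbr: "br u p = 0" if "u \<in> C" "p \<in> P" for u p
    using Pcomb[OF that(2)] that(1) by (auto simp: C_def br_simps)
  have "{c + p |c p. c \<in> C \<and> p \<in> P} = UNIV"
  proof -
    have "\<exists>c p. u = c + p \<and> c \<in> C \<and> p \<in> P" for u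
    proof -
      obtain p where "p \<in> P" "u - p \<in> C" using dec by blast
      then show ?thesis by (intro exI[of _ "u - p"] exI[of _ p]) simp
    qed
    then show ?thesis by blast
  qed
  moreover have "C \<inter> P = {0}" using CP subspace_0[OF C] subspace_0[OF P(1)] by blast
  ultimately have "dim C = 2" using dim_sums_Int[OF C P(1)] P(2) dim by (simp add: dim_UNIV)
  obtain u v where uv: "u \<in> C" "v \<in> C" and Cuv': "\<forall>w\<in>C. \<exists>a b. w = a *\<^sub>R u + b *\<^sub>R v"
    and induv': "\<forall>a b. a *\<^sub>R u + b *\<^sub>R v = 0 \<longrightarrow> a = 0 \<and> b = 0"
    by (rule subspace_dim_2_basis[OF C \<open>dim C = 2\<close>]) (rule that)
  note Cuv = Cuv'[rule_format] and induv = induv'[rule_format]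
  have Cbr: "br c c' \<in> C" if "c \<in> C" "c' \<in> C" for c c'
  proof -
    have "br (br c c') p = 0" if "p \<in> P" for p
      using br_jacobi[of c c' p] CPbr[OF \<open>c \<in> C\<close>] CPbr[OF \<open>c' \<in> C\<close>] that by (simp add: br_simps)
    then show ?thesis using xyzP by (simp add: C_def)
  qed
  obtain s t' where st: "br u v = s *\<^sub>R u + t' *\<^sub>R v" using Cuv[OF Cbr[OF uv]] by blast
  have "\<not> (s = 0 \<and> t' = 0)"
  proof
    assume "s = 0 \<and> t' = 0"
    then have uv0: "br u v = 0" "br v u = 0" using st br_skew[of v u] by simp_all
    have "br c w = 0" if c: "c \<in> C" for c w
    proof -
      obtain p where p: "p \<in> P" "w - p \<in> C" using dec by blast
      obtain a b where c': "c = a *\<^sub>R u + b *\<^sub>R v" using Cuv[OF c] by blast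
      obtain a' b' where w': "w - p = a' *\<^sub>R u + b' *\<^sub>R v" using Cuv[OF p(2)] by blast
      have "br c (w - p) = 0" unfolding c' w' by (simp add: br_simps uv0)
      then show ?thesis using CPbr[OF c p(1)] by (simp add: br_simps)
    qed
    then show False using contact_no_central_plane[OF dim contact C \<open>dim C = 2\<close>] by blast
  qed
  have "\<exists>a\<in>C. \<exists>b\<in>C. br a b = b \<and> b \<noteq> 0"
  proof (cases "t' = 0")
    case False
    have "br u (br u v) = t' *\<^sub>R br u v" by (simp add: st br_simps algebra_simps)
    then have "br ((1 / t') *\<^sub>R u) (br u v) = br u v" using False by (simp add: br_simps)
    moreover have "br u v \<noteq> 0" using st induv[of s t'] False by metis
    ultimately show ?thesis using uv Cbr subspace_scale[OF C] by blast
  next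
    case True
    then have s: "s \<noteq> 0" using \<open>\<not> (s = 0 \<and> t' = 0)\<close> by simp
    have "br v (br u v) = (- s) *\<^sub>R br u v" using br_skew[of v u] st True by (simp add: br_simps)
    then have "br ((- 1 / s) *\<^sub>R v) (br u v) = br u v" using s by (simp add: br_simps)
    moreover have "br u v \<noteq> 0" using st induv[of s t'] s by metis
    ultimately show ?thesis using uv Cbr subspace_scale[OF C] by blast
  qed
  then obtain a b where ab: "a \<in> C" "b \<in> C" "br a b = b" "b \<noteq> 0" by blast
  show ?thesis
  proof (rule aff_complement_isomorphic[OF dim \<nu> ab(3) _ _ _ _ _ _ t])
    show "br a x = 0" "br a y = 0" "br a z = 0" "br b x = 0" "br b y = 0" "br b z = 0"
      using ab by (simp_all add: C_def)
    fix c1 c2 c3 c4 c5 assume rel: "c1 *\<^sub>R a + c2 *\<^sub>R b + c3 *\<^sub>R x + c4 *\<^sub>R y + c5 *\<^sub>R z = 0"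
    have inC: "c1 *\<^sub>R a + c2 *\<^sub>R b \<in> C" using ab C by (simp add: subspace_add subspace_scale)
    have eq: "c1 *\<^sub>R a + c2 *\<^sub>R b = - (c3 *\<^sub>R x + c4 *\<^sub>R y + c5 *\<^sub>R z)"
      using rel by (metis add.assoc eq_neg_iff_add_eq_0)
    have inP: "c1 *\<^sub>R a + c2 *\<^sub>R b \<in> P"
      unfolding eq using xyzP P(1) by (intro subspace_neg subspace_add subspace_scale)
    have 1: "c1 *\<^sub>R a + c2 *\<^sub>R b = 0" by (rule CP[OF inC inP])
    have 0: "c1 *\<^sub>R a + c2 *\<^sub>R b = 0" "c3 *\<^sub>R x + c4 *\<^sub>R y + c5 *\<^sub>R z = 0"
      using 1 eq neg_equal_0_iff_equal by metis+
    have "br a (c1 *\<^sub>R a + c2 *\<^sub>R b) = 0" using 0 by (simp add: br_simps)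
    then have "c2 = 0" using ab by (simp add: br_simps)
    moreover have "a \<noteq> 0" using ab by (auto simp: br_simps)
    ultimately show "c1 = 0 \<and> c2 = 0 \<and> c3 = 0 \<and> c4 = 0 \<and> c5 = 0"
      using 0 ind by auto
  qed
qed

end

section \<open>Perfect contact Lie algebras of dimension five\<close>

context lie_space begin

definition killing :: "'e \<Rightarrow> 'e \<Rightarrow> real" where
  "killing x y = op_trace (\<lambda>z. br x (br y z))"

lemma linear_br_comp: "linear (\<lambda>z. br x (br y z))"
  using linear_compose[OF linear_br linear_br] by (simp add: o_def)

lemma killing_sym: "killing x y = killing y x"
  unfolding killing_def by (rule op_trace_comp_commute) simp_all

lemma killing_linear:
  "killing (x + y) z = killing x z + killing y z" "killing (c *\<^sub>R x) z = c * killing x z"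
  "killing (x - y) z = killing x z - killing y z" "killing 0 z = 0" "killing (- x) z = - killing x z"
  by (simp_all add: killing_def br_simps op_trace_add op_trace_scale op_trace_diff op_trace_zero op_trace_minus)

lemma killing_linear_right:
  "killing z (x + y) = killing z x + killing z y" "killing z (c *\<^sub>R x) = c * killing z x"
  "killing z (x - y) = killing z x - killing z y" "killing z 0 = 0" "killing z (- x) = - killing z x"
  by (simp_all add: killing_sym[of z] killing_linear)

lemma killing_invariant: "killing (br x y) z = killing x (br y z)"
proof -
  have 1: "killing (br x y) z = op_trace (\<lambda>w. br x (br y (br z w))) - op_trace (\<lambda>w. br y (br x (br z w)))"
  proof -
    have "br (br x y) w = br x (br y w) - br y (br x w)" for w by (simp add: br_jacobi[of x y w])
    then show ?thesis by (simp add: killing_def op_trace_diff)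
  qed
  have 2: "killing x (br y z) = op_trace (\<lambda>w. br x (br y (br z w))) - op_trace (\<lambda>w. br x (br z (br y w)))"
  proof -
    have "br (br y z) w = br y (br z w) - br z (br y w)" for w by (simp add: br_jacobi[of y z w])
    then show ?thesis by (simp add: killing_def op_trace_diff br_simps)
  qed
  have "op_trace (\<lambda>w. br y (br x (br z w))) = op_trace (\<lambda>w. br x (br z (br y w)))"
    by (rule op_trace_comp_commute) (simp_all add: linear_br_comp)
  then show ?thesis using 1 2 by simp
qed

text \<open>
  Some \<open>u, v\<close> in \<open>ker \<pi>\<close> have \<open>[u, v] = t x\<close> with \<open>t \<noteq> 0\<close>, since otherwise \<open>\<pi>\<close> would vanish on all
  brackets. In dimension five there is \<open>w \<noteq> 0\<close> in \<open>ker \<pi>\<close> that commutes with \<open>u\<close> and \<open>v\<close>. By the Jacobi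
  identity \<open>t [x, w] = 0\<close>, contrary to the injectivity of \<open>ad x\<close> on \<open>ker \<pi>\<close>.
\<close>

lemma no_perfect_line_bracket:
  assumes dim: "DIM('e) = 5" and perf: "derived = UNIV" and \<pi>: "linear \<pi>" "\<pi> x = (1::real)"
    and inv: "\<And>v. \<pi> (br x v) = 0" and inj: "\<And>v. \<pi> v = 0 \<Longrightarrow> br x v = 0 \<Longrightarrow> v = 0"
    and line: "\<And>u v. \<pi> u = 0 \<Longrightarrow> \<pi> v = 0 \<Longrightarrow> br u v = \<pi> (br u v) *\<^sub>R x"
  shows False
proof -
  note l\<pi> = linear_add[OF \<pi>(1)] linear_diff[OF \<pi>(1)] linear_scale[OF \<pi>(1)] linear_0[OF \<pi>(1)] linear_neg[OF \<pi>(1)]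
  have "\<exists>u v. \<pi> u = 0 \<and> \<pi> v = 0 \<and> \<pi> (br u v) \<noteq> 0"
  proof (rule ccontr)
    assume no: "\<not> ?thesis"
    have inv': "\<pi> (br v x) = 0" for v using inv[of v] br_skew[of v x] by (simp add: l\<pi>)
    have all: "\<pi> (br u v) = 0" for u v
    proof -
      have "\<pi> (br (u - \<pi> u *\<^sub>R x) (v - \<pi> v *\<^sub>R x)) = 0" using no by (simp add: l\<pi> \<pi>(2))
      then show ?thesis by (simp add: br_simps l\<pi> inv inv')
    qed
    have "\<pi> z = 0" if "z \<in> derived" for z
      using that by (rule derived_induct) (auto simp: subspace_def l\<pi> all)
    then show False using perf \<pi>(2) by auto
  qed
  then obtain u v where uv: "\<pi> u = 0" "\<pi> v = 0" "\<pi> (br u v) \<noteq> 0" by blast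
  have lin: "linear (\<lambda>w. (\<pi> w, \<pi> (br w u), \<pi> (br w v)))"
    by (rule linearI) (simp_all add: l\<pi> br_simps)
  obtain w where "w \<noteq> 0" "(\<pi> w, \<pi> (br w u), \<pi> (br w v)) = 0"
    by (rule exists_common_kernel[OF lin subspace_UNIV]) (simp add: dim dim_UNIV, rule that)
  then have w: "w \<noteq> 0" "\<pi> w = 0" "br w u = 0" "br w v = 0"
    using line[of w u] line[of w v] uv by (simp_all add: zero_prod_def)
  have "br (br u v) w = 0"
    using br_jacobi[of u v w] br_skew[of u w] br_skew[of v w] w by (simp add: br_simps)
  then have "\<pi> (br u v) *\<^sub>R br x w = 0" using line[OF uv(1,2)] by (metis br_simps(6))
  then show False using uv(3) inj[OF w(2)] w(1) by simp
qed

text \<open>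
  In dimension four a 3-form is \<open>\<iota>\<^sub>t vol\<close> for a vector \<open>t\<close>, and a traceless \<open>M\<close> preserves \<open>vol\<close>. So invariance
  of the form means \<open>M t = 0\<close>.
\<close>

lemma invariant_3_form_zero:
  fixes M :: "real^4 \<Rightarrow> real^4" and \<Phi> :: "real^4 \<Rightarrow> real^4 \<Rightarrow> real^4 \<Rightarrow> real"
  assumes M: "linear M" "op_trace M = 0" "\<And>v. M v = 0 \<Longrightarrow> v = 0"
    and lin: "\<And>v w. linear (\<lambda>u. \<Phi> u v w)" and alt: "\<And>u v w. \<Phi> v u w = - \<Phi> u v w" "\<And>u v w. \<Phi> v w u = \<Phi> u v w"
    and inv: "\<And>u v w. \<Phi> (M u) v w + \<Phi> u (M v) w + \<Phi> u v (M w) = 0"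
  shows "\<Phi> u v w = 0"
proof -
  define e where "e i = (axis i 1 :: real^4)" for i
  define m where "m i j = M (e j) $ i" for i j
  define F where "F i j k = \<Phi> (e i) (e j) (e k)" for i j k
  have Me: "M (e j) = m 1 j *\<^sub>R e 1 + m 2 j *\<^sub>R e 2 + m 3 j *\<^sub>R e 3 + m 4 j *\<^sub>R e 4" for j
    by (simp add: vec_eq_iff forall_4 m_def e_def axis_def)
  have tr: "m 1 1 + m 2 2 + m 3 3 + m 4 4 = 0"
    using M(2) by (simp add: op_trace_vec sum_4 m_def e_def)
  have a1: "F j i k = - F i j k" and a2: "F j k i = F i j k" for i j k
    unfolding F_def by (rule alt)+
  have a3: "F i k j = - F i j k" for i j k using a1[of k i j] a2[of k i j] a2[of j k i] a1 by metis
  have z1: "F i i k = 0" for i k using a1[of i i k] by simp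
  have z2: "F i k i = 0" and z3: "F k i i = 0" for i k using z1[of i k] a2[of i i k] a2[of k i i] by simp_all
  have lin1: "\<Phi> (M (e i)) v w = m 1 i * \<Phi> (e 1) v w + m 2 i * \<Phi> (e 2) v w + m 3 i * \<Phi> (e 3) v w + m 4 i * \<Phi> (e 4) v w" for i v w
    unfolding Me by (simp add: linear_add[OF lin] linear_scale[OF lin])
  have inv': "(m 1 i * F 1 j k + m 2 i * F 2 j k + m 3 i * F 3 j k + m 4 i * F 4 j k)
    + (m 1 j * F 1 k i + m 2 j * F 2 k i + m 3 j * F 3 k i + m 4 j * F 4 k i)
    + (m 1 k * F 1 i j + m 2 k * F 2 i j + m 3 k * F 3 i j + m 4 k * F 4 i j) = 0" for i j k
    using inv[of "e i" "e j" "e k"] alt(2)[where u="e i" and v="M (e j)" and w="e k"]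
      alt(2)[where u="M (e k)" and v="e i" and w="e j"]
    unfolding lin1[of i] F_def using lin1[of j "e k" "e i"] lin1[of k "e i" "e j"] by linarith
  define t :: "real^4" where "t = F 2 3 4 *\<^sub>R e 1 - F 1 3 4 *\<^sub>R e 2 + F 1 2 4 *\<^sub>R e 3 - F 1 2 3 *\<^sub>R e 4"
  have p: "F j k i = F i j k" "F k i j = F i j k" "F j i k = - F i j k" "F i k j = - F i j k" "F k j i = - F i j k" for i j k
    using a2[of j k i] a2[of k i j] a1[of j i k] a3[of i k j] a1[of k j i] by simp_all
  note o = p[where i=1 and j=2 and k=3] p[where i=1 and j=2 and k=4] p[where i=1 and j=3 and k=4] p[where i=2 and j=3 and k=4]
  have "M t = 0"
  proof -
    have Mt: "M t $ i = F 2 3 4 * m i 1 - F 1 3 4 * m i 2 + F 1 2 4 * m i 3 - F 1 2 3 * m i 4" for i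
      by (simp add: t_def linear_add[OF M(1)] linear_diff[OF M(1)] linear_scale[OF M(1)] m_def)
    have "M t $ 4 = 0" using Mt[of 4] inv'[of 1 2 3] tr unfolding o z1 z2 z3 by algebra
    moreover have "M t $ 3 = 0" using Mt[of 3] inv'[of 1 2 4] tr unfolding o z1 z2 z3 by algebra
    moreover have "M t $ 2 = 0" using Mt[of 2] inv'[of 1 3 4] tr unfolding o z1 z2 z3 by algebra
    moreover have "M t $ 1 = 0" using Mt[of 1] inv'[of 2 3 4] tr unfolding o z1 z2 z3 by algebra
    ultimately show ?thesis by (simp add: vec_eq_iff forall_4)
  qed
  then have "t = 0" by (rule M(3))
  then have "F 2 3 4 = 0" "F 1 3 4 = 0" "F 1 2 4 = 0" "F 1 2 3 = 0"
    by (simp_all add: t_def vec_eq_iff forall_4 e_def axis_def)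
  then have "\<forall>i j k. F i j k = 0" unfolding forall_4 by (simp add: o z1 z2 z3)
  then have 0: "\<Phi> (axis i 1) (axis j 1) (axis k 1) = 0" for i j k by (simp add: F_def e_def)
  have 1: "\<Phi> u (axis j 1) (axis k 1) = 0" for u j k
    by (rule linear_eq_on_vec_Basis[where f="\<lambda>u. \<Phi> u (axis j 1) (axis k 1)"]) (rule lin, rule 0)
  have 2: "\<Phi> u v (axis k 1) = 0" for u v k
  proof -
    have "\<Phi> v (axis k 1) u = 0"
      by (rule linear_eq_on_vec_Basis[where f="\<lambda>v. \<Phi> v (axis k 1) u"]) (rule lin, metis 1 alt(2))
    then show ?thesis by (metis alt(2))
  qed
  have "\<Phi> w u v = 0"
    by (rule linear_eq_on_vec_Basis[where f="\<lambda>w. \<Phi> w u v"]) (rule lin, metis 2 alt(2))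
  then show ?thesis by (metis alt(2))
qed

text \<open>
  If the Killing form \<open>\<kappa>\<close> were nondegenerate, then \<open>\<eta> = \<kappa>(x, \<cdot>)\<close> for some \<open>x\<close>. By invariance of \<open>\<kappa>\<close>, the radical
  of \<open>\<eta> \<circ> [\<cdot>, \<cdot>]\<close> is the kernel of \<open>ad x\<close>; by the contact condition \<open>\<eta> x \<noteq> 0\<close> and this kernel is the line of \<open>x\<close>.
  So \<open>ad x\<close> acts on the four-dimensional \<open>V = ker \<eta>\<close> injectively and without trace, and preserves
  the 3-form \<open>\<kappa>([u, v], w)\<close>. This form vanishes, that is, \<open>[V, V]\<close> is contained in the line of \<open>x\<close>.
\<close>

lemma killing_degenerate:
  assumes dim: "DIM('e) = 5" and perf: "derived = UNIV" and contact: "contact_lie_algebra UNIV br"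
  shows "\<exists>x. x \<noteq> 0 \<and> (\<forall>y. killing x y = 0)"
proof (rule ccontr)
  assume "\<not> ?thesis"
  then have nd: "x = 0" if "\<And>y. killing x y = 0" for x using that by blast
  obtain \<eta> :: "'e \<Rightarrow> real" where \<eta>: "linear \<eta>" and con: "\<And>u. \<eta> u = 0 \<Longrightarrow> (\<And>y. \<eta> (br u y) = 0) \<Longrightarrow> u = 0"
    using contact unfolding contact_iff_5[OF dim] by blast
  note l\<eta> = linear_add[OF \<eta>] linear_diff[OF \<eta>] linear_scale[OF \<eta>] linear_0[OF \<eta>] linear_neg[OF \<eta>]
  define T where "T z = (\<Sum>b\<in>Basis. killing z b *\<^sub>R b)" for z
  have T: "T z \<bullet> y = killing z y" for z y
  proof -
    have "linear (killing z)" by (rule linearI) (simp_all add: killing_linear_right)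
    then have "killing z y = (\<Sum>b\<in>Basis. (y \<bullet> b) * killing z b)"
      using euclidean_representation[of y] linear_sum[of "killing z" "\<lambda>b. (y \<bullet> b) *\<^sub>R b" Basis]
      by (simp add: killing_linear_right)
    then show ?thesis unfolding T_def inner_sum_left by (simp add: inner_commute mult.commute)
  qed
  have linT: "linear T"
    by (rule linearI; rule euclidean_eqI) (simp_all add: T inner_add_left killing_linear)
  have "bij T"
  proof (rule bij_linear_dim[OF linT])
    fix z assume "T z = 0"
    then show "z = 0" using T[of z] by (intro nd) simp
  qed simp
  then obtain x where x: "T x = (\<Sum>b\<in>Basis. \<eta> b *\<^sub>R b)" by (metis bij_pointE)
  have \<kappa>x: "killing x y = \<eta> y" for y
  proof -
    have "\<eta> y = (\<Sum>b\<in>Basis. (y \<bullet> b) * \<eta> b)"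
      using euclidean_representation[of y] linear_sum[OF \<eta>, of "\<lambda>b. (y \<bullet> b) *\<^sub>R b" Basis] by (simp add: l\<eta>)
    then show ?thesis unfolding T[symmetric] x inner_sum_left by (simp add: inner_commute mult.commute)
  qed
  have stab: "\<eta> (br x y) = 0" for y
    unfolding \<kappa>x[symmetric] killing_invariant[symmetric] by (simp add: br_simps killing_linear)
  have \<eta>x: "\<eta> x \<noteq> 0"
  proof
    assume "\<eta> x = 0"
    then have "x = 0" using con stab by blast
    then have "\<eta> y = 0" for y using \<kappa>x[of y] by (simp add: killing_linear)
    then have "y = 0" for y :: 'e using con by blast
    then show False using nonzero_Basis[of "SOME b :: 'e. b \<in> Basis"] by (metis nonempty_Basis some_in_eq)
  qed
  have ker: "y = (\<eta> y / \<eta> x) *\<^sub>R x" if "br x y = 0" for y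
  proof -
    have "\<eta> (br y z) = 0" for z
      unfolding \<kappa>x[symmetric] killing_invariant[symmetric] that by (simp add: killing_linear)
    then have "y - (\<eta> y / \<eta> x) *\<^sub>R x = 0"
      using \<eta>x by (intro con) (simp_all add: l\<eta> br_simps stab)
    then show ?thesis by simp
  qed
  define \<pi> where "\<pi> v = \<eta> v / \<eta> x" for v
  have \<pi>: "linear \<pi>" "\<pi> x = 1" using \<eta>x by (auto intro!: linearI simp: \<pi>_def l\<eta> add_divide_distrib)
  have \<pi>0: "\<pi> v = 0 \<longleftrightarrow> \<eta> v = 0" for v using \<eta>x by (simp add: \<pi>_def)
  have injV: "v = 0" if "\<pi> v = 0" "br x v = 0" for v using ker[OF that(2)] that(1) unfolding \<pi>_def by simp
  define V where "V = {v. \<eta> v = 0}"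
  have V: "subspace V" by (auto simp: V_def subspace_def l\<eta>)
  have "dim V = 4"
  proof -
    have "dim (span {x}) = 1" using \<eta>x by (auto simp: dim_singleton l\<eta>)
    moreover have "{v + w |v w. v \<in> V \<and> w \<in> span {x}} = UNIV"
    proof -
      have "\<exists>v w. y = v + w \<and> v \<in> V \<and> w \<in> span {x}" for y
        by (rule exI[of _ "y - \<pi> y *\<^sub>R x"], rule exI[of _ "\<pi> y *\<^sub>R x"])
          (use \<eta>x in \<open>auto simp: V_def l\<eta> \<pi>_def span_singleton\<close>)
      then show ?thesis by blast
    qed
    moreover have "V \<inter> span {x} = {0}"
      using \<eta>x by (auto simp: V_def span_singleton l\<eta>)
    ultimately show ?thesis using dim_sums_Int[OF V subspace_span, of "{x}"] dim by (simp add: dim_UNIV)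
  qed
  then have "dim (UNIV :: (real^4) set) = dim V" by (simp add: dim_UNIV)
  then obtain g :: "real^4 \<Rightarrow> 'e" where g: "linear g" "g ` UNIV = V" "inj_on g UNIV"
    using subspace_isomorphism[OF subspace_UNIV V] by metis
  note lg = linear_add[OF g(1)] linear_scale[OF g(1)] linear_0[OF g(1)]
  have g0: "g c = 0 \<Longrightarrow> c = 0" for c using g(1,3) linear_injective_0 by blast
  have gV: "\<eta> (g c) = 0" for c using g(2) by (auto simp: V_def)
  define M where "M c = inv_into UNIV g (br x (g c))" for c
  have gM: "g (M c) = br x (g c)" for c
    unfolding M_def by (rule f_inv_into_f) (simp add: g(2) V_def stab)
  have ginj: "a = b" if "g a = g b" for a b using that g(3) by (auto simp: inj_on_def)
  have linM: "linear M" by (rule linearI; rule ginj) (simp_all add: gM lg br_simps)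
  let ?h = "\<lambda>p :: real \<times> (real^4). fst p *\<^sub>R x + g (snd p)"
  have linh: "linear ?h" by (rule linearI) (simp_all add: lg algebra_simps)
  have "bij ?h"
  proof (rule bij_linear_dim[OF linh])
    show "p = 0" if "?h p = 0" for p
    proof -
      have "\<eta> (?h p) = fst p * \<eta> x" by (simp add: l\<eta> gV)
      then have "fst p = 0" using that \<eta>x by (simp add: l\<eta>)
      then have "snd p = 0" using that g0 by simp
      then show ?thesis using \<open>fst p = 0\<close> by (simp add: prod_eq_iff)
    qed
  qed (simp add: dim)
  then have "op_trace (br x) = op_trace (\<lambda>p::real \<times> (real^4). (0::real, M (snd p)))"
    by (intro op_trace_conj[OF linear_br linh]) (simp_all add: br_simps gM)
  then have trM: "op_trace M = 0"
    using op_trace_br[of x] perf by (simp add: op_trace_prod op_trace_zero)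
  have M0: "v = 0" if "M v = 0" for v
    using gM[of v] that injV[of "g v"] by (intro g0) (simp add: lg \<pi>0 gV)
  have \<Phi>0: "killing (br (g a) (g b)) (g c) = 0" for a b c
  proof (rule invariant_3_form_zero[where M=M and \<Phi>="\<lambda>a b c. killing (br (g a) (g b)) (g c)"])
    show "linear (\<lambda>u. killing (br (g u) (g v)) (g w))" for v w
      by (rule linearI) (simp_all add: lg br_simps killing_linear)
    show "killing (br (g v) (g u)) (g w) = - killing (br (g u) (g v)) (g w)" for u v w
      by (simp add: br_skew[of "g v" "g u"] killing_linear)
    show "killing (br (g v) (g w)) (g u) = killing (br (g u) (g v)) (g w)" for u v w
      unfolding killing_invariant[of "g u"] by (rule killing_sym)
    show "killing (br (g (M u)) (g v)) (g w) + killing (br (g u) (g (M v))) (g w) + killing (br (g u) (g v)) (g (M w)) = 0" for u v w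
    proof -
      have "killing (br x (br (g u) (g v))) (g w) = - killing (br (g u) (g v)) (br x (g w))"
        unfolding killing_invariant[symmetric] by (simp add: br_skew[of x "br (g u) (g v)"] killing_linear)
      then show ?thesis unfolding gM br_jacobi[of x "g u" "g v"] by (simp add: killing_linear)
    qed
  qed (use linM trM M0 in auto)
  show False
  proof (rule no_perfect_line_bracket[OF dim perf \<pi>])
    show "\<pi> (br x v) = 0" for v by (simp add: \<pi>0 stab)
    show "v = 0" if "\<pi> v = 0" "br x v = 0" for v using injV that by blast
    show "br u v = \<pi> (br u v) *\<^sub>R x" if "\<pi> u = 0" "\<pi> v = 0" for u v
    proof -
      have "killing (br u v - \<pi> (br u v) *\<^sub>R x) y = 0" for y
      proof -
        have "u \<in> V" "v \<in> V" "y - \<pi> y *\<^sub>R x \<in> V" using that \<eta>x by (auto simp: V_def \<pi>0 l\<eta>) (simp add: \<pi>_def)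
        then obtain a b c where abc: "u = g a" "v = g b" "y - \<pi> y *\<^sub>R x = g c" using g(2) by blast
        have "killing (br u v) (y - \<pi> y *\<^sub>R x) = 0" unfolding abc by (rule \<Phi>0)
        moreover have "killing (br u v) x = \<eta> (br u v)" using killing_sym \<kappa>x by metis
        ultimately show ?thesis using \<eta>x
          by (simp add: killing_linear killing_linear_right \<kappa>x \<pi>_def)
      qed
      then show ?thesis using nd[of "br u v - \<pi> (br u v) *\<^sub>R x"] by simp
    qed
  qed
qed

text \<open>
  Engel's theorem for a quotient module \<open>V / W\<close>. The induction on the subalgebra \<open>M\<close> uses it for two
  modules: on \<open>M / K\<close>, with \<open>K\<close> a maximal proper subalgebra, it gives \<open>x\<close> with \<open>M = K + \<langle>x\<rangle>\<close>; on \<open>V / W\<close> it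
  gives vectors invariant under \<open>K\<close>. These are stable under \<open>x\<close>, which acts nilpotently.
\<close>

lemma engel:
  assumes nil: "\<And>x. \<exists>n. \<forall>y. (br x ^^ n) y = 0"
    and M: "subspace M" "\<And>x y. x \<in> M \<Longrightarrow> y \<in> M \<Longrightarrow> br x y \<in> M"
    and V: "subspace V" "\<And>x v. x \<in> M \<Longrightarrow> v \<in> V \<Longrightarrow> br x v \<in> V"
    and W: "subspace W" "\<And>x w. x \<in> M \<Longrightarrow> w \<in> W \<Longrightarrow> br x w \<in> W" "W \<subseteq> V" "W \<noteq> V"
  shows "\<exists>v\<in>V. v \<notin> W \<and> (\<forall>x\<in>M. br x v \<in> W)"
  using M V W
proof (induction "dim M" arbitrary: M V W rule: less_induct)
  case less
  show ?case
  proof (cases "M = {0}")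
    case True
    then show ?thesis using less.prems(5,7,8) by (auto simp: br_simps subspace_0)
  next
    case False
    define subalg where "subalg K \<longleftrightarrow> subspace K \<and> K \<subseteq> M \<and> K \<noteq> M \<and> (\<forall>x\<in>K. \<forall>y\<in>K. br x y \<in> K)" for K
    have "subalg {0}" using False subspace_0[OF less.prems(1)] by (auto simp: subalg_def br_simps subspace_single_0)
    moreover have "\<forall>K. subalg K \<longrightarrow> dim K < Suc (DIM('e))"
    proof (intro allI impI)
      show "dim K < Suc (DIM('e))" for K :: "'e set" using dim_subset_UNIV[of K] by simp
    qed
    ultimately obtain K where K: "subalg K" and Kmax: "\<And>K'. subalg K' \<Longrightarrow> dim K' \<le> dim K"
      using ex_has_greatest_nat[of subalg "{0}" dim "Suc (DIM('e))"] by blast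
    have Ks: "subspace K" "K \<subseteq> M" "K \<noteq> M" "\<And>x y. x \<in> K \<Longrightarrow> y \<in> K \<Longrightarrow> br x y \<in> K"
      using K by (auto simp: subalg_def)
    have dK: "dim K < dim M"
      using Ks less.prems(1) by (metis dim_psubset psubsetI span_eq_iff)
    obtain x where x: "x \<in> M" "x \<notin> K" "\<And>k. k \<in> K \<Longrightarrow> br k x \<in> K"
      using less.hyps[OF dK Ks(1,4) less.prems(1) _ Ks(1) _ Ks(2,3)] less.prems(2) Ks(2,4) by blast
    define K' where "K' = {k + t *\<^sub>R x |k t. k \<in> K}"
    have K'sub: "subspace K'"
    proof (rule subspaceI)
      show "0 \<in> K'" using subspace_0[OF Ks(1)] unfolding K'_def by (auto intro!: exI[of _ 0])
      show "a + b \<in> K'" if "a \<in> K'" "b \<in> K'" for a b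
      proof -
        obtain k t k' t' where "a = k + t *\<^sub>R x" "b = k' + t' *\<^sub>R x" "k \<in> K" "k' \<in> K" using \<open>a \<in> K'\<close> \<open>b \<in> K'\<close> K'_def by auto
        then have "a + b = (k + k') + (t + t') *\<^sub>R x" "k + k' \<in> K" using Ks(1) by (auto simp: algebra_simps subspace_add)
        then show ?thesis unfolding K'_def by blast
      qed
      show "c *\<^sub>R a \<in> K'" if "a \<in> K'" for c a
      proof -
        obtain k t where "a = k + t *\<^sub>R x" "k \<in> K" using \<open>a \<in> K'\<close> K'_def by auto
        then have "c *\<^sub>R a = (c *\<^sub>R k) + (c * t) *\<^sub>R x" "c *\<^sub>R k \<in> K" using Ks(1) by (auto simp: algebra_simps subspace_scale)
        then show ?thesis unfolding K'_def by blast
      qed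
    qed
    have KK': "K \<subseteq> K'"
    proof
      fix k assume "k \<in> K"
      moreover have "k = k + 0 *\<^sub>R x" by simp
      ultimately show "k \<in> K'" unfolding K'_def by blast
    qed
    have "x = 0 + 1 *\<^sub>R x" by simp
    then have xK': "x \<in> K'" using subspace_0[OF Ks(1)] unfolding K'_def by blast
    have K'M: "K' \<subseteq> M" using Ks(2) x(1) less.prems(1) by (auto simp: K'_def subspace_add subspace_scale subset_iff)
    have K'br: "br a b \<in> K'" if "a \<in> K'" "b \<in> K'" for a b
    proof -
      obtain k t k' t' where ab: "a = k + t *\<^sub>R x" "b = k' + t' *\<^sub>R x" "k \<in> K" "k' \<in> K" using \<open>a \<in> K'\<close> \<open>b \<in> K'\<close> K'_def by auto
      have "br a b = br k k' + t' *\<^sub>R br k x - t *\<^sub>R br k' x"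
        unfolding ab by (simp add: br_simps br_skew[of x k'])
      also have "\<dots> \<in> K" using ab x(3) Ks by (intro subspace_diff subspace_add subspace_scale) auto
      finally show ?thesis using KK' by blast
    qed
    have "K' = M"
    proof (rule ccontr)
      assume "K' \<noteq> M"
      then have "subalg K'" using K'sub K'M K'br by (auto simp: subalg_def)
      then have "dim K' \<le> dim K" by (rule Kmax)
      then have "K = K'" using subspace_dim_equal[OF Ks(1) K'sub KK'] by simp
      then show False using xK' x(2) by simp
    qed
    define V' where "V' = {v \<in> V. \<forall>k\<in>K. br k v \<in> W}"
    obtain v0 where v0: "v0 \<in> V'" "v0 \<notin> W"
      using less.hyps[OF dK Ks(1,4) less.prems(3) _ less.prems(5) _ less.prems(7,8)] less.prems(4,6) Ks(2) unfolding V'_def by blast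
    have V'x: "br x v \<in> V'" if "v \<in> V'" for v
    proof -
      have "br k (br x v) \<in> W" if "k \<in> K" for k
        unfolding br_jacobi[of k x v] using \<open>v \<in> V'\<close> x that less.prems(5,6) by (auto simp: V'_def intro!: subspace_add)
      then show ?thesis using \<open>v \<in> V'\<close> less.prems(4) x(1) by (auto simp: V'_def)
    qed
    have iter: "(br x ^^ n) v0 \<in> V'" for n by (induction n) (simp_all add: v0 V'x)
    obtain N where "\<forall>y. (br x ^^ N) y = 0" using nil by blast
    then have exW: "(br x ^^ N) v0 \<in> W" using subspace_0[OF less.prems(5)] by simp
    define n where "n = (LEAST n. (br x ^^ n) v0 \<in> W)"
    have n: "(br x ^^ n) v0 \<in> W" unfolding n_def using exW by (rule LeastI)
    have "n \<noteq> 0" using n v0(2) by (metis funpow_0)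
    then obtain n' where n': "n = Suc n'" using not0_implies_Suc by blast
    define v where "v = (br x ^^ n') v0"
    have v: "v \<notin> W" using not_less_Least[of n' "\<lambda>n. (br x ^^ n) v0 \<in> W"] n' unfolding n_def[symmetric] v_def by simp
    have xv: "br x v \<in> W" using n unfolding n' v_def by simp
    have vV': "v \<in> V'" unfolding v_def by (rule iter)
    have "br m v \<in> W" if "m \<in> M" for m
    proof -
      obtain k t where "m = k + t *\<^sub>R x" "k \<in> K" using \<open>m \<in> M\<close> \<open>K' = M\<close> K'_def by auto
      then show ?thesis using vV' xv less.prems(5) by (auto simp: V'_def br_simps subspace_add subspace_scale)
    qed
    then show ?thesis using v vV' by (auto simp: V'_def)
  qed
qed

text \<open>
  The quotient is perfect, which excludes the dimensions 1, 2 and 4 for it.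
\<close>

lemma perfect_5_ideal_dim:
  assumes dim: "DIM('e) = 5" and perf: "derived = UNIV"
    and I: "subspace I" "\<And>x y. y \<in> I \<Longrightarrow> br x y \<in> I" "I \<noteq> {0}" "I \<noteq> UNIV"
  shows "dim I = 2"
proof -
  obtain q :: "'e \<Rightarrow> 'e" where q: "linear q" "\<And>x. q x = 0 \<longleftrightarrow> x \<in> I" "\<And>x. q (q x) = q x"
    "dim (range q) + dim I = DIM('e)"
    by (rule orthogonal_projection_exists[OF I(1)]) (rule that)
  have id: "q (br x y) = 0" if "q y = 0" for x y using that q(2) I(2) by blast
  note quot = quotient_lie_algebra[OF q(1) q(3) id]
  have der: "lie_derived (range q) (\<lambda>x y. q (br x y)) = range q" using quot(2) perf by simp
  have "range q \<noteq> {0}"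
  proof
    assume "range q = {0}"
    then have "q x = 0" for x by blast
    then show False using q(2) I(4) by blast
  qed
  then have "3 \<le> dim (range q)" using perfect_dim_ge_3[OF quot(1) der] by blast
  moreover have "dim (range q) \<noteq> 4" using no_perfect_dim_4[OF quot(1) der] by blast
  moreover have "dim I \<noteq> 0" using I(1,3) subspace_0[OF I(1)] by (auto simp: dim_eq_0)
  ultimately show ?thesis using q(4) dim by linarith
qed

text \<open>
  Otherwise Engel's theorem gives a central vector, whose line is an ideal of the wrong dimension.
\<close>

lemma perfect_5_not_nilpotent:
  assumes dim: "DIM('e) = 5" and perf: "derived = UNIV"
  shows "\<exists>x. \<forall>n. \<exists>y. (br x ^^ n) y \<noteq> 0"
proof (rule ccontr)
  assume "\<not> ?thesis"
  then have nil: "\<And>x. \<exists>n. \<forall>y. (br x ^^ n) y = 0" by blast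
  have ne: "{0::'e} \<noteq> UNIV"
    by (metis UNIV_I nonempty_Basis nonzero_Basis singletonD some_in_eq)
  obtain v where v: "v \<noteq> 0" "\<And>x. br x v = 0"
    using engel[OF nil, of UNIV UNIV "{0}"] ne by (auto simp: br_simps subspace_single_0)
  have "span {v} \<noteq> {0}" using v(1) span_base[of v "{v}"] by auto
  moreover have d1: "dim (span {v}) = 1" using v(1) by simp
  moreover have "span {v} \<noteq> UNIV"
  proof
    assume "span {v} = UNIV"
    then have "dim (span {v}) = 5" using dim by (simp only: dim_UNIV)
    then show False using d1 by simp
  qed
  moreover have "br x y \<in> span {v}" if "y \<in> span {v}" for x y
    using that v(2) by (auto simp: span_singleton br_simps)
  ultimately have "dim (span {v}) = 2" by (intro perfect_5_ideal_dim[OF dim perf subspace_span]) auto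
  then show False using d1 by simp
qed

text \<open>
  On the four-dimensional quotient by the line of \<open>x\<close>, \<open>ad x\<close> induces an operator \<open>M\<close> with
  \<open>tr M = tr (ad x) = 0\<close> and \<open>tr M\<^sup>2 = \<kappa>(x, x) = 0\<close>.
\<close>

lemma killing_zero_cayley_hamilton:
  assumes dim: "DIM('e) = 5" and perf: "derived = UNIV" and \<kappa>: "killing x x = 0"
  shows "\<exists>c d. \<forall>y. \<exists>s. br x (br x (br x (br x y))) = c *\<^sub>R br x y - d *\<^sub>R y + s *\<^sub>R x"
proof (cases "x = 0")
  case True
  then show ?thesis by (intro exI[of _ 0]) (simp add: br_simps)
next
  case False
  obtain q :: "'e \<Rightarrow> 'e" where q: "linear q" "\<And>y. q y = 0 \<longleftrightarrow> y \<in> span {x}" "\<And>y. q (q y) = q y"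
    "dim (range q) + dim (span {x}) = DIM('e)"
    by (rule orthogonal_projection_exists[OF subspace_span[of "{x}"]]) (rule that)
  have "dim (UNIV :: (real^4) set) = dim (range q)" using q(4) dim False by (simp add: dim_UNIV)
  moreover have V: "subspace (range q)" by (rule linear_subspace_image[OF q(1) subspace_UNIV])
  ultimately obtain g :: "real^4 \<Rightarrow> 'e" where g: "linear g" "g ` UNIV = range q" "inj_on g UNIV"
    using subspace_isomorphism[OF subspace_UNIV V] by metis
  note lg = linear_add[OF g(1)] linear_scale[OF g(1)] linear_0[OF g(1)] linear_diff[OF g(1)]
  have g0: "g c = 0 \<Longrightarrow> c = 0" for c using g(1,3) linear_injective_0 by blast
  have qg: "q (g c) = g c" for c using g(2) q(3) by (metis rangeE rangeI)
  define h where "h p = fst p *\<^sub>R x + g (snd p)" for p :: "real \<times> (real^4)"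
  have linh: "linear h" unfolding h_def by (rule linearI) (simp_all add: lg algebra_simps)
  have qx: "q x = 0" using q(2) span_base[of x "{x}"] by simp
  have bij: "bij h"
  proof (rule bij_linear_dim[OF linh])
    show "p = 0" if "h p = 0" for p
    proof -
      have "q (h p) = g (snd p)" by (simp add: h_def linear_add[OF q(1)] linear_scale[OF q(1)] qx qg)
      then have "snd p = 0" using that g0 by (simp add: linear_0[OF q(1)])
      then show ?thesis using that False by (simp add: h_def lg prod_eq_iff)
    qed
  qed (simp add: dim)
  define k where "k = inv_into UNIV h"
  have hk: "h (k y) = y" for y unfolding k_def using bij by (intro f_inv_into_f) (simp add: bij_is_surj)
  have hinj: "p = p'" if "h p = h p'" for p p'
    by (rule injD[OF bij_is_inj[OF bij]]) (rule that)
  have link: "linear k"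
    by (rule linearI; rule hinj) (simp_all only: hk linear_add[OF linh] linear_scale[OF linh])
  define M where "M c = snd (k (br x (g c)))" for c
  define \<sigma> where "\<sigma> c = fst (k (br x (g c)))" for c
  have linM: "linear M"
    unfolding M_def by (rule linearI) (simp_all add: lg br_simps linear_add[OF link] linear_scale[OF link])
  have Ah: "br x (h p) = h (\<sigma> (snd p), M (snd p))" for p
    using hk[of "br x (g (snd p))"] by (simp add: h_def br_simps M_def \<sigma>_def)
  have t1: "op_trace M = 0"
  proof -
    have "op_trace (br x) = op_trace (\<lambda>p. (\<sigma> (snd p), M (snd p)))"
      by (rule op_trace_conj[where h=h and m="\<lambda>p. (\<sigma> (snd p), M (snd p))"])
        (rule linear_br, rule linh, rule bij, rule Ah)
    moreover have "\<sigma> 0 = 0" by (simp add: \<sigma>_def lg br_simps linear_0[OF link])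
    ultimately show ?thesis using op_trace_br[of x] perf by (simp add: op_trace_prod op_trace_zero)
  qed
  have t2: "op_trace (\<lambda>c. M (M c)) = 0"
  proof -
    have "br x (br x (h p)) = h (\<sigma> (M (snd p)), M (M (snd p)))" for p
      unfolding Ah by simp
    then have "op_trace (\<lambda>y. br x (br x y)) = op_trace (\<lambda>p. (\<sigma> (M (snd p)), M (M (snd p))))"
      by (rule op_trace_conj[OF linear_br_comp linh bij])
    moreover have "\<sigma> (M 0) = 0" by (simp add: \<sigma>_def lg br_simps linear_0[OF link] linear_0[OF linM])
    ultimately show ?thesis using \<kappa> by (simp add: killing_def op_trace_prod op_trace_zero)
  qed
  have "(\<lambda>v. matrix M *v v) = M" by (rule matrix_vector_mul(2)[OF linM])
  then have mM: "matrix M *v v = M v" for v by (rule fun_cong)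
  have tm: "trace (matrix f) = op_trace f" for f :: "real^4 \<Rightarrow> real^4"
    by (simp add: op_trace_vec trace_def matrix_def)
  have "trace (matrix M) = 0" unfolding tm by (rule t1)
  moreover have "trace (matrix M ** matrix M) = 0"
    unfolding matrix_compose[OF linM linM, symmetric] tm comp_def by (rule t2)
  ultimately have "\<exists>c d. matrix M ** matrix M ** (matrix M ** matrix M) = c *\<^sub>R matrix M - d *\<^sub>R mat 1"
    by (rule matrix_4_cayley_hamilton)
  then obtain c d where "matrix M ** matrix M ** (matrix M ** matrix M) = c *\<^sub>R matrix M - d *\<^sub>R mat 1"
    by (elim exE)
  then have CH: "(matrix M ** matrix M ** (matrix M ** matrix M)) *v v = (c *\<^sub>R matrix M - d *\<^sub>R mat 1) *v v" for v
    by simp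
  have M4: "M (M (M (M v))) = c *\<^sub>R M v - d *\<^sub>R v" for v
  proof -
    have "(c *\<^sub>R X) *v v = c *\<^sub>R (X *v v)" for c and X :: "real^4^4"
      by (simp add: vec_eq_iff matrix_vector_mult_def sum_distrib_left mult.assoc)
    then have "(c *\<^sub>R matrix M - d *\<^sub>R mat 1) *v v = c *\<^sub>R M v - d *\<^sub>R v"
      by (simp add: matrix_vector_mult_diff_rdistrib mM)
    moreover have "(matrix M ** matrix M ** (matrix M ** matrix M)) *v v = M (M (M (M v)))"
      by (simp only: matrix_vector_mul_assoc[symmetric] mM)
    ultimately show ?thesis using CH[of v] by simp
  qed
  have "\<exists>s. br x (br x (br x (br x y))) = c *\<^sub>R br x y - d *\<^sub>R y + s *\<^sub>R x" for y
  proof -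
    define t where "t = fst (k y)"
    define v where "v = snd (k y)"
    have y: "y = t *\<^sub>R x + g v" using hk[of y] by (simp add: h_def t_def v_def)
    have A: "br x (r *\<^sub>R x + g w) = \<sigma> w *\<^sub>R x + g (M w)" for r w
      using Ah[of "(r, w)"] by (simp add: h_def)
    have "br x (br x (br x (br x y))) = \<sigma> (M (M (M v))) *\<^sub>R x + (c *\<^sub>R g (M v) - d *\<^sub>R g v)"
      unfolding y A M4 lg ..
    also have "\<dots> = c *\<^sub>R br x y - d *\<^sub>R y + (\<sigma> (M (M (M v))) - c * \<sigma> v + d * t) *\<^sub>R x"
      unfolding y A by (simp add: algebra_simps)
    finally have "br x (br x (br x (br x y))) = c *\<^sub>R br x y - d *\<^sub>R y + (\<sigma> (M (M (M v))) - c * \<sigma> v + d * t) *\<^sub>R x" .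
    then show ?thesis by blast
  qed
  then show ?thesis by blast
qed

end

context lie_space begin

lemma br_iterated:
  "br x (br u v) = br (br x u) v + br u (br x v)"
  "br x (br x (br u v)) = br (br x (br x u)) v + 2 *\<^sub>R br (br x u) (br x v) + br u (br x (br x v))"
  "br x (br x (br x (br u v))) = br (br x (br x (br x u))) v + 3 *\<^sub>R br (br x (br x u)) (br x v)
     + 3 *\<^sub>R br (br x u) (br x (br x v)) + br u (br x (br x (br x v)))"
proof -
  have d: "br x (br p q) = br (br x p) q + br p (br x q)" for p q by (rule br_jacobi)
  have n: "2 *\<^sub>R w = w + w" "3 *\<^sub>R w = w + w + w" for w :: 'e
    by (simp_all add: scaleR_left_distrib[of 1 1, simplified] scaleR_left_distrib[of 2 1, simplified])
  show "br x (br u v) = br (br x u) v + br u (br x v)" by (rule d)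
  show 2: "br x (br x (br u v)) = br (br x (br x u)) v + 2 *\<^sub>R br (br x u) (br x v) + br u (br x (br x v))" for u v
    unfolding d[of u v] br_simps(1) d[of "br x u" v] d[of u "br x v"] n by simp
  show "br x (br x (br x (br u v))) = br (br x (br x (br x u))) v + 3 *\<^sub>R br (br x (br x u)) (br x v)
     + 3 *\<^sub>R br (br x u) (br x (br x v)) + br u (br x (br x (br x v)))"
    unfolding 2[of u v] br_simps(1,5) d[of "br x (br x u)" v] d[of "br x u" "br x v"] d[of u "br x (br x v)"] n by simp
qed

lemma vector_eq_neg_self: "w = - w \<Longrightarrow> w = 0" for w :: 'e
proof -
  assume "w = - w"
  then have "2 *\<^sub>R w = w + - w" by (simp add: scaleR_2)
  then show "w = 0" by simp
qed

text \<open>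
  With \<open>A = ad x\<close>, the ideal is \<open>I = ker (A\<^sup>3 - c)\<close>. Since \<open>A\<^sup>5 = c A\<^sup>2\<close>, the only possible eigenvalues
  of \<open>A\<^sup>3\<close> are 0 and \<open>c\<close>. For \<open>u, v \<in> I\<close> the Leibniz rule makes \<open>A\<^sup>3\<close> act on \<open>c [u, v]\<close>, \<open>[A\<^sup>2 u, A v]\<close>,
  \<open>[A u, A\<^sup>2 v]\<close> by a matrix with eigenvalues \<open>8 c\<close> and \<open>- c\<close>, so these brackets vanish and \<open>I\<close> is abelian.
  The same rule shows that brackets of \<open>I\<close> with the complement \<open>ker A\<^sup>2\<close> stay in \<open>I\<close>.
\<close>

lemma proper_ideal_from_cubic:
  assumes nn: "\<And>n. \<exists>y. (br x ^^ n) y \<noteq> 0" and c: "c \<noteq> 0"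
    and A5: "\<And>y. br x (br x (br x (br x (br x y)))) = c *\<^sub>R br x (br x y)"
  shows "\<exists>I. subspace I \<and> (\<forall>x y. y \<in> I \<longrightarrow> br x y \<in> I) \<and> I \<noteq> {0} \<and> I \<noteq> UNIV"
proof -
  define A where "A = br x"
  note A_simps = br_simps(1,3,5,7,9)[of x, folded A_def]
  have A5: "A (A (A (A (A y)))) = c *\<^sub>R A (A y)" for y using A5 by (simp add: A_def)
  have A6: "A (A (A (A (A (A y))))) = c *\<^sub>R A (A (A y))" for y by (rule A5)
  have D1: "A (br u v) = br (A u) v + br u (A v)"
    and D2: "A (A (br u v)) = br (A (A u)) v + 2 *\<^sub>R br (A u) (A v) + br u (A (A v))"
    and D3: "A (A (A (br u v))) = br (A (A (A u))) v + 3 *\<^sub>R br (A (A u)) (A v) + 3 *\<^sub>R br (A u) (A (A v)) + br u (A (A (A v)))" for u v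
    unfolding A_def by (rule br_iterated)+
  define I where "I = {y. A (A (A y)) = c *\<^sub>R y}"
  have sub: "subspace I" by (auto simp: I_def subspace_def A_simps algebra_simps)
  have abel: "br u v = 0" if "u \<in> I" "v \<in> I" for u v
  proof -
    have u: "A (A (A u)) = c *\<^sub>R u" and v: "A (A (A v)) = c *\<^sub>R v" using that by (auto simp: I_def)
    define a where "a = c *\<^sub>R br u v"
    define b where "b = br (A (A u)) (A v)"
    define e where "e = br (A u) (A (A v))"
    have 1: "A (A (A a)) = c *\<^sub>R (2 *\<^sub>R a + 3 *\<^sub>R b + 3 *\<^sub>R e)"
      unfolding a_def b_def e_def A_simps D3[of u v] u v
      by (rule euclidean_eqI) (simp add: br_simps inner_add_left algebra_simps)
    have 2: "A (A (A b)) = c *\<^sub>R (3 *\<^sub>R a + 2 *\<^sub>R b + 3 *\<^sub>R e)"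
      unfolding a_def b_def e_def D3 u v by (simp add: A_simps u v br_simps algebra_simps scaleR_2)
    have 3: "A (A (A e)) = c *\<^sub>R (3 *\<^sub>R a + 3 *\<^sub>R b + 2 *\<^sub>R e)"
      unfolding a_def b_def e_def D3 u v by (simp add: A_simps u v br_simps algebra_simps scaleR_2)
    define s where "s = a + b + e"
    have s3: "A (A (A s)) = (8 * c) *\<^sub>R s"
      unfolding s_def A_simps 1 2 3
      by (rule euclidean_eqI) (simp add: inner_add_left algebra_simps)
    have "(8 * c) *\<^sub>R ((8 * c) *\<^sub>R s) = c *\<^sub>R ((8 * c) *\<^sub>R s)"
      using A6[of s] unfolding s3 A_simps .
    then have "(56 * (c * c)) *\<^sub>R s = 0" by (simp add: algebra_simps)
    then have "s = 0" using c by simp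
    have "2 *\<^sub>R a + 3 *\<^sub>R b + 3 *\<^sub>R e = 3 *\<^sub>R s - a"
      unfolding s_def by (rule euclidean_eqI) (simp add: inner_add_left inner_diff_left algebra_simps)
    then have a3: "A (A (A a)) = (- c) *\<^sub>R a"
      unfolding 1 \<open>s = 0\<close> by simp
    have "(- c) *\<^sub>R ((- c) *\<^sub>R a) = c *\<^sub>R ((- c) *\<^sub>R a)"
      using A6[of a] unfolding a3 A_simps .
    then have "(c * c) *\<^sub>R a = - ((c * c) *\<^sub>R a)" by simp
    then have "(c * c) *\<^sub>R a = 0" by (rule vector_eq_neg_self)
    then show ?thesis using c by (simp add: a_def)
  qed
  have ideal: "br y u \<in> I" if "u \<in> I" for y u
  proof -
    have u: "A (A (A u)) = c *\<^sub>R u" using that by (simp add: I_def)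
    \<comment> \<open>the components of \<open>y\<close> in \<open>I\<close> and in \<open>ker A\<^sup>2\<close>\<close>
    define y1 where "y1 = (1 / c) *\<^sub>R A (A (A y))"
    define y0 where "y0 = y - y1"
    have "y1 \<in> I" unfolding I_def y1_def using c by (simp add: A_simps A6)
    then have 1: "br y1 u = 0" using that by (rule abel)
    have y0: "A (A y0) = 0" unfolding y0_def y1_def using c by (simp add: A_simps A5)
    define w where "w = br y0 u"
    define w' where "w' = br (A y0) (A (A u))"
    have w3: "A (A (A w)) = 3 *\<^sub>R w' + c *\<^sub>R w" unfolding w_def w'_def D3 y0 u by (simp add: A_simps br_simps)
    have w'3: "A (A (A w')) = c *\<^sub>R w'" unfolding w'_def D3 y0 by (simp add: A_simps u br_simps y0)
    have "A (A (A (3 *\<^sub>R w' + c *\<^sub>R w))) = c *\<^sub>R (3 *\<^sub>R w' + c *\<^sub>R w)" using A6[of w] unfolding w3 .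
    then have "(3 * c) *\<^sub>R w' = 0" unfolding A_simps w3 w'3 by (simp add: algebra_simps)
    then have "w' = 0" using c by simp
    then have "w \<in> I" using w3 by (simp add: I_def)
    moreover have "br y u = w" using 1 by (simp add: w_def y0_def br_simps)
    ultimately show ?thesis by simp
  qed
  obtain y where "(br x ^^ 3) y \<noteq> 0" using nn by blast
  then have y: "A (A (A y)) \<noteq> 0" by (simp add: A_def numeral_3_eq_3)
  then have "A (A (A y)) \<in> I" by (simp add: I_def A6)
  then have "I \<noteq> {0}" using y by blast
  moreover have "A x = 0" by (simp add: A_def br_simps)
  then have "x \<notin> I \<or> x = 0" using c by (auto simp: I_def A_simps)
  moreover have "x \<noteq> 0" using y by (auto simp: A_def br_simps)
  ultimately show ?thesis using sub ideal by blast
qed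

text \<open>
  \<open>N = A\<^sup>4 - c A + d\<close> maps onto the line of \<open>x\<close>, with \<open>N x = d x\<close>; dividing by \<open>d\<close> gives a projection \<open>\<pi>\<close> that
  vanishes on the image of \<open>A = ad x\<close>. So \<open>\<omega> = \<pi> \<circ> [\<cdot>, \<cdot>]\<close> satisfies \<open>\<omega>(A u, v) = - \<omega>(u, A v)\<close>. If
  \<open>c \<noteq> 0\<close>, applying \<open>N\<close> in either argument of \<open>\<omega>\<close> changes only the sign of the \<open>c\<close>-term; so \<open>\<omega>(u, A v) = 0\<close>,
  then \<open>\<omega> = 0\<close>, and the algebra is not perfect. If \<open>c = 0\<close>, then \<open>A\<^sup>4 = - d\<close> on \<open>ker \<pi>\<close>. For the \<open>ker \<pi>\<close>-component
  \<open>b\<close> of the bracket, the Leibniz rule for \<open>A\<^sup>4\<close> gives a circulant system for \<open>b(u, v)\<close>, \<open>b(A\<^sup>3 u, A v)\<close>,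
  \<open>b(A\<^sup>2 u, A\<^sup>2 v)\<close>, \<open>b(A u, A\<^sup>3 v)\<close> with rows \<open>1, 4, 6, 4\<close>, which is regular; so \<open>b = 0\<close> on \<open>ker \<pi>\<close>.
\<close>

lemma no_perfect_quartic:
  assumes dim: "DIM('e) = 5" and perf: "derived = UNIV" and d: "d \<noteq> 0" and x: "x \<noteq> 0"
    and CH: "\<And>y. \<exists>s. br x (br x (br x (br x y))) = c *\<^sub>R br x y - d *\<^sub>R y + s *\<^sub>R x"
  shows False
proof -
  define A where "A = br x"
  note A_simps = br_simps(1,3,5,7,9)[of x, folded A_def]
  have Ax: "A x = 0" by (simp add: A_def br_simps)
  define N where "N y = A (A (A (A y))) - c *\<^sub>R A y + d *\<^sub>R y" for y
  define \<pi> where "\<pi> y = (N y \<bullet> x) / (d * (x \<bullet> x))" for y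
  have xx: "x \<bullet> x \<noteq> 0" using x by simp
  have Nadd: "N (u + v) = N u + N v" "N (t *\<^sub>R u) = t *\<^sub>R N u" for u v t
    by (simp_all add: N_def A_simps algebra_simps)
  have \<pi>: "linear \<pi>"
    by (rule linearI) (simp_all add: \<pi>_def Nadd inner_add_left add_divide_distrib)
  note l\<pi> = linear_add[OF \<pi>] linear_diff[OF \<pi>] linear_scale[OF \<pi>] linear_0[OF \<pi>] linear_neg[OF \<pi>]
  have N: "N y = (d * \<pi> y) *\<^sub>R x" for y
  proof -
    obtain s where "br x (br x (br x (br x y))) = c *\<^sub>R br x y - d *\<^sub>R y + s *\<^sub>R x" using CH by blast
    then have "N y = s *\<^sub>R x" by (simp add: N_def A_def)
    then show ?thesis using d xx by (simp add: \<pi>_def)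
  qed
  have \<pi>x: "\<pi> x = 1" using d xx by (simp add: \<pi>_def N_def Ax A_simps)
  have \<pi>A: "\<pi> (A y) = 0" for y
  proof -
    have "N (A y) = A (N y)" by (simp add: N_def A_simps)
    also have "\<dots> = 0" unfolding N by (simp add: A_simps Ax)
    finally show ?thesis using N[of "A y"] d x by simp
  qed
  have D: "A (br u v) = br (A u) v + br u (A v)" for u v unfolding A_def by (rule br_jacobi)
  define \<omega> where "\<omega> u v = \<pi> (br u v)" for u v
  have \<omega>A: "\<omega> (A u) v = - \<omega> u (A v)" for u v
    using \<pi>A[of "br u v"] unfolding D by (simp add: \<omega>_def l\<pi> eq_neg_iff_add_eq_0)
  have \<omega>l: "\<omega> (u + v) w = \<omega> u w + \<omega> v w" "\<omega> (t *\<^sub>R u) w = t * \<omega> u w" "\<omega> (u - v) w = \<omega> u w - \<omega> v w"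
     "\<omega> w (u + v) = \<omega> w u + \<omega> w v" "\<omega> w (t *\<^sub>R u) = t * \<omega> w u" "\<omega> w (u - v) = \<omega> w u - \<omega> w v" for u v w t
    by (simp_all add: \<omega>_def br_simps l\<pi>)
  have \<omega>x: "\<omega> x v = 0" "\<omega> v x = 0" for v
    using \<pi>A[of v] br_skew[of v x] by (simp_all add: \<omega>_def A_def l\<pi>)
  show False
  proof (cases "c = 0")
    case False
    have 1: "\<omega> u (A (A (A (A v)))) - c * \<omega> u (A v) + d * \<omega> u v = 0" for u v
      using arg_cong[OF N[of v], of "\<omega> u"] by (simp add: N_def \<omega>l \<omega>x)
    have 2: "\<omega> u (A (A (A (A v)))) + c * \<omega> u (A v) + d * \<omega> u v = 0" for u v
      using arg_cong[OF N[of u], of "\<lambda>y. \<omega> y v"] by (simp add: N_def \<omega>l \<omega>x \<omega>A)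
    have "c * \<omega> u (A v) = 0" for u v using 1[of u v] 2[of u v] by linarith
    then have A0: "\<omega> u (A v) = 0" for u v using False by simp
    have "\<omega> u v = 0" for u v using 1[of u v] A0 d by simp
    then have all: "\<pi> (br u v) = 0" for u v by (simp add: \<omega>_def)
    have "\<pi> z = 0" if "z \<in> derived" for z
      using that by (rule derived_induct) (auto simp: subspace_def l\<pi> all)
    then show False using perf \<pi>x by auto
  next
    case True
    define D' where "D' = - d"
    have A4: "A (A (A (A v))) = D' *\<^sub>R v" if "\<pi> v = 0" for v
      using N[of v] that True unfolding N_def by (simp add: D'_def eq_neg_iff_add_eq_0)
    define b where "b u v = br u v - \<omega> u v *\<^sub>R x" for u v
    have b\<pi>: "\<pi> (b u v) = 0" for u v by (simp add: b_def l\<pi> \<pi>x \<omega>_def)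
    have bA: "A (b u v) = b (A u) v + b u (A v)" for u v
      by (simp add: b_def A_simps Ax D \<omega>A algebra_simps)
    have bl: "b (t *\<^sub>R u) v = t *\<^sub>R b u v" "b u (t *\<^sub>R v) = t *\<^sub>R b u v" for t u v
      by (simp_all add: b_def br_simps \<omega>l algebra_simps)
    have n: "w + w = 2 *\<^sub>R w" for w :: 'e by (simp add: scaleR_2)
    have b2: "A (A (b u v)) = b (A (A u)) v + 2 *\<^sub>R b (A u) (A v) + b u (A (A v))" for u v
      unfolding bA A_simps by (simp add: n[symmetric])
    have b4: "A (A (A (A (b u v)))) = b (A (A (A (A u)))) v + 4 *\<^sub>R b (A (A (A u))) (A v)
        + 6 *\<^sub>R b (A (A u)) (A (A v)) + 4 *\<^sub>R b (A u) (A (A (A v))) + b u (A (A (A (A v))))" for u v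
    proof -
      have "4 *\<^sub>R w = w + w + w + w" "6 *\<^sub>R w = w + w + w + w + w + w" for w :: 'e
        using scaleR_left_distrib[of 2 2 w] scaleR_left_distrib[of 4 2 w] by (simp_all add: scaleR_2)
      then show ?thesis unfolding b2 A_simps by (simp add: n[symmetric])
    qed
    have b0: "b u v = 0" if u: "\<pi> u = 0" and v: "\<pi> v = 0" for u v
    proof -
      note A4u = A4[OF u] and A4v = A4[OF v]
      define p where "p = D' *\<^sub>R b u v"
      define q where "q = b (A (A (A u))) (A v)"
      define r where "r = b (A (A u)) (A (A v))"
      define s where "s = b (A u) (A (A (A v)))"
      have D0: "D' \<noteq> 0" using d by (simp add: D'_def)
      have e1: "p + 4 *\<^sub>R q + 6 *\<^sub>R r + 4 *\<^sub>R s = 0"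
        using b4[of u v] unfolding A4[OF b\<pi>] A4u A4v by (simp add: bl p_def q_def r_def s_def)
      have "D' *\<^sub>R (4 *\<^sub>R p + q + 4 *\<^sub>R r + 6 *\<^sub>R s) = 0"
        using b4[of "A (A (A u))" "A v"] unfolding A4[OF b\<pi>] A4u A4v
        by (simp add: A_simps A4u A4v bl p_def q_def r_def s_def algebra_simps)
      then have e2: "4 *\<^sub>R p + q + 4 *\<^sub>R r + 6 *\<^sub>R s = 0" using D0 by simp
      have "D' *\<^sub>R (6 *\<^sub>R p + 4 *\<^sub>R q + r + 4 *\<^sub>R s) = 0"
        using b4[of "A (A u)" "A (A v)"] unfolding A4[OF b\<pi>] A4u A4v
        by (simp add: A_simps A4u A4v bl p_def q_def r_def s_def algebra_simps)
      then have e3: "6 *\<^sub>R p + 4 *\<^sub>R q + r + 4 *\<^sub>R s = 0" using D0 by simp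
      have "D' *\<^sub>R (4 *\<^sub>R p + 6 *\<^sub>R q + 4 *\<^sub>R r + s) = 0"
        using b4[of "A u" "A (A (A v))"] unfolding A4[OF b\<pi>] A4u A4v
        by (simp add: A_simps A4u A4v bl p_def q_def r_def s_def algebra_simps)
      then have e4: "4 *\<^sub>R p + 6 *\<^sub>R q + 4 *\<^sub>R r + s = 0" using D0 by simp
      have "p \<bullet> k = 0" for k
      proof -
        have "p \<bullet> k + 4 * (q \<bullet> k) + 6 * (r \<bullet> k) + 4 * (s \<bullet> k) = 0" using arg_cong[OF e1, of "\<lambda>y. y \<bullet> k"] by (simp add: inner_add_left)
        moreover have "4 * (p \<bullet> k) + q \<bullet> k + 4 * (r \<bullet> k) + 6 * (s \<bullet> k) = 0" using arg_cong[OF e2, of "\<lambda>y. y \<bullet> k"] by (simp add: inner_add_left)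
        moreover have "6 * (p \<bullet> k) + 4 * (q \<bullet> k) + r \<bullet> k + 4 * (s \<bullet> k) = 0" using arg_cong[OF e3, of "\<lambda>y. y \<bullet> k"] by (simp add: inner_add_left)
        moreover have "4 * (p \<bullet> k) + 6 * (q \<bullet> k) + 4 * (r \<bullet> k) + s \<bullet> k = 0" using arg_cong[OF e4, of "\<lambda>y. y \<bullet> k"] by (simp add: inner_add_left)
        ultimately show ?thesis by linarith
      qed
      then have "p = 0" by (metis inner_eq_zero_iff)
      then show ?thesis using D0 by (simp add: p_def)
    qed
    show False
    proof (rule no_perfect_line_bracket[OF dim perf \<pi> \<pi>x])
      show "\<pi> (br x v) = 0" for v using \<pi>A by (simp add: A_def)
      show "v = 0" if "\<pi> v = 0" "br x v = 0" for v
        using A4[OF that(1)] that(2) d by (simp add: A_def[symmetric] D'_def A_simps)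
      show "br u v = \<pi> (br u v) *\<^sub>R x" if "\<pi> u = 0" "\<pi> v = 0" for u v
        using b0[OF that] by (simp add: b_def \<omega>_def)
    qed
  qed
qed

text \<open>
  The radical of the Killing form is an ideal, and it is nonzero. If it is the whole algebra, some
  \<open>ad x\<close> is not nilpotent and satisfies \<open>A\<^sup>4 = c A - d\<close> modulo \<open>x\<close>. The case \<open>d \<noteq> 0\<close> is impossible, and
  \<open>d = 0\<close> gives \<open>A\<^sup>5 = c A\<^sup>2\<close>, where \<open>c \<noteq> 0\<close> because \<open>A\<close> is not nilpotent.
\<close>

lemma perfect_contact_5_has_ideal:
  assumes dim: "DIM('e) = 5" and perf: "derived = UNIV" and contact: "contact_lie_algebra UNIV br"
  shows "\<exists>I. subspace I \<and> (\<forall>x y. y \<in> I \<longrightarrow> br x y \<in> I) \<and> I \<noteq> {0} \<and> I \<noteq> UNIV"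
proof -
  define R where "R = {x. \<forall>y. killing x y = 0}"
  have R: "subspace R" by (auto simp: R_def subspace_def killing_linear)
  have ideal: "br z x \<in> R" if "x \<in> R" for x z
  proof -
    have "killing (br z x) y = - killing x (br z y)" for y
      unfolding br_skew[of z x] killing_linear killing_invariant ..
    then show ?thesis using that by (simp add: R_def)
  qed
  have R0: "R \<noteq> {0}" using killing_degenerate[OF dim perf contact] by (auto simp: R_def)
  show ?thesis
  proof (cases "R = UNIV")
    case False then show ?thesis using R ideal R0 by blast
  next
    case True
    then have \<kappa>: "killing x x = 0" for x by (auto simp: R_def)
    obtain x where nn: "\<And>n. \<exists>y. (br x ^^ n) y \<noteq> 0" using perfect_5_not_nilpotent[OF dim perf] by blast
    have x: "x \<noteq> 0" using nn[of 1] by (auto simp: br_simps)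
    obtain c d where CH: "\<And>y. \<exists>s. br x (br x (br x (br x y))) = c *\<^sub>R br x y - d *\<^sub>R y + s *\<^sub>R x"
      using killing_zero_cayley_hamilton[OF dim perf \<kappa>] by blast
    have d: "d = 0" using no_perfect_quartic[OF dim perf _ x CH] by blast
    have A5: "br x (br x (br x (br x (br x y)))) = c *\<^sub>R br x (br x y)" for y
    proof -
      obtain s where "br x (br x (br x (br x y))) = c *\<^sub>R br x y - d *\<^sub>R y + s *\<^sub>R x" using CH by blast
      then show ?thesis unfolding d by (simp add: br_simps)
    qed
    have "c \<noteq> 0"
    proof
      assume "c = 0"
      then have "(br x ^^ 5) y = 0" for y using A5[of y] by (simp add: numeral_eq_Suc)
      then show False using nn by blast
    qed
    then show ?thesis using proper_ideal_from_cubic[OF nn _ A5] by blast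
  qed
qed

end

section \<open>Nonsolvable contact Lie algebras of dimension five\<close>

lemma commutator_lie_algebra:
  assumes "subspace W" "\<And>X Y. X \<in> W \<Longrightarrow> Y \<in> W \<Longrightarrow> commutator X Y \<in> W"
  shows "lie_algebra W (commutator :: real^2^2 \<Rightarrow> real^2^2 \<Rightarrow> real^2^2)"
proof
  show "linear_on W (commutator X)" for X :: "real^2^2"
    by (simp add: linear_on_def vec_eq_iff forall_2 commutator_2_nth algebra_simps)
  show "linear_on W (\<lambda>X. commutator X Y)" for Y :: "real^2^2"
    by (simp add: linear_on_def vec_eq_iff forall_2 commutator_2_nth algebra_simps)
  show "commutator X X = 0" for X :: "real^2^2" by (simp add: commutator_def)
  show "commutator X (commutator Y Z) + commutator Y (commutator Z X) + commutator Z (commutator X Y) = 0" for X Y Z :: "real^2^2"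
    by (simp add: vec_eq_iff forall_2 commutator_2_nth algebra_simps)
qed (use assms in auto)

context lie_space begin

text \<open>
  A proper ideal \<open>I\<close> is a plane, and abelian, since \<open>[p, q]\<close> would span a one-dimensional ideal. The
  action \<open>R\<close> on \<open>I\<close> is nonzero, as \<open>I\<close> is not central, and its image is a perfect subalgebra of \<open>sl(2)\<close>,
  hence all of it, with kernel \<open>I\<close>. Lifts \<open>h, e0, f0\<close> of the standard basis satisfy the relations of
  \<open>sl(2)\<close> up to elements of \<open>I\<close>. As \<open>ad h\<close> has the eigenvalues \<open>1, -1\<close> on \<open>I\<close>, different from \<open>2, -2\<close>, the
  error terms can be removed.
\<close>

lemma perfect_contact_5_isomorphic:
  assumes dim: "DIM('e) = 5" and perf: "derived = UNIV" and contact: "contact_lie_algebra UNIV br"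
  shows "lie_isomorphic UNIV br (UNIV \<times> sl2) R2_sl2_bracket"
proof -
  obtain I where I: "subspace I" "\<And>x y. y \<in> I \<Longrightarrow> br x y \<in> I" "I \<noteq> {0}" "I \<noteq> UNIV"
    using perfect_contact_5_has_ideal[OF assms] by blast
  have dI: "dim I = 2" by (rule perfect_5_ideal_dim[OF dim perf I])
  obtain p q where pq: "p \<in> I" "q \<in> I" and Ipq': "\<forall>w\<in>I. \<exists>a b. w = a *\<^sub>R p + b *\<^sub>R q"
    and ind': "\<forall>a b. a *\<^sub>R p + b *\<^sub>R q = 0 \<longrightarrow> a = 0 \<and> b = 0"
    by (rule subspace_dim_2_basis[OF I(1) dI]) (rule that)
  note Ipq = Ipq'[rule_format] and ind = ind'[rule_format]
  have uniq: "s = s' \<and> t = t'" if "s *\<^sub>R p + t *\<^sub>R q = s' *\<^sub>R p + t' *\<^sub>R q" for s t s' t'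
  proof -
    have "(s - s') *\<^sub>R p + (t - t') *\<^sub>R q = 0" using that by (simp add: algebra_simps)
    then show ?thesis using ind by force
  qed
  have "\<exists>a b. br x p = a *\<^sub>R p + b *\<^sub>R q" for x by (rule Ipq[OF I(2)[OF pq(1)]])
  then obtain a b where xp: "\<And>x. br x p = a x *\<^sub>R p + b x *\<^sub>R q" by metis
  have "\<exists>a b. br x q = a *\<^sub>R p + b *\<^sub>R q" for x by (rule Ipq[OF I(2)[OF pq(2)]])
  then obtain a' b' where xq: "\<And>x. br x q = a' x *\<^sub>R p + b' x *\<^sub>R q" by metis
  have pq0: "br p q = 0"
  proof (rule ccontr)
    assume ne: "br p q \<noteq> 0"
    have "br x (br p q) = (a x + b' x) *\<^sub>R br p q" for x
      unfolding br_jacobi[of x p q] xp[of x] xq[of x] by (simp add: br_simps algebra_simps)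
    then have "br x y \<in> span {br p q}" if "y \<in> span {br p q}" for x y
      using that by (auto simp: span_singleton br_simps)
    moreover have d1: "dim (span {br p q}) = 1" using ne by simp
    moreover have "span {br p q} \<noteq> {0}" using ne span_base[of "br p q" "{br p q}"] by auto
    moreover have "span {br p q} \<noteq> UNIV"
    proof
      assume "span {br p q} = UNIV"
      then have "dim (span {br p q}) = 5" using dim by (simp only: dim_UNIV)
      then show False using d1 by simp
    qed
    ultimately have "dim (span {br p q}) = 2" by (intro perfect_5_ideal_dim[OF dim perf subspace_span]) auto
    then show False using d1 by simp
  qed
  define R :: "'e \<Rightarrow> real^2^2" where "R x = vector [vector [a x, a' x], vector [b x, b' x]]" for x
  have Rn: "R x $ 1 $ 1 = a x" "R x $ 1 $ 2 = a' x" "R x $ 2 $ 1 = b x" "R x $ 2 $ 2 = b' x" for x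
    by (simp_all add: R_def)
  have add: "a (x + y) = a x + a y \<and> b (x + y) = b x + b y" "a' (x + y) = a' x + a' y \<and> b' (x + y) = b' x + b' y" for x y
    using br_simps(2)[of x y p] br_simps(2)[of x y q] unfolding xp xq by (intro uniq, simp add: algebra_simps)+
  have sc: "a (c *\<^sub>R x) = c * a x \<and> b (c *\<^sub>R x) = c * b x" "a' (c *\<^sub>R x) = c * a' x \<and> b' (c *\<^sub>R x) = c * b' x" for c x
    using br_simps(6)[of c x p] br_simps(6)[of c x q] unfolding xp xq by (intro uniq, simp add: algebra_simps)+
  have linR: "linear R"
    by (rule linearI) (simp_all add: vec_eq_iff forall_2 Rn add sc)
  have brp: "br (br x y) w = br x (br y w) - br y (br x w)" for x y w
    by (simp add: br_jacobi[of x y w])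
  have cp: "a (br x y) = (a y * a x + b y * a' x) - (a x * a y + b x * a' y) \<and>
    b (br x y) = (a y * b x + b y * b' x) - (a x * b y + b x * b' y)" for x y
    by (rule uniq) (use brp[of x y p] in \<open>simp add: br_simps xp xq algebra_simps\<close>)
  have cq: "a' (br x y) = (a' y * a x + b' y * a' x) - (a' x * a y + b' x * a' y) \<and>
    b' (br x y) = (a' y * b x + b' y * b' x) - (a' x * b y + b' x * b' y)" for x y
    by (rule uniq) (use brp[of x y q] in \<open>simp add: br_simps xp xq algebra_simps\<close>)
  have Rbr: "R (br x y) = commutator (R x) (R y)" for x y
    by (simp add: vec_eq_iff forall_2 commutator_2_nth Rn cp cq algebra_simps)
  have Rsl2: "R z \<in> sl2" for z
  proof -
    have "z \<in> derived" using perf by simp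
    then show ?thesis
    proof (rule derived_induct)
      show "subspace {z. R z \<in> sl2}"
        by (auto simp: subspace_def sl2_iff linear_0[OF linR] linear_add[OF linR] linear_scale[OF linR])
      show "R (br x y) \<in> sl2" for x y by (simp add: Rbr sl2_iff commutator_2_nth)
    qed
  qed
  have Wsub: "subspace (range R)" by (rule linear_subspace_image[OF linR subspace_UNIV])
  have Wlie: "lie_algebra (range R) commutator"
    by (rule commutator_lie_algebra[OF Wsub]) (auto simp flip: Rbr)
  have "{commutator X Y |X Y. X \<in> range R \<and> Y \<in> range R} = R ` {br x y |x y. x \<in> UNIV \<and> y \<in> UNIV}"
    by (auto simp: Rbr image_def) (metis Rbr)+
  then have Wder: "lie_derived (range R) commutator = range R"
    using perf by (simp add: lie_derived_def linear_span_image[OF linR])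
  have "range R \<noteq> {0}"
  proof
    assume "range R = {0}"
    then have "R x = 0" for x by blast
    then have z: "a x = 0" "b x = 0" "a' x = 0" "b' x = 0" for x using Rn[of x] by simp_all
    have "br u y = 0" if uI: "u \<in> I" for u y
    proof -
      obtain s t where "u = s *\<^sub>R p + t *\<^sub>R q" using Ipq[OF uI] by blast
      then have "br y u = 0" by (simp add: br_simps xp xq z)
      then show ?thesis using br_skew[of u y] by simp
    qed
    then show False using contact_no_central_plane[OF dim contact I(1) dI] by blast
  qed
  then have dW: "3 \<le> dim (range R)" by (rule perfect_dim_ge_3[OF Wlie Wder])
  have "dim (sl2 :: (real^2^2) set) < 4"
  proof -
    have "mat 1 \<notin> (sl2 :: (real^2^2) set)" by (simp add: sl2_iff mat_def)
    then have "span sl2 \<subset> (span UNIV :: (real^2^2) set)" using subspace_sl2 by (auto simp: span_eq_iff[THEN iffD2])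
    then have "dim (sl2 :: (real^2^2) set) < dim (UNIV :: (real^2^2) set)" by (rule dim_psubset)
    then show ?thesis by (simp add: dim_UNIV)
  qed
  then have W: "range R = sl2"
    using Rsl2 dW by (intro subspace_dim_equal[OF Wsub subspace_sl2]) auto
  have "vector [vector [1, 0], vector [0, -1]] \<in> range R" "vector [vector [0, 1], vector [0, 0]] \<in> range R"
    "vector [vector [0, 0], vector [1, 0]] \<in> range R" unfolding W by (simp_all add: sl2_iff)
  then obtain h e0 f0 where R3: "R h = vector [vector [1, 0], vector [0, -1]]"
    "R e0 = vector [vector [0, 1], vector [0, 0]]" "R f0 = vector [vector [0, 0], vector [1, 0]]"
    by (metis rangeE)
  have ah: "a h = 1" "a' h = 0" "b h = 0" "b' h = -1" and ae: "a e0 = 0" "a' e0 = 1" "b e0 = 0" "b' e0 = 0"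
    and af: "a f0 = 0" "a' f0 = 0" "b f0 = 1" "b' f0 = 0"
    using Rn[of h] Rn[of e0] Rn[of f0] by (simp_all add: R3)
  have qp0: "br q p = 0" using br_skew[of q p] pq0 by simp
  have ap: "a p = 0" "b p = 0" "a' p = 0" "b' p = 0" and aq: "a q = 0" "b q = 0" "a' q = 0" "b' q = 0"
    using ind[of "a p" "b p"] xp[of p] ind[of "a' p" "b' p"] xq[of p] ind[of "a q" "b q"] xp[of q] ind[of "a' q" "b' q"] xq[of q]
    by (simp_all add: pq0 qp0 br_simps)
  have indep: "c1 = 0 \<and> c2 = 0 \<and> c3 = 0 \<and> c4 = 0 \<and> c5 = 0"
    if rel: "c1 *\<^sub>R p + c2 *\<^sub>R q + c3 *\<^sub>R h + c4 *\<^sub>R e0 + c5 *\<^sub>R f0 = 0" for c1 c2 c3 c4 c5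
  proof -
    have "a 0 = 0" "a' 0 = 0" "b 0 = 0" using sc[of 0 0] by simp_all
    then have "c3 = 0" "c4 = 0" "c5 = 0"
      using arg_cong[OF rel, of a] arg_cong[OF rel, of a'] arg_cong[OF rel, of b]
      by (simp_all add: add sc ap aq ah ae af)
    then show ?thesis using rel ind[of c1 c2] by simp
  qed
  have ker: "\<exists>s t. u = s *\<^sub>R p + t *\<^sub>R q" if "R u = 0" for u
  proof -
    obtain c1 c2 c3 c4 c5 where u: "u = c1 *\<^sub>R p + c2 *\<^sub>R q + c3 *\<^sub>R h + c4 *\<^sub>R e0 + c5 *\<^sub>R f0"
      by (rule basis_5[OF dim indep])
    have "a u = 0" "a' u = 0" "b u = 0" using Rn[of u] that by simp_all
    then have "c3 = 0" "c4 = 0" "c5 = 0" unfolding u by (simp_all add: add sc ap aq ah ae af)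
    then show ?thesis using u by auto
  qed
  have hp: "br h p = p" "br h q = - q" using xp[of h] xq[of h] ah by simp_all
  have nlin: "R (x - y) = R x - R y" "R (c *\<^sub>R x) = c *\<^sub>R R x" "R (x + y) = R x + R y" for x y c
    using linear_diff[OF linR] linear_scale[OF linR] linear_add[OF linR] by auto
  have "R (br h e0 - 2 *\<^sub>R e0) = 0"
    by (simp add: nlin Rbr R3 vec_eq_iff forall_2 commutator_2_nth)
  then obtain s1 t1 where he: "br h e0 - 2 *\<^sub>R e0 = s1 *\<^sub>R p + t1 *\<^sub>R q" using ker by blast
  have "R (br h f0 + 2 *\<^sub>R f0) = 0"
    by (simp add: nlin Rbr R3 vec_eq_iff forall_2 commutator_2_nth)
  then obtain s2 t2 where hf: "br h f0 + 2 *\<^sub>R f0 = s2 *\<^sub>R p + t2 *\<^sub>R q" using ker by blast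
  \<comment> \<open>the denominators are the differences of the eigenvalues \<open>2, -2\<close> and \<open>1, -1\<close>\<close>
  define e where "e = e0 + s1 *\<^sub>R p + (t1 / 3) *\<^sub>R q"
  define f where "f = f0 - (s2 / 3) *\<^sub>R p - t2 *\<^sub>R q"
  have he': "br h e0 = 2 *\<^sub>R e0 + s1 *\<^sub>R p + t1 *\<^sub>R q" using he by (simp add: algebra_simps)
  have hf': "br h f0 = s2 *\<^sub>R p + t2 *\<^sub>R q - 2 *\<^sub>R f0" using hf by (simp add: algebra_simps)
  have hee: "br h e = 2 *\<^sub>R e"
    unfolding e_def br_simps he' hp by (rule euclidean_eqI) (simp add: inner_add_left inner_diff_left algebra_simps)
  have hff: "br h f = -2 *\<^sub>R f"
    unfolding f_def br_simps hf' hp by (rule euclidean_eqI) (simp add: inner_add_left inner_diff_left algebra_simps)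
  have ep: "br e p = 0" "br e q = p" "br f p = q" "br f q = 0"
    by (simp_all add: e_def f_def br_simps xp[of e0] xq[of e0] xp[of f0] xq[of f0] ae af pq0 qp0)
  have Re: "R e = R e0" "R f = R f0"
    by (simp_all add: e_def f_def vec_eq_iff forall_2 nlin Rn ap aq)
  have "R (br e f - h) = 0"
    by (simp add: nlin Rbr Re R3 vec_eq_iff forall_2 commutator_2_nth)
  then obtain s3 t3 where ef: "br e f - h = s3 *\<^sub>R p + t3 *\<^sub>R q" using ker by blast
  \<comment> \<open>\<open>[e, f] - h\<close> lies in \<open>I\<close> and commutes with \<open>h\<close>, which is invertible on \<open>I\<close>\<close>
  have "br h (br e f) = 0" unfolding br_jacobi[of h e f] hee hff by (simp add: br_simps)
  then have "br h (br e f - h) = 0" by (simp add: br_simps)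
  then have "s3 *\<^sub>R p + (- t3) *\<^sub>R q = 0" unfolding ef by (simp add: br_simps hp)
  then have "s3 = 0 \<and> - t3 = 0" by (rule ind)
  then have efh: "br e f = h" using ef by simp
  have ind5: "c1 = 0 \<and> c2 = 0 \<and> c3 = 0 \<and> c4 = 0 \<and> c5 = 0"
    if "c1 *\<^sub>R p + c2 *\<^sub>R q + c3 *\<^sub>R h + c4 *\<^sub>R e + c5 *\<^sub>R f = 0" for c1 c2 c3 c4 c5
  proof -
    have "(c1 + c4 * s1 - c5 * (s2 / 3)) *\<^sub>R p + (c2 + c4 * (t1 / 3) - c5 * t2) *\<^sub>R q + c3 *\<^sub>R h + c4 *\<^sub>R e0 + c5 *\<^sub>R f0 = 0"
      using that unfolding e_def f_def by (simp add: algebra_simps)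
    from indep[OF this] show ?thesis by auto
  qed
  show ?thesis
    by (rule R2_sl2_table_isomorphic[OF dim pq0 hp ep hee hff efh ind5])
qed

text \<open>
  The derived series decreases, so it becomes stationary, at a nonzero ideal.
\<close>

lemma nonsolvable_perfect_ideal:
  assumes "\<not> lie_solvable UNIV br"
  obtains P where "subspace P" "\<And>u p. p \<in> P \<Longrightarrow> br u p \<in> P" "P \<noteq> {0}" "lie_algebra P br" "lie_derived P br = P"
proof -
  define D where "D k = ((\<lambda>S. lie_derived S br) ^^ k) UNIV" for k
  have DS: "D (Suc k) = lie_derived (D k) br" for k by (simp add: D_def)
  have ideal: "subspace (D k) \<and> (\<forall>u p. p \<in> D k \<longrightarrow> br u p \<in> D k)" for k
  proof (induction k)
    case 0 then show ?case by (simp add: D_def)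
  next
    case (Suc k)
    then show ?case using derived_ideal(1,2)[of "D k"] unfolding DS by blast
  qed
  have anti: "D (Suc k) \<subseteq> D k" for k
    unfolding DS lie_derived_def using ideal[of k] by (intro span_minimal) auto
  have "\<exists>k. dim (D (Suc k)) = dim (D k)"
  proof (rule ccontr)
    assume no: "\<not> ?thesis"
    have "dim (D k) + k \<le> DIM('e)" for k
    proof (induction k)
      case 0 show ?case by (simp add: dim_subset_UNIV)
    next
      case (Suc k)
      have "dim (D (Suc k)) \<le> dim (D k)" by (rule dim_subset[OF anti])
      moreover have "dim (D (Suc k)) \<noteq> dim (D k)" using no by blast
      ultimately show ?case using Suc by simp
    qed
    from this[of "Suc (DIM('e))"] show False by simp
  qed
  then obtain k where k: "dim (D (Suc k)) = dim (D k)" by blast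
  have eq: "D (Suc k) = D k" using k ideal anti by (intro subspace_dim_equal) auto
  show ?thesis
  proof (rule that[of "D k"])
    show "D k \<noteq> {0}" using assms unfolding lie_solvable_def D_def by blast
    show "lie_derived (D k) br = D k" using eq by (simp add: DS)
    show "lie_algebra (D k) br"
    proof
      show "linear_on (D k) (br x)" for x by (simp add: linear_on_def br_simps)
      show "linear_on (D k) (\<lambda>x. br x y)" for y by (simp add: linear_on_def br_simps)
      show "br x (br y z) + br y (br z x) + br z (br x y) = 0" for x y z
        using lie_algebra.jacobi[OF lie, of x y z] by simp
    qed (use ideal[of k] in \<open>auto simp: br_simps\<close>)
  qed (use ideal[of k] in auto)
qed

lemma contact_nonsolvable_5_iff:
  assumes dim: "DIM('e) = 5" and ns: "\<not> lie_solvable UNIV br"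
  shows "contact_lie_algebra UNIV br \<longleftrightarrow>
    lie_isomorphic UNIV br (UNIV \<times> sl2) (direct_sum_bracket aff_bracket commutator) \<or>
    lie_isomorphic UNIV br (UNIV \<times> so3) (direct_sum_bracket aff_bracket commutator) \<or>
    lie_isomorphic UNIV br (UNIV \<times> sl2) R2_sl2_bracket"
proof
  assume contact: "contact_lie_algebra UNIV br"
  obtain P where P: "subspace P" "\<And>u p. p \<in> P \<Longrightarrow> br u p \<in> P" "P \<noteq> {0}" "lie_algebra P br" "lie_derived P br = P"
    using nonsolvable_perfect_ideal[OF ns] by metis
  have "3 \<le> dim P" by (rule perfect_dim_ge_3[OF P(4,5,3)])
  moreover have "dim P \<noteq> 4" using no_perfect_dim_4[OF P(4,5)] by blast
  moreover have "dim P \<le> 5" using dim_subset_UNIV[of P] dim by simp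
  ultimately consider "dim P = 3" | "dim P = 5" by linarith
  then show "lie_isomorphic UNIV br (UNIV \<times> sl2) (direct_sum_bracket aff_bracket commutator) \<or>
    lie_isomorphic UNIV br (UNIV \<times> so3) (direct_sum_bracket aff_bracket commutator) \<or>
    lie_isomorphic UNIV br (UNIV \<times> sl2) R2_sl2_bracket"
  proof cases
    case 1
    then show ?thesis using simple_ideal_3_isomorphic[OF dim contact P(1) _ P(2,4,5)] by blast
  next
    case 2
    then have "P = UNIV" using P(1) dim by (metis dim_eq_full span_eq_iff)
    then show ?thesis using perfect_contact_5_isomorphic[OF dim _ contact] P(5) by blast
  qed
next
  assume "lie_isomorphic UNIV br (UNIV \<times> sl2) (direct_sum_bracket aff_bracket commutator) \<or>
    lie_isomorphic UNIV br (UNIV \<times> so3) (direct_sum_bracket aff_bracket commutator) \<or>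
    lie_isomorphic UNIV br (UNIV \<times> sl2) R2_sl2_bracket"
  then show "contact_lie_algebra UNIV br"
    using contact_if_aff_sl2[OF dim] contact_if_aff_so3[OF dim] contact_if_R2_sl2[OF dim] by blast
qed

end

section \<open>Decomposability of the models\<close>

lemma direct_sum_decomposable:
  fixes S :: "(real^'n^'n) set"
  assumes S: "subspace S" "\<And>X Y. X \<in> S \<Longrightarrow> Y \<in> S \<Longrightarrow> commutator X Y \<in> S" and ne: "S \<noteq> {0}"
  shows "lie_decomposable (UNIV \<times> S) (direct_sum_bracket aff_bracket commutator)"
proof -
  let ?I = "(UNIV :: (real \<times> real) set) \<times> {0 :: real^'n^'n}" and ?J = "{0 :: real \<times> real} \<times> S"
  have c0: "commutator X 0 = 0" for X :: "real^'n^'n"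
    by (simp add: commutator_def matrix_matrix_mult_def vec_eq_iff)
  have a0: "aff_bracket x 0 = 0" for x by (simp add: aff_bracket_def zero_prod_def)
  have "lie_ideal ?I (UNIV \<times> S) (direct_sum_bracket aff_bracket commutator)"
    using subspace_0[OF S(1)] by (auto simp: lie_ideal_def direct_sum_bracket_def c0 subspace_def zero_prod_def)
  moreover have "lie_ideal ?J (UNIV \<times> S) (direct_sum_bracket aff_bracket commutator)"
    using S by (auto simp: lie_ideal_def direct_sum_bracket_def a0 subspace_def)
      (auto simp: zero_prod_def)
  moreover have "?I \<noteq> {0}"
  proof
    assume "?I = {0}"
    moreover have "((1, 0), 0) \<in> ?I" by simp
    ultimately show False by (auto simp: zero_prod_def)
  qed
  moreover have "?J \<noteq> {0}" using ne subspace_0[OF S(1)] by (auto simp: zero_prod_def set_eq_iff)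
  moreover have "?I \<inter> ?J = {0}" using subspace_0[OF S(1)] by (auto simp: zero_prod_def)
  moreover have "UNIV \<times> S = {x + y |x y. x \<in> ?I \<and> y \<in> ?J}"
  proof -
    have "(p, X) = (p, 0) + (0, X)" for p :: "real \<times> real" and X :: "real^'n^'n" by simp
    then show ?thesis by (auto simp: zero_prod_def) 
  qed
  ultimately show ?thesis unfolding lie_decomposable_def by blast
qed

text \<open>
  Every nonzero ideal contains the first basis vector of \<open>\<real>\<^sup>2\<close>: bracketing with \<open>\<real>\<^sup>2\<close> produces a nonzero
  element of \<open>\<real>\<^sup>2\<close>, and \<open>\<real>\<^sup>2\<close> is irreducible. So two nonzero ideals meet.
\<close>

lemma R2_sl2_not_decomposable: "\<not> lie_decomposable (UNIV \<times> sl2) R2_sl2_bracket"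
proof
  assume "lie_decomposable (UNIV \<times> sl2) R2_sl2_bracket"
  then obtain I J where IJ: "lie_ideal I (UNIV \<times> sl2) R2_sl2_bracket" "lie_ideal J (UNIV \<times> sl2) R2_sl2_bracket"
    "I \<noteq> {0}" "J \<noteq> {0}" "I \<inter> J = {0}" unfolding lie_decomposable_def by blast
  have key: "(vector [1, 0], 0) \<in> I" if I: "lie_ideal I (UNIV \<times> sl2) R2_sl2_bracket" and ne: "I \<noteq> {0}"
    for I :: "((real^2) \<times> (real^2^2)) set"
  proof -
    have sub: "subspace I" and IM: "I \<subseteq> UNIV \<times> sl2" and br: "\<And>x y. x \<in> UNIV \<times> sl2 \<Longrightarrow> y \<in> I \<Longrightarrow> R2_sl2_bracket x y \<in> I"
      using I by (auto simp: lie_ideal_def)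
    have 0: "(0::real^2^2) \<in> sl2" by (simp add: sl2_iff)
    have from_vec: ?thesis if v: "(v, 0) \<in> I" "v \<noteq> 0" for v
    proof -
      define E :: "real^2^2" where "E = vector [vector [0, 1], vector [0, 0]]"
      define H :: "real^2^2" where "H = vector [vector [1, 0], vector [0, -1]]"
      have EH: "(0::real^2, E) \<in> UNIV \<times> sl2" "(0::real^2, H) \<in> UNIV \<times> sl2" by (simp_all add: E_def H_def sl2_iff)
      have "R2_sl2_bracket (0, E) (v, 0) = (vector [v$2, 0], 0)" "R2_sl2_bracket (0, H) (v, 0) = (vector [v$1, - v$2], 0)"
        by (simp_all add: R2_sl2_bracket_def E_def H_def matrix_vector_mult_def sum_2 vec_eq_iff forall_2 commutator_2_nth)
      then have mem: "(vector [v$2, 0], 0) \<in> I" "(vector [v$1, - v$2], 0) \<in> I" using br[OF EH(1) v(1)] br[OF EH(2) v(1)] by simp_all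
      show ?thesis
      proof (cases "v $ 2 = 0")
        case False
        have "(1 / v$2) *\<^sub>R (vector [v$2, 0], 0) \<in> I" by (rule subspace_scale[OF sub mem(1)])
        moreover have "(1 / v$2) *\<^sub>R (vector [v$2, 0] :: real^2, 0 :: real^2^2) = (vector [1, 0], 0)"
          using False by (simp add: vec_eq_iff forall_2)
        ultimately show ?thesis by simp
      next
        case True
        then have "v $ 1 \<noteq> 0" using v(2) by (auto simp: vec_eq_iff forall_2)
        have "(1 / v$1) *\<^sub>R (v, 0) \<in> I" by (rule subspace_scale[OF sub v(1)])
        moreover have "(1 / v$1) *\<^sub>R (v, 0 :: real^2^2) = (vector [1, 0], 0)"
          using True \<open>v $ 1 \<noteq> 0\<close> by (simp add: vec_eq_iff forall_2)
        ultimately show ?thesis by simp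
      qed
    qed
    obtain v X where vX: "(v, X) \<in> I" "(v, X) \<noteq> 0" using ne subspace_0[OF sub] by auto
    show ?thesis
    proof (cases "X = 0")
      case True
      then show ?thesis using from_vec vX by (simp add: zero_prod_def)
    next
      case False
      have "\<exists>w. X *v w \<noteq> 0"
      proof (rule ccontr)
        assume "\<not> ?thesis"
        then have "X *v w = 0 *v w" for w by simp
        then show False using False matrix_eq[of X 0] by blast
      qed
      then obtain w where w: "X *v w \<noteq> 0" by blast
      have "R2_sl2_bracket (w, 0) (v, X) \<in> I" using 0 by (intro br vX) simp
      moreover have "R2_sl2_bracket (w, 0) (v, X) = (- (X *v w), 0)"
        by (simp add: R2_sl2_bracket_def vec_eq_iff forall_2 commutator_2_nth)
      ultimately show ?thesis using from_vec w by simp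
    qed
  qed
  have "(vector [1, 0] :: real^2, 0 :: real^2^2) \<in> I \<inter> J" using key IJ by blast
  then have "(vector [1, 0] :: real^2, 0 :: real^2^2) = 0" using IJ(5) by blast
  then have "(vector [1, 0] :: real^2) $ 1 = 0" by (simp add: zero_prod_def)
  then show False by simp
qed

lemma sl2_ne_0: "(sl2 :: (real^2^2) set) \<noteq> {0}"
proof
  assume eq: "(sl2 :: (real^2^2) set) = {0}"
  have "vector [vector [0, 1], vector [0, 0]] \<in> (sl2 :: (real^2^2) set)" by (simp add: sl2_iff)
  then have "(vector [vector [0, 1], vector [0, 0]] :: real^2^2) = 0" unfolding eq by blast
  then have "(vector [vector [0, 1], vector [0, 0]] :: real^2^2) $ 1 $ 2 = 0" by simp
  then show False by simp
qed

lemma so3_ne_0: "(so3 :: (real^3^3) set) \<noteq> {0}"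
proof
  assume eq: "(so3 :: (real^3^3) set) = {0}"
  have "vector [vector [0, 1, 0], vector [-1, 0, 0], vector [0, 0, 0]] \<in> (so3 :: (real^3^3) set)"
    by (simp add: so3_iff vector_3)
  then have "(vector [vector [0, 1, 0], vector [-1, 0, 0], vector [0, 0, 0]] :: real^3^3) = 0" unfolding eq by blast
  then have "(vector [vector [0, 1, 0], vector [-1, 0, 0], vector [0, 0, 0]] :: real^3^3) $ 1 $ 2 = 0" by simp
  then show False by (simp add: vector_3)
qed

section \<open>Solvable Lie algebras of dimension five\<close>

text \<open>
  On \<open>V / W\<close>, \<open>E = [R, S]\<close> commutes with \<open>S\<close>. If \<open>E\<close> is invertible there, the identity is the
  commutator \<open>[E\<^sup>-\<^sup>1 R, S]\<close>, so its trace \<open>dim (V / W)\<close> vanishes. The quotient is realised on the range of the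
  orthogonal projection \<open>q\<close>, and \<open>E\<close> is extended to \<open>G\<close> by the identity on the complement in order to have an inverse \<open>F\<close>.
\<close>

lemma no_invertible_commutator:
  fixes E R S :: "'e::euclidean_space \<Rightarrow> 'e"
  assumes V: "subspace V" and W: "subspace W" "W \<subseteq> V" and lin: "linear E" "linear R" "linear S"
    and EV: "\<And>v. v \<in> V \<Longrightarrow> E v \<in> V" and RV: "\<And>v. v \<in> V \<Longrightarrow> R v \<in> V" and SV: "\<And>v. v \<in> V \<Longrightarrow> S v \<in> V"
    and EW: "\<And>w. w \<in> W \<Longrightarrow> E w \<in> W" and RW: "\<And>w. w \<in> W \<Longrightarrow> R w \<in> W" and SW: "\<And>w. w \<in> W \<Longrightarrow> S w \<in> W"
    and com: "\<And>v. v \<in> V \<Longrightarrow> E v - (R (S v) - S (R v)) \<in> W" "\<And>v. v \<in> V \<Longrightarrow> S (E v) - E (S v) \<in> W"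
    and surj: "\<And>v. v \<in> V \<Longrightarrow> \<exists>v'\<in>V. v - E v' \<in> W"
  shows "V = W"
proof -
  obtain qv :: "'e \<Rightarrow> 'e" where qv: "linear qv" "\<And>x. qv x = 0 \<longleftrightarrow> x \<in> V" "\<And>x. qv (qv x) = qv x" "\<And>x y. qv x \<bullet> y = x \<bullet> qv y"
    by (rule orthogonal_projection_exists[OF V]) (rule that)
  obtain qw :: "'e \<Rightarrow> 'e" where qw: "linear qw" "\<And>x. qw x = 0 \<longleftrightarrow> x \<in> W" "\<And>x. qw (qw x) = qw x" "\<And>x y. qw x \<bullet> y = x \<bullet> qw y"
    by (rule orthogonal_projection_exists[OF W(1)]) (rule that)
  \<comment> \<open>the orthogonal projection onto the orthogonal complement of \<open>W\<close> in \<open>V\<close>\<close>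
  define q where "q y = qw y - qv y" for y
  have linq: "linear q" unfolding q_def by (rule linear_compose_sub[OF qw(1) qv(1)])
  note lq = linear_add[OF linq] linear_diff[OF linq] linear_0[OF linq]
  have qW: "q w = 0" if "w \<in> W" for w
    using that W(2) qw(2)[of w] qv(2)[of w] by (auto simp: q_def)
  have vq: "v - q v \<in> W" if "v \<in> V" for v
  proof -
    have "v - q v = v - qw v" using that qv(2)[of v] by (simp add: q_def)
    moreover have "qw (v - qw v) = 0" by (simp add: linear_diff[OF qw(1)] qw(3))
    ultimately show ?thesis using qw(2) by simp
  qed
  have qwqv: "qw (qv y) = qv y" for y
  proof -
    let ?u = "qv y - qw (qv y)"
    have "qw ?u = 0" by (simp add: linear_diff[OF qw(1)] qw(3))
    then have "?u \<in> V" using qw(2) W(2) by blast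
    then have "qv ?u = 0" using qv(2) by blast
    then have "qv y \<bullet> ?u = 0" using qv(4)[of y ?u] by simp
    moreover have "qw (qv y) \<bullet> ?u = 0" using qw(4)[of "qv y" ?u] \<open>qw ?u = 0\<close> by simp
    ultimately have "?u \<bullet> ?u = 0" by (simp add: inner_diff_left)
    then show ?thesis by simp
  qed
  have qV: "q y \<in> V" for y
  proof -
    have "qv (qw y) = qv y"
    proof (rule euclidean_eqI)
      fix b :: 'e
      show "qv (qw y) \<bullet> b = qv y \<bullet> b" using qv(4) qw(4) qwqv by metis
    qed
    then have "qv (q y) = 0" by (simp add: q_def linear_diff[OF qv(1)] qv(3))
    then show ?thesis using qv(2) by blast
  qed
  have idem: "q (q y) = q y" for y
  proof -
    have "qv (q y) = 0" using qv(2) qV by blast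
    then have "q (q y) = qw (qw y - qv y)" unfolding q_def[of "q y"] by (simp add: q_def)
    then show ?thesis by (simp add: linear_diff[OF qw(1)] qw(3) qwqv q_def)
  qed
  have adj: "q x \<bullet> y = x \<bullet> q y" for x y by (simp add: q_def inner_diff_left inner_diff_right qv(4) qw(4))
  define E' where "E' y = q (E (q y))" for y
  define R' where "R' y = q (R (q y))" for y
  define S' where "S' y = q (S (q y))" for y
  have linc: "linear (\<lambda>y. q (f (q y)))" if "linear f" for f
    using linear_compose[OF linear_compose[OF linq that] linq] by (simp add: o_def)
  have lin': "linear E'" "linear R'" "linear S'" unfolding E'_def R'_def S'_def by (intro linc lin)+
  have red: "q (f (q v)) = q (f v)" if "linear f" "\<And>w. w \<in> W \<Longrightarrow> f w \<in> W" "v \<in> V" for f v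
  proof -
    have "f (v - q v) \<in> W" using that(2) vq[OF that(3)] by blast
    then show ?thesis using qW by (fastforce simp: lq linear_diff[OF that(1)])
  qed
  have E'V: "E' v = q (E v)" and R'V: "R' v = q (R v)" and S'V: "S' v = q (S v)" if "v \<in> V" for v
    unfolding E'_def R'_def S'_def using red that lin EW RW SW by blast+
  have q': "q (E' y) = E' y" "q (S' y) = S' y" "E' (q y) = E' y" "S' (q y) = S' y" for y
    by (simp_all add: E'_def S'_def idem)
  have E'eq: "E' y = R' (S' y) - S' (R' y)" for y
  proof -
    let ?v = "q y"
    have "R' (S' y) = q (R (S ?v))" "S' (R' y) = q (S (R ?v))"
      unfolding R'_def S'_def idem using red[OF lin(2) RW SV[OF qV], of y] red[OF lin(3) SW RV[OF qV], of y] by simp_all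
    moreover have "q (E ?v - (R (S ?v) - S (R ?v))) = 0" by (intro qW com qV)
    ultimately show ?thesis by (simp add: E'_def lq)
  qed
  have S'E': "S' (E' y) = E' (S' y)" for y
  proof -
    let ?v = "q y"
    have "S' (E' y) = q (S (E ?v))" "E' (S' y) = q (E (S ?v))"
      unfolding E'_def S'_def idem using red[OF lin(3) SW EV[OF qV], of y] red[OF lin(1) EW SV[OF qV], of y] by simp_all
    moreover have "q (S (E ?v) - E (S ?v)) = 0" by (intro qW com qV)
    ultimately show ?thesis by (simp add: lq)
  qed
  define G where "G y = E' y + (y - q y)" for y
  have linG: "linear G" unfolding G_def
    by (intro linear_compose_add linear_compose_sub lin' linq linear_id[unfolded id_def])
  have "surj G"
  proof -
    have "\<exists>z. y = G z" for y
    proof -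
      obtain v' where v': "v' \<in> V" "q y - E v' \<in> W" using surj[OF qV[of y]] by blast
      have E'v: "E' v' = q y" using qW[OF v'(2)] E'V[OF v'(1)] by (simp add: lq idem)
      have "G (q v' + (y - q y)) = y"
        unfolding G_def by (simp add: linear_add[OF lin'(1)] linear_diff[OF lin'(1)] q' E'v lq idem)
      then show ?thesis by metis
    qed
    then show ?thesis by (auto simp: surj_def)
  qed
  then have "inj G" using linear_surjective_imp_injective[OF linG] by blast
  then obtain F where F: "linear F" "\<And>y. F (G y) = y"
    using linear_injective_left_inverse[OF linG] by (metis comp_apply id_apply)
  have GF: "G (F y) = y" for y using \<open>surj G\<close> F(2) by (metis surjD)
  have S'G: "S' (G y) = G (S' y)" for y
    by (simp add: G_def linear_add[OF lin'(3)] linear_diff[OF lin'(3)] q' S'E')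
  have S'F: "S' (F y) = F (S' y)" for y using S'G[of "F y"] F(2) GF by metis
  have "G (y - q y) = y - q y" for y
    by (simp add: G_def linear_diff[OF lin'(1)] q' lq idem)
  then have F1: "F (y - q y) = y - q y" for y using F(2) by metis
  have FE: "F (E' y) = q y" for y
  proof -
    have "E' y = G y - (y - q y)" by (simp add: G_def)
    then show ?thesis by (simp add: linear_diff[OF F(1)] F(2) F1[unfolded linear_diff[OF F(1)]])
  qed
  have "op_trace q = op_trace (\<lambda>y. F (R' (S' y)) - S' (F (R' y)))"
  proof -
    have "q y = F (R' (S' y)) - S' (F (R' y))" for y
      using FE[of y] unfolding E'eq by (simp add: linear_diff[OF F(1)] S'F)
    then show ?thesis by (simp add: fun_eq_iff op_trace_def)
  qed
  also have "\<dots> = 0"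
  proof -
    have "linear (\<lambda>y. F (R' y))" using linear_compose[OF lin'(2) F(1)] by (simp add: o_def)
    from op_trace_comp_commute[OF this lin'(3)] show ?thesis by (simp add: op_trace_diff)
  qed
  finally have "(\<Sum>b\<in>Basis. q b \<bullet> q b) = 0"
    unfolding op_trace_def by (metis (no_types, lifting) adj idem sum.cong)
  then have "q b = 0" if "b \<in> Basis" for b
    using that by (subst (asm) sum_nonneg_eq_0_iff) auto
  then have q0: "q y = 0" for y by (rule linear_zero_on_Basis[OF linq])
  have "v \<in> W" if "v \<in> V" for v using vq[OF that] q0 by simp
  then show ?thesis using W(2) by blast
qed

lemma functional_5:
  fixes b1 b2 b3 b4 b5 :: "'e::euclidean_space"
  assumes "DIM('e) = 5" and ind: "\<And>c1 c2 c3 c4 c5. c1 *\<^sub>R b1 + c2 *\<^sub>R b2 + c3 *\<^sub>R b3 + c4 *\<^sub>R b4 + c5 *\<^sub>R b5 = 0 \<Longrightarrow>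
    c1 = 0 \<and> c2 = 0 \<and> c3 = 0 \<and> c4 = 0 \<and> c5 = 0"
  obtains \<eta> :: "'e \<Rightarrow> real" where "linear \<eta>" "\<eta> b1 = t1" "\<eta> b2 = t2" "\<eta> b3 = t3" "\<eta> b4 = t4" "\<eta> b5 = t5"
proof -
  define h where "h p = fst p *\<^sub>R b1 + fst (snd p) *\<^sub>R b2 + fst (snd (snd p)) *\<^sub>R b3
    + fst (snd (snd (snd p))) *\<^sub>R b4 + snd (snd (snd (snd p))) *\<^sub>R b5" for p :: "real \<times> real \<times> real \<times> real \<times> real"
  have lin: "linear h" unfolding h_def by (rule linearI) (simp_all add: algebra_simps)
  have "bij h"
  proof (rule bij_linear_dim[OF lin])
    show "p = 0" if "h p = 0" for p using ind[OF that[unfolded h_def]] by (auto simp: prod_eq_iff)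
  qed (simp add: assms(1))
  then obtain k where k: "linear k" "\<And>p. k (h p) = p"
    using linear_injective_left_inverse[OF lin] by (metis bij_is_inj comp_apply id_apply)
  define \<eta> where "\<eta> u = t1 * fst (k u) + t2 * fst (snd (k u)) + t3 * fst (snd (snd (k u)))
    + t4 * fst (snd (snd (snd (k u)))) + t5 * snd (snd (snd (snd (k u))))" for u
  have "linear \<eta>" unfolding \<eta>_def
    by (rule linearI) (simp_all add: linear_add[OF k(1)] linear_scale[OF k(1)] algebra_simps)
  moreover have "k b1 = (1, 0, 0, 0, 0)" "k b2 = (0, 1, 0, 0, 0)" "k b3 = (0, 0, 1, 0, 0)" "k b4 = (0, 0, 0, 1, 0)" "k b5 = (0, 0, 0, 0, 1)"
    using k(2)[of "(1, 0, 0, 0, 0)"] k(2)[of "(0, 1, 0, 0, 0)"] k(2)[of "(0, 0, 1, 0, 0)"] k(2)[of "(0, 0, 0, 1, 0)"] k(2)[of "(0, 0, 0, 0, 1)"]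
    by (simp_all add: h_def)
  ultimately show ?thesis by (intro that[of \<eta>]) (simp_all add: \<eta>_def)
qed

lemma relation_3_in_plane:
  fixes S :: "'e::euclidean_space set"
  assumes "subspace S" "dim S < 3" "x \<in> S" "y \<in> S" "z \<in> S"
  obtains a b c where "a *\<^sub>R x + b *\<^sub>R y + c *\<^sub>R z = 0" "\<not> (a = 0 \<and> b = 0 \<and> c = 0)"
proof -
  define h where "h p = fst p *\<^sub>R x + fst (snd p) *\<^sub>R y + snd (snd p) *\<^sub>R z" for p :: "real \<times> real \<times> real"
  have lin: "linear h" unfolding h_def by (rule linearI) (simp_all add: algebra_simps)
  have "\<not> inj h"
  proof
    assume "inj h"
    then have "dim (range h) = 3" using dim_linear_image_inj[OF lin, of UNIV] by (simp add: dim_UNIV)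
    moreover have "range h \<subseteq> S" using assms by (auto simp: h_def subspace_add subspace_scale)
    ultimately show False using dim_subset[of "range h" S] assms(2) by simp
  qed
  then obtain p where "h p = 0" "p \<noteq> 0" using linear_injective_0[OF lin] by blast
  then show ?thesis using that[of "fst p" "fst (snd p)" "snd (snd p)"] by (auto simp: h_def prod_eq_iff)
qed

lemma subspace_codim_1_decomposition:
  fixes K D :: "'e::euclidean_space set"
  assumes "subspace K" "subspace D" "K \<subseteq> D" "dim D = dim K + 1" "d \<in> D" "d \<notin> K" "u \<in> D"
  obtains t k where "k \<in> K" "u = t *\<^sub>R d + k"
proof -
  have "span (insert d K) = D"
  proof (rule subspace_dim_equal)
    have "K \<subset> span (insert d K)" using assms(6) span_base[of d "insert d K"] span_superset[of "insert d K"] by blast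
    then have "span K \<subset> span (span (insert d K))" using assms(1) by (simp add: span_eq_iff[THEN iffD2])
    then have "dim K < dim (span (insert d K))" by (rule dim_psubset)
    then show "dim D \<le> dim (span (insert d K))" using assms(4) by simp
    show "span (insert d K) \<subseteq> D" using assms by (intro span_minimal) auto
  qed (use assms in auto)
  then obtain t where "u - t *\<^sub>R d \<in> span K" using assms(7) by (metis span_breakdown_eq)
  then have "u - t *\<^sub>R d \<in> K" using assms(1) by (simp add: span_eq_iff[THEN iffD2])
  then show ?thesis using that[of "u - t *\<^sub>R d" t] by simp
qed

context lie_space begin

lemma solvable_not_perfect:
  assumes "lie_solvable UNIV br" "lie_derived K br = K"
  shows "K = {0}"
proof -
  have mono: "lie_derived A br \<subseteq> lie_derived B br" if "A \<subseteq> B" for A B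
    unfolding lie_derived_def using that by (intro span_mono) blast
  have sub: "K \<subseteq> ((\<lambda>S. lie_derived S br) ^^ k) UNIV" for k
  proof (induction k)
    case (Suc k)
    then show ?case using mono[OF Suc] assms(2) by simp
  qed simp
  obtain k where "((\<lambda>S. lie_derived S br) ^^ k) UNIV = {0}" using assms(1) unfolding lie_solvable_def by blast
  then have "K \<subseteq> {0}" using sub by metis
  moreover have "0 \<in> lie_derived K br" unfolding lie_derived_def by (rule span_zero)
  then have "0 \<in> K" unfolding assms(2) .
  ultimately show ?thesis by blast
qed

abbreviation derived2 :: "'e set" where "derived2 \<equiv> lie_derived derived br"

lemma derived2_ideal:
  "subspace derived2" "p \<in> derived2 \<Longrightarrow> br u p \<in> derived2" "derived2 \<subseteq> derived"
  using derived_ideal[OF subspace_derived] br_in_derived by blast+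

text \<open>
  The instance of the preceding fact for \<open>ad\<close> operators: the first assumption on \<open>e\<close> says that it acts
  on \<open>V / W\<close> as \<open>[r, s]\<close>, the second that it commutes with \<open>s\<close> there.
\<close>

lemma no_surjective_action:
  assumes V: "subspace V" "\<And>u p. p \<in> V \<Longrightarrow> br u p \<in> V" and W: "subspace W" "\<And>u p. p \<in> W \<Longrightarrow> br u p \<in> W" "W \<subseteq> V"
    and e: "\<And>v. v \<in> V \<Longrightarrow> br (e - br r s) v \<in> W" "\<And>v. v \<in> V \<Longrightarrow> br (br s e) v \<in> W"
    and surj: "\<And>v. v \<in> V \<Longrightarrow> \<exists>v'\<in>V. v - br e v' \<in> W"
  shows "V = W"
proof (rule no_invertible_commutator[where E="br e" and R="br r" and S="br s"])
  show "br e v - (br r (br s v) - br s (br r v)) \<in> W" if "v \<in> V" for v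
    using e(1)[OF that] by (simp add: br_simps br_jacobi[of r s v])
  show "br s (br e v) - br e (br s v) \<in> W" if "v \<in> V" for v
    using e(2)[OF that] by (simp add: br_jacobi[of s e v])
qed (use assms in auto)

text \<open>
  Write \<open>D, D2, D3\<close> for the iterated derived ideals. If \<open>D = \<langle>e\<rangle> + D2\<close>, then \<open>ad e\<close> maps \<open>D2\<close> onto \<open>D2 / D3\<close>.
  If some \<open>u\<close> has \<open>[u, e] = c e\<close> modulo \<open>D2\<close> with \<open>c \<noteq> 0\<close>, then \<open>e\<close> is the bracket of \<open>u / c\<close> and \<open>e\<close> modulo
  \<open>D2\<close>. If there is no such \<open>u\<close>, then \<open>e = [x, y]\<close> with \<open>[y, e] \<in> D2\<close>. In both cases \<open>no_surjective_action\<close>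
  gives \<open>D2 = D3\<close>, which contradicts solvability.
\<close>

lemma derived2_codim_ne_1:
  assumes solv: "lie_solvable UNIV br" and ne: "derived2 \<noteq> {0}"
  shows "dim derived \<noteq> dim derived2 + 1"
proof
  assume d: "dim derived = dim derived2 + 1"
  note V = derived2_ideal
  have W: "subspace (lie_derived derived2 br)" "\<And>u p. p \<in> lie_derived derived2 br \<Longrightarrow> br u p \<in> lie_derived derived2 br"
    "lie_derived derived2 br \<subseteq> derived2"
    using derived_ideal[OF V(1)] V(2) by blast+
  have VW: "derived2 \<noteq> lie_derived derived2 br" using solvable_not_perfect[OF solv] ne by metis
  have "\<exists>x y. br x y \<notin> derived2"
  proof (rule ccontr)
    assume "\<not> ?thesis"
    then have all: "br x y \<in> derived2" for x y by blast
    have "z \<in> derived2" if "z \<in> derived" for z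
      using that
    proof (rule derived_induct)
      show "subspace {z. z \<in> derived2}" using V(1) by simp
    qed (rule all)
    then have "derived \<subseteq> derived2" by blast
    then have "dim derived \<le> dim derived2" by (rule dim_subset)
    then show False using d by simp
  qed
  then obtain x y where xy: "br x y \<notin> derived2" by blast
  define e where "e = br x y"
  have eD: "e \<in> derived" unfolding e_def by (rule br_in_derived)
  have dec: "\<exists>t. \<exists>k\<in>derived2. u = t *\<^sub>R e + k" if "u \<in> derived" for u
    using subspace_codim_1_decomposition[OF V(1) subspace_derived V(3) d eD xy[folded e_def] that] by metis
  have surj: "\<exists>v'\<in>derived2. v - br e v' \<in> lie_derived derived2 br" if v: "v \<in> derived2" for v
  proof -
    have "v \<in> span {br x y |x y. x \<in> derived \<and> y \<in> derived}" using v by (simp add: lie_derived_def)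
    then show ?thesis
    proof (rule span_induct)
      show "subspace {v. \<exists>v'\<in>derived2. v - br e v' \<in> lie_derived derived2 br}" (is "subspace ?X")
      proof (rule subspaceI)
        have "0 - br e 0 \<in> lie_derived derived2 br" by (simp add: br_simps subspace_0[OF W(1)])
        then show "0 \<in> ?X" using subspace_0[OF V(1)] by blast
      next
        fix a b assume "a \<in> ?X" "b \<in> ?X"
        then obtain a' b' where ab: "a' \<in> derived2" "b' \<in> derived2" "a - br e a' \<in> lie_derived derived2 br" "b - br e b' \<in> lie_derived derived2 br" by blast
        have "a + b - br e (a' + b') = (a - br e a') + (b - br e b')" by (simp add: br_simps)
        then have "a + b - br e (a' + b') \<in> lie_derived derived2 br" using subspace_add[OF W(1) ab(3,4)] by (simp only:)
        then show "a + b \<in> ?X" using subspace_add[OF V(1) ab(1,2)] by blast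
      next
        fix c a assume "a \<in> ?X"
        then obtain a' where a: "a' \<in> derived2" "a - br e a' \<in> lie_derived derived2 br" by blast
        have "c *\<^sub>R a - br e (c *\<^sub>R a') = c *\<^sub>R (a - br e a')" by (simp add: br_simps algebra_simps)
        then have "c *\<^sub>R a - br e (c *\<^sub>R a') \<in> lie_derived derived2 br" using subspace_scale[OF W(1) a(2)] by (simp only:)
        then show "c *\<^sub>R a \<in> ?X" using subspace_scale[OF V(1) a(1)] by blast
      qed
      fix z assume "z \<in> {br x y |x y. x \<in> derived \<and> y \<in> derived}"
      then obtain a b where z: "z = br a b" "a \<in> derived" "b \<in> derived" by blast
      obtain s k where a: "a = s *\<^sub>R e + k" "k \<in> derived2" using dec[OF z(2)] by blast
      obtain t l where b: "b = t *\<^sub>R e + l" "l \<in> derived2" using dec[OF z(3)] by blast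
      have "z - br e (s *\<^sub>R l - t *\<^sub>R k) = br k l"
        unfolding z a b by (simp add: br_simps br_skew[of k e])
      moreover have "br k l \<in> lie_derived derived2 br" using a b by (intro br_in_lie_derived)
      moreover have "s *\<^sub>R l - t *\<^sub>R k \<in> derived2" using a b V(1) by (simp add: subspace_diff subspace_scale)
      ultimately show "\<exists>v'\<in>derived2. z - br e v' \<in> lie_derived derived2 br" by metis
    qed
  qed
  show False
  proof (cases "\<exists>u. br u e \<notin> derived2")
    case True
    then obtain u where u: "br u e \<notin> derived2" by blast
    obtain c k where ck: "br u e = c *\<^sub>R e + k" "k \<in> derived2" using dec[OF br_in_derived] by blast
    have c: "c \<noteq> 0" using u ck by auto
    have "e - br ((1 / c) *\<^sub>R u) e = - ((1 / c) *\<^sub>R k)" using c by (simp add: br_simps ck algebra_simps)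
    then have "e - br ((1 / c) *\<^sub>R u) e \<in> derived2" using ck(2) V(1) by (simp add: subspace_neg subspace_scale)
    then have ed: "br (e - br ((1 / c) *\<^sub>R u) e) v \<in> lie_derived derived2 br" if "v \<in> derived2" for v
      using that by (rule br_in_lie_derived)
    have "derived2 = lie_derived derived2 br"
    proof (rule no_surjective_action[OF V(1,2) W, where r="(1 / c) *\<^sub>R u" and s=e and e=e])
      show "br (br e e) v \<in> lie_derived derived2 br" for v by (simp add: br_simps subspace_0[OF W(1)])
    qed (use surj ed in blast)+
    then show False using VW by blast
  next
    case False
    have "derived2 = lie_derived derived2 br"
    proof (rule no_surjective_action[OF V(1,2) W, where r=x and s=y and e=e])
      show "br (e - br x y) v \<in> lie_derived derived2 br" for v by (simp add: e_def br_simps subspace_0[OF W(1)])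
      show "br (br y e) v \<in> lie_derived derived2 br" if "v \<in> derived2" for v
        by (rule br_in_lie_derived) (use False that in blast)+
    qed (use surj in blast)+
    then show False using VW by blast
  qed
qed

text \<open>
  The algebra acts on the line of \<open>z\<close> by the character \<open>ch\<close>, and a character vanishes on brackets.
\<close>

lemma one_dim_ideal_character:
  assumes "\<And>x. br x z = ch x *\<^sub>R z" "z \<noteq> 0" "u \<in> derived"
  shows "br u z = 0"
  using assms(3)
proof (rule derived_induct)
  show "subspace {u. br u z = 0}" by (auto simp: subspace_def br_simps)
  show "br (br x y) z = 0" for x y
  proof -
    have "br (br x y) z = br x (br y z) - br y (br x z)" by (simp add: br_jacobi[of x y z])
    then show ?thesis by (simp add: assms(1) br_simps)
  qed
qed

text \<open>
  The derived ideal is the Heisenberg algebra with centre \<open>z\<close>. As \<open>z\<close> is not central in the whole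
  algebra, some \<open>x0\<close> acts on it by 1, and \<open>e1, e2'\<close> and \<open>x0, z\<close> are two hyperbolic pairs for \<open>\<omega> = \<eta>0 \<circ> [\<cdot>, \<cdot>]\<close>. The
  radical of \<open>\<omega>\<close> is a line outside the derived ideal. Since \<open>\<omega>\<close> depends only on the values of \<open>\<eta>0\<close> on the derived
  ideal, \<open>\<eta>0\<close> can be changed so as to be nonzero on that line.
\<close>

lemma contact_derived_3_nonabelian:
  assumes dim: "DIM('e) = 5" and solv: "lie_solvable UNIV br" and cen: "lie_center UNIV br = {0}"
    and d: "dim derived = 3" and na: "\<not> lie_abelian derived br"
  shows "contact_lie_algebra UNIV br"
proof -
  obtain e1 e2' where e12: "e1 \<in> derived" "e2' \<in> derived" "br e1 e2' \<noteq> 0" using na unfolding lie_abelian_def by blast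
  define z where "z = br e1 e2'"
  have z: "z \<noteq> 0" "z \<in> derived2" using e12 by (auto simp: z_def br_in_lie_derived)
  then have ne: "derived2 \<noteq> {0}" by auto
  have "derived2 \<noteq> derived" using solvable_not_perfect[OF solv] z derived2_ideal(3) by blast
  then have "dim derived2 \<noteq> 3" using subspace_dim_equal[OF derived2_ideal(1) subspace_derived derived2_ideal(3)] d by auto
  moreover have "dim derived2 \<le> 3" using dim_subset[OF derived2_ideal(3)] d by simp
  moreover have "dim derived2 \<noteq> 2" using derived2_codim_ne_1[OF solv ne] d by simp
  moreover have "dim derived2 \<noteq> 0" using ne subspace_0[OF derived2_ideal(1)] by (auto simp: dim_eq_0)
  ultimately have d2: "dim derived2 = 1" by linarith
  have "span {z} = derived2"
    using z d2 by (intro subspace_dim_equal[OF subspace_span derived2_ideal(1)]) (auto intro: span_minimal simp: derived2_ideal(1) span_minimal)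
  then have line: "\<exists>c. w = c *\<^sub>R z" if "w \<in> derived2" for w using that by (auto simp: span_singleton)
  have "\<exists>c. br x z = c *\<^sub>R z" for x by (intro line derived2_ideal(2) z)
  then obtain ch where ch: "\<And>x. br x z = ch x *\<^sub>R z" by metis
  have zD: "br u z = 0" if "u \<in> derived" for u by (rule one_dim_ideal_character[OF ch z(1) that])
  have "\<exists>x. br x z \<noteq> 0"
  proof (rule ccontr)
    assume "\<not> ?thesis"
    then have "z \<in> lie_center UNIV br" unfolding lie_center_def using br_skew[of z] by simp
    then show False using cen z by blast
  qed
  then obtain x where x: "br x z \<noteq> 0" by blast
  define x0 where "x0 = (1 / ch x) *\<^sub>R x"
  have "ch x \<noteq> 0" using x ch[of x] by auto
  then have "br x0 z = (1 / ch x) *\<^sub>R br x z" by (simp add: x0_def br_simps)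
  with \<open>ch x \<noteq> 0\<close> have x0: "br x0 z = z" by (simp add: ch[of x])
  define \<eta>0 where "\<eta>0 y = (y \<bullet> z) / (z \<bullet> z)" for y
  have lin0: "linear \<eta>0" unfolding \<eta>0_def by (rule linearI) (simp_all add: inner_add_left add_divide_distrib)
  note l0 = linear_add[OF lin0] linear_scale[OF lin0] linear_0[OF lin0] linear_neg[OF lin0]
  have \<eta>0z: "\<eta>0 z = 1" using z by (simp add: \<eta>0_def)
  define \<omega> where "\<omega> u v = \<eta>0 (br u v)" for u v
  have l\<omega>: "\<omega> (u + v) w = \<omega> u w + \<omega> v w" "\<omega> (c *\<^sub>R u) w = c * \<omega> u w" "\<omega> 0 w = 0" "\<omega> u u = 0" for u v w c
    by (simp_all add: \<omega>_def br_simps l0)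
  have skew: "\<omega> v u = - \<omega> u v" for u v unfolding \<omega>_def br_skew[of v u] l0 ..
  have \<omega>e: "\<omega> e1 e2' = 1" "\<omega> x0 z = 1" "\<omega> e1 z = 0" "\<omega> e2' z = 0"
    using zD[OF e12(1)] zD[OF e12(2)] by (simp_all add: \<omega>_def z_def[symmetric] x0 \<eta>0z l0)
  have linw: "linear (\<lambda>u. (\<omega> u e1, \<omega> u e2', \<omega> u z, \<omega> u x0))"
    by (rule linearI) (simp_all add: l\<omega>)
  obtain u0 where "u0 \<noteq> 0" "(\<omega> u0 e1, \<omega> u0 e2', \<omega> u0 z, \<omega> u0 x0) = 0"
    by (rule exists_common_kernel[OF linw subspace_UNIV]) (simp add: dim dim_UNIV, rule that)
  then have u0: "u0 \<noteq> 0" "\<omega> u0 e1 = 0" "\<omega> u0 e2' = 0" "\<omega> u0 z = 0" "\<omega> u0 x0 = 0" by (simp_all add: zero_prod_def)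
  have sk: "\<omega> e2' e1 = -1" "\<omega> z x0 = -1" "\<omega> z e1 = 0" "\<omega> z e2' = 0"
    using skew[of e2' e1] skew[of z x0] skew[of z e1] skew[of z e2'] \<omega>e by simp_all
  have comb: "c1 = 0 \<and> c2 = 0 \<and> c3 = 0 \<and> c4 = 0"
    if "\<And>y. \<omega> (c1 *\<^sub>R e1 + c2 *\<^sub>R e2' + c3 *\<^sub>R z + c4 *\<^sub>R x0 + c5 *\<^sub>R u0) y = 0" for c1 c2 c3 c4 c5
  proof -
    have "c4 = 0" using that[of z] by (simp add: l\<omega> \<omega>e u0)
    moreover have "c1 = 0" "c2 = 0" "c3 = 0"
      using that[of e2'] that[of e1] that[of x0] \<open>c4 = 0\<close>
      by (simp_all add: l\<omega> \<omega>e u0 sk)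
    ultimately show ?thesis by simp
  qed
  have ind: "c1 = 0 \<and> c2 = 0 \<and> c3 = 0 \<and> c4 = 0 \<and> c5 = 0"
    if rel: "c1 *\<^sub>R e1 + c2 *\<^sub>R e2' + c3 *\<^sub>R z + c4 *\<^sub>R x0 + c5 *\<^sub>R u0 = 0" for c1 c2 c3 c4 c5
  proof -
    have "c1 = 0 \<and> c2 = 0 \<and> c3 = 0 \<and> c4 = 0" by (rule comb[of c1 c2 c3 c4 c5]) (simp add: rel l\<omega>)
    then show ?thesis using rel u0(1) by simp
  qed
  have "u0 \<notin> derived"
  proof
    assume "u0 \<in> derived"
    \<comment> \<open>four independent vectors in the three-dimensional derived ideal\<close>
    define h where "h p = fst p *\<^sub>R e1 + fst (snd p) *\<^sub>R e2' + fst (snd (snd p)) *\<^sub>R z + snd (snd (snd p)) *\<^sub>R u0"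
      for p :: "real \<times> real \<times> real \<times> real"
    have lin: "linear h" unfolding h_def by (rule linearI) (simp_all add: algebra_simps)
    have "inj h" unfolding linear_injective_0[OF lin]
    proof (intro allI impI)
      fix p assume "h p = 0"
      then show "p = 0" using ind[of "fst p" "fst (snd p)" "fst (snd (snd p))" 0 "snd (snd (snd p))"]
        by (simp add: h_def prod_eq_iff)
    qed
    then have "dim (range h) = 4" using dim_linear_image_inj[OF lin, of UNIV] by (simp add: dim_UNIV)
    moreover have "range h \<subseteq> derived"
      using e12 z(2) derived2_ideal(3) \<open>u0 \<in> derived\<close> subspace_derived
      by (auto simp: h_def intro!: subspace_add subspace_scale)
    ultimately show False using dim_subset[of "range h" derived] d by simp
  qed
  obtain q :: "'e \<Rightarrow> 'e" where q: "linear q" "\<And>x. q x = 0 \<longleftrightarrow> x \<in> derived"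
    by (rule orthogonal_projection_exists[OF subspace_derived]) (rule that)
  have qu: "q u0 \<bullet> q u0 \<noteq> 0" using q(2) \<open>u0 \<notin> derived\<close> by simp
  define t where "t = (1 - \<eta>0 u0) / (q u0 \<bullet> q u0)"
  define \<eta> where "\<eta> y = \<eta>0 y + t * (q y \<bullet> q u0)" for y
  have lin: "linear \<eta>" unfolding \<eta>_def
    by (rule linearI) (simp_all add: l0 linear_add[OF q(1)] linear_scale[OF q(1)] inner_add_left algebra_simps)
  have \<eta>br: "\<eta> (br u v) = \<omega> u v" for u v using q(2)[of "br u v"] br_in_derived by (simp add: \<eta>_def \<omega>_def)
  have \<eta>u: "\<eta> u0 = 1" using qu by (simp add: \<eta>_def t_def)
  show ?thesis unfolding contact_iff_5[OF dim]
  proof (intro exI[of _ \<eta>] conjI lin allI impI)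
    fix u assume u: "\<eta> u = 0" "\<forall>y. \<eta> (br u y) = 0"
    obtain c1 c2 c3 c4 c5 where uc: "u = c1 *\<^sub>R e1 + c2 *\<^sub>R e2' + c3 *\<^sub>R z + c4 *\<^sub>R x0 + c5 *\<^sub>R u0"
      by (rule basis_5[OF dim ind])
    have "c1 = 0 \<and> c2 = 0 \<and> c3 = 0 \<and> c4 = 0" by (rule comb[of c1 c2 c3 c4 c5]) (use u(2) uc \<eta>br in simp)
    then show "u = 0" using u(1) uc \<eta>u by (simp add: linear_scale[OF lin])
  qed
qed

end

context lie_space begin

lemma complement_vector:
  assumes "DIM('e) = 5" "dim derived = 4"
  obtains v where "v \<notin> derived" "\<forall>u. \<exists>t k. k \<in> derived \<and> u = t *\<^sub>R v + k"
proof -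
  have "derived \<noteq> UNIV" using assms by (auto simp: dim_UNIV)
  then obtain v where v: "v \<notin> derived" by blast
  have "\<exists>t k. k \<in> derived \<and> u = t *\<^sub>R v + k" for u
    by (rule subspace_codim_1_decomposition[OF subspace_derived subspace_UNIV subset_UNIV _ UNIV_I v UNIV_I, of u])
      (use assms in \<open>auto simp: dim_UNIV\<close>)
  then show thesis using v that by blast
qed

text \<open>
  If \<open>L = \<langle>v\<rangle> + D\<close> with \<open>D\<close> abelian, a vector \<open>u \<in> D\<close> is in \<open>ker \<eta>\<close> and in the radical as soon as
  \<open>\<eta> u = 0\<close> and \<open>\<eta> [u, v] = 0\<close>: two conditions on a four-dimensional space.
\<close>

lemma abelian_derived_4_not_contact:
  assumes dim: "DIM('e) = 5" and d: "dim derived = 4" and ab: "derived2 = {0}"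
  shows "\<not> contact_lie_algebra UNIV br" "lie_center derived br = derived"
proof -
  have com: "br x y = 0" if "x \<in> derived" "y \<in> derived" for x y
    using br_in_lie_derived[OF that] ab by simp
  show "lie_center derived br = derived" unfolding lie_center_def using com by auto
  show "\<not> contact_lie_algebra UNIV br"
  proof
    assume "contact_lie_algebra UNIV br"
    then obtain \<eta> :: "'e \<Rightarrow> real" where \<eta>: "linear \<eta>" "\<forall>u. \<eta> u = 0 \<longrightarrow> (\<forall>y. \<eta> (br u y) = 0) \<longrightarrow> u = 0"
      unfolding contact_iff_5[OF dim] by blast
    obtain v where v: "v \<notin> derived" "\<forall>u. \<exists>t k. k \<in> derived \<and> u = t *\<^sub>R v + k"
      by (rule complement_vector[OF dim d]) (rule that)
    have lin: "linear (\<lambda>u. (\<eta> u, \<eta> (br u v)))"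
      by (rule linearI) (simp_all add: br_simps linear_add[OF \<eta>(1)] linear_scale[OF \<eta>(1)])
    obtain u where u: "u \<in> derived" "u \<noteq> 0" "(\<eta> u, \<eta> (br u v)) = 0"
      by (rule exists_common_kernel[OF lin subspace_derived]) (simp add: d, rule that)
    have "\<eta> (br u y) = 0" for y
    proof -
      obtain t k where tk: "k \<in> derived" "y = t *\<^sub>R v + k" using v(2) by blast
      show ?thesis using u(3) com[OF u(1) tk(1)] by (simp add: tk(2) br_simps linear_scale[OF \<eta>(1)] zero_prod_def)
    qed
    then show False using \<eta>(2) u by (simp add: zero_prod_def)
  qed
qed

text \<open>
  If every \<open>ad v\<close> were scalar on the plane \<open>Z(D)\<close>, a vector of \<open>Z(D)\<close> in \<open>ker \<eta>\<close> would be in the radical.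
\<close>

lemma contact_center_not_scalar:
  assumes dim: "DIM('e) = 5" and "contact_lie_algebra UNIV br" "dim (lie_center derived br) = 2"
  shows "\<exists>v. \<not> (\<exists>r::real. \<forall>x\<in>lie_center derived br. br v x = r *\<^sub>R x)"
proof (rule ccontr)
  assume scalar: "\<not> ?thesis"
  obtain \<eta> :: "'e \<Rightarrow> real" where \<eta>: "linear \<eta>" "\<forall>u. \<eta> u = 0 \<longrightarrow> (\<forall>y. \<eta> (br u y) = 0) \<longrightarrow> u = 0"
    using assms(2) unfolding contact_iff_5[OF dim] by blast
  have sub: "subspace (lie_center derived br)"
    using subspace_derived unfolding lie_center_def by (auto simp: subspace_def br_simps)
  obtain u where u: "u \<in> lie_center derived br" "u \<noteq> 0" "\<eta> u = 0"
    by (rule exists_common_kernel[OF \<eta>(1) sub]) (simp add: assms(3), rule that)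
  have "\<eta> (br u y) = 0" for y
  proof -
    obtain r where "br y u = r *\<^sub>R u" using scalar u(1) by blast
    then show ?thesis using u(3) by (simp add: br_skew[of u y] linear_scale[OF \<eta>(1)] linear_neg[OF \<eta>(1)])
  qed
  then show False using \<eta>(2) u by blast
qed

lemma center_derived_ideal:
  assumes "x \<in> lie_center derived br" shows "br v x \<in> lie_center derived br"
proof -
  have "br (br v x) y = 0" if "y \<in> derived" for y
  proof -
    have "br x y = 0" "br x (br v y) = 0" using assms br_in_derived that unfolding lie_center_def by auto
    then show ?thesis using br_jacobi[of v x y] by (simp add: br_simps)
  qed
  then show ?thesis unfolding lie_center_def using br_in_derived by auto
qed

text \<open>
  On the derived ideal \<open>D\<close> the bracket is a 2-form with values in the line of \<open>z\<close>. As \<open>z\<close> is in its radical,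
  the form has rank two: \<open>D\<close> is the sum of the hyperbolic plane of \<open>e1, e2\<close> and of the orthogonal plane \<open>D'\<close>, which is
  then the centre.
\<close>

lemma derived2_dim_1_center:
  assumes d: "dim derived = 4" and d2: "dim derived2 = 1"
  obtains z e1 e2 where "e1 \<in> derived" "e2 \<in> derived" "br e1 e2 = z" "z \<noteq> 0" "z \<in> lie_center derived br"
    "\<forall>v. \<exists>c. br v z = c *\<^sub>R z" "dim (lie_center derived br) = 2"
proof -
  have "\<exists>x\<in>derived. \<exists>y\<in>derived. br x y \<noteq> 0"
  proof (rule ccontr)
    assume "\<not> ?thesis"
    then have "derived2 \<subseteq> {0}" unfolding lie_derived_def[of derived] by (intro span_minimal) auto
    then have "dim derived2 \<le> dim {0::'e}" by (rule dim_subset)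
    then show False using d2 by simp
  qed
  then obtain e1 e2 where e: "e1 \<in> derived" "e2 \<in> derived" "br e1 e2 \<noteq> 0" by blast
  define z where "z = br e1 e2"
  have z: "z \<noteq> 0" "z \<in> derived2" "z \<in> derived" using e br_in_derived by (auto simp: z_def br_in_lie_derived)
  have "span {z} = derived2"
    using z d2 by (intro subspace_dim_equal[OF subspace_span derived2_ideal(1)]) (auto intro: span_minimal simp: derived2_ideal(1) span_minimal)
  then have line: "\<exists>c. w = c *\<^sub>R z" if "w \<in> derived2" for w using that by (auto simp: span_singleton)
  have "\<exists>c. br v z = c *\<^sub>R z" for v by (intro line derived2_ideal(2) z)
  then obtain ch where ch: "\<And>v. br v z = ch v *\<^sub>R z" by metis
  have uz: "br u z = 0" if "u \<in> derived" for u by (rule one_dim_ideal_character[OF ch z(1) that])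
  have zu: "br z u = 0" if "u \<in> derived" for u using uz[OF that] br_skew[of z u] by simp
  define \<kappa> where "\<kappa> y = (y \<bullet> z) / (z \<bullet> z)" for y
  have brk: "br u w = \<kappa> (br u w) *\<^sub>R z" if uw: "u \<in> derived" "w \<in> derived" for u w
  proof -
    obtain c where c: "br u w = c *\<^sub>R z" using line[OF br_in_lie_derived[OF uw]] by blast
    show ?thesis using z(1) by (simp add: c \<kappa>_def)
  qed
  define D' where "D' = {u \<in> derived. br u e1 = 0 \<and> br u e2 = 0}"
  have sub: "subspace D'" using subspace_derived unfolding D'_def by (auto simp: subspace_def br_simps)
  have dec: "w - (\<kappa> (br w e2) *\<^sub>R e1 + \<kappa> (br e1 w) *\<^sub>R e2) \<in> D'" if w: "w \<in> derived" for w
  proof -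
    have k1: "br w e2 = \<kappa> (br w e2) *\<^sub>R z" and k2: "br e1 w = \<kappa> (br e1 w) *\<^sub>R z" using e w by (blast intro: brk)+
    have "br (w - (\<kappa> (br w e2) *\<^sub>R e1 + \<kappa> (br e1 w) *\<^sub>R e2)) e2 = br w e2 - \<kappa> (br w e2) *\<^sub>R z"
      by (simp add: br_simps z_def)
    moreover have "br (w - (\<kappa> (br w e2) *\<^sub>R e1 + \<kappa> (br e1 w) *\<^sub>R e2)) e1 = \<kappa> (br e1 w) *\<^sub>R z - br e1 w"
      by (simp add: br_simps z_def br_skew[of w e1] br_skew[of e2 e1])
    ultimately show ?thesis unfolding D'_def using k1 k2 e w subspace_derived
      by (auto intro!: subspace_diff subspace_add subspace_scale)
  qed
  define h where "h p = fst p *\<^sub>R e1 + snd p *\<^sub>R e2" for p :: "real \<times> real"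
  have lin: "linear h" unfolding h_def by (rule linearI) (simp_all add: algebra_simps)
  have h12: "br (h p) e2 = fst p *\<^sub>R z" "br (h p) e1 = - (snd p *\<^sub>R z)" for p
    by (simp_all add: h_def br_simps z_def br_skew[of e2 e1])
  have hD: "h p \<in> D' \<Longrightarrow> p = 0" for p using h12[of p] z(1) unfolding D'_def by (auto simp: prod_eq_iff)
  have "inj h" unfolding linear_injective_0[OF lin] using hD subspace_0[OF sub] by auto
  then have dh: "dim (range h) = 2" using dim_linear_image_inj[OF lin, of UNIV] by (simp add: dim_UNIV)
  have shr: "subspace (range h)" by (rule linear_subspace_image[OF lin subspace_UNIV])
  have sum: "{x + y |x y. x \<in> range h \<and> y \<in> D'} = derived"
  proof (intro equalityI subsetI)
    fix w assume "w \<in> {x + y |x y. x \<in> range h \<and> y \<in> D'}"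
    then show "w \<in> derived" using e subspace_derived unfolding D'_def h_def
      by (auto intro!: subspace_add subspace_scale)
  next
    fix w assume w: "w \<in> derived"
    have "w = h (\<kappa> (br w e2), \<kappa> (br e1 w)) + (w - (\<kappa> (br w e2) *\<^sub>R e1 + \<kappa> (br e1 w) *\<^sub>R e2))" by (simp add: h_def)
    then show "w \<in> {x + y |x y. x \<in> range h \<and> y \<in> D'}" using dec[OF w] by blast
  qed
  have int0: "range h \<inter> D' = {0}" using hD linear_0[OF lin] subspace_0[OF sub] by (auto simp: image_iff) metis
  have dD': "dim D' = 2" using dim_sums_Int[OF shr sub] dh d unfolding sum int0 by simp
  have zD': "z \<in> D'" unfolding D'_def using z zu e by auto
  have van: "br u w = 0" if u: "u \<in> D'" and w: "w \<in> D'" for u w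
  proof -
    \<comment> \<open>three vectors of the plane \<open>D'\<close>, one of which is central, are dependent\<close>
    obtain a b c where abc: "a *\<^sub>R u + b *\<^sub>R w + c *\<^sub>R z = 0" "\<not> (a = 0 \<and> b = 0 \<and> c = 0)"
      by (rule relation_3_in_plane[OF sub _ u w zD']) (simp add: dD', rule that)
    have uD: "u \<in> derived" "w \<in> derived" using u w unfolding D'_def by auto
    have "br u (a *\<^sub>R u + b *\<^sub>R w + c *\<^sub>R z) = b *\<^sub>R br u w" by (simp add: br_simps uz[OF uD(1)])
    moreover have "br (a *\<^sub>R u + b *\<^sub>R w + c *\<^sub>R z) w = a *\<^sub>R br u w" by (simp add: br_simps zu[OF uD(2)])
    ultimately have ab: "b *\<^sub>R br u w = 0" "a *\<^sub>R br u w = 0" using abc(1) by (simp_all add: br_simps)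
    show ?thesis
    proof (rule ccontr)
      assume "br u w \<noteq> 0"
      then have "a = 0" "b = 0" using ab by auto
      then show False using abc z(1) by simp
    qed
  qed
  have "lie_center derived br = D'"
  proof (intro equalityI subsetI)
    fix u assume "u \<in> lie_center derived br"
    then show "u \<in> D'" unfolding D'_def lie_center_def using e by auto
  next
    fix u assume u: "u \<in> D'"
    have "br u w = 0" if w: "w \<in> derived" for w
    proof -
      have "br u (w - (\<kappa> (br w e2) *\<^sub>R e1 + \<kappa> (br e1 w) *\<^sub>R e2)) = 0" by (rule van[OF u dec[OF w]])
      then show ?thesis using u unfolding D'_def by (simp add: br_simps)
    qed
    then show "u \<in> lie_center derived br" using u unfolding D'_def lie_center_def by auto
  qed
  then show thesis using that[of e1 e2 z] e zD' z ch dD' by (auto simp: z_def)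
qed

text \<open>
  Let \<open>z, w\<close> span the centre of the derived ideal, \<open>[v, z] = \<lambda> z\<close> and \<open>[v, w] = \<mu> w + c z\<close>. The functional with
  \<open>\<eta> z = 1\<close>, \<open>\<eta> w = s\<close> that vanishes on \<open>e1, e2, v\<close> is a contact form iff \<open>s (\<lambda> - \<mu>) \<noteq> c\<close>, and such an \<open>s\<close>
  exists because \<open>ad v\<close> is not scalar.
\<close>

lemma contact_derived2_dim_1:
  assumes dim: "DIM('e) = 5" and d: "dim derived = 4" and d2: "dim derived2 = 1"
    and ns: "\<not> (\<exists>r::real. \<forall>x\<in>lie_center derived br. br v x = r *\<^sub>R x)"
  shows "contact_lie_algebra UNIV br"
proof -
  obtain z e1 e2 where e: "e1 \<in> derived" "e2 \<in> derived" "br e1 e2 = z" and z: "z \<noteq> 0" "z \<in> lie_center derived br"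
    and zi: "\<forall>v. \<exists>c. br v z = c *\<^sub>R z" and dZ: "dim (lie_center derived br) = 2"
    by (rule derived2_dim_1_center[OF d d2]) (rule that)
  have sub: "subspace (lie_center derived br)"
    using subspace_derived unfolding lie_center_def by (auto simp: subspace_def br_simps)
  have ZD: "x \<in> derived" "u \<in> derived \<Longrightarrow> br x u = 0" "u \<in> derived \<Longrightarrow> br u x = 0" if "x \<in> lie_center derived br" for x u
    using that br_skew[of u x] unfolding lie_center_def by auto
  have zs: "span {z} \<subseteq> lie_center derived br" using z sub by (intro span_minimal) auto
  have "dim (span {z}) = 1" using z by simp
  then have "lie_center derived br \<noteq> span {z}" using dZ by auto
  then obtain w where w: "w \<in> lie_center derived br" "w \<notin> span {z}" using zs by blast
  have dec: "\<exists>a b. x = a *\<^sub>R w + b *\<^sub>R z" if "x \<in> lie_center derived br" for x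
    by (rule subspace_codim_1_decomposition[OF subspace_span sub zs _ w that])
      (use dZ \<open>dim (span {z}) = 1\<close> in \<open>auto simp: span_singleton\<close>)
  obtain la where l: "br v z = la *\<^sub>R z" using zi by blast
  obtain mu c where m: "br v w = mu *\<^sub>R w + c *\<^sub>R z" using dec[OF center_derived_ideal[OF w(1)]] by blast
  have lm: "c \<noteq> 0 \<or> la \<noteq> mu"
  proof (rule ccontr)
    assume "\<not> ?thesis"
    then have cm: "c = 0" "mu = la" by auto
    have "br v x = la *\<^sub>R x" if x: "x \<in> lie_center derived br" for x
    proof -
      obtain a b where "x = a *\<^sub>R w + b *\<^sub>R z" using dec[OF x] by blast
      then show ?thesis by (simp add: br_simps l m cm algebra_simps)
    qed
    then show False using ns by blast
  qed
  have vD: "v \<notin> derived"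
  proof
    assume "v \<in> derived"
    then have "\<forall>x\<in>lie_center derived br. br v x = 0 *\<^sub>R x" using ZD(3) by simp
    then show False using ns by blast
  qed
  define s :: real where "s = (if c = 0 then 1 else 0)"
  have s: "s * (la - mu) \<noteq> c" using lm by (auto simp: s_def)
  have e': "br e1 e2 = z" "br e2 e1 = - z" "br z e1 = 0" "br z e2 = 0" "br w e1 = 0" "br w e2 = 0"
    "br e1 z = 0" "br e2 z = 0" "br e1 w = 0" "br e2 w = 0" "br z w = 0" "br w z = 0"
    "br z v = - (la *\<^sub>R z)" "br w v = - (mu *\<^sub>R w + c *\<^sub>R z)"
    using e z w ZD br_skew[of e2 e1] br_skew[of z v] br_skew[of w v] l m by auto
  have ind: "c1 = 0 \<and> c2 = 0 \<and> c3 = 0 \<and> c4 = 0 \<and> c5 = 0"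
    if rel: "c1 *\<^sub>R z + c2 *\<^sub>R w + c3 *\<^sub>R e1 + c4 *\<^sub>R e2 + c5 *\<^sub>R v = 0" for c1 c2 c3 c4 c5
  proof -
    have c5: "c5 = 0"
    proof (rule ccontr)
      assume c5: "c5 \<noteq> 0"
      have "c5 *\<^sub>R v = - (c1 *\<^sub>R z + c2 *\<^sub>R w + c3 *\<^sub>R e1 + c4 *\<^sub>R e2)" using rel by (simp add: add_eq_0_iff)
      moreover have "- (c1 *\<^sub>R z + c2 *\<^sub>R w + c3 *\<^sub>R e1 + c4 *\<^sub>R e2) \<in> derived"
        by (intro subspace_neg subspace_add subspace_scale subspace_derived ZD(1)[OF z(2)] ZD(1)[OF w(1)] e(1,2))
      ultimately have "(1 / c5) *\<^sub>R (c5 *\<^sub>R v) \<in> derived" using subspace_derived by (simp only: subspace_scale)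
      then show False using vD c5 by simp
    qed
    have "br (c1 *\<^sub>R z + c2 *\<^sub>R w + c3 *\<^sub>R e1 + c4 *\<^sub>R e2 + c5 *\<^sub>R v) e2 = 0"
      "br (c1 *\<^sub>R z + c2 *\<^sub>R w + c3 *\<^sub>R e1 + c4 *\<^sub>R e2 + c5 *\<^sub>R v) e1 = 0" unfolding rel by (simp_all add: br_simps)
    then have c34: "c3 = 0" "c4 = 0" using z(1) by (simp_all add: br_simps e' c5)
    have "c2 = 0"
    proof (rule ccontr)
      assume c2: "c2 \<noteq> 0"
      have "c2 *\<^sub>R w = - (c1 *\<^sub>R z)" using rel c34 c5 by (simp add: add_eq_0_iff)
      then have "(1 / c2) *\<^sub>R (c2 *\<^sub>R w) \<in> span {z}" by (simp only:) (intro span_scale span_neg span_base, simp)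
      then show False using w c2 by simp
    qed
    then show ?thesis using rel c34 c5 z(1) by simp
  qed
  obtain \<eta> :: "'e \<Rightarrow> real" where \<eta>: "linear \<eta>" "\<eta> z = 1" "\<eta> w = s" "\<eta> e1 = 0" "\<eta> e2 = 0" "\<eta> v = 0"
    by (rule functional_5[OF dim ind, where ?t1.0=1 and ?t2.0=s and ?t3.0=0 and ?t4.0=0 and ?t5.0=0]) (assumption, rule that)
  note l\<eta> = linear_add[OF \<eta>(1)] linear_scale[OF \<eta>(1)] linear_neg[OF \<eta>(1)] linear_diff[OF \<eta>(1)] linear_0[OF \<eta>(1)] \<eta>(2-6)
  show ?thesis unfolding contact_iff_5[OF dim]
  proof (intro exI[of _ \<eta>] conjI \<eta>(1) allI impI)
    fix u assume u: "\<eta> u = 0" "\<forall>y. \<eta> (br u y) = 0"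
    obtain c1 c2 c3 c4 c5 where uc: "u = c1 *\<^sub>R z + c2 *\<^sub>R w + c3 *\<^sub>R e1 + c4 *\<^sub>R e2 + c5 *\<^sub>R v"
      by (rule basis_5[OF dim ind])
    have 1: "\<eta> (br u z) = 0" "\<eta> (br u w) = 0" "\<eta> (br u e1) = 0" "\<eta> (br u e2) = 0" "\<eta> (br u v) = 0" using u(2) by blast+
    have c5: "c5 = 0"
    proof (rule ccontr)
      assume "c5 \<noteq> 0"
      moreover have "c5 * la = 0" using 1(1) by (simp add: uc br_simps e' l l\<eta>)
      moreover have "c5 * (mu * s + c) = 0" using 1(2) by (simp add: uc br_simps e' m l\<eta>)
      ultimately have "la = 0" "mu * s + c = 0" by auto
      then show False using s by (simp add: algebra_simps)
    qed
    have c34: "c3 = 0" "c4 = 0" using 1(3,4) by (simp_all add: uc br_simps e' l\<eta> c5)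
    have "c1 * la + c2 * (mu * s + c) = 0" using 1(5) by (simp add: uc br_simps e' l\<eta> c5 c34 algebra_simps)
    moreover have "c1 = - (c2 * s)" using u(1) by (simp add: uc l\<eta> c5 c34)
    ultimately have "c2 * (c - s * (la - mu)) = 0" by (simp add: algebra_simps)
    then have "c2 = 0" using s by simp
    then show "u = 0" using \<open>c1 = - (c2 * s)\<close> by (simp add: uc c34 c5)
  qed
qed

text \<open>
  Otherwise \<open>[p, q]\<close> spans a one-dimensional ideal, on which \<open>p\<close> and \<open>q\<close> act trivially since they lie in the
  derived ideal. But \<open>[p, q]\<close> is a combination of \<open>p\<close> and \<open>q\<close>, and commutes with both only if it is 0.
\<close>

lemma derived2_plane_abelian:
  assumes d2: "dim derived2 = 2" and "x \<in> derived2" "y \<in> derived2"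
  shows "br x y = 0"
proof -
  obtain p q where pq: "p \<in> derived2" "q \<in> derived2" "\<forall>w\<in>derived2. \<exists>a b. w = a *\<^sub>R p + b *\<^sub>R q"
    by (rule subspace_dim_2_basis[OF derived2_ideal(1) d2]) (rule that)
  have all: "\<exists>c. br x y = c *\<^sub>R br p q" if xy: "x \<in> derived2" "y \<in> derived2" for x y
  proof -
    obtain a b c e where "x = a *\<^sub>R p + b *\<^sub>R q" "y = c *\<^sub>R p + e *\<^sub>R q" using pq xy by meson
    then have "br x y = (a * e - b * c) *\<^sub>R br p q" by (simp add: br_simps br_skew[of q p] algebra_simps)
    then show ?thesis by blast
  qed
  have "br p q = 0"
  proof (rule ccontr)
    assume c0: "br p q \<noteq> 0"
    have "\<exists>c. br v (br p q) = c *\<^sub>R br p q" for v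
    proof -
      obtain c1 where c1: "br (br v p) q = c1 *\<^sub>R br p q" using all pq derived2_ideal(2) by blast
      obtain c2 where c2: "br p (br v q) = c2 *\<^sub>R br p q" using all pq derived2_ideal(2) by blast
      have "br v (br p q) = (c1 + c2) *\<^sub>R br p q" unfolding br_jacobi[of v p q] c1 c2 by (simp add: algebra_simps)
      then show ?thesis by blast
    qed
    then obtain ch where ch: "\<And>v. br v (br p q) = ch v *\<^sub>R br p q" by metis
    have k: "br p (br p q) = 0" "br q (br p q) = 0"
      using one_dim_ideal_character[OF ch c0] pq(1,2) derived2_ideal(3) by blast+
    obtain a b where ab: "br p q = a *\<^sub>R p + b *\<^sub>R q"
      using pq derived2_ideal(2) by blast
    have "br p (a *\<^sub>R p + b *\<^sub>R q) = b *\<^sub>R br p q" "br q (a *\<^sub>R p + b *\<^sub>R q) = - (a *\<^sub>R br p q)"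
      by (simp_all only: br_simps br_skew[of q p]) simp_all
    then have "b *\<^sub>R br p q = 0" "a *\<^sub>R br p q = 0" using k unfolding ab[symmetric] by simp_all
    then show False using c0 ab by simp
  qed
  then show ?thesis using all[OF assms(2,3)] by auto
qed

end

context lie_space begin

text \<open>
  With \<open>L = \<langle>v\<rangle> + D\<close>, all brackets lie in \<open>[v, D] + [D, D]\<close>.
\<close>

lemma derived_mod_derived2:
  assumes v: "\<forall>u. \<exists>t k. k \<in> derived \<and> u = t *\<^sub>R v + k" and e: "e \<in> derived"
  shows "\<exists>e'\<in>derived. e - br v e' \<in> derived2"
  using e
proof (rule derived_induct)
  show "subspace {e. \<exists>e'\<in>derived. e - br v e' \<in> derived2}" (is "subspace ?X")
  proof (rule subspaceI)
    have "0 - br v 0 \<in> derived2" by (simp add: br_simps subspace_0[OF derived2_ideal(1)])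
    then show "0 \<in> ?X" using subspace_0[OF subspace_derived] by blast
  next
    fix a b assume "a \<in> ?X" "b \<in> ?X"
    then obtain a' b' where ab: "a' \<in> derived" "b' \<in> derived" "a - br v a' \<in> derived2" "b - br v b' \<in> derived2" by blast
    have "a + b - br v (a' + b') = (a - br v a') + (b - br v b')" by (simp add: br_simps)
    then have "a + b - br v (a' + b') \<in> derived2" using subspace_add[OF derived2_ideal(1) ab(3,4)] by (simp only:)
    then show "a + b \<in> ?X" using subspace_add[OF subspace_derived ab(1,2)] by blast
  next
    fix c a assume "a \<in> ?X"
    then obtain a' where a: "a' \<in> derived" "a - br v a' \<in> derived2" by blast
    have "c *\<^sub>R a - br v (c *\<^sub>R a') = c *\<^sub>R (a - br v a')" by (simp add: br_simps algebra_simps)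
    then have "c *\<^sub>R a - br v (c *\<^sub>R a') \<in> derived2" using subspace_scale[OF derived2_ideal(1) a(2)] by (simp only:)
    then show "c *\<^sub>R a \<in> ?X" using subspace_scale[OF subspace_derived a(1)] by blast
  qed
  fix x y
  obtain t k where x: "k \<in> derived" "x = t *\<^sub>R v + k" using v by blast
  obtain s l where y: "l \<in> derived" "y = s *\<^sub>R v + l" using v by blast
  have "br x y - br v (t *\<^sub>R l - s *\<^sub>R k) = br k l"
    unfolding x y by (simp add: br_simps br_skew[of k v])
  moreover have "br k l \<in> derived2" using x y by (intro br_in_lie_derived)
  moreover have "t *\<^sub>R l - s *\<^sub>R k \<in> derived" using x y subspace_derived by (simp add: subspace_diff subspace_scale)
  ultimately show "\<exists>e'\<in>derived. br x y - br v e' \<in> derived2" by metis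
qed

text \<open>
  Write \<open>e = [v, e']\<close> modulo the second derived ideal, which acts trivially on itself. On it, \<open>E = ad e\<close> is
  the commutator of \<open>ad v\<close> with \<open>ad e'\<close>, and it commutes with \<open>ad e'\<close>; so it has a kernel vector \<open>p\<close>. If it had another eigenvalue
  \<open>\<gamma> \<noteq> 0\<close>, with eigenvector \<open>q'\<close>, then \<open>ad e'\<close> would be diagonal in \<open>p, q'\<close>, and the commutator of a
  diagonal matrix with any other has zero diagonal.
\<close>

lemma derived2_plane_nilpotent:
  assumes dim: "DIM('e) = 5" and d: "dim derived = 4" and d2: "dim derived2 = 2" and e: "e \<in> derived" and x: "x \<in> derived2"
  shows "br e (br e x) = 0"
proof -
  obtain v where v: "v \<notin> derived" "\<forall>u. \<exists>t k. k \<in> derived \<and> u = t *\<^sub>R v + k"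
    by (rule complement_vector[OF dim d]) (rule that)
  obtain e' where e': "e' \<in> derived" "e - br v e' \<in> derived2" using derived_mod_derived2[OF v(2) e] by blast
  note ab = derived2_plane_abelian[OF d2]
  have com: "br e' (br e y) = br e (br e' y)" if "y \<in> derived2" for y
    using ab[OF br_in_lie_derived[OF e'(1) e] that] by (simp add: br_jacobi[of e' e y])
  have ev: "br e y = br v (br e' y) - br e' (br v y)" if "y \<in> derived2" for y
    using ab[OF e'(2) that] by (simp add: br_simps br_jacobi[of v e' y])
  have nsurj: "\<not> (\<forall>y\<in>derived2. \<exists>y'\<in>derived2. y = br e y')"
  proof
    assume s: "\<forall>y\<in>derived2. \<exists>y'\<in>derived2. y = br e y'"
    have "derived2 = {0}"
    proof (rule no_surjective_action[OF derived2_ideal(1,2), where r=v and s=e' and e=e])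
      show "br (e - br v e') y \<in> {0}" if "y \<in> derived2" for y using ab[OF e'(2) that] by simp
      show "br (br e' e) y \<in> {0}" if "y \<in> derived2" for y using ab[OF br_in_lie_derived[OF e'(1) e] that] by simp
    qed (use s subspace_0[OF derived2_ideal(1)] in \<open>auto simp: subspace_single_0 br_simps\<close>)
    then show False using d2 by simp
  qed
  have "\<not> inj_on (br e) derived2"
  proof
    assume inj: "inj_on (br e) derived2"
    have "dim (br e ` derived2) = dim derived2"
      using inj by (intro dim_image_eq[OF linear_br]) (simp add: span_eq_iff[THEN iffD2, OF derived2_ideal(1)])
    then have "br e ` derived2 = derived2"
      by (intro subspace_dim_equal linear_subspace_image[OF linear_br] derived2_ideal(1)) (use derived2_ideal(2) in auto)
    then show False using nsurj by blast
  qed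
  then obtain p where p: "p \<in> derived2" "p \<noteq> 0" "br e p = 0"
    using linear_injective_on_subspace_0[OF linear_br derived2_ideal(1)] by blast
  have sp: "span {p} \<subseteq> derived2" by (rule span_minimal[OF _ derived2_ideal(1)]) (simp add: p)
  have sp1: "dim (span {p}) = 1" using p by simp
  have "derived2 \<noteq> span {p}" using d2 sp1 by auto
  then obtain q where q: "q \<in> derived2" "q \<notin> span {p}" using sp by blast
  have dec: "\<exists>a b. y = a *\<^sub>R q + b *\<^sub>R p" if "y \<in> derived2" for y
    by (rule subspace_codim_1_decomposition[OF subspace_span derived2_ideal(1) sp _ q that])
      (use d2 sp1 in \<open>auto simp: span_singleton\<close>)
  obtain \<gamma> \<delta> where gd: "br e q = \<gamma> *\<^sub>R q + \<delta> *\<^sub>R p" using dec derived2_ideal(2) q by blast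
  have \<gamma>: "\<gamma> = 0"
  proof (rule ccontr)
    assume g0: "\<gamma> \<noteq> 0"
    define q' where "q' = \<gamma> *\<^sub>R q + \<delta> *\<^sub>R p"
    have q'2: "q' \<in> derived2" using p q derived2_ideal(1) by (simp add: q'_def subspace_add subspace_scale)
    have eq': "br e q' = \<gamma> *\<^sub>R q'" by (simp add: q'_def br_simps p gd)
    have dec': "\<exists>a b. y = a *\<^sub>R q' + b *\<^sub>R p" if y: "y \<in> derived2" for y
    proof -
      obtain a b where "y = a *\<^sub>R q + b *\<^sub>R p" using dec[OF y] by blast
      then have "y = (a / \<gamma>) *\<^sub>R q' + (b - a * \<delta> / \<gamma>) *\<^sub>R p" using g0 by (simp add: q'_def algebra_simps)
      then show ?thesis by blast
    qed
    have ind: "a = 0" "b = 0" if "a *\<^sub>R q' = b *\<^sub>R p" for a b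
    proof -
      have "br e (a *\<^sub>R q') = br e (b *\<^sub>R p)" unfolding \<open>a *\<^sub>R q' = b *\<^sub>R p\<close> ..
      then have "a *\<^sub>R q' = 0" using g0 by (simp add: br_simps eq' p)
      moreover have "q' \<noteq> 0"
      proof
        assume "q' = 0"
        then have "\<gamma> *\<^sub>R q = - (\<delta> *\<^sub>R p)" by (simp add: q'_def add_eq_0_iff2)
        then have "(1 / \<gamma>) *\<^sub>R (\<gamma> *\<^sub>R q) \<in> span {p}" by (simp only:) (intro span_scale span_neg span_base, simp)
        then show False using q g0 by simp
      qed
      ultimately show "a = 0" by simp
      then show "b = 0" using \<open>a *\<^sub>R q' = b *\<^sub>R p\<close> p(2) by simp
    qed
    obtain al1 al2 where al: "br e' p = al1 *\<^sub>R q' + al2 *\<^sub>R p" using dec' derived2_ideal(2) p by blast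
    obtain be1 be2 where be: "br e' q' = be1 *\<^sub>R q' + be2 *\<^sub>R p" using dec' derived2_ideal(2) q'2 by blast
    obtain v1 v2 where v12: "br v q' = v1 *\<^sub>R q' + v2 *\<^sub>R p" using dec' derived2_ideal(2) q'2 by blast
    have "al1 *\<^sub>R (\<gamma> *\<^sub>R q') = 0" using com[OF p(1)] by (simp add: p al be br_simps eq')
    then have "al1 = 0" using ind(1)[of "al1 * \<gamma>" 0] g0 by simp
    have "(- (\<gamma> * be2)) *\<^sub>R p = 0" using com[OF q'2] by (simp add: p al be br_simps eq' algebra_simps)
    then have "be2 = 0" using p(2) g0 by simp
    have "\<gamma> *\<^sub>R q' = (v2 * (be1 - al2)) *\<^sub>R p"
      using ev[OF q'2] by (simp add: eq' be al v12 br_simps \<open>al1 = 0\<close> \<open>be2 = 0\<close> algebra_simps)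
    then show False using ind(1) g0 by blast
  qed
  obtain a b where "x = a *\<^sub>R q + b *\<^sub>R p" using dec[OF x] by blast
  then show ?thesis by (simp add: br_simps gd \<gamma> p)
qed

text \<open>
  The abelian plane \<open>[D, D]\<close> is not central in \<open>D\<close>, because \<open>D\<close> has only two generators modulo \<open>[D, D]\<close>, whose bracket alone would not
  span a plane. So some \<open>e1\<close> acts on it by a nonzero nilpotent map; the others commute with this map and are nilpotent, hence are
  multiples of it. Subtracting a multiple of \<open>e1\<close> from a second generator gives \<open>e2\<close> with trivial action, and then
  \<open>c = [e1, e2]\<close> and \<open>z = [e1, c]\<close> span \<open>[D, D]\<close>.
\<close>

lemma derived2_dim_2_filiform:
  assumes dim: "DIM('e) = 5" and d: "dim derived = 4" and d2: "dim derived2 = 2"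
  obtains e1 e2 c z where "e1 \<in> derived" "e2 \<in> derived" "c \<in> derived" "z \<in> derived" "z \<noteq> 0"
    "br e1 e2 = c" "br e1 c = z" "br e1 z = 0" "br e2 c = 0" "br e2 z = 0" "br c z = 0"
    "\<forall>x\<in>derived. \<exists>a1 a2 a3 a4. x = a1 *\<^sub>R e1 + a2 *\<^sub>R e2 + a3 *\<^sub>R c + a4 *\<^sub>R z"
    "\<forall>x\<in>derived2. \<exists>a3 a4. x = a3 *\<^sub>R c + a4 *\<^sub>R z"
    "\<forall>a1 a2 a3 a4. a1 *\<^sub>R e1 + a2 *\<^sub>R e2 + a3 *\<^sub>R c + a4 *\<^sub>R z = 0 \<longrightarrow> a1 = 0 \<and> a2 = 0 \<and> a3 = 0 \<and> a4 = 0"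
proof -
  note ab = derived2_plane_abelian[OF d2] and nil = derived2_plane_nilpotent[OF dim d d2]
  have step: "\<exists>a\<in>derived. a \<notin> K \<and> (\<forall>x. x \<in> span (insert a K) \<longleftrightarrow> (\<exists>t. \<exists>k\<in>K. x = t *\<^sub>R a + k)) \<and> dim (span (insert a K)) = dim K + 1 \<and> span (insert a K) \<subseteq> derived"
    if K: "subspace K" "K \<subseteq> derived" "dim K < 4" for K
  proof -
    have "K \<noteq> derived" using K d by auto
    then obtain a where a: "a \<in> derived" "a \<notin> K" using K by blast
    have "dim (insert a K) = dim K + 1" using a K(1) by (simp add: dim_insert span_eq_iff[THEN iffD2, OF K(1)])
    moreover have "span (insert a K) \<subseteq> derived" using a K by (intro span_minimal) (auto simp: subspace_derived)
    moreover have "x \<in> span (insert a K) \<longleftrightarrow> (\<exists>t. \<exists>k\<in>K. x = t *\<^sub>R a + k)" for x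
    proof -
      have "x \<in> span (insert a K) \<longleftrightarrow> (\<exists>t. x - t *\<^sub>R a \<in> K)" by (simp add: span_insert span_eq_iff[THEN iffD2, OF K(1)])
      also have "\<dots> \<longleftrightarrow> (\<exists>t. \<exists>k\<in>K. x = t *\<^sub>R a + k)" by (metis add.commute add_diff_cancel_right' diff_add_cancel)
      finally show ?thesis .
    qed
    ultimately show ?thesis using a by (intro bexI[of _ a]) auto
  qed
  obtain a where a: "a \<in> derived" "a \<notin> derived2" "\<And>x. x \<in> span (insert a derived2) \<longleftrightarrow> (\<exists>t. \<exists>k\<in>derived2. x = t *\<^sub>R a + k)"
      "dim (span (insert a derived2)) = 3" "span (insert a derived2) \<subseteq> derived"
    using step[OF derived2_ideal(1,3)] d2 by auto
  obtain b where b: "b \<in> derived" "\<And>x. x \<in> span (insert b (span (insert a derived2))) \<longleftrightarrow> (\<exists>t. \<exists>k\<in>span (insert a derived2). x = t *\<^sub>R b + k)"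
      "dim (span (insert b (span (insert a derived2)))) = 4" "span (insert b (span (insert a derived2))) \<subseteq> derived"
    using step[OF subspace_span a(5)] a(4) by auto
  have "span (insert b (span (insert a derived2))) = derived"
    by (rule subspace_dim_equal[OF subspace_span subspace_derived b(4)]) (simp only: d b(3))
  then have dec0: "\<exists>s t k. k \<in> derived2 \<and> x = s *\<^sub>R b + t *\<^sub>R a + k" if "x \<in> derived" for x
    using that a(3) b(2) by (metis add.assoc)
  \<comment> \<open>otherwise \<open>[a, b]\<close> alone spans the second derived ideal\<close>
  have "\<exists>e\<in>derived. \<exists>t\<in>derived2. br e t \<noteq> 0"
  proof (rule ccontr)
    assume "\<not> ?thesis"
    then have triv: "br e t = 0" "br t e = 0" if "e \<in> derived" "t \<in> derived2" for e t
      using that br_skew[of t e] by auto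
    have "derived2 \<subseteq> span {br a b}" unfolding lie_derived_def[of derived]
    proof (rule span_minimal[OF _ subspace_span], safe)
      fix x y assume "x \<in> derived" "y \<in> derived"
      then obtain s t k s' t' k' where "k \<in> derived2" "x = s *\<^sub>R b + t *\<^sub>R a + k" "k' \<in> derived2" "y = s' *\<^sub>R b + t' *\<^sub>R a + k'"
        using dec0 by metis
      then have "br x y = (t * s' - s * t') *\<^sub>R br a b"
        using a b triv derived2_ideal(3) by (simp add: br_simps br_skew[of b a] ab algebra_simps)
      then show "br x y \<in> span {br a b}" by (auto simp: span_singleton)
    qed
    then have "dim derived2 \<le> dim (span {br a b})" by (rule dim_subset)
    also have "\<dots> \<le> 1" using dim_le_card'[of "{br a b}"] by simp
    finally show False using d2 by simp
  qed
  then obtain e1 t where e1: "e1 \<in> derived" "t \<in> derived2" "br e1 t \<noteq> 0" by blast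
  define z0 where "z0 = br e1 t"
  have z0: "z0 \<noteq> 0" "z0 \<in> derived2" "br e1 z0 = 0" using e1 derived2_ideal(2) nil[OF e1(1,2)] by (auto simp: z0_def)
  have tn: "t \<notin> span {z0}"
  proof
    assume "t \<in> span {z0}"
    then obtain r where "t = r *\<^sub>R z0" by (auto simp: span_singleton)
    then have "br e1 t = 0" by (simp add: br_simps z0)
    then show False using e1 by simp
  qed
  have sz0: "span {z0} \<subseteq> derived2" by (rule span_minimal[OF _ derived2_ideal(1)]) (simp add: z0)
  have "dim (span {z0}) = 1" using z0 by simp
  note sz = sz0 this
  have dec2: "\<exists>a b. y = a *\<^sub>R t + b *\<^sub>R z0" if "y \<in> derived2" for y
    by (rule subspace_codim_1_decomposition[OF subspace_span derived2_ideal(1) sz(1) _ e1(2) tn that])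
      (use d2 sz(2) in \<open>auto simp: span_singleton\<close>)
  have act: "br e z0 = 0 \<and> (\<exists>g. br e t = g *\<^sub>R z0)" if e: "e \<in> derived" for e
  proof -
    obtain g h where gh: "br e t = g *\<^sub>R t + h *\<^sub>R z0" using dec2 derived2_ideal(2)[OF e1(2)] by blast
    have "br e z0 = br e1 (br e t)" unfolding z0_def br_jacobi[of e e1 t] using ab[OF br_in_lie_derived[OF e e1(1)] e1(2)] by simp
    then have ez: "br e z0 = g *\<^sub>R z0" by (simp add: gh br_simps z0 z0_def[symmetric])
    have "br e (br e z0) = 0" by (rule nil[OF e z0(2)])
    then have "g = 0" using z0(1) by (simp add: ez br_simps)
    then show ?thesis using ez gh by auto
  qed
  have e1n: "e1 \<notin> derived2" using ab[OF _ e1(2)] e1(3) by blast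
  define K1 where "K1 = span (insert e1 derived2)"
  have dK1: "dim K1 = 3" using e1n d2 by (simp add: K1_def dim_insert span_eq_iff[THEN iffD2, OF derived2_ideal(1)])
  have K1: "subspace K1" "K1 \<subseteq> derived" "e1 \<in> K1" "derived2 \<subseteq> K1" unfolding K1_def
    by (auto simp: span_base) (metis (no_types, lifting) e1(1) derived2_ideal(3) insert_subset span_minimal subsetD subspace_derived)
  have decK1: "\<exists>s k. k \<in> derived2 \<and> x = s *\<^sub>R e1 + k" if "x \<in> K1" for x
    by (rule subspace_codim_1_decomposition[OF derived2_ideal(1) K1(1,4) _ K1(3) e1n that]) (use d2 dK1 in auto)
  have "K1 \<noteq> derived" using dK1 d by auto
  then obtain b where b: "b \<in> derived" "b \<notin> K1" using K1(2) by blast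
  obtain g where g: "br b t = g *\<^sub>R z0" using act[OF b(1)] by blast
  define e2 where "e2 = b - g *\<^sub>R e1"
  have e2: "e2 \<in> derived" "br e2 t = 0" "br e2 z0 = 0"
    using b e1 act[OF b(1)] z0(3) by (simp_all add: e2_def g br_simps z0_def[symmetric] subspace_diff subspace_scale subspace_derived)
  have "e2 \<notin> K1"
  proof
    assume "e2 \<in> K1"
    then have "e2 + g *\<^sub>R e1 \<in> K1" using K1 by (simp add: subspace_add subspace_scale)
    then show False using b by (simp add: e2_def)
  qed
  have decK: "\<exists>r x. x \<in> K1 \<and> u = r *\<^sub>R e2 + x" if "u \<in> derived" for u
    by (rule subspace_codim_1_decomposition[OF K1(1) subspace_derived K1(2) _ e2(1) \<open>e2 \<notin> K1\<close> that]) (use d dK1 in auto)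
  have dec: "\<exists>r s k. k \<in> derived2 \<and> u = s *\<^sub>R e1 + r *\<^sub>R e2 + k" if u: "u \<in> derived" for u
  proof -
    obtain r x where 1: "x \<in> K1" "u = r *\<^sub>R e2 + x" using decK[OF u] by blast
    obtain s k where 2: "k \<in> derived2" "x = s *\<^sub>R e1 + k" using decK1[OF 1(1)] by blast
    have "u = s *\<^sub>R e1 + r *\<^sub>R e2 + k" using 1 2 by simp
    then show ?thesis using 2 by blast
  qed
  have e2k: "br e2 k = 0" if k: "k \<in> derived2" for k
  proof -
    obtain x y where "k = x *\<^sub>R t + y *\<^sub>R z0" using dec2[OF k] by blast
    then show ?thesis by (simp add: br_simps e2)
  qed
  have e1k: "\<exists>x. br e1 k = x *\<^sub>R z0" if k: "k \<in> derived2" for k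
  proof -
    obtain x y where "k = x *\<^sub>R t + y *\<^sub>R z0" using dec2[OF k] by blast
    then have "br e1 k = x *\<^sub>R z0" by (simp add: br_simps z0 z0_def[symmetric])
    then show ?thesis by blast
  qed
  define c where "c = br e1 e2"
  have c2: "c \<in> derived2" using e1 e2 by (simp add: c_def br_in_lie_derived)
  have "derived2 \<subseteq> span {z0, c}" unfolding lie_derived_def[of derived]
  proof (rule span_minimal[OF _ subspace_span], safe)
    fix x y assume "x \<in> derived" "y \<in> derived"
    then obtain r s k r' s' k' where xy: "k \<in> derived2" "x = s *\<^sub>R e1 + r *\<^sub>R e2 + k" "k' \<in> derived2" "y = s' *\<^sub>R e1 + r' *\<^sub>R e2 + k'"
      using dec by metis
    obtain m m' where m: "br e1 k = m *\<^sub>R z0" "br e1 k' = m' *\<^sub>R z0" using e1k xy by metis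
    have "br x y = (s * r' - r * s') *\<^sub>R c + (s * m' - s' * m) *\<^sub>R z0"
      unfolding xy by (simp add: br_simps br_skew[of e2 e1] br_skew[of k e1] br_skew[of k e2] e2k[OF xy(1)] e2k[OF xy(3)] m ab[OF xy(1,3)] c_def[symmetric] algebra_simps)
    then show "br x y \<in> span {z0, c}" by (simp only:) (intro span_add span_scale span_base; simp)
  qed
  obtain c1 c2' where cc: "c = c2' *\<^sub>R t + c1 *\<^sub>R z0" using dec2[OF c2] by blast
  have c20: "c2' \<noteq> 0"
  proof
    assume "c2' = 0"
    then have "c \<in> span {z0}" using cc by (simp only:) (simp add: span_scale span_base)
    then have "span {z0, c} \<subseteq> span {z0}" by (intro span_minimal subspace_span) (simp add: span_base)
    then have "derived2 \<subseteq> span {z0}" using \<open>derived2 \<subseteq> span {z0, c}\<close> by (rule subset_trans[rotated])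
    then show False using dim_subset[of derived2 "span {z0}"] sz d2 by simp
  qed
  define z where "z = c2' *\<^sub>R z0"
  have e1c: "br e1 c = z" by (simp add: cc br_simps z0 z_def z0_def[symmetric])
  have zn: "z \<noteq> 0" "z \<in> derived2" "br e1 z = 0" using z0 c20 derived2_ideal(1) by (auto simp: z_def br_simps subspace_scale)
  have dec3: "\<exists>a3 a4. x = a3 *\<^sub>R c + a4 *\<^sub>R z" if x: "x \<in> derived2" for x
  proof -
    obtain p q where "x = p *\<^sub>R t + q *\<^sub>R z0" using dec2[OF x] by blast
    then have "x = (p / c2') *\<^sub>R c + ((q - p / c2' * c1) / c2') *\<^sub>R z" using c20
      by (simp add: cc z_def scaleR_add_right scaleR_diff_left)
    then show ?thesis by blast
  qed
  have dec4: "\<exists>a1 a2 a3 a4. x = a1 *\<^sub>R e1 + a2 *\<^sub>R e2 + a3 *\<^sub>R c + a4 *\<^sub>R z" if x: "x \<in> derived" for x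
  proof -
    obtain r s k where 1: "k \<in> derived2" "x = s *\<^sub>R e1 + r *\<^sub>R e2 + k" using dec[OF x] by blast
    obtain a3 a4 where "k = a3 *\<^sub>R c + a4 *\<^sub>R z" using dec3[OF 1(1)] by blast
    then have "x = s *\<^sub>R e1 + r *\<^sub>R e2 + a3 *\<^sub>R c + a4 *\<^sub>R z" using 1 by simp
    then show ?thesis by blast
  qed
  have ind: "a1 = 0 \<and> a2 = 0 \<and> a3 = 0 \<and> a4 = 0" if rel: "a1 *\<^sub>R e1 + a2 *\<^sub>R e2 + a3 *\<^sub>R c + a4 *\<^sub>R z = 0" for a1 a2 a3 a4
  proof -
    have "br (a1 *\<^sub>R e1 + a2 *\<^sub>R e2 + a3 *\<^sub>R c + a4 *\<^sub>R z) c = 0" unfolding rel by (simp add: br_simps)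
    then have a1: "a1 = 0" using zn(1) by (simp add: br_simps e1c e2k[OF c2] ab[OF zn(2) c2])
    have "br e1 (br e1 (a1 *\<^sub>R e1 + a2 *\<^sub>R e2 + a3 *\<^sub>R c + a4 *\<^sub>R z)) = 0" unfolding rel by (simp add: br_simps)
    then have a2: "a2 = 0" using zn(1) by (simp add: br_simps c_def[symmetric] e1c zn)
    have "br e1 (a1 *\<^sub>R e1 + a2 *\<^sub>R e2 + a3 *\<^sub>R c + a4 *\<^sub>R z) = 0" unfolding rel by (simp add: br_simps)
    then have a3: "a3 = 0" using zn(1) by (simp add: br_simps a1 a2 e1c zn)
    show ?thesis using rel a1 a2 a3 zn(1) by simp
  qed
  show thesis
    by (rule that[of e1 e2 c z]) (use e1 e2 c2 zn derived2_ideal(3) e1c dec3 dec4 ind e2k[OF c2] e2k[OF zn(2)] ab[OF c2 zn(2)] in \<open>auto simp: c_def[symmetric]\<close>)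
qed

text \<open>
  The complement \<open>v\<close> acts on the filiform algebra with diagonal entries \<open>a\<close> on \<open>e1\<close>, \<open>b\<close> on \<open>e2\<close> and \<open>\<lambda> = 2 a + b\<close>
  on \<open>z\<close>. Here \<open>\<lambda> \<noteq> 0\<close> because the centre is trivial, and \<open>a \<noteq> 0\<close> because \<open>e1\<close> lies in the derived ideal, which is
  \<open>[v, D] + [D, D]\<close>. If \<open>n\<close> is the \<open>z\<close>-coordinate of \<open>[v, e2]\<close>, the functional with \<open>\<eta> z = 1\<close>, \<open>\<eta> e2 = y\<close> that vanishes on
  \<open>e1, c, v\<close> is a contact form iff \<open>n \<noteq> 2 a y\<close>.
\<close>

lemma contact_derived2_dim_2:
  assumes dim: "DIM('e) = 5" and cen: "lie_center UNIV br = {0}" and d: "dim derived = 4" and d2: "dim derived2 = 2"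
  shows "contact_lie_algebra UNIV br" "dim (lie_center derived br) = 1"
proof -
  obtain e1 e2 c z where D: "e1 \<in> derived" "e2 \<in> derived" "c \<in> derived" "z \<in> derived" and z0: "z \<noteq> 0"
    and t: "br e1 e2 = c" "br e1 c = z" "br e1 z = 0" "br e2 c = 0" "br e2 z = 0" "br c z = 0"
    and dec: "\<forall>x\<in>derived. \<exists>a1 a2 a3 a4. x = a1 *\<^sub>R e1 + a2 *\<^sub>R e2 + a3 *\<^sub>R c + a4 *\<^sub>R z"
    and dec2: "\<forall>x\<in>derived2. \<exists>a3 a4. x = a3 *\<^sub>R c + a4 *\<^sub>R z"
    and ind4: "\<forall>a1 a2 a3 a4. a1 *\<^sub>R e1 + a2 *\<^sub>R e2 + a3 *\<^sub>R c + a4 *\<^sub>R z = 0 \<longrightarrow> a1 = 0 \<and> a2 = 0 \<and> a3 = 0 \<and> a4 = 0"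
    by (rule derived2_dim_2_filiform[OF dim d d2]) (rule that)
  have t': "br e2 e1 = - c" "br c e1 = - z" "br z e1 = 0" "br c e2 = 0" "br z e2 = 0" "br z c = 0"
    using t br_skew[of e2 e1] br_skew[of c e1] br_skew[of z e1] br_skew[of c e2] br_skew[of z e2] br_skew[of z c] by auto
  have Z: "\<exists>r. x = r *\<^sub>R z" if x: "x \<in> lie_center derived br" for x
  proof -
    have xD: "x \<in> derived" "br x e1 = 0" "br x c = 0" using x D unfolding lie_center_def by auto
    obtain a1 a2 a3 a4 where a: "x = a1 *\<^sub>R e1 + a2 *\<^sub>R e2 + a3 *\<^sub>R c + a4 *\<^sub>R z" using dec xD(1) by blast
    have "a1 = 0" using xD(3) z0 by (simp add: a br_simps t t')
    moreover have "0 *\<^sub>R e1 + 0 *\<^sub>R e2 + (- a2) *\<^sub>R c + (- a3) *\<^sub>R z = 0" using xD(2) by (simp add: a br_simps t t')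
    then have "- a2 = 0 \<and> - a3 = 0" using ind4 by blast
    ultimately show ?thesis using a by auto
  qed
  have zZ: "z \<in> lie_center derived br"
  proof -
    have "br z y = 0" if y: "y \<in> derived" for y
    proof -
      obtain a1 a2 a3 a4 where a: "y = a1 *\<^sub>R e1 + a2 *\<^sub>R e2 + a3 *\<^sub>R c + a4 *\<^sub>R z" using dec y by blast
      show ?thesis by (simp add: a br_simps t t')
    qed
    then show ?thesis unfolding lie_center_def using D by auto
  qed
  have "lie_center derived br = span {z}"
  proof (intro equalityI subsetI)
    fix x assume "x \<in> lie_center derived br"
    then show "x \<in> span {z}" using Z by (auto simp: span_singleton)
  next
    fix x assume "x \<in> span {z}"
    then show "x \<in> lie_center derived br" using zZ subspace_derived unfolding lie_center_def
      by (auto simp: span_singleton br_simps subspace_scale)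
  qed
  then show "dim (lie_center derived br) = 1" using z0 by simp
  obtain v where v: "v \<notin> derived" "\<forall>u. \<exists>t k. k \<in> derived \<and> u = t *\<^sub>R v + k"
    by (rule complement_vector[OF dim d]) (rule that)
  obtain la where la: "br v z = la *\<^sub>R z" using Z[OF center_derived_ideal[OF zZ]] by blast
  obtain a a2 a3 a4 where va: "br v e1 = a *\<^sub>R e1 + a2 *\<^sub>R e2 + a3 *\<^sub>R c + a4 *\<^sub>R z" using dec br_in_derived by blast
  obtain b1 b m n where vb: "br v e2 = b1 *\<^sub>R e1 + b *\<^sub>R e2 + m *\<^sub>R c + n *\<^sub>R z" using dec br_in_derived by blast
  have vc: "br v c = (a + b) *\<^sub>R c + m *\<^sub>R z"
    using br_jacobi[of v e1 e2] by (simp add: va vb t t' br_simps algebra_simps)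
  have "la *\<^sub>R z = (a + (a + b)) *\<^sub>R z"
    using br_jacobi[of v e1 c] by (simp only: scaleR_add_left) (simp add: va vb vc la t t' br_simps scaleR_add_left)
  then have lab: "la = 2 * a + b" using z0 by simp
  have "b1 *\<^sub>R z = 0" using br_jacobi[of v e2 c] by (simp add: vb vc t t' br_simps)
  then have b1: "b1 = 0" using z0 by simp
  have la0: "la \<noteq> 0"
  proof
    assume "la = 0"
    have "br z y = 0" for y
    proof -
      obtain s k where sk: "k \<in> derived" "y = s *\<^sub>R v + k" using v(2) by blast
      have "br z k = 0" using zZ sk(1) unfolding lie_center_def by simp
      then show ?thesis using br_skew[of z v] la \<open>la = 0\<close> by (simp add: sk(2) br_simps)
    qed
    then have "z \<in> lie_center UNIV br" unfolding lie_center_def by simp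
    then show False using cen z0 by blast
  qed
  have a0: "a \<noteq> 0"
  proof
    assume a0: "a = 0"
    obtain e' where e': "e' \<in> derived" "e1 - br v e' \<in> derived2" using derived_mod_derived2[OF v(2) D(1)] by blast
    obtain x1 x2 x3 x4 where x: "e' = x1 *\<^sub>R e1 + x2 *\<^sub>R e2 + x3 *\<^sub>R c + x4 *\<^sub>R z" using dec e'(1) by blast
    obtain y3 y4 where y: "e1 - br v e' = y3 *\<^sub>R c + y4 *\<^sub>R z" using dec2 e'(2) by blast
    have eq: "1 *\<^sub>R e1 + (- (x1 * a2) - x2 * b) *\<^sub>R e2 + (- (x1 * a3) - x2 * m - x3 * (a + b) - y3) *\<^sub>R c
      + (- (x1 * a4) - x2 * n - x3 * m - x4 * la - y4) *\<^sub>R z = e1 - br v e' - (y3 *\<^sub>R c + y4 *\<^sub>R z)"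
      by (simp add: x br_simps va vb vc la b1 a0 algebra_simps)
    have "(1::real) = 0" using ind4 eq unfolding y by (metis diff_self)
    then show False by simp
  qed
  define y where "y = (n - 1) / (2 * a)"
  have y: "n - 2 * a * y = 1" using a0 by (simp add: y_def)
  have ind: "c1 = 0 \<and> c2 = 0 \<and> c3 = 0 \<and> c4 = 0 \<and> c5 = 0"
    if rel: "c1 *\<^sub>R e1 + c2 *\<^sub>R e2 + c3 *\<^sub>R c + c4 *\<^sub>R z + c5 *\<^sub>R v = 0" for c1 c2 c3 c4 c5
  proof -
    have c5: "c5 = 0"
    proof (rule ccontr)
      assume c5: "c5 \<noteq> 0"
      have "c5 *\<^sub>R v = - (c1 *\<^sub>R e1 + c2 *\<^sub>R e2 + c3 *\<^sub>R c + c4 *\<^sub>R z)" using rel by (simp add: add_eq_0_iff)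
      moreover have "- (c1 *\<^sub>R e1 + c2 *\<^sub>R e2 + c3 *\<^sub>R c + c4 *\<^sub>R z) \<in> derived"
        by (intro subspace_neg subspace_add subspace_scale subspace_derived D)
      ultimately have "(1 / c5) *\<^sub>R (c5 *\<^sub>R v) \<in> derived" using subspace_derived by (simp only: subspace_scale)
      then show False using v(1) c5 by simp
    qed
    then show ?thesis using ind4 rel by simp
  qed
  obtain \<eta> :: "'e \<Rightarrow> real" where \<eta>: "linear \<eta>" "\<eta> e1 = 0" "\<eta> e2 = y" "\<eta> c = 0" "\<eta> z = 1" "\<eta> v = 0"
    by (rule functional_5[OF dim ind, where ?t1.0=0 and ?t2.0=y and ?t3.0=0 and ?t4.0=1 and ?t5.0=0]) (assumption, rule that)
  note l\<eta> = linear_add[OF \<eta>(1)] linear_scale[OF \<eta>(1)] linear_neg[OF \<eta>(1)] linear_diff[OF \<eta>(1)] linear_0[OF \<eta>(1)] \<eta>(2-6)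
  show "contact_lie_algebra UNIV br" unfolding contact_iff_5[OF dim]
  proof (intro exI[of _ \<eta>] conjI \<eta>(1) allI impI)
    fix u assume u: "\<eta> u = 0" "\<forall>y. \<eta> (br u y) = 0"
    obtain c1 c2 c3 c4 c5 where uc: "u = c1 *\<^sub>R e1 + c2 *\<^sub>R e2 + c3 *\<^sub>R c + c4 *\<^sub>R z + c5 *\<^sub>R v"
      by (rule basis_5[OF dim ind])
    have 1: "\<eta> (br u z) = 0" "\<eta> (br u c) = 0" "\<eta> (br u e1) = 0" "\<eta> (br v u) = 0"
      using u(2) br_skew[of v u] by (auto simp: l\<eta>)
    have c5: "c5 = 0" using 1(1) la0 by (simp add: uc br_simps t t' la l\<eta>)
    have c1: "c1 = 0" using 1(2) by (simp add: uc br_simps t t' l\<eta> c5)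
    have c3: "c3 = 0" using 1(3) by (simp add: uc br_simps t t' l\<eta> c5)
    have "c2 * (b * y + n) + c4 * la = 0" using 1(4) by (simp add: uc br_simps vb la b1 l\<eta> c5 c1 c3)
    moreover have c4: "c4 = - (c2 * y)" using u(1) by (simp add: uc l\<eta> c5 c1 c3)
    ultimately have "c2 * (n - 2 * a * y) = 0" by (simp add: lab algebra_simps)
    then have "c2 = 0" using y by simp
    then show "u = 0" using c4 by (simp add: uc c1 c3 c5)
  qed
qed

lemma contact_derived_4_iff:
  assumes dim: "DIM('e) = 5" and solv: "lie_solvable UNIV br" and cen: "lie_center UNIV br = {0}" and d: "dim derived = 4"
  shows "contact_lie_algebra UNIV br \<longleftrightarrow>
    dim (lie_center derived br) = 1 \<or>
    dim (lie_center derived br) = 2 \<and> (\<exists>v. \<not> (\<exists>r::real. \<forall>x\<in>lie_center derived br. br v x = r *\<^sub>R x))"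
proof -
  have "dim derived2 \<le> 4" using dim_subset[OF derived2_ideal(3)] d by simp
  moreover have "dim derived2 \<noteq> 4"
  proof
    assume "dim derived2 = 4"
    then have "derived2 = derived" by (intro subspace_dim_equal[OF derived2_ideal(1) subspace_derived derived2_ideal(3)]) (simp add: d)
    then show False using solvable_not_perfect[OF solv, of derived] d by simp
  qed
  moreover have "dim derived2 \<noteq> 3" using derived2_codim_ne_1[OF solv] d by (cases "derived2 = {0}") auto
  ultimately consider "dim derived2 = 0" | "dim derived2 = 1" | "dim derived2 = 2" by linarith
  then show ?thesis
  proof cases
    case 1
    then have "derived2 = {0}" using subspace_0[OF derived2_ideal(1)] by (auto simp: dim_eq_0)
    then show ?thesis using abelian_derived_4_not_contact[OF dim d] d by simp
  next
    case 2
    have "dim (lie_center derived br) = 2" by (rule derived2_dim_1_center[OF d 2])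
    then show ?thesis using contact_derived2_dim_1[OF dim d 2] contact_center_not_scalar[OF dim] by auto
  next
    case 3
    then show ?thesis using contact_derived2_dim_2[OF dim cen d] by simp
  qed
qed

end

lemma solvable_contact_5:
  fixes L :: "'a::real_vector set"
  assumes L: "lie_algebra L br" "dim L = 5" "lie_solvable L br" "lie_center L br = {0}"
  shows "dim (lie_derived L br) = 3 \<and> \<not> lie_abelian (lie_derived L br) br \<longrightarrow> contact_lie_algebra L br"
    and "dim (lie_derived L br) = 4 \<longrightarrow>
           (contact_lie_algebra L br \<longleftrightarrow>
              dim (lie_center (lie_derived L br) br) = 1 \<or>
              dim (lie_center (lie_derived L br) br) = 2 \<and>
              (\<exists>v\<in>L. \<not> (\<exists>r::real. \<forall>x\<in>lie_center (lie_derived L br) br. br v x = r *\<^sub>R x)))"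
proof -
  have dv: "DIM(real^5) = 5" by simp
  have "dim L = DIM(real^5)" using L(2) by simp
  then obtain g :: "real^5 \<Rightarrow> 'a" and br' where emb: "lie_embedding g br' br" and lie': "lie_algebra UNIV br'" and g: "range g = L"
    by (rule lie_algebra_coordinates[OF L(1)]) (rule that)
  interpret S: lie_space br' by (rule lie_space.intro) (rule lie')
  have lin: "linear g" and inj: "inj g" and gbr: "\<And>x y. g (br' x y) = br (g x) (g y)" using emb by (auto simp: lie_embedding_def)
  have der: "lie_derived L br = g ` S.derived" using lie_derived_image[OF emb, of UNIV] g by simp
  have cenD: "lie_center (lie_derived L br) br = g ` lie_center S.derived br'" unfolding der by (rule lie_center_image[OF emb])
  have "g ` lie_center UNIV br' = {0}" using lie_center_image[OF emb, of UNIV] g L(4) by simp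
  then have cen: "lie_center UNIV br' = {0}" using inj_image_eq_iff[OF inj, of _ "{0}"] linear_0[OF lin] by simp
  have solv: "lie_solvable UNIV br'" using lie_solvable_image[OF emb, of UNIV] g L(3) by simp
  have con: "contact_lie_algebra L br \<longleftrightarrow> contact_lie_algebra UNIV br'" using contact_lie_algebra_image[OF emb] g by simp
  have dimD: "dim (lie_derived L br) = dim S.derived" unfolding der by (rule dim_linear_image_inj[OF lin inj])
  have dimC: "dim (lie_center (lie_derived L br) br) = dim (lie_center S.derived br')"
    unfolding cenD by (rule dim_linear_image_inj[OF lin inj])
  have ab: "lie_abelian (lie_derived L br) br \<longleftrightarrow> lie_abelian S.derived br'" unfolding der by (rule lie_abelian_image[OF emb])
  show "dim (lie_derived L br) = 3 \<and> \<not> lie_abelian (lie_derived L br) br \<longrightarrow> contact_lie_algebra L br"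
    using S.contact_derived_3_nonabelian[OF dv solv cen] unfolding con dimD ab by blast
  have sc: "br (g v) (g x) = r *\<^sub>R g x \<longleftrightarrow> br' v x = r *\<^sub>R x" for v x r
    by (simp add: gbr[symmetric] linear_scale[OF lin, symmetric] inj_eq[OF inj])
  have "(\<exists>v\<in>L. \<not> (\<exists>r::real. \<forall>x\<in>lie_center (lie_derived L br) br. br v x = r *\<^sub>R x)) \<longleftrightarrow>
    (\<exists>v. \<not> (\<exists>r::real. \<forall>x\<in>lie_center S.derived br'. br' v x = r *\<^sub>R x))"
  proof -
    have "(\<forall>x\<in>lie_center (lie_derived L br) br. br (g v) x = r *\<^sub>R x) \<longleftrightarrow>
      (\<forall>x\<in>lie_center S.derived br'. br' v x = r *\<^sub>R x)" for v and r :: real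
      unfolding cenD by (simp add: sc)
    moreover have "(\<exists>v\<in>L. P v) \<longleftrightarrow> (\<exists>v. P (g v))" for P using g by blast
    ultimately show ?thesis by (simp only:)
  qed
  then show "dim (lie_derived L br) = 4 \<longrightarrow>
           (contact_lie_algebra L br \<longleftrightarrow>
              dim (lie_center (lie_derived L br) br) = 1 \<or>
              dim (lie_center (lie_derived L br) br) = 2 \<and>
              (\<exists>v\<in>L. \<not> (\<exists>r::real. \<forall>x\<in>lie_center (lie_derived L br) br. br v x = r *\<^sub>R x)))"
    using S.contact_derived_4_iff[OF dv solv cen] unfolding con dimD dimC by blast
qed

section \<open>Smooth maps between Euclidean spaces\<close>

lemma frechet_derivative_eqI: "(f has_derivative f') (at x) \<Longrightarrow> frechet_derivative f (at x) = f'"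
  by (metis frechet_derivative_at)

lemma frechet_derivative_cong_open:
  assumes "open S" "x \<in> S" "\<And>y. y \<in> S \<Longrightarrow> f y = g y"
  shows "frechet_derivative f (at x) = frechet_derivative g (at x)" "f differentiable (at x) \<longleftrightarrow> g differentiable (at x)"
proof -
  have "(f has_derivative f') (at x) \<longleftrightarrow> (g has_derivative f') (at x)" for f'
    using has_derivative_transform_within_open[OF _ assms(1,2), of f f' UNIV g]
      has_derivative_transform_within_open[OF _ assms(1,2), of g f' UNIV f] assms(3) by auto
  then show "frechet_derivative f (at x) = frechet_derivative g (at x)" "f differentiable (at x) \<longleftrightarrow> g differentiable (at x)"
    unfolding frechet_derivative_def differentiable_def by simp_all
qed

lemma Ck_on_cong:
  assumes "open S" "\<And>x. x \<in> S \<Longrightarrow> f x = g x" "Ck_on k S f"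
  shows "Ck_on k S g"
  using assms(2,3)
proof (induction k arbitrary: f g)
  case 0
  then show ?case by (simp cong: continuous_on_cong)
next
  case (Suc k)
  have "Ck_on k S (\<lambda>x. frechet_derivative g (at x) v)" for v
  proof (rule Suc.IH)
    show "frechet_derivative f (at x) v = frechet_derivative g (at x) v" if "x \<in> S" for x
      using frechet_derivative_cong_open(1)[OF assms(1) that Suc.prems(1)] by simp
    show "Ck_on k S (\<lambda>x. frechet_derivative f (at x) v)" using Suc.prems(2) by simp
  qed
  moreover have "g differentiable (at x)" if "x \<in> S" for x
    using frechet_derivative_cong_open(2)[where f=f and g=g, OF assms(1) that Suc.prems(1)] Suc.prems(2) that by simp
  ultimately show ?case by simp
qed

lemma Ck_on_local:
  assumes "\<And>x. x \<in> S \<Longrightarrow> \<exists>T. open T \<and> x \<in> T \<and> Ck_on k T f"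
  shows "Ck_on k S f"
  using assms
proof (induction k arbitrary: f)
  case 0
  have "isCont f x" if "x \<in> S" for x
    using "0.prems"[OF that] continuous_on_eq_continuous_at by auto
  then show ?case by (simp add: continuous_at_imp_continuous_on)
next
  case (Suc k)
  have "Ck_on k S (\<lambda>x. frechet_derivative f (at x) v)" for v
  proof (rule Suc.IH)
    fix x assume "x \<in> S"
    then obtain T where "open T" "x \<in> T" "Ck_on (Suc k) T f" using Suc.prems by blast
    then show "\<exists>T. open T \<and> x \<in> T \<and> Ck_on k T (\<lambda>x. frechet_derivative f (at x) v)" by auto
  qed
  moreover have "f differentiable (at x)" if "x \<in> S" for x using Suc.prems[OF that] by auto
  ultimately show ?case by simp
qed

lemma Ck_on_SucD: "Ck_on (Suc k) S f \<Longrightarrow> Ck_on k S f"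
proof (induction k arbitrary: f)
  case 0
  then show ?case by (auto intro!: continuous_at_imp_continuous_on differentiable_imp_continuous_within)
next
  case (Suc k)
  then show ?case by simp
qed

lemma Ck_on_linear:
  assumes "open S" "bounded_linear L" "Ck_on k S f"
  shows "Ck_on k S (\<lambda>x. L (f x))"
  using assms(3)
proof (induction k arbitrary: f)
  case 0
  then show ?case using bounded_linear.continuous_on[OF assms(2)] by simp
next
  case (Suc k)
  have D: "((\<lambda>x. L (f x)) has_derivative (\<lambda>v. L (frechet_derivative f (at x) v))) (at x)" if "x \<in> S" for x
    by (rule bounded_linear.has_derivative[OF assms(2)]) (use Suc.prems that in \<open>simp add: frechet_derivative_works[symmetric]\<close>)
  have "Ck_on k S (\<lambda>x. L (frechet_derivative f (at x) v))" for v using Suc by simp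
  then have "Ck_on k S (\<lambda>x. frechet_derivative (\<lambda>x. L (f x)) (at x) v)" for v
    by (rule Ck_on_cong[OF assms(1), rotated]) (simp add: frechet_derivative_eqI[OF D])
  then show ?case using D by (auto intro: differentiableI)
qed

lemma Ck_on_const: "Ck_on k S (\<lambda>x. c)"
proof (induction k arbitrary: c)
  case (Suc k)
  then show ?case by (simp add: frechet_derivative_const)
qed simp

lemma Ck_on_id: "Ck_on k S (\<lambda>x. x)"
proof (cases k)
  case (Suc k)
  have "frechet_derivative (\<lambda>x::'a. x) (at x) = (\<lambda>v. v)" for x :: 'a by (rule frechet_derivative_eqI) (rule has_derivative_ident)
  then show ?thesis using Suc by (simp add: Ck_on_const)
qed simp

lemma Ck_on_add:
  assumes "open S" "Ck_on k S f" "Ck_on k S g"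
  shows "Ck_on k S (\<lambda>x. f x + g x)"
  using assms(2,3)
proof (induction k arbitrary: f g)
  case 0
  then show ?case by (simp add: continuous_on_add)
next
  case (Suc k)
  have D: "((\<lambda>x. f x + g x) has_derivative (\<lambda>v. frechet_derivative f (at x) v + frechet_derivative g (at x) v)) (at x)" if "x \<in> S" for x
    by (rule has_derivative_add) (use Suc.prems that in \<open>simp_all add: frechet_derivative_works[symmetric]\<close>)
  have "Ck_on k S (\<lambda>x. frechet_derivative f (at x) v + frechet_derivative g (at x) v)" for v using Suc by simp
  then have "Ck_on k S (\<lambda>x. frechet_derivative (\<lambda>x. f x + g x) (at x) v)" for v
    by (rule Ck_on_cong[OF assms(1), rotated]) (simp add: frechet_derivative_eqI[OF D])
  then show ?case using D by (auto intro: differentiableI)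
qed

lemma Ck_on_sum:
  assumes "open S" "finite I" "\<And>i. i \<in> I \<Longrightarrow> Ck_on k S (f i)"
  shows "Ck_on k S (\<lambda>x. \<Sum>i\<in>I. f i x)"
  using assms(2,3) by (induction I) (auto intro: Ck_on_const Ck_on_add[OF assms(1)])

lemma Ck_on_scaleR:
  fixes f :: "'a::real_normed_vector \<Rightarrow> real"
  assumes "open S" "Ck_on k S f" "Ck_on k S g"
  shows "Ck_on k S (\<lambda>x. f x *\<^sub>R g x)"
  using assms(2,3)
proof (induction k arbitrary: f g)
  case 0
  then show ?case by (simp add: continuous_on_scaleR)
next
  case (Suc k)
  have D: "((\<lambda>x. f x *\<^sub>R g x) has_derivative (\<lambda>v. f x *\<^sub>R frechet_derivative g (at x) v + frechet_derivative f (at x) v *\<^sub>R g x)) (at x)"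
    if "x \<in> S" for x
    by (rule has_derivative_scaleR) (use Suc.prems that in \<open>simp_all add: frechet_derivative_works[symmetric]\<close>)
  have "Ck_on k S (\<lambda>x. f x *\<^sub>R frechet_derivative g (at x) v + frechet_derivative f (at x) v *\<^sub>R g x)" for v
    by (rule Ck_on_add[OF assms(1)]; rule Suc.IH) (use Suc.prems Ck_on_SucD in auto)
  then have "Ck_on k S (\<lambda>x. frechet_derivative (\<lambda>x. f x *\<^sub>R g x) (at x) v)" for v
    by (rule Ck_on_cong[OF assms(1), rotated]) (simp add: frechet_derivative_eqI[OF D])
  then show ?case using D by (auto intro: differentiableI)
qed

lemma Ck_on_Pair:
  assumes "open S" "Ck_on k S f" "Ck_on k S g"
  shows "Ck_on k S (\<lambda>x. (f x, g x))"
proof -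
  have L: "bounded_linear (\<lambda>y::'b. (y, 0::'c))" "bounded_linear (\<lambda>y::'c. (0::'b, y))"
    by (intro bounded_linear_Pair bounded_linear_ident bounded_linear_zero)+
  have "Ck_on k S (\<lambda>x. (f x, 0) + (0, g x))"
    by (rule Ck_on_add[OF assms(1) Ck_on_linear[OF assms(1) L(1) assms(2)] Ck_on_linear[OF assms(1) L(2) assms(3)]])
  then show ?thesis by simp
qed

lemma linear_sum_Basis:
  fixes L :: "'b::euclidean_space \<Rightarrow> 'c::real_vector"
  assumes "linear L"
  shows "L w = (\<Sum>b\<in>Basis. (w \<bullet> b) *\<^sub>R L b)"
proof -
  have "L w = L (\<Sum>b\<in>Basis. (w \<bullet> b) *\<^sub>R b)" by (simp add: euclidean_representation)
  then show ?thesis by (simp add: linear_sum[OF assms] linear_scale[OF assms])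
qed

lemma linear_frechet_derivative_at: "f differentiable (at x) \<Longrightarrow> linear (frechet_derivative f (at x))"
  by (simp add: linear_frechet_derivative)

text \<open>
  The chain rule \<open>D(F \<circ> g)(x) v = (\<Sum>b. (Dg(x) v \<bullet> b) DF(g x) b)\<close> expresses the derivatives in terms of
  directional derivatives along fixed vectors, to which the induction hypothesis applies.
\<close>

lemma Ck_on_compose:
  fixes F :: "'b::euclidean_space \<Rightarrow> 'c::real_normed_vector"
  assumes S: "open S" and "Ck_on k U F" "Ck_on k S g" "g ` S \<subseteq> U"
  shows "Ck_on k S (\<lambda>x. F (g x))"
  using assms(2,3)
proof (induction k arbitrary: F)
  case 0
  then show ?case using continuous_on_compose2[of U F S g] assms(4) by simp
next
  case (Suc k)
  have F: "F differentiable (at (g x))" and g: "g differentiable (at x)" if "x \<in> S" for x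
    using Suc.prems assms(4) that by auto
  have "((\<lambda>x. F (g x)) has_derivative (\<lambda>v. frechet_derivative F (at (g x)) (frechet_derivative g (at x) v))) (at x)" if "x \<in> S" for x
    using F[OF that] g[OF that] by (intro has_derivative_compose[where g=F and f=g]) (auto simp: frechet_derivative_works[symmetric])
  then have D: "((\<lambda>x. F (g x)) has_derivative (\<lambda>v. \<Sum>b\<in>Basis. (frechet_derivative g (at x) v \<bullet> b) *\<^sub>R frechet_derivative F (at (g x)) b)) (at x)" if "x \<in> S" for x
    by (simp only: linear_sum_Basis[OF linear_frechet_derivative_at[OF F[OF that]], symmetric] that)
  have "Ck_on k S (\<lambda>x. \<Sum>b\<in>Basis. (frechet_derivative g (at x) v \<bullet> b) *\<^sub>R frechet_derivative F (at (g x)) b)" for v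
  proof (rule Ck_on_sum[OF S finite_Basis], rule Ck_on_scaleR[OF S])
    fix b :: 'b
    show "Ck_on k S (\<lambda>x. frechet_derivative g (at x) v \<bullet> b)"
      by (rule Ck_on_linear[OF S bounded_linear_inner_left]) (use Suc.prems in simp)
    show "Ck_on k S (\<lambda>x. frechet_derivative F (at (g x)) b)"
      using Suc.IH[of "\<lambda>y. frechet_derivative F (at y) b"] Suc.prems Ck_on_SucD by auto
  qed
  then have "Ck_on k S (\<lambda>x. frechet_derivative (\<lambda>x. F (g x)) (at x) v)" for v
    by (rule Ck_on_cong[OF S, rotated]) (simp add: frechet_derivative_eqI[OF D])
  then show ?case using D by (auto intro: differentiableI)
qed

lemma smooth_on_continuous: "smooth_on S f \<Longrightarrow> continuous_on S f"
  unfolding smooth_on_def by (metis Ck_on.simps(1))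

lemma smooth_on_differentiable: "smooth_on S f \<Longrightarrow> x \<in> S \<Longrightarrow> f differentiable (at x)"
  unfolding smooth_on_def by (metis Ck_on.simps(2))

lemma smooth_on_has_derivative:
  "smooth_on S f \<Longrightarrow> x \<in> S \<Longrightarrow> (f has_derivative frechet_derivative f (at x)) (at x)"
  using smooth_on_differentiable frechet_derivative_works by blast

lemma smooth_on_derivative: "smooth_on S f \<Longrightarrow> smooth_on S (\<lambda>x. frechet_derivative f (at x) v)"
  unfolding smooth_on_def by (metis Ck_on.simps(2))

text \<open>
  The product rule for evaluating a moving linear map at a moving vector, when the family \<open>H\<close> is only known
  to be differentiable at each fixed vector.
\<close>

lemma has_derivative_linear_family:
  fixes H :: "'a::real_normed_vector \<Rightarrow> 'b::euclidean_space \<Rightarrow> 'c::real_normed_vector"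
  assumes U: "open U" "\<phi> y \<in> U" and lin: "\<And>z. z \<in> U \<Longrightarrow> linear (H z)"
    and H: "\<And>b. (\<lambda>z. H z b) differentiable (at (\<phi> y))"
    and \<phi>: "(\<phi> has_derivative \<phi>') (at y)" and \<psi>: "(\<psi> has_derivative \<psi>') (at y)"
  shows "((\<lambda>y. H (\<phi> y) (\<psi> y)) has_derivative
    (\<lambda>w. H (\<phi> y) (\<psi>' w) + frechet_derivative (\<lambda>z. H z (\<psi> y)) (at (\<phi> y)) (\<phi>' w))) (at y)"
proof -
  have HD: "((\<lambda>z. H z b) has_derivative frechet_derivative (\<lambda>z. H z b) (at (\<phi> y))) (at (\<phi> y))" for b
    using H[of b] by (simp add: frechet_derivative_works)
  have HD': "((\<lambda>y. H (\<phi> y) b) has_derivative (\<lambda>w. frechet_derivative (\<lambda>z. H z b) (at (\<phi> y)) (\<phi>' w))) (at y)" for b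
    by (rule has_derivative_compose[OF \<phi> HD])
  have "((\<lambda>z. \<Sum>b\<in>Basis. (\<psi> y \<bullet> b) *\<^sub>R H z b) has_derivative
    (\<lambda>w. \<Sum>b\<in>Basis. (\<psi> y \<bullet> b) *\<^sub>R frechet_derivative (\<lambda>z. H z b) (at (\<phi> y)) w)) (at (\<phi> y))"
    by (intro has_derivative_sum has_derivative_scaleR_right HD)
  then have "((\<lambda>z. H z (\<psi> y)) has_derivative
    (\<lambda>w. \<Sum>b\<in>Basis. (\<psi> y \<bullet> b) *\<^sub>R frechet_derivative (\<lambda>z. H z b) (at (\<phi> y)) w)) (at (\<phi> y))"
    by (rule has_derivative_transform_within_open[OF _ U]) (simp add: linear_sum_Basis[OF lin, symmetric])
  then have fd: "frechet_derivative (\<lambda>z. H z (\<psi> y)) (at (\<phi> y)) w = (\<Sum>b\<in>Basis. (\<psi> y \<bullet> b) *\<^sub>R frechet_derivative (\<lambda>z. H z b) (at (\<phi> y)) w)" for w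
    by (simp add: frechet_derivative_eqI)
  have "((\<lambda>y. \<Sum>b\<in>Basis. (\<psi> y \<bullet> b) *\<^sub>R H (\<phi> y) b) has_derivative
    (\<lambda>w. \<Sum>b\<in>Basis. (\<psi> y \<bullet> b) *\<^sub>R frechet_derivative (\<lambda>z. H z b) (at (\<phi> y)) (\<phi>' w) + (\<psi>' w \<bullet> b) *\<^sub>R H (\<phi> y) b)) (at y)"
    by (intro has_derivative_sum has_derivative_scaleR has_derivative_inner_left HD' \<psi>)
  then have main: "((\<lambda>y. \<Sum>b\<in>Basis. (\<psi> y \<bullet> b) *\<^sub>R H (\<phi> y) b) has_derivative
    (\<lambda>w. H (\<phi> y) (\<psi>' w) + frechet_derivative (\<lambda>z. H z (\<psi> y)) (at (\<phi> y)) (\<phi>' w))) (at y)"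
    by (simp add: fd sum.distrib linear_sum_Basis[OF lin[OF U(2)], symmetric] add.commute)
  have "isCont \<phi> y" using \<phi> by (rule has_derivative_continuous)
  then have "\<exists>V. open V \<and> y \<in> V \<and> (\<forall>y'\<in>V. \<phi> y' \<in> U)"
    using U unfolding continuous_at_open by simp
  then obtain V where V: "open V" "y \<in> V" "\<And>y'. y' \<in> V \<Longrightarrow> \<phi> y' \<in> U" by blast
  show ?thesis
    by (rule has_derivative_transform_within_open[OF main V(1,2)]) (use V(3) in \<open>simp add: linear_sum_Basis[OF lin, symmetric]\<close>)
qed

text \<open>
  Two applications of the mean value theorem turn the second difference quotient into the second derivative
  at an intermediate point, which is close to its value at \<open>x\<close> by continuity.
\<close>

lemma second_difference_limit:
  fixes f :: "'a::real_normed_vector \<Rightarrow> 'b::euclidean_space"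
  assumes S: "open S" "x \<in> S" and f: "smooth_on S f" and e: "0 < e"
  shows "\<exists>d>0. \<forall>h. 0 < h \<and> h < d \<longrightarrow>
    \<bar>(f (x + h *\<^sub>R u + h *\<^sub>R v) - f (x + h *\<^sub>R u) - f (x + h *\<^sub>R v) + f x) \<bullet> b / h\<^sup>2
      - frechet_derivative (\<lambda>y. frechet_derivative f (at y) u) (at x) v \<bullet> b\<bar> < e"
proof -
  define F where "F y = frechet_derivative f (at y) u" for y
  define G where "G y = frechet_derivative F (at y) v" for y
  have sF: "smooth_on S F" unfolding F_def by (rule smooth_on_derivative[OF f])
  have sG: "smooth_on S G" unfolding G_def by (rule smooth_on_derivative[OF sF])
  have "isCont (\<lambda>y. G y \<bullet> b) x" using smooth_on_continuous[OF sG] S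
    by (intro continuous_intros) (simp add: continuous_on_eq_continuous_at)
  then obtain r where r: "0 < r" "\<And>y. dist y x < r \<Longrightarrow> \<bar>G y \<bullet> b - G x \<bullet> b\<bar> < e"
    using e unfolding continuous_at_eps_delta dist_real_def by blast
  obtain r' where r': "0 < r'" "ball x r' \<subseteq> S" using S openE by blast
  define d where "d = min r r' / (norm u + norm v + 1)"
  have nuv: "0 < norm u + norm v + 1" by (smt (verit) norm_ge_zero)
  have d: "0 < d" using r r' nuv by (simp add: d_def)
  have near: "dist (x + s *\<^sub>R u + t *\<^sub>R v) x < min r r'" if "0 \<le> s" "s \<le> h" "0 \<le> t" "t \<le> h" "0 < h" "h < d" for s t h
  proof -
    have "dist (x + s *\<^sub>R u + t *\<^sub>R v) x = norm (s *\<^sub>R u + t *\<^sub>R v)" by (simp add: dist_norm)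
    also have "\<dots> \<le> s * norm u + t * norm v" using norm_triangle_ineq[of "s *\<^sub>R u" "t *\<^sub>R v"] that by simp
    also have "\<dots> \<le> h * norm u + h * norm v" using that by (intro add_mono mult_right_mono) auto
    also have "\<dots> \<le> h * (norm u + norm v + 1)" using that by (simp add: algebra_simps)
    also have "\<dots> < d * (norm u + norm v + 1)" using that nuv by (intro mult_strict_right_mono) auto
    also have "\<dots> = min r r'" using nuv by (simp add: d_def)
    finally show ?thesis .
  qed
  have inS: "x + s *\<^sub>R u + t *\<^sub>R v \<in> S" if "0 \<le> s" "s \<le> h" "0 \<le> t" "t \<le> h" "0 < h" "h < d" for s t h
    using near[OF that] r' by (auto simp: dist_commute)
  show ?thesis
  proof (intro exI[of _ d] conjI allI impI d; elim conjE)
    fix h :: real assume h: "0 < h" "h < d"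
    define p where "p s = (f (x + s *\<^sub>R u + h *\<^sub>R v) - f (x + s *\<^sub>R u + 0 *\<^sub>R v)) \<bullet> b" for s
    have dp: "DERIV p s :> (F (x + s *\<^sub>R u + h *\<^sub>R v) - F (x + s *\<^sub>R u + 0 *\<^sub>R v)) \<bullet> b" if s: "0 \<le> s" "s \<le> h" for s
    proof -
      have D: "((\<lambda>s. f (x + s *\<^sub>R u + t *\<^sub>R v)) has_derivative (\<lambda>k. k *\<^sub>R F (x + s *\<^sub>R u + t *\<^sub>R v))) (at s)" if t: "0 \<le> t" "t \<le> h" for t
      proof -
        have "((\<lambda>s. f (x + s *\<^sub>R u + t *\<^sub>R v)) has_derivative (\<lambda>k. frechet_derivative f (at (x + s *\<^sub>R u + t *\<^sub>R v)) (k *\<^sub>R u))) (at s)"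
          by (rule has_derivative_compose[where g=f and f="\<lambda>s. x + s *\<^sub>R u + t *\<^sub>R v", OF _ smooth_on_has_derivative[OF f inS[OF s t h]]]) (auto intro!: derivative_eq_intros)
        then show ?thesis unfolding F_def
          using linear_frechet_derivative_at[OF smooth_on_differentiable[OF f inS[OF s t h]]] by (simp add: linear_scale)
      qed
      have "(p has_derivative (\<lambda>k. (k *\<^sub>R F (x + s *\<^sub>R u + h *\<^sub>R v) - k *\<^sub>R F (x + s *\<^sub>R u + 0 *\<^sub>R v)) \<bullet> b)) (at s)"
        unfolding p_def by (intro has_derivative_inner_left has_derivative_diff D) (use h in auto)
      then show ?thesis unfolding has_field_derivative_def
        by (rule has_derivative_eq_rhs) (simp add: fun_eq_iff inner_diff_left algebra_simps)
    qed
    obtain s where s: "0 < s" "s < h" "p h - p 0 = (h - 0) * ((F (x + s *\<^sub>R u + h *\<^sub>R v) - F (x + s *\<^sub>R u + 0 *\<^sub>R v)) \<bullet> b)"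
      using MVT2[of 0 h p "\<lambda>s. (F (x + s *\<^sub>R u + h *\<^sub>R v) - F (x + s *\<^sub>R u + 0 *\<^sub>R v)) \<bullet> b"] dp h by auto
    define q where "q t = F (x + s *\<^sub>R u + t *\<^sub>R v) \<bullet> b" for t
    have dq: "DERIV q t :> G (x + s *\<^sub>R u + t *\<^sub>R v) \<bullet> b" if t: "0 \<le> t" "t \<le> h" for t
    proof -
      have in': "x + s *\<^sub>R u + t *\<^sub>R v \<in> S" using inS[of s h t] s t h by simp
      have "((\<lambda>t. F (x + s *\<^sub>R u + t *\<^sub>R v)) has_derivative (\<lambda>k. frechet_derivative F (at (x + s *\<^sub>R u + t *\<^sub>R v)) (k *\<^sub>R v))) (at t)"
        by (rule has_derivative_compose[where g=F and f="\<lambda>t. x + s *\<^sub>R u + t *\<^sub>R v", OF _ smooth_on_has_derivative[OF sF in']]) (auto intro!: derivative_eq_intros)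
      then have "(q has_derivative (\<lambda>k. k *\<^sub>R G (x + s *\<^sub>R u + t *\<^sub>R v) \<bullet> b)) (at t)"
        unfolding q_def G_def using linear_frechet_derivative_at[OF smooth_on_differentiable[OF sF in']]
        by (intro has_derivative_inner_left) (simp add: linear_scale)
      then show ?thesis unfolding has_field_derivative_def
        by (rule has_derivative_eq_rhs) (simp add: fun_eq_iff algebra_simps)
    qed
    obtain t where t: "0 < t" "t < h" "q h - q 0 = (h - 0) * (G (x + s *\<^sub>R u + t *\<^sub>R v) \<bullet> b)"
      using MVT2[of 0 h q "\<lambda>t. G (x + s *\<^sub>R u + t *\<^sub>R v) \<bullet> b"] dq h by auto
    have "(f (x + h *\<^sub>R u + h *\<^sub>R v) - f (x + h *\<^sub>R u) - f (x + h *\<^sub>R v) + f x) \<bullet> b = p h - p 0"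
      by (simp add: p_def inner_diff_left inner_add_left)
    also have "\<dots> = h * (q h - q 0)" using s(3) by (simp add: q_def inner_diff_left)
    also have "\<dots> = h\<^sup>2 * (G (x + s *\<^sub>R u + t *\<^sub>R v) \<bullet> b)" by (simp add: t(3) power2_eq_square)
    finally have "(f (x + h *\<^sub>R u + h *\<^sub>R v) - f (x + h *\<^sub>R u) - f (x + h *\<^sub>R v) + f x) \<bullet> b / h\<^sup>2 = G (x + s *\<^sub>R u + t *\<^sub>R v) \<bullet> b"
      using h by simp
    moreover have "\<bar>G (x + s *\<^sub>R u + t *\<^sub>R v) \<bullet> b - G x \<bullet> b\<bar> < e"
      by (rule r(2)) (use near[of s h t] s t h in simp)
    ultimately show "\<bar>(f (x + h *\<^sub>R u + h *\<^sub>R v) - f (x + h *\<^sub>R u) - f (x + h *\<^sub>R v) + f x) \<bullet> b / h\<^sup>2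
      - frechet_derivative (\<lambda>y. frechet_derivative f (at y) u) (at x) v \<bullet> b\<bar> < e"
      by (simp add: G_def F_def[symmetric])
  qed
qed

text \<open>
  The second difference is symmetric in \<open>u\<close> and \<open>v\<close>.
\<close>

lemma second_derivative_symmetric:
  fixes f :: "'a::real_normed_vector \<Rightarrow> 'b::euclidean_space"
  assumes S: "open S" "x \<in> S" and f: "smooth_on S f"
  shows "frechet_derivative (\<lambda>y. frechet_derivative f (at y) u) (at x) v =
    frechet_derivative (\<lambda>y. frechet_derivative f (at y) v) (at x) u" (is "?A = ?B")
proof (rule euclidean_eqI)
  fix b :: 'b
  have "\<bar>?A \<bullet> b - ?B \<bullet> b\<bar> \<le> 0 + e" if e: "0 < e" for e
  proof -
    have e2: "0 < e / 2" using e by simp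
    obtain d1 where d1: "d1 > 0" "\<And>h. 0 < h \<and> h < d1 \<Longrightarrow>
      \<bar>(f (x + h *\<^sub>R u + h *\<^sub>R v) - f (x + h *\<^sub>R u) - f (x + h *\<^sub>R v) + f x) \<bullet> b / h\<^sup>2 - ?A \<bullet> b\<bar> < e / 2"
      using second_difference_limit[OF S f e2, of u v b] by blast
    obtain d2 where d2: "d2 > 0" "\<And>h. 0 < h \<and> h < d2 \<Longrightarrow>
      \<bar>(f (x + h *\<^sub>R v + h *\<^sub>R u) - f (x + h *\<^sub>R v) - f (x + h *\<^sub>R u) + f x) \<bullet> b / h\<^sup>2 - ?B \<bullet> b\<bar> < e / 2"
      using second_difference_limit[OF S f e2, of v u b] by blast
    define h where "h = min d1 d2 / 2"
    have h: "0 < h \<and> h < d1" "0 < h \<and> h < d2" using d1 d2 by (auto simp: h_def)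
    have "f (x + h *\<^sub>R v + h *\<^sub>R u) - f (x + h *\<^sub>R v) - f (x + h *\<^sub>R u) + f x =
      f (x + h *\<^sub>R u + h *\<^sub>R v) - f (x + h *\<^sub>R u) - f (x + h *\<^sub>R v) + f x" by (simp add: algebra_simps)
    then show ?thesis using d1(2)[OF h(1)] d2(2)[OF h(2)] by (simp only:)
  qed
  then have "\<bar>?A \<bullet> b - ?B \<bullet> b\<bar> \<le> 0" by (rule field_le_epsilon)
  then show "?A \<bullet> b = ?B \<bullet> b" by simp
qed

lemma smooth_on_cong:
  "open S \<Longrightarrow> (\<And>x. x \<in> S \<Longrightarrow> f x = g x) \<Longrightarrow> smooth_on S f \<Longrightarrow> smooth_on S g"
  unfolding smooth_on_def using Ck_on_cong by blast

lemma smooth_on_compose: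
  fixes F :: "'b::euclidean_space \<Rightarrow> 'c::real_normed_vector"
  assumes "open S" "smooth_on U F" "smooth_on S g" "g ` S \<subseteq> U"
  shows "smooth_on S (\<lambda>x. F (g x))"
  using assms unfolding smooth_on_def by (auto intro: Ck_on_compose)

lemma smooth_on_Pair: "open S \<Longrightarrow> smooth_on S f \<Longrightarrow> smooth_on S g \<Longrightarrow> smooth_on S (\<lambda>x. (f x, g x))"
  unfolding smooth_on_def using Ck_on_Pair by blast

lemma smooth_on_linear: "open S \<Longrightarrow> bounded_linear L \<Longrightarrow> smooth_on S f \<Longrightarrow> smooth_on S (\<lambda>x. L (f x))"
  unfolding smooth_on_def using Ck_on_linear by blast

lemma smooth_on_local:
  "(\<And>x. x \<in> S \<Longrightarrow> \<exists>T. open T \<and> x \<in> T \<and> smooth_on T f) \<Longrightarrow> smooth_on S f"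
  unfolding smooth_on_def by (intro allI Ck_on_local) meson

lemma smooth_on_id_const: "smooth_on S (\<lambda>x. x)" "smooth_on S (\<lambda>x. a)"
  unfolding smooth_on_def by (simp_all add: Ck_on_id Ck_on_const)

section \<open>Charts and left translations of a Lie group\<close>

context lie_group begin

lemma chart:
  assumes "d \<in> A"
  shows "openin T (fst d)" "open (snd d ` fst d)" "fst d \<subseteq> carrier G" "inj_on (snd d) (fst d)"
    "continuous_map (top_of_set (snd d ` fst d)) T (chart_inv d)"
proof -
  show o: "openin T (fst d)" and "open (snd d ` fst d)"
    using manifold assms unfolding smooth_manifold_def by auto
  have hm: "homeomorphic_map (subtopology T (fst d)) (top_of_set (snd d ` fst d)) (snd d)"
    using manifold assms unfolding smooth_manifold_def by auto
  show "fst d \<subseteq> carrier G" using openin_subset[OF o] topspace by simp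
  have ts: "topspace (subtopology T (fst d)) = fst d" using openin_subset[OF o] by (simp add: topspace_subtopology inf.absorb2)
  show inj: "inj_on (snd d) (fst d)" using homeomorphic_imp_injective_map[OF hm] ts by simp
  obtain g where g: "homeomorphic_maps (subtopology T (fst d)) (top_of_set (snd d ` fst d)) (snd d) g"
    using hm homeomorphic_map_maps by blast
  have "continuous_map (top_of_set (snd d ` fst d)) (subtopology T (fst d)) (chart_inv d)"
  proof (rule continuous_map_eq)
    show "continuous_map (top_of_set (snd d ` fst d)) (subtopology T (fst d)) g"
      using g unfolding homeomorphic_maps_def by blast
    fix x assume "x \<in> topspace (top_of_set (snd d ` fst d))"
    then obtain p where p: "p \<in> fst d" "x = snd d p" by auto
    then have "g x = p" using g ts unfolding homeomorphic_maps_def by auto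
    then show "g x = chart_inv d x" using p inj by (simp add: chart_inv_def)
  qed
  then show "continuous_map (top_of_set (snd d ` fst d)) T (chart_inv d)"
    by (simp add: continuous_map_in_subtopology)
qed

lemma chart_inv:
  "x \<in> snd d ` fst d \<Longrightarrow> chart_inv d x \<in> fst d" "x \<in> snd d ` fst d \<Longrightarrow> snd d (chart_inv d x) = x"
  "d \<in> A \<Longrightarrow> p \<in> fst d \<Longrightarrow> chart_inv d (snd d p) = p"
  "d \<in> A \<Longrightarrow> x \<in> snd d ` fst d \<Longrightarrow> chart_inv d x \<in> carrier G"
  using chart(3,4)[of d] inv_into_into[of x "snd d" "fst d"]
  by (auto simp: chart_inv_def f_inv_into_f)

lemma chart_around: "p \<in> carrier G \<Longrightarrow> \<exists>d\<in>A. p \<in> fst d"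
  using manifold topspace unfolding smooth_manifold_def by blast

text \<open>
  \<open>mult_coord d c e\<close> is the multiplication, read in \<open>d\<close> and \<open>c\<close> around the factors and in \<open>e\<close> around the
  product; \<open>mult_dom d c e\<close> is the set on which this makes sense.
\<close>

definition mult_dom :: "('g, 'e) chart \<Rightarrow> ('g, 'e) chart \<Rightarrow> ('g, 'e) chart \<Rightarrow> ('e \<times> 'e) set" where
  "mult_dom d c e = {(x, y). x \<in> snd d ` fst d \<and> y \<in> snd c ` fst c \<and> chart_inv d x \<otimes> chart_inv c y \<in> fst e}"

definition mult_coord :: "('g, 'e) chart \<Rightarrow> ('g, 'e) chart \<Rightarrow> ('g, 'e) chart \<Rightarrow> 'e \<times> 'e \<Rightarrow> 'e" where
  "mult_coord d c e = (\<lambda>(x, y). snd e (chart_inv d x \<otimes> chart_inv c y))"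

lemma open_mult_dom:
  assumes "d \<in> A" "c \<in> A" "e \<in> A"
  shows "open (mult_dom d c e)"
proof -
  let ?D = "snd d ` fst d" and ?C = "snd c ` fst c"
  have m: "continuous_map (prod_topology T T) T (\<lambda>(x, y). x \<otimes> y)" using smooth_mult unfolding smooth_map_def by blast
  have top: "prod_topology (top_of_set ?D) (top_of_set ?C) = top_of_set (?D \<times> ?C)"
    by (simp add: subtopology_Times)
  have "continuous_map (prod_topology (top_of_set ?D) (top_of_set ?C)) T (chart_inv d \<circ> fst)"
    "continuous_map (prod_topology (top_of_set ?D) (top_of_set ?C)) T (chart_inv c \<circ> snd)"
    by (rule continuous_map_compose[OF continuous_map_fst chart(5)[OF assms(1)]]
      continuous_map_compose[OF continuous_map_snd chart(5)[OF assms(2)]])+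
  then have "continuous_map (prod_topology (top_of_set ?D) (top_of_set ?C)) (prod_topology T T) (\<lambda>z. (chart_inv d (fst z), chart_inv c (snd z)))"
    unfolding o_def by (rule continuous_map_pairedI)
  then have "continuous_map (top_of_set (?D \<times> ?C)) T (\<lambda>z. chart_inv d (fst z) \<otimes> chart_inv c (snd z))"
    unfolding top using continuous_map_compose[OF _ m] by (fastforce simp: o_def)
  then have "openin (top_of_set (?D \<times> ?C)) {z \<in> topspace (top_of_set (?D \<times> ?C)). chart_inv d (fst z) \<otimes> chart_inv c (snd z) \<in> fst e}"
    using chart(1)[OF assms(3)] by (rule openin_continuous_map_preimage)
  moreover have "{z \<in> topspace (top_of_set (?D \<times> ?C)). chart_inv d (fst z) \<otimes> chart_inv c (snd z) \<in> fst e} = mult_dom d c e"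
    unfolding mult_dom_def by auto
  moreover have "open (?D \<times> ?C)" using chart(2) assms by (intro open_Times) auto
  ultimately show ?thesis by (simp add: openin_open_eq)
qed

lemma smooth_mult_coord:
  assumes "d \<in> A" "c \<in> A" "e \<in> A"
  shows "smooth_on (mult_dom d c e) (mult_coord d c e)"
proof -
  let ?pc = "(fst d \<times> fst c, map_prod (snd d) (snd c))"
  have "?pc \<in> prod_atlas A A" using assms unfolding prod_atlas_def by blast
  then have sm: "smooth_on (snd ?pc ` {p \<in> fst ?pc. (\<lambda>(x, y). x \<otimes> y) p \<in> fst e}) (in_charts ?pc e (\<lambda>(x, y). x \<otimes> y))"
    using smooth_mult assms(3) unfolding smooth_map_def smooth_in_charts_def by blast
  have dom: "snd ?pc ` {p \<in> fst ?pc. (\<lambda>(x, y). x \<otimes> y) p \<in> fst e} = mult_dom d c e"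
  proof (intro equalityI subsetI)
    fix z assume "z \<in> snd ?pc ` {p \<in> fst ?pc. (\<lambda>(x, y). x \<otimes> y) p \<in> fst e}"
    then obtain p q where "p \<in> fst d" "q \<in> fst c" "p \<otimes> q \<in> fst e" "z = (snd d p, snd c q)" by auto
    then show "z \<in> mult_dom d c e" using chart_inv(3) assms unfolding mult_dom_def by auto
  next
    fix z assume z: "z \<in> mult_dom d c e"
    then have "z = snd ?pc (chart_inv d (fst z), chart_inv c (snd z))"
      unfolding mult_dom_def by (auto simp: chart_inv(2))
    moreover have "(chart_inv d (fst z), chart_inv c (snd z)) \<in> {p \<in> fst ?pc. (\<lambda>(x, y). x \<otimes> y) p \<in> fst e}"
      using z unfolding mult_dom_def by (auto simp: chart_inv(1))
    ultimately show "z \<in> snd ?pc ` {p \<in> fst ?pc. (\<lambda>(x, y). x \<otimes> y) p \<in> fst e}" by (rule image_eqI)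
  qed
  show ?thesis
  proof (rule smooth_on_cong[OF open_mult_dom[OF assms] _ sm[unfolded dom]])
    fix z assume z: "z \<in> mult_dom d c e"
    have inj: "inj_on (map_prod (snd d) (snd c)) (fst d \<times> fst c)"
      using chart(4) assms by (intro map_prod_inj_on) auto
    have "(chart_inv d (fst z), chart_inv c (snd z)) \<in> fst d \<times> fst c" "map_prod (snd d) (snd c) (chart_inv d (fst z), chart_inv c (snd z)) = z"
      using z unfolding mult_dom_def by (auto simp: chart_inv(1,2))
    then have "chart_inv ?pc z = (chart_inv d (fst z), chart_inv c (snd z))"
      using inv_into_f_f[OF inj] unfolding chart_inv_def[of ?pc] by (metis fst_conv snd_conv)
    then show "in_charts ?pc e (\<lambda>(x, y). x \<otimes> y) z = mult_coord d c e z"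
      by (simp add: in_charts_def mult_coord_def case_prod_beta)
  qed
qed

lemma smooth_inv_coord:
  assumes "d \<in> A" "e \<in> A"
  shows "open {x \<in> snd d ` fst d. inv (chart_inv d x) \<in> fst e}"
    "smooth_on {x \<in> snd d ` fst d. inv (chart_inv d x) \<in> fst e} (\<lambda>x. snd e (inv (chart_inv d x)))"
proof -
  have i: "continuous_map T T (\<lambda>x. inv x)" using smooth_inv unfolding smooth_map_def by blast
  have "openin (top_of_set (snd d ` fst d)) {x \<in> topspace (top_of_set (snd d ` fst d)). ((\<lambda>x. inv x) \<circ> chart_inv d) x \<in> fst e}"
    by (rule openin_continuous_map_preimage[OF continuous_map_compose[OF chart(5)[OF assms(1)] i] chart(1)[OF assms(2)]])
  then show "open {x \<in> snd d ` fst d. inv (chart_inv d x) \<in> fst e}"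
    using chart(2)[OF assms(1)] by (simp add: openin_open_eq o_def)
  have "smooth_on (snd d ` {p \<in> fst d. inv p \<in> fst e}) (in_charts d e (\<lambda>x. inv x))"
    using smooth_inv assms unfolding smooth_map_def smooth_in_charts_def by blast
  moreover have "snd d ` {p \<in> fst d. inv p \<in> fst e} = {x \<in> snd d ` fst d. inv (chart_inv d x) \<in> fst e}"
    using chart_inv(3)[OF assms(1)] by auto
  ultimately show "smooth_on {x \<in> snd d ` fst d. inv (chart_inv d x) \<in> fst e} (\<lambda>x. snd e (inv (chart_inv d x)))"
    by (simp add: in_charts_def)
qed

text \<open>
  The differential of a left translation is the second partial differential of the multiplication. All
  smoothness statements about left translations are obtained in this way.
\<close>

lemma mult_coord_second:
  assumes "d \<in> A" "c \<in> A" "e \<in> A" "(x, y) \<in> mult_dom d c e"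
  shows "(in_charts c e (\<lambda>q. chart_inv d x \<otimes> q) has_derivative (\<lambda>v. frechet_derivative (mult_coord d c e) (at (x, y)) (0, v))) (at y)"
proof -
  have "((\<lambda>y. mult_coord d c e (x, y)) has_derivative (\<lambda>v. frechet_derivative (mult_coord d c e) (at (x, y)) (0, v))) (at y)"
    by (rule has_derivative_compose[where g="mult_coord d c e" and f="\<lambda>y. (x, y)", OF _ smooth_on_has_derivative[OF smooth_mult_coord[OF assms(1-3)] assms(4)]])
      (auto intro!: derivative_eq_intros)
  then show ?thesis by (simp add: mult_coord_def in_charts_def)
qed

lemma tangent_map_mult_coord:
  assumes "d \<in> A" "c \<in> A" "e \<in> A" "(x, y) \<in> mult_dom d c e"
  shows "tangent_map c e (\<lambda>q. chart_inv d x \<otimes> q) (chart_inv c y) v = frechet_derivative (mult_coord d c e) (at (x, y)) (0, v)"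
proof -
  have "snd c (chart_inv c y) = y" using assms(4) chart_inv(2) unfolding mult_dom_def by blast
  then show ?thesis unfolding tangent_map_def using frechet_derivative_eqI[OF mult_coord_second[OF assms]] by simp
qed

lemma mult_domI:
  assumes "d \<in> A" "c \<in> A" "p \<in> fst d" "q \<in> fst c" "p \<otimes> q \<in> fst e"
  shows "(snd d p, snd c q) \<in> mult_dom d c e"
  using assms chart_inv(3) unfolding mult_dom_def by auto

lemma translation:
  assumes "c \<in> A" "e \<in> A" "a \<in> carrier G" "p \<in> fst c" "a \<otimes> p \<in> fst e"
  shows "(in_charts c e (\<lambda>q. a \<otimes> q) has_derivative tangent_map c e (\<lambda>q. a \<otimes> q) p) (at (snd c p))"
    "\<exists>V. open V \<and> snd c p \<in> V \<and> V \<subseteq> snd c ` fst c \<and> (\<forall>y\<in>V. a \<otimes> chart_inv c y \<in> fst e)"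
proof -
  obtain d where d: "d \<in> A" "a \<in> fst d" using chart_around[OF assms(3)] by blast
  have ad: "chart_inv d (snd d a) = a" using d chart_inv(3) by blast
  have m: "(snd d a, snd c p) \<in> mult_dom d c e" using mult_domI[OF d(1) assms(1) d(2) assms(4,5)] .
  from mult_coord_second[OF d(1) assms(1,2) m]
  show "(in_charts c e (\<lambda>q. a \<otimes> q) has_derivative tangent_map c e (\<lambda>q. a \<otimes> q) p) (at (snd c p))"
    unfolding ad tangent_map_def using frechet_derivative_eqI by (metis (no_types, lifting))
  have "open ((\<lambda>y. (snd d a, y)) -` mult_dom d c e)"
    by (rule open_vimage[OF open_mult_dom[OF d(1) assms(1,2)]]) (intro continuous_intros)
  then show "\<exists>V. open V \<and> snd c p \<in> V \<and> V \<subseteq> snd c ` fst c \<and> (\<forall>y\<in>V. a \<otimes> chart_inv c y \<in> fst e)"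
    using m ad unfolding mult_dom_def by (intro exI[of _ "(\<lambda>y. (snd d a, y)) -` mult_dom d c e"]) (auto simp: mult_dom_def)
qed

lemma linear_tangent_translation:
  assumes "c \<in> A" "e \<in> A" "a \<in> carrier G" "p \<in> fst c" "a \<otimes> p \<in> fst e"
  shows "linear (tangent_map c e (\<lambda>q. a \<otimes> q) p)"
  using translation(1)[OF assms] by (rule has_derivative_linear)

text \<open>
  The chain rule for \<open>L\<^sub>a\<^sub>b = L\<^sub>a \<circ> L\<^sub>b\<close>.
\<close>

lemma translation_chain:
  assumes "c \<in> A" "d \<in> A" "e \<in> A" "a \<in> carrier G" "b \<in> carrier G" "p \<in> fst c" "b \<otimes> p \<in> fst d" "(a \<otimes> b) \<otimes> p \<in> fst e"
  shows "tangent_map c e (\<lambda>q. (a \<otimes> b) \<otimes> q) p v = tangent_map d e (\<lambda>q. a \<otimes> q) (b \<otimes> p) (tangent_map c d (\<lambda>q. b \<otimes> q) p v)"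
proof -
  have pG: "p \<in> carrier G" using assms chart(3) by blast
  have ab: "a \<otimes> (b \<otimes> p) \<in> fst e" using assms pG by (simp add: m_assoc)
  have D1: "(in_charts c d (\<lambda>q. b \<otimes> q) has_derivative tangent_map c d (\<lambda>q. b \<otimes> q) p) (at (snd c p))"
    by (rule translation(1)) (use assms in auto)
  have D2: "(in_charts d e (\<lambda>q. a \<otimes> q) has_derivative tangent_map d e (\<lambda>q. a \<otimes> q) (b \<otimes> p)) (at (snd d (b \<otimes> p)))"
    by (rule translation(1)) (use assms ab in auto)
  have at: "in_charts c d (\<lambda>q. b \<otimes> q) (snd c p) = snd d (b \<otimes> p)" using assms chart_inv(3) by (simp add: in_charts_def)
  have comp: "((\<lambda>x. in_charts d e (\<lambda>q. a \<otimes> q) (in_charts c d (\<lambda>q. b \<otimes> q) x)) has_derivative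
    (\<lambda>v. tangent_map d e (\<lambda>q. a \<otimes> q) (b \<otimes> p) (tangent_map c d (\<lambda>q. b \<otimes> q) p v))) (at (snd c p))"
    by (rule has_derivative_compose[OF D1]) (simp add: at D2)
  obtain V where V: "open V" "snd c p \<in> V" "V \<subseteq> snd c ` fst c" "\<And>y. y \<in> V \<Longrightarrow> b \<otimes> chart_inv c y \<in> fst d"
    using translation(2)[OF assms(1,2,5,6,7)] by blast
  have "(in_charts c e (\<lambda>q. (a \<otimes> b) \<otimes> q) has_derivative
    (\<lambda>v. tangent_map d e (\<lambda>q. a \<otimes> q) (b \<otimes> p) (tangent_map c d (\<lambda>q. b \<otimes> q) p v))) (at (snd c p))"
  proof (rule has_derivative_transform_within_open[OF comp V(1,2)])
    fix y assume y: "y \<in> V"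
    have "chart_inv c y \<in> carrier G" using V(3) y chart_inv(4)[OF assms(1)] by blast
    then show "in_charts d e (\<lambda>q. a \<otimes> q) (in_charts c d (\<lambda>q. b \<otimes> q) y) = in_charts c e (\<lambda>q. (a \<otimes> b) \<otimes> q) y"
      using V(4)[OF y] assms by (simp add: in_charts_def chart_inv(3) m_assoc)
  qed
  then show ?thesis by (simp add: tangent_map_def frechet_derivative_eqI)
qed

lemma tangent_map_identity:
  assumes "c \<in> A" "d \<in> A" "p \<in> fst c"
  shows "tangent_map c d (\<lambda>q. q) p = tangent_map c d (\<lambda>q. \<one> \<otimes> q) p" "tangent_map c c (\<lambda>q. \<one> \<otimes> q) p v = v"
proof -
  have eq: "in_charts c d (\<lambda>q. q) x = in_charts c d (\<lambda>q. \<one> \<otimes> q) x" if "x \<in> snd c ` fst c" for d x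
    using chart_inv(4)[OF assms(1) that] by (simp add: in_charts_def)
  have 1: "tangent_map c d (\<lambda>q. q) p = tangent_map c d (\<lambda>q. \<one> \<otimes> q) p" for d
    unfolding tangent_map_def by (rule frechet_derivative_cong_open(1)[OF chart(2)[OF assms(1)] imageI[OF assms(3)] eq])
  show "tangent_map c d (\<lambda>q. q) p = tangent_map c d (\<lambda>q. \<one> \<otimes> q) p" by (rule 1)
  have "tangent_map c c (\<lambda>q. q) p = frechet_derivative (\<lambda>x. x) (at (snd c p))"
    unfolding tangent_map_def using assms(3) chart_inv(2)
    by (intro frechet_derivative_cong_open(1)[OF chart(2)[OF assms(1)]]) (auto simp: in_charts_def)
  then show "tangent_map c c (\<lambda>q. \<one> \<otimes> q) p v = v" by (simp add: 1[symmetric] frechet_derivative_eqI[OF has_derivative_ident])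
qed

end

section \<open>Left invariant fields and forms\<close>

locale lie_group_identity_chart = lie_group G T A
  for G :: "'g monoid" (structure) and T :: "'g topology" and A :: "('g, 'e::euclidean_space) chart set" +
  fixes c :: "('g, 'e) chart"
  assumes c: "c \<in> A" "\<one> \<in> fst c"
begin

abbreviation e0 :: 'e where "e0 \<equiv> snd c \<one>"

abbreviation bracket :: "'e \<Rightarrow> 'e \<Rightarrow> 'e" where "bracket \<equiv> lie_group_bracket G c"

text \<open>
  The left invariant field with value \<open>v\<close> at the identity, read in an arbitrary chart \<open>d\<close>, while
  the tangent space at the identity keeps the coordinates of \<open>c\<close>.
\<close>

definition field :: "('g, 'e) chart \<Rightarrow> 'e \<Rightarrow> 'e \<Rightarrow> 'e" where
  "field d v x = tangent_map c d (\<lambda>q. chart_inv d x \<otimes> q) \<one> v"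

lemma field_left_field: "left_field G c = field c"
  by (simp add: fun_eq_iff left_field_def field_def)

lemma c_inv: "chart_inv c e0 = \<one>" using chart_inv(3) c by blast

lemma e0: "e0 \<in> snd c ` fst c" using c by blast

lemma dom_e0:
  assumes "d \<in> A" "x \<in> snd d ` fst d" shows "(x, e0) \<in> mult_dom d c d"
  using assms c chart_inv(1)[OF assms(2)] chart_inv(4)[OF assms] by (simp add: mult_dom_def c_inv)

lemma field_eq:
  assumes "d \<in> A" "x \<in> snd d ` fst d"
  shows "field d v x = frechet_derivative (mult_coord d c d) (at (x, e0)) (0, v)"
  using tangent_map_mult_coord[OF assms(1) c(1) assms(1) dom_e0[OF assms]] by (simp add: field_def c_inv)

lemma linear_field:
  assumes "d \<in> A" "x \<in> snd d ` fst d" shows "linear (\<lambda>v. field d v x)"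
  unfolding field_def
  using linear_tangent_translation[OF c(1) assms(1) chart_inv(4)[OF assms] c(2)] chart_inv(1)[OF assms(2)] chart_inv(4)[OF assms] by simp

lemma field_e0: "field c v e0 = v"
  using tangent_map_identity(2)[OF c(1) c(1) c(2)] by (simp add: field_def c_inv)

lemma smooth_field:
  assumes d: "d \<in> A" shows "smooth_on (snd d ` fst d) (field d v)"
proof -
  have "smooth_on (snd d ` fst d) (\<lambda>x. frechet_derivative (mult_coord d c d) (at (x, e0)) (0, v))"
    by (rule smooth_on_compose[where g="\<lambda>x. (x, e0)", OF chart(2)[OF d] smooth_on_derivative[OF smooth_mult_coord[OF d c(1) d]]])
      (use dom_e0[OF d] in \<open>auto intro!: smooth_on_Pair smooth_on_id_const chart(2)[OF d]\<close>)
  then show ?thesis by (rule smooth_on_cong[OF chart(2)[OF d], rotated]) (simp add: field_eq[OF d])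
qed

text \<open>
  Left invariance, \<open>X\<^sub>v(x y) = D\<^sub>2m(x, y) X\<^sub>v(y)\<close>, with the factors and the product in charts.
\<close>

lemma field_left_invariant:
  assumes d: "d \<in> A" and xy: "(x, y) \<in> mult_dom d c d"
  shows "field d v (mult_coord d c d (x, y)) = frechet_derivative (mult_coord d c d) (at (x, y)) (0, field c v y)"
proof -
  have x: "x \<in> snd d ` fst d" and y: "y \<in> snd c ` fst c" and m: "chart_inv d x \<otimes> chart_inv c y \<in> fst d"
    using xy by (auto simp: mult_dom_def)
  have G: "chart_inv d x \<in> carrier G" "chart_inv c y \<in> carrier G" using chart_inv(4) d c(1) x y by blast+
  have 1: "chart_inv c y \<otimes> \<one> = chart_inv c y" using G by simp
  have "field d v (mult_coord d c d (x, y)) = tangent_map c d (\<lambda>q. (chart_inv d x \<otimes> chart_inv c y) \<otimes> q) \<one> v"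
    using m by (simp add: field_def mult_coord_def chart_inv(3)[OF d])
  also have "\<dots> = tangent_map c d (\<lambda>q. chart_inv d x \<otimes> q) (chart_inv c y \<otimes> \<one>) (tangent_map c c (\<lambda>q. chart_inv c y \<otimes> q) \<one> v)"
    by (rule translation_chain) (use d c G m y chart_inv(1) in auto)
  also have "\<dots> = frechet_derivative (mult_coord d c d) (at (x, y)) (0, field c v y)"
    unfolding 1 using tangent_map_mult_coord[OF d c(1) d xy] by (simp add: field_def)
  finally show ?thesis .
qed

text \<open>
  This is \<open>field_left_invariant\<close>, differentiated at \<open>y = 1\<close> in the direction \<open>w\<close>.
\<close>

lemma field_derivative:
  assumes d: "d \<in> A" and x: "x \<in> snd d ` fst d"
  shows "frechet_derivative (field d v) (at x) (field d w x) =
    field d (frechet_derivative (field c v) (at e0) w) x +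
    frechet_derivative (\<lambda>\<xi>. frechet_derivative (mult_coord d c d) (at \<xi>) (0, v)) (at (x, e0)) (0, w)"
proof -
  let ?F = "mult_coord d c d"
  let ?G = "\<lambda>v \<xi>. frechet_derivative ?F (at \<xi>) (0, v)"
  note sm = smooth_mult_coord[OF d c(1) d] and dom = dom_e0[OF d x]
  define U where "U = (\<lambda>y. (x, y)) -` mult_dom d c d"
  have U: "open U" "e0 \<in> U" unfolding U_def using dom
    by (auto intro!: open_vimage[OF open_mult_dom[OF d c(1) d]] continuous_intros)
  have Fx: "?F (x, e0) = x" using x chart_inv(2,4) d by (simp add: mult_coord_def c_inv)
  have Pd: "((\<lambda>y. (x, y)) has_derivative (\<lambda>w. (0, w))) (at y)" for y by (auto intro!: derivative_eq_intros)
  have D1: "((\<lambda>y. ?F (x, y)) has_derivative (\<lambda>w. field d w x)) (at e0)"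
    unfolding field_eq[OF d x]
    by (rule has_derivative_compose[where g="?F" and f="\<lambda>y. (x, y)", OF Pd smooth_on_has_derivative[OF sm dom]])
  have L: "((\<lambda>y. field d v (?F (x, y))) has_derivative (\<lambda>w. frechet_derivative (field d v) (at x) (field d w x))) (at e0)"
    by (rule has_derivative_compose[where g="field d v", OF D1]) (simp only: Fx smooth_on_has_derivative[OF smooth_field[OF d] x])
  have GD: "((\<lambda>y. ?G b (x, y)) has_derivative (\<lambda>w. frechet_derivative (?G b) (at (x, e0)) (0, w))) (at e0)" for b
    by (rule has_derivative_compose[where g="?G b" and f="\<lambda>y. (x, y)", OF Pd smooth_on_has_derivative[OF smooth_on_derivative[OF sm] dom]])
  have lin: "linear (\<lambda>b. ?G b (x, y))" if "y \<in> U" for y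
  proof -
    have "linear (frechet_derivative ?F (at (x, y)))"
      using smooth_on_differentiable[OF sm] that by (intro linear_frechet_derivative_at) (simp add: U_def)
    from linear_compose[OF has_derivative_linear[OF Pd] this] show ?thesis by (simp add: o_def)
  qed
  have R: "((\<lambda>y. ?G (field c v y) (x, y)) has_derivative
    (\<lambda>w. ?G (frechet_derivative (field c v) (at e0) w) (x, e0) + frechet_derivative (\<lambda>z. ?G (field c v e0) (x, z)) (at e0) w)) (at e0)"
    by (rule has_derivative_linear_family[where H="\<lambda>y b. ?G b (x, y)" and \<phi>="\<lambda>y. y" and U=U and \<psi>="field c v"])
      (use U lin GD has_derivative_ident smooth_on_has_derivative[OF smooth_field[OF c(1)] e0] in \<open>auto intro: differentiableI\<close>)
  have "((\<lambda>y. field d v (?F (x, y))) has_derivative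
    (\<lambda>w. ?G (frechet_derivative (field c v) (at e0) w) (x, e0) + frechet_derivative (\<lambda>z. ?G (field c v e0) (x, z)) (at e0) w)) (at e0)"
    by (rule has_derivative_transform_within_open[OF R U]) (simp add: U_def field_left_invariant[OF d])
  from has_derivative_unique[OF L this]
  have "frechet_derivative (field d v) (at x) (field d w x) =
    ?G (frechet_derivative (field c v) (at e0) w) (x, e0) + frechet_derivative (\<lambda>z. ?G (field c v e0) (x, z)) (at e0) w"
    by (rule fun_cong)
  then show ?thesis by (simp add: field_e0 frechet_derivative_eqI[OF GD] field_eq[OF d x])
qed

lemma bracket_eq: "bracket u v = frechet_derivative (field c v) (at e0) u - frechet_derivative (field c u) (at e0) v"
  by (simp add: lie_group_bracket_def field_bracket_def field_left_field field_e0)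

text \<open>
  Left invariant fields are closed under brackets: when \<open>field_derivative\<close> is antisymmetrised in \<open>v, w\<close>, the second
  derivative of the multiplication cancels.
\<close>

lemma field_bracket:
  assumes d: "d \<in> A" and x: "x \<in> snd d ` fst d"
  shows "frechet_derivative (field d v) (at x) (field d w x) - frechet_derivative (field d w) (at x) (field d v x) =
    field d (bracket w v) x"
  using field_derivative[OF assms, of v w] field_derivative[OF assms, of w v]
    second_derivative_symmetric[OF open_mult_dom[OF d c(1) d] dom_e0[OF assms] smooth_mult_coord[OF d c(1) d], of "(0, v)" "(0, w)"]
    linear_diff[OF linear_field[OF assms]]
  by (simp add: bracket_eq)

text \<open>
  The mixed second derivative of the multiplication at the identity; the bracket is its
  antisymmetrisation.
\<close>

definition second :: "'e \<Rightarrow> 'e \<Rightarrow> 'e" where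
  "second u v = frechet_derivative (field c v) (at e0) u"

lemma second_linear: "linear (\<lambda>u. second u v)" "linear (second u)"
proof -
  show "linear (\<lambda>u. second u v)" unfolding second_def
    using linear_frechet_derivative_at[OF smooth_on_differentiable[OF smooth_field[OF c(1)] e0]] by simp
  let ?F = "mult_coord c c c"
  note sm = smooth_mult_coord[OF c(1) c(1) c(1)] and dom = dom_e0[OF c(1) e0]
  \<comment> \<open>exchanging the order of differentiation shows the linear dependence on \<open>v\<close>\<close>
  have "second u v = frechet_derivative (\<lambda>\<xi>. frechet_derivative ?F (at \<xi>) (u, 0)) (at (e0, e0)) (0, v)" for u v
  proof -
    have Pd: "((\<lambda>x. (x, e0)) has_derivative (\<lambda>w. (w, 0))) (at e0)" by (auto intro!: derivative_eq_intros)
    have "((\<lambda>x. frechet_derivative ?F (at (x, e0)) (0, v)) has_derivative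
      (\<lambda>w. frechet_derivative (\<lambda>\<xi>. frechet_derivative ?F (at \<xi>) (0, v)) (at (e0, e0)) (w, 0))) (at e0)"
      by (rule has_derivative_compose[where g="\<lambda>\<xi>. frechet_derivative ?F (at \<xi>) (0, v)" and f="\<lambda>x. (x, e0)", OF Pd smooth_on_has_derivative[OF smooth_on_derivative[OF sm] dom]])
    then have "(field c v has_derivative
      (\<lambda>w. frechet_derivative (\<lambda>\<xi>. frechet_derivative ?F (at \<xi>) (0, v)) (at (e0, e0)) (w, 0))) (at e0)"
      by (rule has_derivative_transform_within_open[OF _ chart(2)[OF c(1)] e0]) (simp add: field_eq[OF c(1)])
    then show ?thesis unfolding second_def
      by (simp add: frechet_derivative_eqI second_derivative_symmetric[OF open_mult_dom[OF c(1) c(1) c(1)] dom sm, of "(0, v)" "(u, 0)"])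
  qed
  moreover have "linear (\<lambda>v. frechet_derivative (\<lambda>\<xi>. frechet_derivative ?F (at \<xi>) (u, 0)) (at (e0, e0)) (0, v))"
  proof -
    have "linear (frechet_derivative (\<lambda>\<xi>. frechet_derivative ?F (at \<xi>) (u, 0)) (at (e0, e0)))"
      by (rule linear_frechet_derivative_at[OF smooth_on_differentiable[OF smooth_on_derivative[OF sm] dom]])
    moreover have "linear (\<lambda>v::'e. (0::'e, v))" by (rule linearI) simp_all
    ultimately show ?thesis using linear_compose[of "\<lambda>v::'e. (0::'e, v)"] by (simp add: o_def)
  qed
  ultimately show "linear (second u)" by (simp add: second_def[abs_def])
qed

text \<open>
  This is \<open>field_bracket\<close>, differentiated at the identity in the direction \<open>u\<close>.
\<close>

lemma second_bracket_derivative: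
  "second (second u w) v - second (second u v) w
    + (frechet_derivative (\<lambda>z. frechet_derivative (field c v) (at z) w) (at e0) u
       - frechet_derivative (\<lambda>z. frechet_derivative (field c w) (at z) v) (at e0) u) = second u (bracket w v)"
proof -
  note sm = smooth_field[OF c(1)] and op = chart(2)[OF c(1)]
  have H: "((\<lambda>x. frechet_derivative (field c v) (at x) (field c w x)) has_derivative
    (\<lambda>u. frechet_derivative (field c v) (at e0) (frechet_derivative (field c w) (at e0) u)
      + frechet_derivative (\<lambda>z. frechet_derivative (field c v) (at z) (field c w e0)) (at e0) u)) (at e0)" for v w
    by (rule has_derivative_linear_family[where H="\<lambda>x. frechet_derivative (field c v) (at x)" and \<phi>="\<lambda>y. y" and U="snd c ` fst c" and \<psi>="field c w"])
      (use op e0 linear_frechet_derivative_at[OF smooth_on_differentiable[OF sm]] has_derivative_ident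
        smooth_on_differentiable[OF smooth_on_derivative[OF sm] e0] smooth_on_has_derivative[OF sm e0] in auto)
  have "((\<lambda>x. field c (bracket w v) x) has_derivative
    (\<lambda>u. (frechet_derivative (field c v) (at e0) (frechet_derivative (field c w) (at e0) u)
      + frechet_derivative (\<lambda>z. frechet_derivative (field c v) (at z) (field c w e0)) (at e0) u)
      - (frechet_derivative (field c w) (at e0) (frechet_derivative (field c v) (at e0) u)
      + frechet_derivative (\<lambda>z. frechet_derivative (field c w) (at z) (field c v e0)) (at e0) u))) (at e0)"
    by (rule has_derivative_transform_within_open[OF has_derivative_diff[OF H H] op e0]) (rule field_bracket[OF c(1)])
  from fun_cong[OF frechet_derivative_eqI[OF this], of u] show ?thesis
    by (simp add: second_def field_e0)
qed

text \<open>
  In the cyclic sum of \<open>second_bracket_derivative\<close> the second derivatives of the fields cancel by symmetry,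
  and the remaining terms are those of the Jacobi identity.
\<close>

lemma lie_algebra_bracket: "lie_algebra UNIV bracket"
proof
  note l = linear_add[OF second_linear(1)] linear_add[OF second_linear(2)] linear_scale[OF second_linear(1)] linear_scale[OF second_linear(2)]
    linear_diff[OF second_linear(1)] linear_diff[OF second_linear(2)]
  have br: "bracket u v = second u v - second v u" for u v by (simp add: bracket_eq second_def)
  show "linear_on UNIV (bracket x)" for x unfolding linear_on_def br by (simp add: l algebra_simps)
  show "linear_on UNIV (\<lambda>x. bracket x y)" for y unfolding linear_on_def br by (simp add: l algebra_simps)
  show "bracket x x = 0" for x by (simp add: br)
  fix x y z
  let ?C = "\<lambda>v w u. frechet_derivative (\<lambda>z. frechet_derivative (field c v) (at z) w) (at e0) u"
  have sym: "?C v w u = ?C v u w" for v w u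
    by (rule second_derivative_symmetric[OF chart(2)[OF c(1)] e0 smooth_field[OF c(1)]])
  have b: "second u (bracket w v) = second (second u w) v - second (second u v) w + (?C v w u - ?C w v u)" for u v w
    by (rule second_bracket_derivative[symmetric])
  have e: "bracket x (bracket y z) = second x (bracket y z) - second (second y z) x + second (second z y) x" for x y z
    by (simp add: br[of x] br[of y z] l)
  show "bracket x (bracket y z) + bracket y (bracket z x) + bracket z (bracket x y) = 0"
    unfolding e b sym[of z x y] sym[of x y z] sym[of y z x] by simp
qed (auto simp: subspace_UNIV)

text \<open>
  The functions \<open>\<eta>(X\<^sub>v)\<close> are constant. Differentiating them along \<open>X\<^sub>u\<close> expresses \<open>d\<eta>(X\<^sub>u, X\<^sub>v)\<close> by the derivatives of the
  fields, that is, by \<open>[X\<^sub>u, X\<^sub>v] = X\<^sub>[\<^sub>u\<^sub>,\<^sub>v\<^sub>]\<close>.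
\<close>

lemma left_invariant_form:
  assumes \<eta>: "one_form A \<eta>" "left_invariant G A \<eta>" and d: "d \<in> A" and p: "p \<in> fst d"
  shows "\<eta> d p (field d u (snd d p)) = \<eta> c \<one> u"
    "ext_deriv \<eta> d p (field d u (snd d p)) (field d v (snd d p)) = - \<eta> c \<one> (bracket u v)"
proof -
  have const: "\<eta> d (chart_inv d x) (field d v x) = \<eta> c \<one> v" if x: "x \<in> snd d ` fst d" for x v
  proof -
    have G: "chart_inv d x \<in> carrier G" by (rule chart_inv(4)[OF d x])
    then have "chart_inv d x \<otimes> \<one> \<in> fst d" using chart_inv(1)[OF x] by simp
    with G have "\<eta> d (chart_inv d x \<otimes> \<one>) (tangent_map c d (\<lambda>q. chart_inv d x \<otimes> q) \<one> v) = \<eta> c \<one> v"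
      using \<eta>(2) c d unfolding left_invariant_def by blast
    then show ?thesis using G by (simp add: field_def)
  qed
  have x: "snd d p \<in> snd d ` fst d" using p by blast
  then show "\<eta> d p (field d u (snd d p)) = \<eta> c \<one> u" using const[OF x] chart_inv(3)[OF d p] by simp
  have lin: "linear (\<eta> d (chart_inv d x))" if "x \<in> snd d ` fst d" for x
    using \<eta>(1) d chart_inv(1)[OF that] unfolding one_form_def by blast
  have sm: "smooth_on (snd d ` fst d) (\<lambda>x. \<eta> d (chart_inv d x) b)" for b
    using \<eta>(1) d unfolding one_form_def by blast
  let ?D = "\<lambda>w. frechet_derivative (\<lambda>z. \<eta> d (chart_inv d z) w) (at (snd d p))"
  have ext: "?D (field d v (snd d p)) w = - \<eta> d p (frechet_derivative (field d v) (at (snd d p)) w)" for v w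
  proof -
    have "((\<lambda>x. \<eta> d (chart_inv d x) (field d v x)) has_derivative
      (\<lambda>w. \<eta> d (chart_inv d (snd d p)) (frechet_derivative (field d v) (at (snd d p)) w) + ?D (field d v (snd d p)) w)) (at (snd d p))"
      by (rule has_derivative_linear_family[where H="\<lambda>x. \<eta> d (chart_inv d x)" and \<phi>="\<lambda>y. y" and U="snd d ` fst d" and \<psi>="field d v"])
        (use x lin chart(2)[OF d] has_derivative_ident smooth_on_differentiable[OF sm x] smooth_on_has_derivative[OF smooth_field[OF d] x] in auto)
    moreover have "((\<lambda>x. \<eta> d (chart_inv d x) (field d v x)) has_derivative (\<lambda>w. 0)) (at (snd d p))"
      by (rule has_derivative_transform_within_open[OF has_derivative_const chart(2)[OF d] x]) (rule const[symmetric])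
    ultimately have "\<eta> d (chart_inv d (snd d p)) (frechet_derivative (field d v) (at (snd d p)) w) + ?D (field d v (snd d p)) w = 0"
      using has_derivative_unique by (metis (no_types, lifting))
    then show ?thesis by (simp add: chart_inv(3)[OF d p])
  qed
  have linp: "linear (\<eta> d p)" using lin[OF x] chart_inv(3)[OF d p] by simp
  have "ext_deriv \<eta> d p (field d u (snd d p)) (field d v (snd d p)) =
    - \<eta> d p (frechet_derivative (field d v) (at (snd d p)) (field d u (snd d p)) - frechet_derivative (field d u) (at (snd d p)) (field d v (snd d p)))"
    unfolding ext_deriv_def ext by (simp add: linear_diff[OF linp])
  also have "\<dots> = - \<eta> c \<one> (bracket u v)"
    unfolding field_bracket[OF d x] using const[OF x] chart_inv(3)[OF d p] by simp
  finally show "ext_deriv \<eta> d p (field d u (snd d p)) (field d v (snd d p)) = - \<eta> c \<one> (bracket u v)" .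
qed

text \<open>
  The form at \<open>p\<close> is \<open>\<eta>0\<close>, pulled back by the left translation by the inverse of \<open>p\<close>. In charts its coefficients are
  second partial derivatives of the multiplication along \<open>(p\<^sup>-\<^sup>1, p)\<close>, so they are smooth by the smoothness of the inversion.
\<close>

lemma left_invariant_form_exists:
  assumes lin: "linear (\<eta>0 :: 'e \<Rightarrow> real)"
  obtains \<eta> where "one_form A \<eta>" "left_invariant G A \<eta>" "\<And>v. \<eta> c \<one> v = \<eta>0 v"
proof -
  define \<eta> where "\<eta> d p w = \<eta>0 (tangent_map d c (\<lambda>q. inv p \<otimes> q) p w)" for d :: "('g, 'e) chart" and p w
  have G: "p \<in> carrier G" "inv p \<in> carrier G" "inv p \<otimes> p = \<one>" if "d \<in> A" "p \<in> fst d" for d p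
    using that chart(3)[of d] by (auto simp: l_inv)
  have one: "one_form A \<eta>" unfolding one_form_def
  proof (intro conjI ballI allI)
    fix d p assume d: "d \<in> A" "p \<in> fst d"
    show "linear (\<eta> d p)" unfolding \<eta>_def
      using linear_compose[OF linear_tangent_translation[OF d(1) c(1) G(2)[OF d] d(2)] lin] G(3)[OF d] c by (simp add: o_def)
  next
    fix d e p v assume d: "d \<in> A" and e: "e \<in> A" and p: "p \<in> fst d \<inter> fst e"
    have pd: "p \<in> fst d" "p \<in> fst e" using p by auto
    note Gp = G[OF d pd(1)]
    have "tangent_map d c (\<lambda>q. (inv p \<otimes> \<one>) \<otimes> q) p v = tangent_map e c (\<lambda>q. inv p \<otimes> q) (\<one> \<otimes> p) (tangent_map d e (\<lambda>q. \<one> \<otimes> q) p v)"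
      by (rule translation_chain) (use d e c pd Gp in auto)
    then show "\<eta> e p (tangent_map d e (\<lambda>q. q) p v) = \<eta> d p v"
      using Gp by (simp add: \<eta>_def tangent_map_identity(1)[OF d e pd(1)])
  next
    fix d w assume d: "d \<in> A"
    show "smooth_on (snd d ` fst d) (\<lambda>x. \<eta> d (chart_inv d x) w)"
    proof (rule smooth_on_local)
      fix x0 assume x0: "x0 \<in> snd d ` fst d"
      have "inv (chart_inv d x0) \<in> carrier G" using chart_inv(4)[OF d x0] by simp
      \<comment> \<open>near \<open>x0\<close> the inverses lie in the domain of a single chart \<open>e\<close>\<close>
      then obtain e where e: "e \<in> A" "inv (chart_inv d x0) \<in> fst e" using chart_around by blast
      define V where "V = {x \<in> snd d ` fst d. inv (chart_inv d x) \<in> fst e}"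
      note iv = smooth_inv_coord[OF d e(1), folded V_def]
      let ?F = "mult_coord e d c"
      let ?g = "\<lambda>x. (snd e (inv (chart_inv d x)), x)"
      have gV: "?g x \<in> mult_dom e d c" if "x \<in> V" for x
      proof -
        have x: "x \<in> snd d ` fst d" "inv (chart_inv d x) \<in> fst e" using that by (auto simp: V_def)
        have "(snd e (inv (chart_inv d x)), snd d (chart_inv d x)) \<in> mult_dom e d c"
          by (rule mult_domI[OF e(1) d x(2) chart_inv(1)[OF x(1)]]) (use G(3)[OF d chart_inv(1)[OF x(1)]] c in simp)
        then show ?thesis by (simp add: chart_inv(2)[OF x(1)])
      qed
      have "smooth_on V (\<lambda>x. frechet_derivative ?F (at (?g x)) (0, w))"
        by (rule smooth_on_compose[where g="?g", OF iv(1) smooth_on_derivative[OF smooth_mult_coord[OF e(1) d c(1)]]])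
          (use gV in \<open>auto intro!: smooth_on_Pair smooth_on_id_const iv\<close>)
      then have "smooth_on V (\<lambda>x. \<eta>0 (frechet_derivative ?F (at (?g x)) (0, w)))"
        by (rule smooth_on_linear[OF iv(1) linear_conv_bounded_linear[THEN iffD1, OF lin]])
      then have "smooth_on V (\<lambda>x. \<eta> d (chart_inv d x) w)"
      proof (rule smooth_on_cong[OF iv(1), rotated])
        fix x assume x: "x \<in> V"
        then have "chart_inv e (snd e (inv (chart_inv d x))) = inv (chart_inv d x)" using chart_inv(3)[OF e(1)] by (simp add: V_def)
        then show "\<eta>0 (frechet_derivative ?F (at (?g x)) (0, w)) = \<eta> d (chart_inv d x) w"
          using tangent_map_mult_coord[OF e(1) d c(1) gV[OF x], of w] by (simp add: \<eta>_def)
      qed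
      moreover have "x0 \<in> V" using x0 e by (simp add: V_def)
      ultimately show "\<exists>T. open T \<and> x0 \<in> T \<and> smooth_on T (\<lambda>x. \<eta> d (chart_inv d x) w)" using iv(1) by blast
    qed
  qed
  have inva: "left_invariant G A \<eta>" unfolding left_invariant_def
  proof (intro ballI impI allI)
    fix g d e p v assume g: "g \<in> carrier G" and d: "d \<in> A" and e: "e \<in> A" and p: "p \<in> fst d" and gp: "g \<otimes> p \<in> fst e"
    note Gp = G[OF d p] and Ggp = G[OF e gp]
    have i: "inv (g \<otimes> p) \<otimes> g = inv p" using g Gp by (simp add: inv_mult_group m_assoc)
    have "tangent_map d c (\<lambda>q. (inv (g \<otimes> p) \<otimes> g) \<otimes> q) p v = tangent_map e c (\<lambda>q. inv (g \<otimes> p) \<otimes> q) (g \<otimes> p) (tangent_map d e (\<lambda>q. g \<otimes> q) p v)"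
      by (rule translation_chain) (use d e c p gp g Gp Ggp i in auto)
    then show "\<eta> e (g \<otimes> p) (tangent_map d e (\<lambda>q. g \<otimes> q) p v) = \<eta> d p v" by (simp add: \<eta>_def i)
  qed
  have "\<eta> c \<one> v = \<eta>0 v" for v using tangent_map_identity(2)[OF c(1) c(1) c(2)] by (simp add: \<eta>_def)
  then show thesis using that one inva by blast
qed

text \<open>
  A left invariant contact form restricts to a contact form at the identity. Conversely, for the left invariant
  extension of a contact form \<open>\<eta>0\<close>, the fields \<open>X\<^sub>u(p)\<close> carry the contact pair at the identity to the one at \<open>p\<close>.
\<close>

lemma contact_lie_group_iff: "contact_lie_group G A \<longleftrightarrow> contact_lie_algebra UNIV bracket"
proof
  assume "contact_lie_group G A"
  then obtain \<eta> where \<eta>: "contact_form A \<eta>" "left_invariant G A \<eta>" unfolding contact_lie_group_def by blast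
  then obtain n where n: "DIM('e) = 2 * n + 1" and one: "one_form A \<eta>" and cp: "contact_pair UNIV n (ext_deriv \<eta> c \<one>) (\<eta> c \<one>)"
    using c unfolding contact_form_def by blast
  have "ext_deriv \<eta> c \<one> = (\<lambda>u v. - \<eta> c \<one> (bracket u v))"
    using left_invariant_form(2)[OF one \<eta>(2) c] by (simp add: field_e0 fun_eq_iff)
  moreover have "linear (\<eta> c \<one>)" using one c unfolding one_form_def by blast
  ultimately show "contact_lie_algebra UNIV bracket" unfolding contact_lie_algebra_def
    using n cp by (intro exI[of _ n] exI[of _ "\<eta> c \<one>"]) (simp add: linear_on_UNIV)
next
  assume "contact_lie_algebra UNIV bracket"
  then obtain n \<eta>0 where n: "DIM('e) = 2 * n + 1" and l0: "linear \<eta>0" and cp: "contact_pair UNIV n (\<lambda>x y. - \<eta>0 (bracket x y)) \<eta>0"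
    unfolding contact_lie_algebra_def by (auto simp: linear_on_UNIV dim_UNIV)
  obtain \<eta> where \<eta>: "one_form A \<eta>" "left_invariant G A \<eta>" "\<And>v. \<eta> c \<one> v = \<eta>0 v"
    by (rule left_invariant_form_exists[OF l0]) (rule that)
  have "contact_pair UNIV n (ext_deriv \<eta> d p) (\<eta> d p)" if "d \<in> A" "p \<in> fst d" for d p
    by (rule contact_pair_transport[OF cp, where f="\<lambda>u. field d u (snd d p)"])
      (use left_invariant_form[OF \<eta>(1,2) that] \<eta>(3) in auto)
  then show "contact_lie_group G A" unfolding contact_lie_group_def contact_form_def using \<eta> n by blast
qed

end

section \<open>Five-dimensional contact Lie groups and Lie algebras\<close>

theorem theorem7:
  shows
    "(\<forall>(G :: 'g monoid) T (A :: ('g, 'e::euclidean_space) chart set) c.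
        lie_group G T A \<and> DIM('e) = 5 \<and> c \<in> A \<and> \<one>\<^bsub>G\<^esub> \<in> fst c \<and>
        \<not> lie_solvable UNIV (lie_group_bracket G c) \<longrightarrow>
        (contact_lie_group G A \<longleftrightarrow>
           lie_isomorphic UNIV (lie_group_bracket G c)
             (UNIV \<times> sl2) (direct_sum_bracket aff_bracket commutator) \<or>
           lie_isomorphic UNIV (lie_group_bracket G c)
             (UNIV \<times> so3) (direct_sum_bracket aff_bracket commutator) \<or>
           lie_isomorphic UNIV (lie_group_bracket G c) (UNIV \<times> sl2) R2_sl2_bracket)) \<and>
     lie_decomposable (UNIV \<times> sl2) (direct_sum_bracket aff_bracket commutator) \<and>
     lie_decomposable (UNIV \<times> so3) (direct_sum_bracket aff_bracket commutator) \<and>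
     \<not> lie_decomposable (UNIV \<times> sl2) R2_sl2_bracket \<and>
     (\<forall>(L :: 'a::real_vector set) br.
        lie_algebra L br \<and> dim L = 5 \<and> \<not> lie_decomposable L br \<and> lie_solvable L br \<and>
        lie_center L br = {0} \<longrightarrow>
        (dim (lie_derived L br) = 3 \<and> \<not> lie_abelian (lie_derived L br) br \<longrightarrow>
           contact_lie_algebra L br) \<and>
        (dim (lie_derived L br) = 4 \<longrightarrow>
           (contact_lie_algebra L br \<longleftrightarrow>
              dim (lie_center (lie_derived L br) br) = 1 \<or>
              dim (lie_center (lie_derived L br) br) = 2 \<and>
              (\<exists>v\<in>L. \<not> (\<exists>r::real. \<forall>x\<in>lie_center (lie_derived L br) br. br v x = r *\<^sub>R x)))))"
proof (intro conjI allI impI)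
  fix G :: "'g monoid" and T and A :: "('g, 'e) chart set" and c
  assume as: "lie_group G T A \<and> DIM('e) = 5 \<and> c \<in> A \<and> \<one>\<^bsub>G\<^esub> \<in> fst c \<and> \<not> lie_solvable UNIV (lie_group_bracket G c)"
  then interpret lie_group_identity_chart G T A c
    by (intro lie_group_identity_chart.intro lie_group_identity_chart_axioms.intro) auto
  interpret S: lie_space "lie_group_bracket G c" by (rule lie_space.intro) (rule lie_algebra_bracket)
  show "contact_lie_group G A \<longleftrightarrow>
           lie_isomorphic UNIV (lie_group_bracket G c)
             (UNIV \<times> sl2) (direct_sum_bracket aff_bracket commutator) \<or>
           lie_isomorphic UNIV (lie_group_bracket G c)
             (UNIV \<times> so3) (direct_sum_bracket aff_bracket commutator) \<or>
           lie_isomorphic UNIV (lie_group_bracket G c) (UNIV \<times> sl2) R2_sl2_bracket"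
    unfolding contact_lie_group_iff using as by (intro S.contact_nonsolvable_5_iff) auto
next
  show "lie_decomposable (UNIV \<times> sl2) (direct_sum_bracket aff_bracket commutator)"
    by (rule direct_sum_decomposable[OF subspace_sl2 sl2_commutator sl2_ne_0])
next
  show "lie_decomposable (UNIV \<times> so3) (direct_sum_bracket aff_bracket commutator)"
    by (rule direct_sum_decomposable[OF subspace_so3 so3_commutator so3_ne_0])
next
  show "\<not> lie_decomposable (UNIV \<times> sl2) R2_sl2_bracket" by (rule R2_sl2_not_decomposable)
next
  fix L :: "'a set" and br
  assume as: "lie_algebra L br \<and> dim L = 5 \<and> \<not> lie_decomposable L br \<and> lie_solvable L br \<and> lie_center L br = {0}"
  then have L: "lie_algebra L br" "dim L = 5" "lie_solvable L br" "lie_center L br = {0}" by auto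
  {
    assume "dim (lie_derived L br) = 3 \<and> \<not> lie_abelian (lie_derived L br) br"
    with solvable_contact_5(1)[OF L] show "contact_lie_algebra L br" by (rule mp)
  }
  {
    assume "dim (lie_derived L br) = 4"
    with solvable_contact_5(2)[OF L] show "contact_lie_algebra L br \<longleftrightarrow>
              dim (lie_center (lie_derived L br) br) = 1 \<or>
              dim (lie_center (lie_derived L br) br) = 2 \<and>
              (\<exists>v\<in>L. \<not> (\<exists>r::real. \<forall>x\<in>lie_center (lie_derived L br) br. br v x = r *\<^sub>R x))"
      by (rule mp)
  }
qed

end
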